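(* Let $A,B$ be the rainbow arrays (with parameter $\beta>0$) defined in the context, and let $F(r)=\sum_{n\in\mathbb N_0^3}A_nr^n$ and $G(r)=\sum_{n\in\mathbb N_0^3}B_nr^n$. (i) If $\beta>1/2$, then $\sum_{n\in\mathbb N_0^3}|A_n|<\infty$, so $F$ is defined and continuous on $[-1,1]^3$, and $$F(r_1,r_2,1)=\frac{\Gamma(3\beta)\Gamma(3\beta-1)}{\Gamma(2\beta)\Gamma(4\beta-1)}\,f_\beta(r_1)f_\beta(r_2).$$ (ii) For all $\beta>0$, the series $\sum A_nr^n$ and $\sum B_nr^n$ converge locally uniformly in $(-1,1)^3$, so $F$ and $G$ are analytic in $(-1,1)^3$, and they satisfy, for all $\{j,k,\ell\}=\{1,2,3\}$, $$\big(r_\ell(1-r_\ell)\partial_{r_\ell}^2+(2\beta-2r_\ell)\partial_{r_\ell}-\beta(1-\beta)\big)F=(1-r_j)(1-r_k)G,$$ $$\big(2r_jr_k\partial_{r_j}\partial_{r_k}+\beta r_j\partial_{r_j}+\beta r_k\partial_{r_k}-\beta r_\ell\partial_{r_\ell}\big)F=\big(r_\ell(1+r_jr_k)-(r_j+r_k)\big)G.$$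
   Context: $\mathbb N_0=\{0,1,2,\dots\}$, $r^n=r_1^{n_1}r_2^{n_2}r_3^{n_3}$, $e_j$ is the $j$-th unit vector of $\mathbb Z^3$, and $f_\beta(x)={}_2F_1(1-\beta,\beta;2\beta;x)$ (Gauss hypergeometric function). The rainbow arrays: for $\beta>0$, $A,B:\mathbb N_0^3\to\mathbb R$, extended by $0$ to $\mathbb Z^3$, are the unique pair with $A_{(0,0,0)}=1$ such that for all $n\in\mathbb Z^3$ and all $\{j,k,\ell\}=\{1,2,3\}$, $$(n_\ell+1)(n_\ell+2\beta)A_{n+e_\ell}-(n_\ell+\beta)(n_\ell+1-\beta)A_n=B_n-B_{n-e_j}-B_{n-e_k}+B_{n-e_j-e_k},$$ $$(2n_jn_k+\beta n_j+\beta n_k-\beta n_\ell)A_n=B_{n-e_\ell}+B_{n-e_\ell-e_j-e_k}-B_{n-e_j}-B_{n-e_k}.$$ *)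

theory Defs
  imports "HOL-Analysis.Analysis"
begin

definition zero_extension :: "(nat^'n \<Rightarrow> real) \<Rightarrow> int^'n \<Rightarrow> real" where
  "zero_extension a n = (if \<forall>i. 0 \<le> n $ i then a (\<chi> i. nat (n $ i)) else 0)"

abbreviation unit_index :: "'n \<Rightarrow> int^'n" where
  "unit_index j \<equiv> axis j 1"

(* Existence and uniqueness of the pair A, B for given \<beta> > 0 are theorems, not part of
   the definition: the predicate says that the pair satisfies the defining system. *)
definition rainbow_arrays :: "real \<Rightarrow> (nat^3 \<Rightarrow> real) \<Rightarrow> (nat^3 \<Rightarrow> real) \<Rightarrow> bool" where
  "rainbow_arrays \<beta> a b \<longleftrightarrow>
    (let A = zero_extension a; B = zero_extension b; e = unit_index in
      A 0 = 1 \<and>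
      (\<forall>n j k l. {j, k, l} = {1, 2, 3} \<longrightarrow>
        (of_int (n $ l) + 1) * (of_int (n $ l) + 2 * \<beta>) * A (n + e l)
          - (of_int (n $ l) + \<beta>) * (of_int (n $ l) + 1 - \<beta>) * A n
        = B n - B (n - e j) - B (n - e k) + B (n - e j - e k) \<and>
        (2 * of_int (n $ j) * of_int (n $ k)
          + \<beta> * of_int (n $ j) + \<beta> * of_int (n $ k) - \<beta> * of_int (n $ l)) * A n
        = B (n - e l) + B (n - e l - e j - e k) - B (n - e j) - B (n - e k)))"

definition monomial :: "real^'n \<Rightarrow> nat^'n \<Rightarrow> real" where
  "monomial r n = (\<Prod>i\<in>UNIV. (r $ i) ^ (n $ i))"

(* The Gauss hypergeometric function 2F1(1-\<beta>, \<beta>; 2\<beta>; x), as the sum of its power series.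
   For \<beta> > 1/2 the series also converges at x = 1 and x = -1. *)
definition gauss_f :: "real \<Rightarrow> real \<Rightarrow> real" where
  "gauss_f \<beta> x = eval_fps (fps_hypergeo [1 - \<beta>, \<beta>] [2 * \<beta>] 1) x"

(* The limit along finite_subsets_at_top is that of unordered summation, so no enumeration of
   the multi-indices is singled out. *)
definition power_series_locally_uniform_on ::
    "(nat^'n \<Rightarrow> real) \<Rightarrow> (real^'n) set \<Rightarrow> bool" where
  "power_series_locally_uniform_on c U \<longleftrightarrow>
    (\<forall>p\<in>U. \<exists>V. open V \<and> p \<in> V \<and>
      uniform_limit (V \<inter> U) (\<lambda>S r. \<Sum>n\<in>S. c n * monomial r n)
        (\<lambda>r. \<Sum>\<^sub>\<infinity>n. c n * monomial r n) (finite_subsets_at_top UNIV))"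

(* Analyticity in several real variables; the library's analytic_on is about functions of one
   complex variable. *)
definition real_analytic_on :: "(real^'n \<Rightarrow> real) \<Rightarrow> (real^'n) set \<Rightarrow> bool" where
  "real_analytic_on f U \<longleftrightarrow>
    (\<forall>p\<in>U. \<exists>\<epsilon>>0. \<exists>c. \<forall>r\<in>ball p \<epsilon>. ((\<lambda>n. c n * monomial (r - p) n) has_sum f r) UNIV)"

definition partial_deriv :: "'n \<Rightarrow> (real^'n \<Rightarrow> real) \<Rightarrow> real^'n \<Rightarrow> real" where
  "partial_deriv i f r = deriv (\<lambda>t. f (r + t *\<^sub>R axis i 1)) 0"

abbreviation open_cube :: "(real^3) set" where
  "open_cube \<equiv> {r. \<forall>i. r $ i \<in> {-1<..<1}}"

abbreviation closed_cube :: "(real^3) set" where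
  "closed_cube \<equiv> {r. \<forall>i. r $ i \<in> {-1..1}}"

end

theory Submission
  imports Defs "HOL-Complex_Analysis.Cauchy_Integral_Formula"
begin

text \<open>
  In each index the array \<open>A\<close> satisfies one and the same three-term recursion up to a common right-hand side, so it is
  separated by the continuous dual Hahn polynomials \<open>P\<^sub>n\<close> with parameters \<open>1/2, 2 \<beta> - 1/2, 1/2 - \<beta>\<close>:
  \<open>A (i, j, k) = L (P\<^sub>i P\<^sub>j P\<^sub>k)\<close> for a linear functional \<open>L\<close> which, up to finitely many point masses, is the
  integral against \<open>x sinh (\<pi> x) \<bar>\<Gamma> (b + i x)\<bar>\<^sup>4 \<bar>\<Gamma> (c + i x)\<bar>\<^sup>2\<close>. Bounds for \<open>P\<^sub>n (- x\<^sup>2)\<close>, which come from the Meixner--Pollaczek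
  generating function, are \<open>O(exp (\<pi> \<bar>x\<bar> / 2))\<close> in \<open>x\<close>, so three factors are beaten by the weight
  \<open>exp (- 2 \<pi> \<bar>x\<bar>)\<close>. This gives polynomial growth of \<open>A\<close> for all \<open>\<beta>\<close> and absolute summability for \<open>\<beta> > 1/2\<close>.
  The growth of \<open>B\<close> follows since \<open>B (i, j, k) - B (i - 1, j - 1, k)\<close> is a multiple of \<open>A (i, j, k + 1)\<close>, and
  the differential equations are the recursions read off coefficientwise. On the face \<open>r\<^sub>3 = 1\<close> the sum of the
  recursion over the third index telescopes, and \<open>B (i, j, k) \<rightarrow> 0\<close> as \<open>k \<rightarrow> \<infinity>\<close> turns it into the hypergeometric
  recursion in each of the two remaining indices; the constant is a Gauss sum.
\<close>

section \<open>Decay of the Gamma function and the Wilson weight\<close>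

text \<open>The parameters are read off the system. With a, b, c for those of the polynomials, the
  first equations ask for a + b = 2 \<beta>, a + c = 1 - \<beta>, b + c = \<beta>; on one axis the
  array has the denominator (3 \<beta>)_n, which makes the fourth parameter of the functional equal
  to b. The obstacle is positivity: b = 2 \<beta> - 1/2 is positive only for \<beta> > 1/4, c = 1/2
  - \<beta> only for \<beta> < 1/2. The functional is therefore defined by its moments, rational in
  the parameters, and the integral is used only after a parameter has been raised: c by division by
  a Newton polynomial if \<beta> \<ge> 1/2, b by an expansion in the polynomials with c = -b if
  \<beta> < 1/2. Bounds in n come from c = 0, where the polynomials are even Meixner-Pollaczek
  coefficients, and a change of c multiplies the generating function by a power of 1 - t. A supremum
  estimate on a circle would lose one power of n, and the summation argument would then fail for
  \<beta> close to 1/2; hence the estimate by the circle mean of a Poisson kernel.\<close>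

lemma norm_Gamma_Complex_le:
  assumes s: "0 < s" and sm: "s \<le> m"
  shows "norm (Gamma (Complex s y)) * Gamma m \<le> Gamma s * norm (Gamma (Complex m y))"
proof (rule LIMSEQ_le)
  show "(\<lambda>n. norm (Gamma_series (Complex s y) n) * Gamma_series m n) \<longlonglongrightarrow> norm (Gamma (Complex s y)) * Gamma m"
    by (intro tendsto_intros)
  show "(\<lambda>n. Gamma_series s n * norm (Gamma_series (Complex m y) n)) \<longlonglongrightarrow> Gamma s * norm (Gamma (Complex m y))"
    by (intro tendsto_intros)
  \<comment> \<open>Euler's limit writes the quotient of |\<Gamma>(t + iy)| by \<Gamma>(t) as a
    product of factors (t + k) / |t + k + iy|, each of which increases with t. So a larger real part
    bounds the quotient, and decay has to be known for integer real parts only.\<close>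
  have gs: "norm (Gamma_series (Complex t y) n) =
      Gamma_series t n * (\<Prod>k\<le>n. (t + real k) / norm (Complex (t + real k) y))" if "t > 0" for t n
  proof -
    have "norm (pochhammer (Complex t y) (n + 1)) = (\<Prod>k\<le>n. norm (Complex (t + real k) y))"
    proof -
      have "Complex t y + of_nat k = Complex (t + real k) y" for k by (simp add: complex_eq_iff)
      thus ?thesis by (simp add: pochhammer_Suc_prod prod_norm atLeast0AtMost)
    qed
    moreover have "pochhammer t (n + 1) = (\<Prod>k\<le>n. t + real k)"
      by (simp add: pochhammer_Suc_prod atLeast0AtMost)
    moreover have "(\<Prod>k\<le>n. t + real k) \<noteq> 0" using that by (auto simp: prod_zero_iff)
    moreover have "norm (exp (Complex t y * of_real (ln (real n)))) = exp (t * ln (real n))"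
      by simp
    ultimately show ?thesis
      by (simp add: Gamma_series_def norm_mult norm_divide norm_fact prod_dividef)
  qed
  have "norm (Gamma_series (Complex s y) n) * Gamma_series m n \<le> Gamma_series s n * norm (Gamma_series (Complex m y) n)" for n
  proof -
    have "(\<Prod>k\<le>n. (s + real k) / norm (Complex (s + real k) y)) \<le> (\<Prod>k\<le>n. (m + real k) / norm (Complex (m + real k) y))"
    proof (rule prod_mono, safe)
      fix k
      define u v where "u = s + real k" and "v = m + real k"
      have uv: "0 < u" "u \<le> v" using s sm by (auto simp: u_def v_def)
      have "u\<^sup>2 * (v\<^sup>2 + y\<^sup>2) \<le> v\<^sup>2 * (u\<^sup>2 + y\<^sup>2)"
        using mult_right_mono[OF power_mono[OF uv(2), of 2], of "y\<^sup>2"] uv by (simp add: algebra_simps)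
      hence "u * sqrt (v\<^sup>2 + y\<^sup>2) \<le> v * sqrt (u\<^sup>2 + y\<^sup>2)"
        using uv real_sqrt_le_mono by (fastforce simp: real_sqrt_mult)
      moreover have "sqrt (u\<^sup>2 + y\<^sup>2) > 0" "sqrt (v\<^sup>2 + y\<^sup>2) > 0"
        using uv by (auto intro!: add_pos_nonneg)
      ultimately show "(s + real k) / norm (Complex (s + real k) y) \<le> (m + real k) / norm (Complex (m + real k) y)"
        unfolding u_def[symmetric] v_def[symmetric] complex_norm by (simp add: divide_simps)
      show "0 \<le> (s + real k) / norm (Complex (s + real k) y)" using s by simp
    qed
    moreover have "0 \<le> Gamma_series s n * Gamma_series m n"
      using s sm by (auto simp: Gamma_series_def intro!: mult_nonneg_nonneg divide_nonneg_nonneg pochhammer_nonneg)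
    ultimately have "Gamma_series s n * Gamma_series m n * (\<Prod>k\<le>n. (s + real k) / norm (Complex (s + real k) y))
      \<le> Gamma_series s n * Gamma_series m n * (\<Prod>k\<le>n. (m + real k) / norm (Complex (m + real k) y))"
      by (rule mult_left_mono)
    thus ?thesis using s sm by (simp add: gs mult_ac)
  qed
  thus "\<exists>N. \<forall>n\<ge>N. norm (Gamma_series (Complex s y) n) * Gamma_series m n \<le> Gamma_series s n * norm (Gamma_series (Complex m y) n)"
    by blast
qed

text \<open>Equivalent to 1 + 2 x \<le> exp (2 x).\<close>

lemma div_sinh_le:
  fixes x :: real
  assumes "x > 0"
  shows "x / sinh x \<le> (1 + 2 * x) * exp (- x)"
proof -
  have "(1 + 2 * x) * exp (- (2 * x)) \<le> exp (2 * x) * exp (- (2 * x))"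
    by (intro mult_right_mono) auto
  hence "2 * x \<le> (1 + 2 * x) * (1 - exp (- (2 * x)))"
    by (simp add: exp_add[symmetric] algebra_simps)
  also have "\<dots> = (1 + 2 * x) * exp (- x) * (2 * sinh x)"
    by (simp add: sinh_def exp_add[symmetric] algebra_simps)
  finally show ?thesis using assms by (simp add: pos_divide_le_eq)
qed

text \<open>The reflection formula gives the square of the left side as \<pi> y / sinh (\<pi> y).
  The polynomial factor is generous, the rate \<pi>/2 is exact.\<close>

lemma norm_Gamma_Complex_1_le: "norm (Gamma (Complex 1 y)) \<le> (1 + 2 * pi * \<bar>y\<bar>) * exp (- pi * \<bar>y\<bar> / 2)"
proof (cases "y = 0")
  case True
  have "Complex 1 0 = 1" by (simp add: complex_eq_iff)
  thus ?thesis using True by simp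
next
  case False
  define t where "t = pi * \<bar>y\<bar>"
  have t: "t > 0" using False by (simp add: t_def)
  have "\<i> * complex_of_real y \<notin> \<int>\<^sub>\<le>\<^sub>0"
    using False by (auto elim!: nonpos_Ints_cases simp: complex_eq_iff)
  hence "Gamma (1 + \<i> * y) * Gamma (1 - \<i> * y) = \<i> * y * Gamma (\<i> * y) * Gamma (1 - \<i> * y)"
    using Gamma_plus1[of "\<i> * y"] by (simp add: add.commute)
  also have "\<dots> = \<i> * y * (of_real pi / sin (\<i> * of_real (pi * y)))"
    using Gamma_reflection_complex[of "\<i> * y"] by (simp add: mult_ac)
  also have "\<dots> = of_real (pi * y / sinh (pi * y))"
    by (simp add: sin_i_times sinh_def exp_of_real[symmetric] exp_minus scaleR_conv_of_real divide_simps)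
  finally have "Gamma (Complex 1 y) * Gamma (cnj (Complex 1 y)) = of_real (pi * y / sinh (pi * y))"
    by (simp add: Complex_eq complex_cnj)
  hence "(norm (Gamma (Complex 1 y)))\<^sup>2 = \<bar>pi * y / sinh (pi * y)\<bar>"
    by (metis cnj_Gamma complex_mod_cnj norm_mult norm_of_real power2_eq_square)
  also have "\<dots> = t / sinh t"
  proof -
    have "pi * y / sinh (pi * y) = t / sinh t" by (cases "y > 0") (auto simp: t_def)
    moreover have "0 < t / sinh t" using t by simp
    ultimately show ?thesis by (simp only: abs_of_pos)
  qed
  also have "\<dots> \<le> (1 + 2 * t) * exp (- t)" by (rule div_sinh_le[OF t])
  also have "\<dots> \<le> (1 + 2 * t)\<^sup>2 * exp (- t)"
    using t by (intro mult_right_mono) (auto simp: power2_eq_square algebra_simps)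
  also have "\<dots> = ((1 + 2 * t) * exp (- t / 2))\<^sup>2"
    by (simp add: power_mult_distrib exp_double[symmetric])
  finally have "(norm (Gamma (Complex 1 y)))\<^sup>2 \<le> ((1 + 2 * t) * exp (- t / 2))\<^sup>2" .
  hence "norm (Gamma (Complex 1 y)) \<le> (1 + 2 * t) * exp (- t / 2)"
    by (rule power2_le_imp_le) (use t in simp)
  moreover have "(1 + 2 * t) * exp (- t / 2) = (1 + 2 * pi * \<bar>y\<bar>) * exp (- pi * \<bar>y\<bar> / 2)"
    by (simp add: t_def)
  ultimately show ?thesis by (simp only:)
qed

lemma norm_Gamma_Complex_Suc_le:
  "\<exists>C>0. \<forall>y. norm (Gamma (Complex (real (Suc m)) y)) \<le> C * (1 + \<bar>y\<bar>) ^ (m + 1) * exp (- pi * \<bar>y\<bar> / 2)"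
proof (induction m)
  case 0
  have "norm (Gamma (Complex 1 y)) \<le> 7 * (1 + \<bar>y\<bar>) * exp (- pi * \<bar>y\<bar> / 2)" for y
  proof (rule order.trans[OF norm_Gamma_Complex_1_le mult_right_mono])
    have "pi * \<bar>y\<bar> \<le> 3.5 * \<bar>y\<bar>" using pi_less_4 pi_approx by (intro mult_right_mono) auto
    thus "1 + 2 * pi * \<bar>y\<bar> \<le> 7 * (1 + \<bar>y\<bar>)" by simp
  qed simp
  thus ?case by (intro exI[of _ 7]) simp
next
  case (Suc m)
  then obtain C where C: "C > 0" "\<And>y. norm (Gamma (Complex (real (Suc m)) y)) \<le> C * (1 + \<bar>y\<bar>) ^ (m + 1) * exp (- pi * \<bar>y\<bar> / 2)"
    by blast
  have "norm (Gamma (Complex (real (Suc (Suc m))) y)) \<le> (real (Suc m) * C) * (1 + \<bar>y\<bar>) ^ (m + 2) * exp (- pi * \<bar>y\<bar> / 2)" for y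
  proof -
    have "Complex (real (Suc m)) y \<notin> \<int>\<^sub>\<le>\<^sub>0"
      by (auto elim!: nonpos_Ints_cases simp: complex_eq_iff)
    hence "Gamma (Complex (real (Suc (Suc m))) y) = Complex (real (Suc m)) y * Gamma (Complex (real (Suc m)) y)"
      using Gamma_plus1[of "Complex (real (Suc m)) y"] by (simp add: complex_eq_iff Complex_eq add_ac)
    also have "norm \<dots> \<le> (real (Suc m) * (1 + \<bar>y\<bar>)) * (C * (1 + \<bar>y\<bar>) ^ (m + 1) * exp (- pi * \<bar>y\<bar> / 2))"
      unfolding norm_mult
    proof (intro mult_mono C)
      have "norm (Complex (real (Suc m)) y) \<le> \<bar>real (Suc m)\<bar> + \<bar>y\<bar>"
        using cmod_le[of "Complex (real (Suc m)) y"] by simp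
      also have "\<dots> \<le> real (Suc m) * (1 + \<bar>y\<bar>)" by (simp add: algebra_simps)
      finally show "norm (Complex (real (Suc m)) y) \<le> real (Suc m) * (1 + \<bar>y\<bar>)" .
    qed auto
    finally show ?thesis by (simp add: mult_ac)
  qed
  thus ?case using C(1) by (intro exI[of _ "real (Suc m) * C"]) auto
qed

text \<open>The whole strip is compared with one integer abscissa \<open>Suc m\<close> to its right,
  and \<Gamma>(s) is bounded on the compact interval; so the constants are uniform in the real part.
  All later exponential rates are counted in units of this \<pi>/2.\<close>

lemma Gamma_vertical_decay:
  assumes "0 < \<delta>"
  shows "\<exists>C>0. \<exists>q::nat. \<forall>s\<in>{\<delta>..M}. \<forall>y. norm (Gamma (Complex s y)) \<le> C * (1 + \<bar>y\<bar>) ^ q * exp (- pi * \<bar>y\<bar> / 2)"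
proof -
  obtain m where m: "M \<le> real (Suc m)"
    by (metis real_arch_simple le_add2 of_nat_Suc order.trans zero_le_one add_increasing)
  obtain C where C: "C > 0" "\<And>y. norm (Gamma (Complex (real (Suc m)) y)) \<le> C * (1 + \<bar>y\<bar>) ^ (m + 1) * exp (- pi * \<bar>y\<bar> / 2)"
    using norm_Gamma_Complex_Suc_le[of m] by blast
  have "continuous_on {\<delta>..M} (Gamma :: real \<Rightarrow> real)"
    using assms by (intro continuous_intros) (auto elim!: nonpos_Ints_cases)
  then obtain D where D: "\<And>s. s \<in> {\<delta>..M} \<Longrightarrow> norm (Gamma s) \<le> D"
    using compact_imp_bounded[OF compact_continuous_image[of "{\<delta>..M}" Gamma]]
    by (force simp: bounded_iff)
  define G where "G = Gamma (real (Suc m))"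
  have G: "G > 0" unfolding G_def by (rule Gamma_real_pos) simp
  have "norm (Gamma (Complex s y)) \<le> (\<bar>D\<bar> + 1) * C / G * (1 + \<bar>y\<bar>) ^ (m + 1) * exp (- pi * \<bar>y\<bar> / 2)"
    if s: "s \<in> {\<delta>..M}" for s y
  proof -
    have "norm (Gamma (Complex s y)) * G \<le> Gamma s * norm (Gamma (Complex (real (Suc m)) y))"
      unfolding G_def by (rule norm_Gamma_Complex_le) (use assms m s in auto)
    also have "\<dots> \<le> (\<bar>D\<bar> + 1) * (C * (1 + \<bar>y\<bar>) ^ (m + 1) * exp (- pi * \<bar>y\<bar> / 2))"
      using D[OF s] by (intro mult_mono C) auto
    finally show ?thesis using G by (simp add: field_simps)
  qed
  moreover have "(\<bar>D\<bar> + 1) * C / G > 0" using C G by auto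
  ultimately show ?thesis by blast
qed

text \<open>A single term of the exponential series at \<epsilon> (1 + t): any polynomial factor
  costs an arbitrarily small exponential rate.\<close>

lemma one_plus_power_le_exp:
  fixes t \<epsilon> :: real
  assumes "0 \<le> t" "0 < \<epsilon>"
  shows "(1 + t) ^ q \<le> fact q / \<epsilon> ^ q * exp \<epsilon> * exp (\<epsilon> * t)"
proof -
  have "(\<epsilon> * (1 + t)) ^ q / fact q \<le> exp (\<epsilon> * (1 + t))"
    using sum_le_suminf[OF summable_exp_generic, of "{q}" "\<epsilon> * (1 + t)"] assms
    by (simp add: exp_def divide_inverse mult.commute)
  hence "(\<epsilon> * (1 + t)) ^ q \<le> fact q * exp (\<epsilon> * (1 + t))"
    by (simp add: pos_divide_le_eq mult.commute)
  moreover have "exp (\<epsilon> * (1 + t)) = exp \<epsilon> * exp (\<epsilon> * t)"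
    by (simp add: exp_add[symmetric] algebra_simps)
  ultimately have "(1 + t) ^ q * \<epsilon> ^ q \<le> fact q * exp \<epsilon> * exp (\<epsilon> * t)"
    by (simp add: power_mult_distrib mult_ac)
  hence "(1 + t) ^ q \<le> fact q * exp \<epsilon> * exp (\<epsilon> * t) / \<epsilon> ^ q"
    using assms by (subst pos_le_divide_eq) auto
  thus ?thesis by simp
qed

section \<open>Integrability against the Wilson weight\<close>

lemma integrable_exp_minus_abs:
  assumes "0 < (\<epsilon>::real)"
  shows "integrable lborel (\<lambda>x::real. exp (- \<epsilon> * \<bar>x\<bar>))"
proof -
  have "(\<lambda>x::real. exp (- \<epsilon> * x)) absolutely_integrable_on {0..}"
    using integrable_on_exp_minus_to_infinity[OF assms, of 0]
    by (intro nonnegative_absolutely_integrable_1) auto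
  hence "integrable lebesgue (\<lambda>x::real. indicator {0..} x * exp (- \<epsilon> * x))"
    by (simp add: set_integrable_def)
  hence 2: "integrable lborel (\<lambda>x::real. indicator {0..} x * exp (- \<epsilon> * x))"
    by (subst (asm) integrable_completion) auto
  from lborel_integrable_real_affine[OF 2, of "- 1" 0]
  have 3: "integrable lborel (\<lambda>x::real. indicator {0..} (- x) * exp (\<epsilon> * x))" by simp
  show ?thesis
    by (rule Bochner_Integration.integrable_bound[OF Bochner_Integration.integrable_add[OF 2 3]])
      (auto simp: indicator_def abs_if)
qed

text \<open>Up to a factor 4 this is the Wilson weight |\<Gamma>(1/2 + ix) \<Gamma>(b + ix)^2
  \<Gamma>(c + ix) / \<Gamma>(2 ix)|^2 with parameters 1/2, b, b, c: the quotient of \<Gamma>(1/2 +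
  ix) by \<Gamma>(2 ix) has squared modulus 4 x sinh (\<pi> x).\<close>

definition wilson_weight :: "real \<Rightarrow> real \<Rightarrow> real \<Rightarrow> real" where
  "wilson_weight b c x = x * sinh (pi * x) * norm (Gamma (Complex b x)) ^ 4 * norm (Gamma (Complex c x)) ^ 2"

lemma mult_sinh_nonneg: "0 \<le> x * sinh (pi * x)" for x :: real
  by (auto simp: zero_le_mult_iff mult_le_0_iff)

lemma wilson_weight_nonneg: "0 \<le> wilson_weight b c x"
  unfolding wilson_weight_def by (intro mult_nonneg_nonneg mult_sinh_nonneg) auto

lemma continuous_Gamma_Complex: "0 < b \<Longrightarrow> continuous_on UNIV (\<lambda>x. Gamma (Complex b x))"
  unfolding Complex_eq
  by (rule continuous_on_compose2[OF continuous_on_Gamma[of "{z. 0 < Re z}"]])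
    (auto intro!: continuous_intros elim!: nonpos_Ints_cases)

lemma continuous_wilson_weight:
  "0 < b \<Longrightarrow> 0 < c \<Longrightarrow> continuous_on UNIV (wilson_weight b c)"
  unfolding wilson_weight_def sinh_def by (intro continuous_intros continuous_Gamma_Complex) auto

lemma abs_sinh_le: "\<bar>sinh x\<bar> \<le> \<bar>x\<bar> * exp \<bar>x\<bar>" for x :: real
proof -
  have nonneg: "sinh t \<le> t * exp t" if "0 \<le> t" for t :: real
  proof -
    have "1 - exp (- (2 * t)) \<le> 2 * t" using exp_ge_add_one_self[of "- (2 * t)"] by linarith
    hence "(1 - exp (- (2 * t))) * exp t \<le> 2 * t * exp t" by (rule mult_right_mono) simp
    thus ?thesis by (simp add: sinh_field_def left_diff_distrib exp_add[symmetric])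
  qed
  show ?thesis
  proof (cases "0 \<le> x")
    case True thus ?thesis using nonneg[of x] by simp
  next
    case False thus ?thesis using nonneg[of "- x"] by simp
  qed
qed

text \<open>The factor x^2 is kept apart because the weight is later divided by a polynomial that
  vanishes to this order at x = 0 when the original c is a nonpositive integer. The rate 2 \<pi> is
  that of six Gamma factors at \<pi>/2 each, less \<pi> from the hyperbolic sine.\<close>

lemma wilson_weight_le_square:
  assumes "0 < b" "0 < c"
  shows "\<exists>C>0. \<exists>q::nat. \<forall>x. wilson_weight b c x \<le> x\<^sup>2 * (C * (1 + \<bar>x\<bar>) ^ q * exp (- 2 * pi * \<bar>x\<bar>))"
proof -
  obtain C q where C: "C > 0" "\<And>y. norm (Gamma (Complex b y)) \<le> C * (1 + \<bar>y\<bar>) ^ q * exp (- pi * \<bar>y\<bar> / 2)"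
    using Gamma_vertical_decay[OF assms(1), of b] by force
  obtain D p where D: "D > 0" "\<And>y. norm (Gamma (Complex c y)) \<le> D * (1 + \<bar>y\<bar>) ^ p * exp (- pi * \<bar>y\<bar> / 2)"
    using Gamma_vertical_decay[OF assms(2), of c] by force
  have "wilson_weight b c x \<le> x\<^sup>2 * (pi * C ^ 4 * D\<^sup>2 * (1 + \<bar>x\<bar>) ^ (q * 4 + p * 2) * exp (- 2 * pi * \<bar>x\<bar>))" for x
  proof -
    have "x * sinh (pi * x) = \<bar>x\<bar> * \<bar>sinh (pi * x)\<bar>" using mult_sinh_nonneg[of x] by (simp add: abs_mult[symmetric])
    also have "\<dots> \<le> \<bar>x\<bar> * (\<bar>pi * x\<bar> * exp \<bar>pi * x\<bar>)" by (intro mult_left_mono abs_sinh_le) auto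
    also have "\<dots> = x\<^sup>2 * pi * exp \<bar>pi * x\<bar>" by (simp add: abs_mult power2_eq_square)
    finally have xs: "x * sinh (pi * x) \<le> x\<^sup>2 * pi * exp \<bar>pi * x\<bar>" .
    have "wilson_weight b c x \<le> x\<^sup>2 * pi * exp \<bar>pi * x\<bar> *
        (C * (1 + \<bar>x\<bar>) ^ q * exp (- pi * \<bar>x\<bar> / 2)) ^ 4 * (D * (1 + \<bar>x\<bar>) ^ p * exp (- pi * \<bar>x\<bar> / 2)) ^ 2"
      unfolding wilson_weight_def
      by (rule mult_mono[OF mult_mono[OF xs power_mono[OF C(2)]] power_mono[OF D(2)]])
        (use C(1) in \<open>auto intro!: mult_nonneg_nonneg\<close>)
    also have "\<dots> = x\<^sup>2 * (pi * C ^ 4 * D\<^sup>2 * ((1 + \<bar>x\<bar>) ^ (q * 4) * (1 + \<bar>x\<bar>) ^ (p * 2)) *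
        (exp (pi * \<bar>x\<bar>) * exp (- pi * \<bar>x\<bar> / 2) ^ 4 * exp (- pi * \<bar>x\<bar> / 2) ^ 2))"
      by (simp add: power_mult_distrib power_mult[symmetric] abs_mult mult_ac)
    also have "exp (pi * \<bar>x\<bar>) * exp (- pi * \<bar>x\<bar> / 2) ^ 4 * exp (- pi * \<bar>x\<bar> / 2) ^ 2 = exp (- 2 * pi * \<bar>x\<bar>)"
      by (simp add: exp_add[symmetric] exp_of_nat_mult[symmetric] flip: power_add)
    also have "(1 + \<bar>x\<bar>) ^ (q * 4) * (1 + \<bar>x\<bar>) ^ (p * 2) = (1 + \<bar>x\<bar>) ^ (q * 4 + p * 2)"
      by (simp add: power_add)
    finally show ?thesis .
  qed
  thus ?thesis using C(1) D(1)
    by (intro exI[of _ "pi * C ^ 4 * D\<^sup>2"] conjI exI[of _ "q * 4 + p * 2"] allI impI) (blast | simp)+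
qed

lemma wilson_weight_le:
  assumes "0 < b" "0 < c"
  shows "\<exists>C>0. \<exists>q::nat. \<forall>x. wilson_weight b c x \<le> C * (1 + \<bar>x\<bar>) ^ q * exp (- 2 * pi * \<bar>x\<bar>)"
proof -
  obtain C q where C: "C > 0" "\<And>x. wilson_weight b c x \<le> x\<^sup>2 * (C * (1 + \<bar>x\<bar>) ^ q * exp (- 2 * pi * \<bar>x\<bar>))"
    using wilson_weight_le_square[OF assms] by blast
  have "wilson_weight b c x \<le> C * (1 + \<bar>x\<bar>) ^ (q + 2) * exp (- 2 * pi * \<bar>x\<bar>)" for x
  proof (rule order.trans[OF C(2)])
    have "x\<^sup>2 * (C * (1 + \<bar>x\<bar>) ^ q * exp (- 2 * pi * \<bar>x\<bar>)) \<le> (1 + \<bar>x\<bar>)\<^sup>2 * (C * (1 + \<bar>x\<bar>) ^ q * exp (- 2 * pi * \<bar>x\<bar>))"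
      using C(1) by (intro mult_right_mono power2_le_iff_abs_le[THEN iffD2]) auto
    thus "x\<^sup>2 * (C * (1 + \<bar>x\<bar>) ^ q * exp (- 2 * pi * \<bar>x\<bar>)) \<le> C * (1 + \<bar>x\<bar>) ^ (q + 2) * exp (- 2 * pi * \<bar>x\<bar>)"
      unfolding power_add by (simp only: mult_ac)
  qed
  thus ?thesis using C(1) by blast
qed

lemma integrable_poly_exp_bound:
  fixes g :: "real \<Rightarrow> real"
  assumes "g \<in> borel_measurable borel" "0 < \<epsilon>"
    and "\<And>x. \<bar>g x\<bar> \<le> C * (1 + \<bar>x\<bar>) ^ q * exp (- \<epsilon> * \<bar>x\<bar>)"
  shows "integrable lborel g"
proof (rule Bochner_Integration.integrable_bound)
  define K where "K = \<bar>C\<bar> * (fact q / (\<epsilon> / 2) ^ q * exp (\<epsilon> / 2))"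
  show "integrable lborel (\<lambda>x. K * exp (- (\<epsilon> / 2) * \<bar>x\<bar>))"
    using assms(2) by (intro integrable_mult_right integrable_exp_minus_abs) auto
  have "norm (g x) \<le> norm (K * exp (- (\<epsilon> / 2) * \<bar>x\<bar>))" for x
  proof -
    have "\<bar>g x\<bar> \<le> \<bar>C\<bar> * (1 + \<bar>x\<bar>) ^ q * exp (- \<epsilon> * \<bar>x\<bar>)"
      by (rule order.trans[OF assms(3)]) (intro mult_right_mono, auto)
    also have "\<dots> \<le> \<bar>C\<bar> * (fact q / (\<epsilon> / 2) ^ q * exp (\<epsilon> / 2) * exp (\<epsilon> / 2 * \<bar>x\<bar>)) * exp (- \<epsilon> * \<bar>x\<bar>)"
      using assms(2) by (intro mult_right_mono mult_left_mono one_plus_power_le_exp) auto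
    also have "\<dots> = K * (exp (\<epsilon> / 2 * \<bar>x\<bar>) * exp (- \<epsilon> * \<bar>x\<bar>))" by (simp add: K_def mult_ac)
    also have "exp (\<epsilon> / 2 * \<bar>x\<bar>) * exp (- \<epsilon> * \<bar>x\<bar>) = exp (- (\<epsilon> / 2) * \<bar>x\<bar>)"
      by (simp add: exp_add[symmetric] algebra_simps)
    finally show ?thesis using assms(2) by (simp add: K_def abs_mult)
  qed
  thus "AE x in lborel. norm (g x) \<le> norm (K * exp (- (\<epsilon> / 2) * \<bar>x\<bar>))" by simp
qed (use assms(1) in auto)

lemma integrable_wilson_weight_mult:
  fixes g :: "real \<Rightarrow> real"
  assumes "0 < b" "0 < c" "g \<in> borel_measurable borel" "\<kappa> < 2 * pi"
    and "\<And>x. \<bar>g x\<bar> \<le> D * (1 + \<bar>x\<bar>) ^ p * exp (\<kappa> * \<bar>x\<bar>)"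
  shows "integrable lborel (\<lambda>x. g x * wilson_weight b c x)"
proof -
  obtain C q where C: "C > 0" "\<And>x. wilson_weight b c x \<le> C * (1 + \<bar>x\<bar>) ^ q * exp (- 2 * pi * \<bar>x\<bar>)"
    using wilson_weight_le[OF assms(1,2)] by blast
  show ?thesis
  proof (rule integrable_poly_exp_bound)
    show "(\<lambda>x. g x * wilson_weight b c x) \<in> borel_measurable borel"
      by (intro borel_measurable_times assms borel_measurable_continuous_onI continuous_wilson_weight)
    show "0 < 2 * pi - \<kappa>" using assms by simp
    show "\<bar>g x * wilson_weight b c x\<bar> \<le> (D * C) * (1 + \<bar>x\<bar>) ^ (p + q) * exp (- (2 * pi - \<kappa>) * \<bar>x\<bar>)" for x
    proof -
      have "\<bar>g x * wilson_weight b c x\<bar> \<le> (D * (1 + \<bar>x\<bar>) ^ p * exp (\<kappa> * \<bar>x\<bar>)) * (C * (1 + \<bar>x\<bar>) ^ q * exp (- 2 * pi * \<bar>x\<bar>))"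
        unfolding abs_mult abs_of_nonneg[OF wilson_weight_nonneg]
        by (intro mult_mono assms(5) C(2) wilson_weight_nonneg order.trans[OF abs_ge_zero assms(5)])
      also have "\<dots> = (D * C) * (1 + \<bar>x\<bar>) ^ (p + q) * (exp (\<kappa> * \<bar>x\<bar>) * exp (- 2 * pi * \<bar>x\<bar>))"
        by (simp add: power_add mult_ac)
      also have "exp (\<kappa> * \<bar>x\<bar>) * exp (- 2 * pi * \<bar>x\<bar>) = exp (- (2 * pi - \<kappa>) * \<bar>x\<bar>)"
        by (simp add: exp_add[symmetric] algebra_simps)
      finally show ?thesis .
    qed
  qed
qed

lemma integral_wilson_weight_pos:
  assumes "0 < b" "0 < c"
  shows "0 < (\<integral>x. wilson_weight b c x \<partial>lborel)"
proof -
  have int: "integrable lborel (wilson_weight b c)"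
    using integrable_wilson_weight_mult[OF assms, of "\<lambda>_. 1" 0 1 0] by simp
  have "(\<integral>x. wilson_weight b c x \<partial>lborel) \<noteq> 0"
  proof
    assume "(\<integral>x. wilson_weight b c x \<partial>lborel) = 0"
    hence "AE x in lborel. wilson_weight b c x = 0"
      using integral_nonneg_eq_0_iff_AE[OF int] wilson_weight_nonneg by simp
    moreover have "wilson_weight b c x \<noteq> 0" if "x \<noteq> 0" for x
    proof -
      have "Complex b x \<notin> \<int>\<^sub>\<le>\<^sub>0" "Complex c x \<notin> \<int>\<^sub>\<le>\<^sub>0"
        using assms by (auto elim!: nonpos_Ints_cases simp: complex_eq_iff)
      thus ?thesis using that by (simp add: wilson_weight_def Gamma_eq_zero_iff)
    qed
    ultimately have "AE x in lborel. x = (0::real)" by (auto elim: AE_mp)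
    moreover have "AE x in lborel. x \<noteq> (0::real)" by (rule AE_lborel_singleton)
    ultimately have "AE x in (lborel :: real measure). x \<notin> UNIV" by eventually_elim auto
    thus False by (subst (asm) AE_iff_null_sets[symmetric]) (auto simp: null_sets_def)
  qed
  thus ?thesis using Bochner_Integration.integral_nonneg[of lborel "wilson_weight b c"] wilson_weight_nonneg
    by (simp add: order_less_le)
qed

section \<open>Contour shift and the quotient of consecutive total masses\<close>

lemma norm_cos_le_exp: "norm (cos z) \<le> exp \<bar>Im z\<bar>" for z :: complex
proof -
  have "norm (cos z) \<le> (norm (exp (\<i> * z)) + norm (exp (- (\<i> * z)))) / 2"
    unfolding cos_exp_eq norm_divide using norm_triangle_ineq[of "exp (\<i> * z)" "exp (- (\<i> * z))"] by simp
  also have "\<dots> = (exp (- Im z) + exp (Im z)) / 2" by simp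
  also have "\<dots> \<le> exp \<bar>Im z\<bar>"
  proof -
    define E where "E = exp \<bar>Im z\<bar>"
    have "exp (- Im z) + exp (Im z) \<le> E + E" by (intro add_mono) (auto simp: E_def)
    thus ?thesis unfolding E_def[symmetric] by simp
  qed
  finally show ?thesis .
qed

text \<open>
  The contour of the kernel below is moved from \<open>Re z = -1/2\<close> to \<open>Re z = 1/2\<close>; on the two lines
  the functional equation of the Gamma function turns it into polynomial multiples of the weight.
\<close>

definition shift_kernel :: "real \<Rightarrow> real \<Rightarrow> complex \<Rightarrow> complex" where
  "shift_kernel b c z = z * cos (of_real pi * z) * Gamma (of_real b + 1 / 2 + z) ^ 2 * Gamma (of_real b + 1 / 2 - z) ^ 2
     * Gamma (of_real c + 1 / 2 + z) * Gamma (of_real c + 1 / 2 - z)"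

text \<open>No Gamma factor has a pole before |Re z| = min b c + 1/2; for positive b and c the open
  strip thus contains the closed strip |Re z| \<le> 1/2 between the two contours.\<close>

lemma shift_kernel_holomorphic:
  assumes "0 < b" "0 < c"
  shows "shift_kernel b c holomorphic_on {z. \<bar>Re z\<bar> < min b c + 1 / 2}"
proof -
  have G: "Gamma holomorphic_on {z. 0 < Re z}"
    by (rule holomorphic_Gamma) (auto elim!: nonpos_Ints_cases)
  have 1: "(\<lambda>z. Gamma (of_real a + 1 / 2 + z)) holomorphic_on {z. \<bar>Re z\<bar> < min b c + 1 / 2}"
    if "a = b \<or> a = c" for a
  proof -
    have "(Gamma \<circ> (\<lambda>z. of_real a + 1 / 2 + z)) holomorphic_on {z. \<bar>Re z\<bar> < min b c + 1 / 2}"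
      by (rule holomorphic_on_compose_gen[OF _ G]) (use that in \<open>auto intro!: holomorphic_intros\<close>)
    thus ?thesis by (simp add: o_def)
  qed
  have 2: "(\<lambda>z. Gamma (of_real a + 1 / 2 - z)) holomorphic_on {z. \<bar>Re z\<bar> < min b c + 1 / 2}"
    if "a = b \<or> a = c" for a
  proof -
    have "(Gamma \<circ> (\<lambda>z. of_real a + 1 / 2 - z)) holomorphic_on {z. \<bar>Re z\<bar> < min b c + 1 / 2}"
      by (rule holomorphic_on_compose_gen[OF _ G]) (use that in \<open>auto intro!: holomorphic_intros\<close>)
    thus ?thesis by (simp add: o_def)
  qed
  have 3: "(\<lambda>z. cos (of_real pi * z)) holomorphic_on {z. \<bar>Re z\<bar> < min b c + 1 / 2}"
    by (intro holomorphic_intros)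
  show ?thesis unfolding shift_kernel_def
    by (intro holomorphic_on_mult holomorphic_on_power holomorphic_on_ident 1 2 3) simp_all
qed

lemma shift_kernel_le:
  assumes "0 < b" "0 < c"
  shows "\<exists>C>0. \<exists>q::nat. \<forall>z. \<bar>Re z\<bar> \<le> 1 / 2 \<longrightarrow>
    norm (shift_kernel b c z) \<le> C * (1 + \<bar>Im z\<bar>) ^ q * exp (- 2 * pi * \<bar>Im z\<bar>)"
proof -
  obtain C q where C: "C > 0" "\<And>s y. s \<in> {b..b + 1} \<Longrightarrow> norm (Gamma (Complex s y)) \<le> C * (1 + \<bar>y\<bar>) ^ q * exp (- pi * \<bar>y\<bar> / 2)"
    using Gamma_vertical_decay[OF assms(1), of "b + 1"] by blast
  obtain D p where D: "D > 0" "\<And>s y. s \<in> {c..c + 1} \<Longrightarrow> norm (Gamma (Complex s y)) \<le> D * (1 + \<bar>y\<bar>) ^ p * exp (- pi * \<bar>y\<bar> / 2)"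
    using Gamma_vertical_decay[OF assms(2), of "c + 1"] by blast
  have "norm (shift_kernel b c z) \<le> (C ^ 4 * D\<^sup>2) * (1 + \<bar>Im z\<bar>) ^ (1 + q * 4 + p * 2) * exp (- 2 * pi * \<bar>Im z\<bar>)"
    if z: "\<bar>Re z\<bar> \<le> 1 / 2" for z
  proof -
    define y where "y = Im z"
    have G: "norm (Gamma (of_real a + 1 / 2 + z)) = norm (Gamma (Complex (a + 1 / 2 + Re z) y))"
      "norm (Gamma (of_real a + 1 / 2 - z)) = norm (Gamma (Complex (a + 1 / 2 - Re z) (- y)))" for a
      by (auto simp: y_def complex_eq_iff intro!: arg_cong[where f = "\<lambda>w. norm (Gamma w)"])
    have z': "Re z \<le> 1 / 2" "- 1 / 2 \<le> Re z" using z by linarith+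
    have 1: "norm (Gamma (of_real b + 1 / 2 + z)) \<le> C * (1 + \<bar>y\<bar>) ^ q * exp (- pi * \<bar>y\<bar> / 2)"
      "norm (Gamma (of_real b + 1 / 2 - z)) \<le> C * (1 + \<bar>y\<bar>) ^ q * exp (- pi * \<bar>y\<bar> / 2)"
      unfolding G using C(2)[of "b + 1 / 2 + Re z" y] C(2)[of "b + 1 / 2 - Re z" "- y"] z' by auto
    have 2: "norm (Gamma (of_real c + 1 / 2 + z)) \<le> D * (1 + \<bar>y\<bar>) ^ p * exp (- pi * \<bar>y\<bar> / 2)"
      "norm (Gamma (of_real c + 1 / 2 - z)) \<le> D * (1 + \<bar>y\<bar>) ^ p * exp (- pi * \<bar>y\<bar> / 2)"
      unfolding G using D(2)[of "c + 1 / 2 + Re z" y] D(2)[of "c + 1 / 2 - Re z" "- y"] z' by auto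
    have 3: "norm z \<le> 1 + \<bar>y\<bar>" using cmod_le[of z] z by (simp add: y_def)
    have 4: "norm (cos (pi * z)) \<le> exp (pi * \<bar>y\<bar>)"
      using norm_cos_le_exp[of "pi * z"] by (simp add: y_def abs_mult)
    define CC where "CC = C * (1 + \<bar>y\<bar>) ^ q * exp (- pi * \<bar>y\<bar> / 2)"
    define DD where "DD = D * (1 + \<bar>y\<bar>) ^ p * exp (- pi * \<bar>y\<bar> / 2)"
    have CD: "0 \<le> CC" "0 \<le> DD" using C(1) D(1) by (auto simp: CC_def DD_def)
    have "norm (shift_kernel b c z) \<le> (1 + \<bar>y\<bar>) * exp (pi * \<bar>y\<bar>) * CC ^ 2 * CC ^ 2 * DD * DD"
      unfolding shift_kernel_def norm_mult norm_power CC_def[symmetric] DD_def[symmetric]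
      using 1 2 3 4 CD unfolding CC_def[symmetric] DD_def[symmetric]
      by (intro mult_mono power_mono) auto
    also have "\<dots> = C ^ 4 * D\<^sup>2 * ((1 + \<bar>y\<bar>) * (1 + \<bar>y\<bar>) ^ (q * 4) * (1 + \<bar>y\<bar>) ^ (p * 2)) *
        (exp (pi * \<bar>y\<bar>) * exp (- pi * \<bar>y\<bar> / 2) ^ 4 * exp (- pi * \<bar>y\<bar> / 2) ^ 2)"
      by (simp add: CC_def DD_def power_mult power4_eq_xxxx power2_eq_square mult_ac)
    also have "exp (pi * \<bar>y\<bar>) * exp (- pi * \<bar>y\<bar> / 2) ^ 4 * exp (- pi * \<bar>y\<bar> / 2) ^ 2 = exp (- 2 * pi * \<bar>y\<bar>)"
      by (simp add: exp_add[symmetric] exp_of_nat_mult[symmetric] flip: power_add)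
    also have "(1 + \<bar>y\<bar>) * (1 + \<bar>y\<bar>) ^ (q * 4) * (1 + \<bar>y\<bar>) ^ (p * 2) = (1 + \<bar>y\<bar>) ^ (1 + q * 4 + p * 2)"
      by (simp add: power_add)
    finally show ?thesis by (simp add: y_def)
  qed
  thus ?thesis using C(1) D(1)
    by (intro exI[of _ "C ^ 4 * D\<^sup>2"] conjI exI[of _ "1 + q * 4 + p * 2"] allI impI) (blast | simp)+
qed

lemma sinh_complex_of_real: "sin (\<i> * of_real x) = \<i> * of_real (sinh x)"
  by (simp add: sin_i_times sinh_field_def exp_of_real exp_minus)

lemma cnj_shift_kernel: "shift_kernel b c (cnj z) = cnj (shift_kernel b c z)"
  by (simp add: shift_kernel_def cnj_Gamma cnj_cos)

lemma shift_kernel_minus: "shift_kernel b c (- z) = - shift_kernel b c z"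
proof -
  have "(- w) * x * p * q * u * v = - (w * x * q * p * v * u)" for w x p q u v :: complex by algebra
  thus ?thesis
    unfolding shift_kernel_def mult_minus_right cos_minus add_uminus_conv_diff diff_minus_eq_add .
qed

text \<open>On this line each pair of Gamma factors is \<Gamma>(a + 1 + ix) \<Gamma>(a - ix) = (a +
  ix) |\<Gamma>(a + ix)|^2, and the cosine is -i sinh (\<pi> x). Besides the weight there remains a
  polynomial whose relevant part is even and quadratic, so the vanishing of the integral relates the
  zeroth and second moments.\<close>

lemma shift_kernel_half:
  assumes "0 < b" "0 < c"
  shows "Re (shift_kernel b c (Complex (1 / 2) x)) =
    (b * c + b\<^sup>2 / 2 + b\<^sup>2 * c - (1 / 2 + 2 * b + c) * x\<^sup>2) * wilson_weight b c x"
proof -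
  define g where "g = (norm (Gamma (Complex b x)))\<^sup>2"
  define h where "h = (norm (Gamma (Complex c x)))\<^sup>2"
  have Gp: "Gamma (of_real a + 1 / 2 + Complex (1 / 2) x) * Gamma (of_real a + 1 / 2 - Complex (1 / 2) x)
      = Complex a x * of_real ((norm (Gamma (Complex a x)))\<^sup>2)" if "0 < a" for a
  proof -
    have "Complex a x \<notin> \<int>\<^sub>\<le>\<^sub>0"
      using that by (auto elim!: nonpos_Ints_cases simp: complex_eq_iff)
    hence 1: "Gamma (Complex a x + 1) = Complex a x * Gamma (Complex a x)" by (rule Gamma_plus1)
    have 2: "of_real a + 1 / 2 + Complex (1 / 2) x = Complex a x + 1"
      "of_real a + 1 / 2 - Complex (1 / 2) x = cnj (Complex a x)"
      by (auto simp: complex_eq_iff)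
    show ?thesis unfolding 2 1 cnj_Gamma[symmetric] by (simp add: complex_norm_square mult_ac del: of_real_power)
  qed
  have c: "cos (of_real pi * Complex (1 / 2) x) = - (\<i> * of_real (sinh (pi * x)))"
  proof -
    have "of_real pi * Complex (1 / 2) x = of_real pi / 2 + \<i> * of_real (pi * x)"
      by (simp add: complex_eq_iff)
    hence "cos (of_real pi * Complex (1 / 2) x) = - sin (\<i> * of_real (pi * x))"
      by (simp only: cos_add) (simp flip: cos_of_real sin_of_real)
    thus ?thesis by (simp only: sinh_complex_of_real)
  qed
  have "shift_kernel b c (Complex (1 / 2) x) = Complex (1 / 2) x * cos (of_real pi * Complex (1 / 2) x) *
      (Gamma (of_real b + 1 / 2 + Complex (1 / 2) x) * Gamma (of_real b + 1 / 2 - Complex (1 / 2) x)) ^ 2 *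
      (Gamma (of_real c + 1 / 2 + Complex (1 / 2) x) * Gamma (of_real c + 1 / 2 - Complex (1 / 2) x))"
    by (simp add: shift_kernel_def power_mult_distrib mult_ac)
  also have "\<dots> = Complex (1 / 2) x * (- (\<i> * of_real (sinh (pi * x)))) * (Complex b x * of_real g) ^ 2 * (Complex c x * of_real h)"
    unfolding c Gp[OF assms(1)] Gp[OF assms(2)] g_def h_def ..
  also have "\<dots> = of_real (sinh (pi * x) * g\<^sup>2 * h) * (- \<i> * (Complex (1 / 2) x * Complex b x ^ 2 * Complex c x))"
    by (simp add: power_mult_distrib mult_ac)
  also have "Re \<dots> = sinh (pi * x) * g\<^sup>2 * h * Im (Complex (1 / 2) x * Complex b x ^ 2 * Complex c x)"
    by (subst times_complex.sel(1)) (simp del: of_real_mult)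
  also have "Im (Complex (1 / 2) x * Complex b x ^ 2 * Complex c x) = x * (b * c + b\<^sup>2 / 2 + b\<^sup>2 * c - (1 / 2 + 2 * b + c) * x\<^sup>2)"
    by (simp add: power2_eq_square algebra_simps)
  finally show ?thesis by (simp add: wilson_weight_def g_def h_def power_mult[symmetric] mult_ac)
qed

text \<open>Cauchy's theorem by means of a primitive \<open>K\<close> on the strip: the imaginary
  part of its difference across the strip has twice the integrand as derivative and is at most the
  kernel on a segment of length one, so it tends to 0 at both ends.\<close>

lemma integral_shift_kernel:
  assumes b: "0 < b" and c: "0 < c"
  shows "(\<integral>x. Re (shift_kernel b c (Complex (1 / 2) x)) \<partial>lborel) = 0"
proof -
  define S where "S = {z::complex. \<bar>Re z\<bar> < min b c + 1 / 2}"
  define k where "k = shift_kernel b c"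
  have S: "S = {z. Re z < min b c + 1 / 2} \<inter> {z. Re z > - (min b c + 1 / 2)}"
    unfolding S_def by (auto simp: abs_less_iff)
  have "open S" "convex S" unfolding S
    by (auto intro!: open_Int convex_Int open_halfspace_Re_lt open_halfspace_Re_gt convex_halfspace_Re_lt convex_halfspace_Re_gt)
  have holo: "k holomorphic_on S" unfolding S_def k_def using shift_kernel_holomorphic[OF b c] .
  then obtain K where K0: "\<And>z. z \<in> S \<Longrightarrow> (K has_field_derivative k z) (at z within S)"
    using holomorphic_convex_primitive'[OF \<open>convex S\<close> \<open>open S\<close>] by blast
  have K: "(K has_field_derivative k z) (at z)" if "z \<in> S" for z
    using K0[OF that] at_within_open[OF that \<open>open S\<close>] by simp
  have inS: "Complex u y \<in> S" if "\<bar>u\<bar> \<le> 1 / 2" for u y using that b c by (auto simp: S_def)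
  obtain C q where C: "C > 0" "\<And>z. \<bar>Re z\<bar> \<le> 1 / 2 \<Longrightarrow> norm (k z) \<le> C * (1 + \<bar>Im z\<bar>) ^ q * exp (- 2 * pi * \<bar>Im z\<bar>)"
    using shift_kernel_le[OF b c] unfolding k_def by blast
  define H where "H y = Im (K (Complex (1 / 2) y) - K (Complex (- 1 / 2) y))" for y
  have H': "(H has_vector_derivative 2 * Re (k (Complex (1 / 2) y))) (at y)" for y
  proof -
    have 1: "((\<lambda>y. K (Complex u y)) has_vector_derivative \<i> * k (Complex u y)) (at y)" if "\<bar>u\<bar> \<le> 1 / 2" for u
    proof -
      have "((\<lambda>y. Complex u y) has_vector_derivative \<i>) (at y)"
        unfolding Complex_eq by (auto intro!: derivative_eq_intros)
      from field_vector_diff_chain_at[OF this K[OF inS[OF that]]] show ?thesis by (simp add: o_def)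
    qed
    \<comment> \<open>Reflection in the imaginary axis is conjugation followed by negation. The
      kernel on the left line is therefore minus the conjugate of the kernel on the right line, and
      the real parts add up.\<close>
    have "Complex (- 1 / 2) y = - cnj (Complex (1 / 2) y)" by (simp add: complex_eq_iff)
    hence 2: "k (Complex (- 1 / 2) y) = - cnj (k (Complex (1 / 2) y))"
      unfolding k_def by (simp only: shift_kernel_minus cnj_shift_kernel)
    have "((\<lambda>y. Im (K (Complex (1 / 2) y) - K (Complex (- 1 / 2) y))) has_vector_derivative
        Im (\<i> * k (Complex (1 / 2) y) - \<i> * k (Complex (- 1 / 2) y))) (at y)"
      by (intro bounded_linear.has_vector_derivative[OF bounded_linear_Im] has_vector_derivative_diff 1) auto
    thus ?thesis unfolding H_def 2 by simp
  qed
  have Hle: "\<bar>H y\<bar> \<le> C * (1 + \<bar>y\<bar>) ^ q * exp (- 2 * pi * \<bar>y\<bar>)" for y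
  proof -
    have "norm (K (Complex (1 / 2) y) - K (Complex (- 1 / 2) y)) \<le>
        (C * (1 + \<bar>y\<bar>) ^ q * exp (- 2 * pi * \<bar>y\<bar>)) * norm (Complex (1 / 2) y - Complex (- 1 / 2) y)"
    proof (rule field_differentiable_bound[where S = "closed_segment (Complex (- 1 / 2) y) (Complex (1 / 2) y)"])
      fix z assume "z \<in> closed_segment (Complex (- 1 / 2) y) (Complex (1 / 2) y)"
      hence z: "\<bar>Re z\<bar> \<le> 1 / 2" "Im z = y"
        by (auto simp: in_segment complex_eq_iff abs_le_iff algebra_simps)
      thus "(K has_field_derivative k z) (at z within closed_segment (Complex (- 1 / 2) y) (Complex (1 / 2) y))"
        using K[of z] inS[of "Re z" y] by (auto intro: has_field_derivative_at_within)
      show "norm (k z) \<le> C * (1 + \<bar>y\<bar>) ^ q * exp (- 2 * pi * \<bar>y\<bar>)"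
        using C(2)[OF z(1)] z by simp
    qed auto
    moreover have "Complex (1 / 2) y - Complex (- 1 / 2) y = 1" by (simp add: complex_eq_iff)
    ultimately show ?thesis unfolding H_def using abs_Im_le_cmod order.trans by fastforce
  qed
  have Hlim: "(H \<longlongrightarrow> 0) F" if "filterlim abs at_top F" for F :: "real filter"
  proof (rule Lim_null_comparison)
    show "\<forall>\<^sub>F y in F. norm (H y) \<le> C * (1 + \<bar>y\<bar>) ^ q * exp (- 2 * pi * \<bar>y\<bar>)"
      using Hle by (intro always_eventually) auto
    have "((\<lambda>t::real. C * (1 + t) ^ q * exp (- 2 * pi * t)) \<longlongrightarrow> 0) at_top"
    proof -
      have "((\<lambda>t::real. C * ((fact q * exp 1) * exp (- t))) \<longlongrightarrow> 0) at_top"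
        by (intro tendsto_mult_right_zero filterlim_compose[OF exp_at_bot filterlim_uminus_at_bot_at_top])
      moreover have "\<forall>\<^sub>F t::real in at_top. norm (C * (1 + t) ^ q * exp (- 2 * pi * t)) \<le> C * ((fact q * exp 1) * exp (- t))"
        using eventually_ge_at_top[of 0]
      proof eventually_elim
        case (elim t)
        have "(1 + t) ^ q * exp (- 2 * pi * t) \<le> (fact q * exp 1 * exp t) * exp (- 2 * t)"
          using one_plus_power_le_exp[of t 1 q] elim pi_ge_two mult_right_mono[of 1 pi t]
          by (intro mult_mono) auto
        also have "\<dots> = fact q * exp 1 * (exp t * exp (- 2 * t))" by simp
        also have "exp t * exp (- 2 * t) = exp (- t)" by (simp add: exp_add[symmetric])
        finally show ?case using C(1) elim by (simp add: mult.assoc)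
      qed
      ultimately show ?thesis by (rule Lim_null_comparison[rotated])
    qed
    from filterlim_compose[OF this that] show "((\<lambda>y. C * (1 + \<bar>y\<bar>) ^ q * exp (- 2 * pi * \<bar>y\<bar>)) \<longlongrightarrow> 0) F" by simp
  qed
  have cont: "continuous_on UNIV (\<lambda>y. k (Complex (1 / 2) y))"
    unfolding Complex_eq
    by (rule continuous_on_compose2[OF holomorphic_on_imp_continuous_on[OF holo]])
      (auto intro!: continuous_intros simp: S_def b c)
  have int: "integrable lborel (\<lambda>y. 2 * Re (k (Complex (1 / 2) y)))"
  proof (rule integrable_poly_exp_bound)
    show "(\<lambda>y. 2 * Re (k (Complex (1 / 2) y))) \<in> borel_measurable borel"
      by (intro borel_measurable_continuous_onI continuous_intros cont)
    show "\<bar>2 * Re (k (Complex (1 / 2) y))\<bar> \<le> (2 * C) * (1 + \<bar>y\<bar>) ^ q * exp (- (2 * pi) * \<bar>y\<bar>)" for y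
      using C(2)[of "Complex (1 / 2) y"] abs_Re_le_cmod[of "k (Complex (1 / 2) y)"] by (simp add: abs_mult)
  qed simp
  have "(LBINT y=-\<infinity>..\<infinity>. 2 * Re (k (Complex (1 / 2) y))) = 0 - 0"
  proof (rule interval_integral_FTC_integrable)
    show "isCont (\<lambda>y. 2 * Re (k (Complex (1 / 2) y))) x" for x
      using cont by (auto simp: continuous_on_eq_continuous_at intro!: continuous_intros)
    show "set_integrable lborel (einterval (- \<infinity>) \<infinity>) (\<lambda>y. 2 * Re (k (Complex (1 / 2) y)))"
      using int by (simp add: set_integrable_def)
    have "filterlim (abs :: real \<Rightarrow> real) at_top at_bot"
      using filterlim_compose[OF filterlim_abs_real filterlim_uminus_at_top_at_bot] by simp
    thus "((H \<circ> real_of_ereal) \<longlongrightarrow> 0) (at_right (- \<infinity>))"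
      unfolding at_right_MInf filterlim_filtermap o_def by (simp add: Hlim)
    show "((H \<circ> real_of_ereal) \<longlongrightarrow> 0) (at_left \<infinity>)"
      unfolding at_left_PInf filterlim_filtermap o_def by (simp add: Hlim filterlim_abs_real)
  qed (use H' in auto)
  thus ?thesis
    by (simp add: interval_lebesgue_integral_def set_lebesgue_integral_def k_def)
qed

text \<open>Raising c by one multiplies the weight by c^2 + x^2, and the vanishing contour integral
  expresses the second moment by the zeroth. The factor is the quotient of consecutive values of
  \<open>wilson_moment\<close>.\<close>

lemma integral_wilson_weight_Suc:
  assumes b: "0 < b" and c: "0 < c"
  shows "(\<integral>x. wilson_weight b (c + 1) x \<partial>lborel) =
    (c + 1 / 2) * (c + b)\<^sup>2 / (1 / 2 + 2 * b + c) * (\<integral>x. wilson_weight b c x \<partial>lborel)"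
proof -
  have i0: "integrable lborel (wilson_weight b c)"
    using integrable_wilson_weight_mult[OF assms, of "\<lambda>_. 1" 0 1 0] by simp
  have "x\<^sup>2 \<le> (1 + \<bar>x\<bar>)\<^sup>2" for x :: real by (rule power2_le_iff_abs_le[THEN iffD2]) auto
  hence i2: "integrable lborel (\<lambda>x. x\<^sup>2 * wilson_weight b c x)"
    by (intro integrable_wilson_weight_mult[OF assms, of _ 0 1 2]) auto
  define e where "e = 1 / 2 + 2 * b + c"
  have e: "e > 0" using b c by (simp add: e_def)
  define I0 where "I0 = (\<integral>x. wilson_weight b c x \<partial>lborel)"
  define I2 where "I2 = (\<integral>x. x\<^sup>2 * wilson_weight b c x \<partial>lborel)"
  have "(\<integral>x. (b * c + b\<^sup>2 / 2 + b\<^sup>2 * c) * wilson_weight b c x - e * (x\<^sup>2 * wilson_weight b c x) \<partial>lborel) = 0"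
    using integral_shift_kernel[OF assms] unfolding shift_kernel_half[OF assms] e_def[symmetric]
    by (simp add: algebra_simps)
  hence *: "e * I2 = (b * c + b\<^sup>2 / 2 + b\<^sup>2 * c) * I0"
    using i0 i2 by (simp add: I0_def I2_def)
  have "wilson_weight b (c + 1) x = c\<^sup>2 * wilson_weight b c x + x\<^sup>2 * wilson_weight b c x" for x
  proof -
    have "Complex c x \<notin> \<int>\<^sub>\<le>\<^sub>0"
      using c by (auto elim!: nonpos_Ints_cases simp: complex_eq_iff)
    moreover have "Complex (c + 1) x = Complex c x + 1" by (simp add: complex_eq_iff)
    ultimately have "norm (Gamma (Complex (c + 1) x)) ^ 2 = (c\<^sup>2 + x\<^sup>2) * norm (Gamma (Complex c x)) ^ 2"
      by (simp add: Gamma_plus1 norm_mult power_mult_distrib cmod_power2)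
    thus ?thesis by (simp add: wilson_weight_def algebra_simps)
  qed
  hence "(\<integral>x. wilson_weight b (c + 1) x \<partial>lborel) = c\<^sup>2 * I0 + I2"
    using i0 i2 by (simp add: I0_def I2_def)
  also have "\<dots> = (c + 1 / 2) * (c + b)\<^sup>2 / e * I0"
  proof -
    have "e * (c\<^sup>2 * I0 + I2) = (c + 1 / 2) * (c + b)\<^sup>2 * I0"
      unfolding distrib_left * by (simp add: e_def power2_eq_square algebra_simps)
    thus ?thesis using e by (simp add: field_simps)
  qed
  finally show ?thesis by (simp add: e_def I0_def)
qed

section \<open>Meixner--Pollaczek coefficients\<close>

text \<open>The coefficient is the circle mean of f(y) / y^n, and the mean of Re g is Re g(0). A
  harmonic majorant in place of a constant one replaces the supremum over the circle by a mean; for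
  a Poisson kernel this gains a factor of order 1 - R.\<close>

lemma norm_taylor_coeff_le_Re:
  fixes f g :: "complex \<Rightarrow> complex"
  assumes f: "f holomorphic_on ball 0 1" and g: "g holomorphic_on ball 0 1"
    and R: "0 < R" "R < 1" and le: "\<And>y. norm y = R \<Longrightarrow> norm (f y) \<le> Re (g y)"
  shows "norm ((deriv ^^ n) f 0 / fact n) * R ^ n \<le> Re (g 0)"
proof -
  define \<gamma> where "\<gamma> = circlepath (0::complex) R"
  have sub: "cball 0 R \<subseteq> ball (0::complex) 1" using R by auto
  have norm\<gamma>: "norm (\<gamma> x) = R" for x
    using R by (simp add: \<gamma>_def circlepath norm_mult)
  have \<gamma>0: "\<gamma> x \<noteq> 0" for x using norm\<gamma>[of x] R by auto
  have coeff: "((\<lambda>x. h (\<gamma> x) / \<gamma> x ^ n) has_integral (deriv ^^ n) h 0 / fact n) {0..1}"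
    if h: "h holomorphic_on ball 0 1" for h n
  proof -
    have "((\<lambda>u. h u / (u - 0) ^ Suc n) has_contour_integral ((2 * pi * \<i>) / fact n * (deriv ^^ n) h 0)) \<gamma>"
      unfolding \<gamma>_def
      by (rule Cauchy_has_contour_integral_higher_derivative_circlepath)
        (use h sub R in \<open>auto intro: holomorphic_on_subset holomorphic_on_imp_continuous_on\<close>)
    hence I: "((\<lambda>x. h (\<gamma> x) / \<gamma> x ^ Suc n * (2 * pi * \<i> * R * exp (2 * of_real pi * \<i> * x))) has_integral
        ((2 * pi * \<i>) / fact n * (deriv ^^ n) h 0)) {0..1}"
      unfolding has_contour_integral_def \<gamma>_def vector_derivative_circlepath01
      by (rule has_integral_eq[rotated]) (simp add: vector_derivative_circlepath01)
    have "2 * pi * \<i> * R * exp (2 * of_real pi * \<i> * x) = 2 * pi * \<i> * \<gamma> x" for x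
      by (simp add: \<gamma>_def circlepath)
    hence eq: "h (\<gamma> x) / \<gamma> x ^ Suc n * (2 * pi * \<i> * R * exp (2 * of_real pi * \<i> * x))
        = (2 * pi * \<i>) * (h (\<gamma> x) / \<gamma> x ^ n)" for x
      using \<gamma>0[of x] by (simp add: divide_simps)
    have "((\<lambda>x. (2 * pi * \<i>) * (h (\<gamma> x) / \<gamma> x ^ n)) has_integral
        ((2 * pi * \<i>) * ((deriv ^^ n) h 0 / fact n))) {0..1}"
      using has_integral_eq[OF eq I] by (simp only: times_divide_eq_left times_divide_eq_right)
    thus ?thesis
      by (subst (asm) has_integral_mult_right_iff) simp_all
  qed
  have g': "((\<lambda>x. Re (g (\<gamma> x))) has_integral Re (g 0)) {0..1}"
    using has_integral_Re[OF coeff[OF g, of 0]] by simp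
  have f': "((\<lambda>x. f (\<gamma> x) / \<gamma> x ^ n) has_integral (deriv ^^ n) f 0 / fact n) {0..1}"
    by (rule coeff[OF f])
  have "norm ((deriv ^^ n) f 0 / fact n) = norm (integral {0..1} (\<lambda>x. f (\<gamma> x) / \<gamma> x ^ n))"
    using f' by (simp add: integral_unique)
  also have "\<dots> \<le> integral {0..1} (\<lambda>x. Re (g (\<gamma> x)) / R ^ n)"
  proof (rule integral_norm_bound_integral)
    show "(\<lambda>x. Re (g (\<gamma> x)) / R ^ n) integrable_on {0..1}"
      using has_integral_divide[OF g', of "R ^ n"] by blast
    show "norm (f (\<gamma> x) / \<gamma> x ^ n) \<le> Re (g (\<gamma> x)) / R ^ n" for x
      using le[OF norm\<gamma>[of x]] R by (simp add: norm_divide norm_power norm\<gamma> divide_right_mono)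
  qed (use f' in blast)
  also have "\<dots> = Re (g 0) / R ^ n"
    using has_integral_divide[OF g', of "R ^ n"] by (rule integral_unique)
  finally show ?thesis using R by (simp add: field_simps)
qed

text \<open>At z = ix this is (1 - y)^(-b - ix) (1 + y)^(-b + ix), the generating function of the
  Meixner-Pollaczek polynomials with angle \<pi>/2 in the variable t = iy.\<close>

definition mp_gf :: "real \<Rightarrow> complex \<Rightarrow> complex \<Rightarrow> complex" where
  "mp_gf b z y = (1 - y\<^sup>2) powr (- of_real b) * ((1 + y) / (1 - y)) powr z"

lemma Re_one_minus_pos: "norm (y::complex) < 1 \<Longrightarrow> 0 < Re (1 - y)"
  using complex_Re_le_cmod[of y] by simp

lemma Re_cayley:
  fixes y :: complex
  assumes "norm y < 1"
  shows "Re ((1 + y) / (1 - y)) = (1 - (norm y)\<^sup>2) / (norm (1 - y))\<^sup>2"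
  unfolding Re_divide cmod_power2 by (simp add: power2_eq_square algebra_simps add_divide_distrib diff_divide_distrib)

lemma Re_cayley_pos:
  fixes y :: complex
  assumes "norm y < 1"
  shows "0 < Re ((1 + y) / (1 - y))"
proof -
  have "y \<noteq> 1" using assms by auto
  moreover have "(norm y)\<^sup>2 < 1" using assms by (simp add: power_less_one_iff abs_square_less_1)
  ultimately show ?thesis unfolding Re_cayley[OF assms] by simp
qed

lemma norm_sq_less_1: "norm (y::complex) < 1 \<Longrightarrow> norm (y\<^sup>2) < 1"
  by (simp add: norm_power power_less_one_iff)

lemma not_nonpos_Reals_of_Re_pos: "0 < Re w \<Longrightarrow> w \<notin> \<real>\<^sub>\<le>\<^sub>0"
  by (auto simp: complex_nonpos_Reals_iff)

text \<open>Differentiation raises b by one and leaves z alone. This is behind the three-term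
  recursion, and it lets two derivatives be bounded through the function with b + 2.\<close>

lemma mp_gf_has_field_derivative:
  assumes y: "norm y < 1"
  shows "(mp_gf b z has_field_derivative (2 * z + 2 * b * y) * mp_gf (b + 1) z y) (at y)"
proof -
  have 1: "1 - y\<^sup>2 \<notin> \<real>\<^sub>\<le>\<^sub>0"
    by (rule not_nonpos_Reals_of_Re_pos[OF Re_one_minus_pos[OF norm_sq_less_1[OF y]]])
  have 2: "(1 + y) / (1 - y) \<notin> \<real>\<^sub>\<le>\<^sub>0"
    by (rule not_nonpos_Reals_of_Re_pos[OF Re_cayley_pos[OF y]])
  have n0: "1 - y \<noteq> 0" using y by auto
  have n1: "1 + y \<noteq> 0" using 2 by auto
  have n2: "1 - y\<^sup>2 \<noteq> 0" using 1 by auto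
  have n3: "1 - y\<^sup>2 = (1 - y) * (1 + y)" by (simp add: power2_eq_square algebra_simps)
  define P where "P = (1 - y\<^sup>2) powr (- of_real b)"
  define Q where "Q = ((1 + y) / (1 - y)) powr z"
  have d1: "((\<lambda>y. (1 - y\<^sup>2) powr (- of_real b)) has_field_derivative
      (- of_real b) * (1 - y\<^sup>2) powr (- of_real b - 1) * (- (2 * y))) (at y)"
    using 1 by (auto intro!: derivative_eq_intros)
  have d2: "((\<lambda>y. ((1 + y) / (1 - y)) powr z) has_field_derivative
      z * ((1 + y) / (1 - y)) powr (z - 1) * (2 / (1 - y)\<^sup>2)) (at y)"
    using 2 n0 by (auto intro!: derivative_eq_intros simp: field_simps power2_eq_square)
  have e1: "(1 - y\<^sup>2) powr (- of_real b - 1) = P / (1 - y\<^sup>2)"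
    using n2 by (simp add: P_def powr_diff)
  have e2: "((1 + y) / (1 - y)) powr (z - 1) = Q * (1 - y) / (1 + y)"
    using n0 n1 by (simp add: Q_def powr_diff)
  have "(mp_gf b z has_field_derivative
      (P * (z * (Q * (1 - y) / (1 + y)) * (2 / (1 - y)\<^sup>2)) + (- of_real b) * (P / (1 - y\<^sup>2)) * (- (2 * y)) * Q)) (at y)"
    using DERIV_mult[OF d1 d2] unfolding mp_gf_def e1 e2 P_def Q_def by (simp add: algebra_simps)
  moreover have "mp_gf (b + 1) z y = P * Q / (1 - y\<^sup>2)"
  proof -
    have "- complex_of_real (b + 1) = - of_real b - 1" by simp
    thus ?thesis unfolding mp_gf_def using e1 by (simp add: Q_def)
  qed
  moreover have "P * (z * (Q * (1 - y) / (1 + y)) * (2 / (1 - y)\<^sup>2)) + (- of_real b) * (P / (1 - y\<^sup>2)) * (- (2 * y)) * Q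
     = (2 * z + 2 * b * y) * (P * Q / (1 - y\<^sup>2))"
    using n0 n1 unfolding n3 by (simp add: divide_simps power2_eq_square) (simp add: algebra_simps)
  ultimately show ?thesis by simp
qed

lemma mp_gf_holomorphic: "mp_gf b z holomorphic_on ball 0 1"
  by (rule holomorphic_onI)
    (meson field_differentiable_def has_field_derivative_at_within mem_ball_0 mp_gf_has_field_derivative)

lemma deriv_mp_gf:
  assumes "norm y < 1"
  shows "deriv (mp_gf b z) y = (2 * z + 2 * b * y) * mp_gf (b + 1) z y"
  using mp_gf_has_field_derivative[OF assms] by (rule DERIV_imp_deriv)

lemma mp_gf_Suc:
  assumes "norm y < 1"
  shows "mp_gf b z y = (1 - y\<^sup>2) * mp_gf (b + 1) z y"
proof -
  have n2: "1 - y\<^sup>2 \<noteq> 0" using Re_one_minus_pos[OF norm_sq_less_1[OF assms]] by auto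
  have "- complex_of_real (b + 1) = - of_real b - 1" by simp
  thus ?thesis unfolding mp_gf_def using n2 by (simp add: powr_diff)
qed

lemma mp_gf_0 [simp]: "mp_gf b z 0 = 1"
  by (simp add: mp_gf_def)

definition mp_coeff :: "real \<Rightarrow> complex \<Rightarrow> nat \<Rightarrow> complex" where
  "mp_coeff b z n = (deriv ^^ n) (mp_gf b z) 0 / fact n"

text \<open>Comparison of coefficients in (1 - y^2) f' = (2 z + 2 b y) f, the differential equation
  of the generating function f.\<close>

lemma mp_coeff_rec:
  "of_nat (n + 2) * mp_coeff b z (n + 2) = 2 * z * mp_coeff b z (n + 1) + (of_nat n + 2 * of_real b) * mp_coeff b z n"
  "mp_coeff b z 1 = 2 * z" "mp_coeff b z 0 = 1"
proof -
  define F where "F = fps_expansion (mp_gf b z) 0"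
  have nth: "fps_nth F n = mp_coeff b z n" for n
    by (simp add: F_def fps_expansion_def mp_coeff_def)
  have exp: "mp_gf b z has_fps_expansion F"
    unfolding F_def by (rule has_fps_expansion_fps_expansion[of "ball 0 1"]) (auto intro: mp_gf_holomorphic)
  have 1: "(\<lambda>y. (1 - y ^ 2) * deriv (mp_gf b z) y) has_fps_expansion (1 - fps_X ^ 2) * fps_deriv F"
    by (intro fps_expansion_intros exp)
  have 2: "(\<lambda>y. (2 * z + 2 * of_real b * y) * mp_gf b z y) has_fps_expansion
     (fps_const (2 * z) + fps_const (2 * of_real b) * fps_X) * F"
    by (intro fps_expansion_intros exp)
  have 3: "eventually (\<lambda>y. (1 - y ^ 2) * deriv (mp_gf b z) y = (2 * z + 2 * of_real b * y) * mp_gf b z y) (nhds 0)"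
    by (rule eventually_nhds_in_open[of "ball 0 1", THEN eventually_mono])
      (auto simp: deriv_mp_gf mp_gf_Suc[where b = b])
  have 4: "(\<lambda>y. (2 * z + 2 * of_real b * y) * mp_gf b z y) has_fps_expansion (1 - fps_X ^ 2) * fps_deriv F"
    using 1 3 unfolding has_fps_expansion_def by (auto elim: eventually_elim2)
  have eq: "(1 - fps_X ^ 2) * fps_deriv F = (fps_const (2 * z) + fps_const (2 * of_real b) * fps_X) * F"
    using fps_nth_fps_expansion[OF 4] fps_nth_fps_expansion[OF 2] by (intro fps_ext) (simp only:)
  hence eq': "fps_deriv F - fps_X * (fps_X * fps_deriv F) = fps_const (2 * z) * F + fps_const (2 * of_real b) * (fps_X * F)"
    by (simp add: power2_eq_square ring_distribs mult.assoc)
  show "of_nat (n + 2) * mp_coeff b z (n + 2) = 2 * z * mp_coeff b z (n + 1) + (of_nat n + 2 * of_real b) * mp_coeff b z n"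
  proof -
    have "of_nat (n + 2) * mp_coeff b z (n + 2) - of_nat n * mp_coeff b z n
        = 2 * z * mp_coeff b z (n + 1) + 2 * of_real b * mp_coeff b z n"
      using arg_cong[OF eq', of "\<lambda>G. fps_nth G (Suc n)"] by (cases n) (simp_all add: nth add_ac)
    thus ?thesis by (simp add: algebra_simps)
  qed
  show "mp_coeff b z 1 = 2 * z"
    using arg_cong[OF eq', of "\<lambda>G. fps_nth G 0"] by (simp add: nth mp_coeff_def[of b z 0])
  show "mp_coeff b z 0 = 1" by (simp add: mp_coeff_def)
qed

text \<open>The Cayley transform maps the disc into the right half-plane, where |Arg| \<le> \<pi>/2;
  this gives the exponential in x. Of the power -(b + 2) two units are kept as |1 - y^2|^(-2), which
  is a Poisson kernel up to 1 - |y|^4 and hence the real part of a holomorphic function.\<close>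

lemma norm_mp_gf_le:
  assumes y: "norm y < 1" and b: "0 \<le> b"
  shows "norm (mp_gf (b + 2) (\<i> * of_real x) y)
    \<le> exp (pi * \<bar>x\<bar> / 2) * (1 - (norm y)\<^sup>2) powr (- b) * (Re ((1 + y\<^sup>2) / (1 - y\<^sup>2)) / (1 - (norm y) ^ 4))"
proof -
  define w where "w = (1 + y) / (1 - y)"
  have w: "0 < Re w" unfolding w_def by (rule Re_cayley_pos[OF y])
  have y2: "norm (y\<^sup>2) < 1" by (rule norm_sq_less_1[OF y])
  have pos: "norm (1 - y\<^sup>2) > 0" using y2 by auto
  have ny: "(norm y)\<^sup>2 < 1" using y2 by (simp add: norm_power)
  have "- (x * Arg w) \<le> \<bar>x\<bar> * \<bar>Arg w\<bar>" by (metis abs_ge_minus_self abs_mult)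
  also have "\<dots> \<le> \<bar>x\<bar> * (pi / 2)"
    using w Arg_Re_pos[of w] by (intro mult_left_mono) auto
  finally have 1: "norm (w powr (\<i> * of_real x)) \<le> exp (pi * \<bar>x\<bar> / 2)"
    using w by (auto simp: norm_powr_complex mult.commute)
  have "norm ((1 - y\<^sup>2) powr (- of_real (b + 2))) = norm (1 - y\<^sup>2) powr (- (b + 2))"
    by (subst norm_powr_real_powr') auto
  also have "\<dots> = norm (1 - y\<^sup>2) powr (- b) * norm (1 - y\<^sup>2) powr (- 2)"
    by (simp add: powr_add[symmetric])
  also have "norm (1 - y\<^sup>2) powr (- 2) = 1 / (norm (1 - y\<^sup>2))\<^sup>2"
    using pos by (simp add: powr_minus powr_numeral divide_inverse)
  also have "\<dots> = Re ((1 + y\<^sup>2) / (1 - y\<^sup>2)) / (1 - (norm y) ^ 4)"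
  proof -
    have "(norm y) ^ 4 < 1" using y by (simp add: power_less_one_iff)
    thus ?thesis unfolding Re_cayley[OF y2] using pos by (simp add: norm_power)
  qed
  finally have 2: "norm ((1 - y\<^sup>2) powr (- of_real (b + 2))) =
      norm (1 - y\<^sup>2) powr (- b) * (Re ((1 + y\<^sup>2) / (1 - y\<^sup>2)) / (1 - (norm y) ^ 4))" .
  have le: "1 - (norm y)\<^sup>2 \<le> norm (1 - y\<^sup>2)"
    using norm_triangle_ineq2[of 1 "y\<^sup>2"] by (simp add: norm_power)
  have 3: "norm (1 - y\<^sup>2) powr (- b) \<le> (1 - (norm y)\<^sup>2) powr (- b)"
    using b ny le by (intro powr_mono2') auto
  have 4: "0 \<le> Re ((1 + y\<^sup>2) / (1 - y\<^sup>2)) / (1 - (norm y) ^ 4)"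
    using Re_cayley_pos[OF y2] y by (intro divide_nonneg_nonneg) (auto simp: power_le_one less_imp_le)
  have "norm (mp_gf (b + 2) (\<i> * of_real x) y)
      \<le> (1 - (norm y)\<^sup>2) powr (- b) * (Re ((1 + y\<^sup>2) / (1 - y\<^sup>2)) / (1 - (norm y) ^ 4)) * exp (pi * \<bar>x\<bar> / 2)"
    unfolding mp_gf_def norm_mult w_def[symmetric] 2
    by (rule mult_mono[OF mult_right_mono[OF 3 4] 1 mult_nonneg_nonneg[OF _ 4]]) simp_all
  thus ?thesis by (simp add: mult_ac)
qed

lemma deriv_deriv_mp_gf:
  assumes "norm y < 1"
  shows "deriv (deriv (mp_gf b z)) y =
    (2 * of_real b * (1 - y\<^sup>2) + (2 * z + 2 * of_real b * y) * (2 * z + 2 * (of_real b + 1) * y)) * mp_gf (b + 2) z y"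
proof -
  have "eventually (\<lambda>y. deriv (mp_gf b z) y = (2 * z + 2 * b * y) * mp_gf (b + 1) z y) (nhds y)"
    by (rule eventually_nhds_in_open[of "ball 0 1", THEN eventually_mono])
      (use assms in \<open>auto simp: deriv_mp_gf\<close>)
  hence "deriv (deriv (mp_gf b z)) y = deriv (\<lambda>y. (2 * z + 2 * b * y) * mp_gf (b + 1) z y) y"
    by (intro deriv_cong_ev) auto
  also have "\<dots> = 2 * b * mp_gf (b + 1) z y + (2 * z + 2 * b * y) * ((2 * z + 2 * (b + 1) * y) * mp_gf (b + 2) z y)"
  proof (rule DERIV_imp_deriv)
    have "(mp_gf (b + 1) z has_field_derivative (2 * z + 2 * (b + 1) * y) * mp_gf (b + 2) z y) (at y)"
      using mp_gf_has_field_derivative[OF assms, of "b + 1" z] by (simp add: add.assoc)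
    thus "((\<lambda>y. (2 * z + 2 * b * y) * mp_gf (b + 1) z y) has_field_derivative
      2 * b * mp_gf (b + 1) z y + (2 * z + 2 * b * y) * ((2 * z + 2 * (b + 1) * y) * mp_gf (b + 2) z y)) (at y)"
      by (auto intro!: derivative_eq_intros)
  qed
  also have "mp_gf (b + 1) z y = (1 - y\<^sup>2) * mp_gf (b + 2) z y"
    using mp_gf_Suc[OF assms, of "b + 1" z] by (simp add: add.assoc)
  finally show ?thesis by (simp add: algebra_simps)
qed

lemma power_one_minus_inverse_ge:
  fixes n :: nat
  shows "exp (- 1) \<le> (1 - 1 / (real n + 2)) ^ (n + 1)"
proof -
  define u where "u = 1 + 1 / (real n + 1)"
  have "u \<le> exp (1 / (real n + 1))" unfolding u_def by (rule exp_ge_add_one_self)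
  hence "u ^ (n + 1) \<le> exp (1 / (real n + 1)) ^ (n + 1)"
    by (intro power_mono) (auto simp: u_def)
  also have "\<dots> = exp 1"
    by (subst exp_of_nat_mult[symmetric]) (auto simp: add.commute add_divide_distrib[symmetric] divide_simps)
  finally have "u ^ (n + 1) \<le> exp 1" .
  moreover have "1 - 1 / (real n + 2) = inverse u" by (simp add: u_def field_simps)
  moreover have "u > 0" by (auto simp: u_def intro!: add_pos_nonneg)
  ultimately show ?thesis
    by (simp only: power_inverse exp_minus) (intro le_imp_inverse_le, auto)
qed

text \<open>The order n^(b - 1) is the one to expect from the singularities at 1 and -1. Two
  derivatives put the exponent at b + 2, so that the Poisson kernel can be split off for every b
  \<ge> 0; they are paid back by (n + 2) (n + 1).\<close>

lemma norm_mp_coeff_le: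
  assumes b: "0 \<le> b"
  shows "norm (mp_coeff b (\<i> * of_real x) (n + 2))
    \<le> 4 * exp 1 * (\<bar>x\<bar> + b + 1)\<^sup>2 * exp (pi * \<bar>x\<bar> / 2) * (real n + 2) powr (b + 1) / ((real n + 2) * (real n + 1))"
proof -
  define z where "z = \<i> * complex_of_real x"
  \<comment> \<open>With 1 - R^2 = 1 / (n + 2) the negative powers of 1 - R^2 become powers of n +
    2, while R^n stays above exp (-1).\<close>
  define R where "R = sqrt (1 - 1 / (real n + 2))"
  define M where "M = 4 * (\<bar>x\<bar> + b + 1)\<^sup>2 * exp (pi * \<bar>x\<bar> / 2) * (1 - R\<^sup>2) powr (- b) / (1 - R ^ 4)"
  define f where "f = deriv (deriv (mp_gf b z))"
  have R2: "R\<^sup>2 = 1 - 1 / (real n + 2)" by (simp add: R_def)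
  have R: "0 < R" "R < 1" by (auto simp: R_def)
  have nz: "norm z = \<bar>x\<bar>" by (simp add: z_def norm_mult)
  have holf: "f holomorphic_on ball 0 1"
    unfolding f_def by (intro holomorphic_deriv mp_gf_holomorphic) auto
  have holg: "(\<lambda>y. of_real M * ((1 + y\<^sup>2) / (1 - y\<^sup>2))) holomorphic_on ball 0 1"
    by (intro holomorphic_intros) (use norm_sq_less_1 in force)
  have "norm ((deriv ^^ n) f 0 / fact n) * R ^ n \<le> Re (of_real M * ((1 + 0\<^sup>2) / (1 - 0\<^sup>2)))"
  proof (rule norm_taylor_coeff_le_Re[OF holf holg R])
    fix y :: complex assume y: "norm y = R"
    have y1: "norm y < 1" using y R by simp
    have "norm (2 * of_real b * (1 - y\<^sup>2) + (2 * z + 2 * of_real b * y) * (2 * z + 2 * (of_real b + 1) * y))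
        \<le> 2 * b * (1 + 1) + (2 * \<bar>x\<bar> + 2 * b) * (2 * \<bar>x\<bar> + 2 * (b + 1))"
    proof (intro norm_triangle_le add_mono)
      have "norm (1 - y\<^sup>2) \<le> 1 + 1"
        using norm_triangle_ineq4[of 1 "y\<^sup>2"] norm_sq_less_1[OF y1] by simp
      hence "2 * b * norm (1 - y\<^sup>2) \<le> 2 * b * (1 + 1)"
        using b by (intro mult_left_mono) auto
      thus "norm (2 * of_real b * (1 - y\<^sup>2)) \<le> 2 * b * (1 + 1)" using b by (simp add: norm_mult)
      have aux: "norm (2 * z + 2 * of_real c * y) \<le> 2 * \<bar>x\<bar> + 2 * c" if "c \<ge> 0" for c
      proof -
        have "norm (2 * z + 2 * of_real c * y) \<le> norm (2 * z) + norm (2 * of_real c * y)"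
          by (rule norm_triangle_ineq)
        also have "\<dots> \<le> 2 * \<bar>x\<bar> + 2 * c"
          using that y1 nz by (simp add: norm_mult mult_left_le)
        finally show ?thesis .
      qed
      have "norm (2 * z + 2 * of_real b * y) * norm (2 * z + 2 * (of_real b + 1) * y)
          \<le> (2 * \<bar>x\<bar> + 2 * b) * (2 * \<bar>x\<bar> + 2 * (b + 1))"
        using aux[of b] aux[of "b + 1"] b by (intro mult_mono) auto
      thus "norm ((2 * z + 2 * of_real b * y) * (2 * z + 2 * (of_real b + 1) * y))
          \<le> (2 * \<bar>x\<bar> + 2 * b) * (2 * \<bar>x\<bar> + 2 * (b + 1))" by (simp add: norm_mult)
    qed
    also have "\<dots> \<le> 4 * (\<bar>x\<bar> + b + 1)\<^sup>2"
      using b by (simp add: power2_eq_square algebra_simps)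
    finally have 1: "norm (2 * of_real b * (1 - y\<^sup>2) + (2 * z + 2 * of_real b * y) * (2 * z + 2 * (of_real b + 1) * y)) \<le> 4 * (\<bar>x\<bar> + b + 1)\<^sup>2" .
    have "norm (f y) \<le> 4 * (\<bar>x\<bar> + b + 1)\<^sup>2 * (exp (pi * \<bar>x\<bar> / 2) * (1 - (norm y)\<^sup>2) powr (- b) * (Re ((1 + y\<^sup>2) / (1 - y\<^sup>2)) / (1 - (norm y) ^ 4)))"
      unfolding f_def deriv_deriv_mp_gf[OF y1] norm_mult[of _ "mp_gf _ _ _"]
      by (rule mult_mono[OF 1 norm_mp_gf_le[OF y1 b, of x, folded z_def]]) auto
    also have "\<dots> = Re (of_real M * ((1 + y\<^sup>2) / (1 - y\<^sup>2)))"
      unfolding M_def y times_complex.sel by simp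
    finally show "norm (f y) \<le> Re (of_real M * ((1 + y\<^sup>2) / (1 - y\<^sup>2)))" .
  qed
  hence le: "norm ((deriv ^^ n) f 0 / fact n) * R ^ n \<le> M" by simp
  have "(deriv ^^ n) f = (deriv ^^ (n + 2)) (mp_gf b z)"
    by (simp add: f_def funpow_swap1 numeral_2_eq_2)
  moreover have "fact (n + 2) = (of_nat ((n + 2) * (n + 1)) * fact n :: complex)"
    by (simp add: numeral_2_eq_2 algebra_simps)
  moreover have "of_nat ((n + 2) * (n + 1)) \<noteq> (0 :: complex)"
    by (subst of_nat_eq_0_iff) simp
  ultimately have c: "(deriv ^^ n) f 0 / fact n = of_nat ((n + 2) * (n + 1)) * mp_coeff b z (n + 2)"
    by (simp only: mp_coeff_def) (simp add: divide_simps del: of_nat_mult of_nat_add)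
  have "exp (- 1) \<le> (R\<^sup>2) ^ (n + 1)" unfolding R2 by (rule power_one_minus_inverse_ge)
  also have "\<dots> = R ^ (2 * (n + 1))" by (simp only: power_mult)
  also have "\<dots> \<le> R ^ n" using R by (intro power_decreasing) auto
  finally have "exp (- 1) \<le> R ^ n" .
  have "norm ((deriv ^^ n) f 0 / fact n) * exp (- 1) \<le> norm ((deriv ^^ n) f 0 / fact n) * R ^ n"
    by (intro mult_left_mono) (use \<open>exp (- 1) \<le> R ^ n\<close> in auto)
  also note le
  also have "M \<le> 4 * (\<bar>x\<bar> + b + 1)\<^sup>2 * exp (pi * \<bar>x\<bar> / 2) * (real n + 2) powr (b + 1)"
  proof -
    have "R ^ 4 \<le> R\<^sup>2" using R by (intro power_decreasing) auto
    hence "(1 - R\<^sup>2) powr (- b) / (1 - R ^ 4) \<le> (1 - R\<^sup>2) powr (- b) / (1 - R\<^sup>2)"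
      using R by (intro divide_left_mono mult_pos_pos) (auto simp: power_less_one_iff abs_square_less_1)
    also have "\<dots> = (real n + 2) powr (b + 1)"
      by (simp add: R2 powr_add powr_minus powr_divide)
    finally show ?thesis unfolding M_def times_divide_eq_right[symmetric] mult.assoc
      by (intro mult_left_mono) auto
  qed
  finally have "real ((n + 2) * (n + 1)) * norm (mp_coeff b z (n + 2)) * exp (- 1)
      \<le> 4 * (\<bar>x\<bar> + b + 1)\<^sup>2 * exp (pi * \<bar>x\<bar> / 2) * (real n + 2) powr (b + 1)"
    unfolding c norm_mult norm_of_nat .
  hence "real ((n + 2) * (n + 1)) * norm (mp_coeff b z (n + 2))
      \<le> 4 * (\<bar>x\<bar> + b + 1)\<^sup>2 * exp (pi * \<bar>x\<bar> / 2) * (real n + 2) powr (b + 1) * exp 1"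
    by (simp only: exp_minus divide_inverse[symmetric] pos_divide_le_eq[OF exp_gt_zero])
  moreover have "real ((n + 2) * (n + 1)) = (real n + 2) * (real n + 1)" by (simp add: algebra_simps)
  moreover have "0 < (real n + 2) * (real n + 1)" by simp
  ultimately show ?thesis unfolding z_def[symmetric]
    by (simp only: pos_le_divide_eq) (simp only: mult_ac)
qed

section \<open>Continuous dual Hahn polynomials\<close>

definition linear_functional :: "(real poly \<Rightarrow> real) \<Rightarrow> bool" where
  "linear_functional W \<longleftrightarrow> (\<forall>p q. W (p + q) = W p + W q) \<and> (\<forall>c p. W (smult c p) = c * W p)"

lemma linear_functionalD:
  assumes "linear_functional W"
  shows "W (p + q) = W p + W q" "W (smult c p) = c * W p" "W 0 = 0" "W (- p) = - W p" "W (p - q) = W p - W q"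
proof -
  show add: "W (p + q) = W p + W q" and sm: "\<And>c p. W (smult c p) = c * W p" for p q
    using assms by (auto simp: linear_functional_def)
  show "W 0 = 0" using sm[of 0 0] by simp
  show m: "W (- p) = - W p" for p using sm[of "- 1" p] by simp
  show "W (p - q) = W p - W q" using add[of p "- q"] m[of q] by simp
qed

lemma linear_functional_sum:
  assumes "linear_functional W"
  shows "W (\<Sum>i\<in>I. f i) = (\<Sum>i\<in>I. W (f i))"
  by (induction I rule: infinite_finite_induct) (auto simp: linear_functionalD[OF assms])

lemma linear_functional_mult_left:
  assumes "linear_functional W" shows "linear_functional (\<lambda>q. W (p * q))"
  unfolding linear_functional_def by (simp add: ring_distribs linear_functionalD[OF assms])

lemma linear_functional_scale:
  assumes "linear_functional W" shows "linear_functional (\<lambda>q. k * W q)"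
  unfolding linear_functional_def by (simp add: ring_distribs linear_functionalD[OF assms])

lemma linear_functional_eqI:
  fixes N :: "nat \<Rightarrow> real poly"
  assumes U: "linear_functional U" and V: "linear_functional V"
    and N: "\<And>k. degree (N k) = k" "\<And>k. N k \<noteq> 0" and eq: "\<And>k. U (N k) = V (N k)"
  shows "U p = V p"
proof (induction "degree p" arbitrary: p rule: less_induct)
  case less
  define k where "k = degree p"
  define r where "r = p - smult (lead_coeff p / lead_coeff (N k)) (N k)"
  have lc: "lead_coeff (N k) \<noteq> 0" using N(2) by simp
  have p: "p = r + smult (lead_coeff p / lead_coeff (N k)) (N k)" by (simp add: r_def)
  have "U r = V r"
  proof (cases "r = 0")
    case True thus ?thesis by (simp add: linear_functionalD[OF U] linear_functionalD[OF V])
  next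
    case False
    have "degree r \<le> k"
      unfolding r_def by (rule degree_diff_le) (auto simp: k_def[symmetric] N(1))
    moreover have "coeff r k = 0" using lc by (simp add: r_def k_def[symmetric] N(1))
    ultimately have "degree r < k" using False by (metis le_neq_implies_less leading_coeff_0_iff)
    thus ?thesis using less.hyps by (simp add: k_def)
  qed
  thus ?case by (subst (1 2) p) (simp add: linear_functionalD[OF U] linear_functionalD[OF V] eq)
qed

text \<open>The value at the k-th power of the variable, obtained by solving the triangular system
  whose right-hand sides \<open>e\<close> are the prescribed values.\<close>

fun basis_moment :: "(nat \<Rightarrow> real poly) \<Rightarrow> (nat \<Rightarrow> real) \<Rightarrow> nat \<Rightarrow> real" where
  "basis_moment N e k = (e k - (\<Sum>i<k. coeff (N k) i * basis_moment N e i)) / lead_coeff (N k)"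

declare basis_moment.simps [simp del]

lemma linear_functional_exists:
  fixes N :: "nat \<Rightarrow> real poly"
  assumes N: "\<And>k. degree (N k) = k" "\<And>k. N k \<noteq> 0"
  shows "\<exists>W. linear_functional W \<and> (\<forall>k. W (N k) = e k)"
proof -
  define W where "W p = (\<Sum>i\<le>degree p. coeff p i * basis_moment N e i)" for p
  have W: "W p = (\<Sum>i\<le>m. coeff p i * basis_moment N e i)" if "degree p \<le> m" for p m
    unfolding W_def by (rule sum.mono_neutral_left) (use that in \<open>auto simp: coeff_eq_0\<close>)
  have "linear_functional W"
    unfolding linear_functional_def
  proof (intro conjI allI)
    fix p q :: "real poly" and c :: real
    define m where "m = max (degree p) (degree q)"
    have m: "degree (p + q) \<le> m" "degree p \<le> m" "degree q \<le> m"
      unfolding m_def by (simp_all add: degree_add_le_max)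
    show "W (p + q) = W p + W q"
      by (simp only: m[THEN W] coeff_add distrib_right sum.distrib)
    show "W (smult c p) = c * W p"
      by (simp add: W[of _ "degree p"] degree_smult_le sum_distrib_left mult.assoc)
  qed
  moreover have "W (N k) = e k" for k
  proof -
    have "coeff (N k) k \<noteq> 0" using N by (metis leading_coeff_0_iff)
    thus ?thesis
      by (simp add: W[of _ k] N lessThan_Suc_atMost[symmetric] basis_moment.simps[of N e k])
  qed
  ultimately show ?thesis by blast
qed

text \<open>At the argument -x^2 this is the product of (c + m)^2 + x^2 over m < k, the factor by
  which the weight changes when c is raised by k.\<close>

definition newton :: "real \<Rightarrow> nat \<Rightarrow> real poly" where
  "newton c k = (\<Prod>i<k. [:(c + real i)\<^sup>2, - 1:])"

lemma newton_0 [simp]: "newton c 0 = 1" by (simp add: newton_def)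

lemma newton_Suc: "newton c (Suc k) = [:(c + real k)\<^sup>2, - 1:] * newton c k"
  by (simp add: newton_def mult.commute)

lemma newton_nonzero [simp]: "newton c k \<noteq> 0" by (simp add: newton_def)

lemma degree_newton [simp]: "degree (newton c k) = k"
  by (induction k) (simp_all add: newton_Suc degree_mult_eq del: mult_pCons_left)

lemma newton_add: "newton c (m + j) = newton c m * newton (c + real m) j"
  by (induction j) (simp_all add: newton_Suc mult_ac add_ac del: mult_pCons_left mult_pCons_right)

text \<open>Quotient of Wilson's integrals with parameters 1/2, b, d, c + k and 1/2, b, d, c. The
  rational expression continues it to parameters b and c that are not positive, where the integral
  no longer represents it.\<close>

definition wilson_moment :: "real \<Rightarrow> real \<Rightarrow> real \<Rightarrow> nat \<Rightarrow> real" where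
  "wilson_moment b d c k =
     pochhammer (c + 1 / 2) k * pochhammer (c + b) k * pochhammer (c + d) k / pochhammer (1 / 2 + b + c + d) k"

definition wilson :: "real \<Rightarrow> real \<Rightarrow> real \<Rightarrow> real poly \<Rightarrow> real" where
  "wilson b d c = (SOME W. linear_functional W \<and> (\<forall>k. W (newton c k) = wilson_moment b d c k))"

lemma
  shows linear_wilson: "linear_functional (wilson b d c)"
    and wilson_newton: "wilson b d c (newton c k) = wilson_moment b d c k"
  using someI_ex[OF linear_functional_exists[of "newton c" "wilson_moment b d c"]]
  unfolding wilson_def[symmetric] by auto

lemma wilson_eqI:
  assumes "linear_functional U" "\<And>k. U (newton c k) = wilson_moment b d c k"
  shows "wilson b d c p = U p"
  by (rule linear_functional_eqI[OF linear_wilson assms(1), of "newton c"]) (auto simp: wilson_newton assms)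

lemma wilson_commute: "wilson b d c p = wilson d b c p"
  by (rule wilson_eqI[OF linear_wilson]) (simp add: wilson_newton wilson_moment_def add_ac mult_ac)

text \<open>The Pochhammer symbols split at m. This is the change of weight in algebraic form, and
  it covers nonpositive c.\<close>

lemma wilson_newton_mult:
  "wilson b d c (newton c m * q) = wilson_moment b d c m * wilson b d (c + real m) q"
proof (rule linear_functional_eqI[of _ _ "newton (c + real m)"])
  show "wilson b d c (newton c m * newton (c + real m) k) = wilson_moment b d c m * wilson b d (c + real m) (newton (c + real m) k)" for k
    unfolding newton_add[symmetric] wilson_newton wilson_moment_def pochhammer_product'
    by (simp add: add_ac)
qed (auto intro!: linear_functional_mult_left linear_functional_scale linear_wilson)

text \<open>Wilson's integral is symmetric in its parameters, the Newton basis at c is not; so the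
  shift of b, unlike that of c, has to be checked on the basis. With C = c + k and e = 1/2 + b + c +
  d it comes down to (C + 1/2) (C + b) (C + d) + (b^2 - C^2) (e + k) = (b + C) (b + 1/2) (b +
  d).\<close>

lemma wilson_mult_shift:
  assumes "0 < 1 / 2 + b + c + d"
  shows "wilson b d c ([:b\<^sup>2, - 1:] * q) =
    (b + 1 / 2) * (b + d) * (b + c) / (1 / 2 + b + c + d) * wilson (b + 1) d c q"
proof (rule linear_functional_eqI[of _ _ "newton c"])
  fix k :: nat
  define e where "e = 1 / 2 + b + c + d"
  have e: "e > 0" using assms by (simp add: e_def)
  define C where "C = c + real k"
  have ek: "e + real k > 0" using e by simp
  have pe: "pochhammer e k > 0" using e by (rule pochhammer_pos)
  have "[:b\<^sup>2, - 1:] * newton c k = newton c (Suc k) + smult (b\<^sup>2 - C\<^sup>2) (newton c k)"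
    unfolding newton_Suc C_def[symmetric] by (simp add: algebra_simps smult_diff_left)
  hence "wilson b d c ([:b\<^sup>2, - 1:] * newton c k) = wilson_moment b d c (Suc k) + (b\<^sup>2 - C\<^sup>2) * wilson_moment b d c k"
    by (simp add: linear_functionalD[OF linear_wilson] wilson_newton)
  also have "wilson_moment b d c (Suc k) = wilson_moment b d c k * ((C + 1 / 2) * (C + b) * (C + d) / (e + real k))"
    by (simp add: wilson_moment_def pochhammer_Suc C_def e_def add_ac mult_ac)
  also have "\<dots> + (b\<^sup>2 - C\<^sup>2) * wilson_moment b d c k =
      wilson_moment b d c k * (((C + 1 / 2) * (C + b) * (C + d) + (b\<^sup>2 - C\<^sup>2) * (e + real k)) / (e + real k))"
    using ek by (simp add: divide_simps) (simp add: algebra_simps)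
  also have "(C + 1 / 2) * (C + b) * (C + d) + (b\<^sup>2 - C\<^sup>2) * (e + real k) = (b + C) * (b + 1 / 2) * (b + d)"
    by (simp add: e_def C_def power2_eq_square field_simps)
  also have "wilson_moment b d c k * ((b + C) * (b + 1 / 2) * (b + d) / (e + real k)) =
      (b + 1 / 2) * (b + d) * (b + c) / e * wilson_moment (b + 1) d c k"
  proof -
    have 1: "(b + c) * pochhammer (c + (b + 1)) k = pochhammer (c + b) k * (b + C)"
      using pochhammer_rec[of "c + b" k] pochhammer_Suc[of "c + b" k] by (simp add: C_def add_ac)
    have 2: "e * pochhammer (1 / 2 + (b + 1) + c + d) k = pochhammer e k * (e + real k)"
      using pochhammer_rec[of e k] pochhammer_Suc[of e k] by (simp add: e_def add_ac)
    have pe': "pochhammer (1 / 2 + (b + 1) + c + d) k > 0"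
      by (rule pochhammer_pos) (use e in \<open>simp add: e_def\<close>)
    define p1 where "p1 = pochhammer (1 / 2 + (b + 1) + c + d) k"
    have "wilson_moment b d c k * ((b + C) * (b + 1 / 2) * (b + d) / (e + real k)) =
        pochhammer (c + 1 / 2) k * (pochhammer (c + b) k * (b + C)) * pochhammer (c + d) k * (b + 1 / 2) * (b + d) / (pochhammer e k * (e + real k))"
      by (simp add: wilson_moment_def e_def)
    also have "\<dots> = pochhammer (c + 1 / 2) k * ((b + c) * pochhammer (c + (b + 1)) k) * pochhammer (c + d) k * (b + 1 / 2) * (b + d) / (e * p1)"
      unfolding 1 2[symmetric] p1_def ..
    also have "\<dots> = (b + 1 / 2) * (b + d) * (b + c) / e * wilson_moment (b + 1) d c k"
      by (simp add: wilson_moment_def p1_def)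
    finally show ?thesis .
  qed
  finally show "wilson b d c ([:b\<^sup>2, - 1:] * newton c k) =
      (b + 1 / 2) * (b + d) * (b + c) / (1 / 2 + b + c + d) * wilson (b + 1) d c (newton c k)"
    by (simp add: wilson_newton e_def)
qed (intro linear_functional_mult_left linear_functional_scale linear_wilson | simp)+

text \<open>The two equal parameters are raised one after the other, with an exchange of their
  places in between.\<close>

lemma wilson_mult_shift2:
  assumes "0 < 1 / 2 + 2 * b + c"
  shows "\<exists>K. \<forall>q. wilson b b c ([:b\<^sup>2, - 1:] ^ 2 * q) = K * wilson (b + 1) (b + 1) c q"
proof -
  define K1 where "K1 = (b + 1 / 2) * (b + b) * (b + c) / (1 / 2 + b + c + b)"
  define K2 where "K2 = (b + 1 / 2) * (b + (b + 1)) * (b + c) / (1 / 2 + b + c + (b + 1))"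
  have "wilson b b c ([:b\<^sup>2, - 1:] ^ 2 * q) = K1 * K2 * wilson (b + 1) (b + 1) c q" for q
  proof -
    have "wilson b b c ([:b\<^sup>2, - 1:] ^ 2 * q) = wilson b b c ([:b\<^sup>2, - 1:] * ([:b\<^sup>2, - 1:] * q))"
      by (simp only: power2_eq_square mult.assoc)
    also have "\<dots> = K1 * wilson (b + 1) b c ([:b\<^sup>2, - 1:] * q)"
      unfolding K1_def by (rule wilson_mult_shift) (use assms in simp)
    also have "wilson (b + 1) b c ([:b\<^sup>2, - 1:] * q) = wilson b (b + 1) c ([:b\<^sup>2, - 1:] * q)"
      by (rule wilson_commute)
    also have "\<dots> = K2 * wilson (b + 1) (b + 1) c q"
      unfolding K2_def by (rule wilson_mult_shift) (use assms in simp)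
    finally show ?thesis by simp
  qed
  thus ?thesis by blast
qed

lemma poly_minus_square_le:
  "\<exists>D p. \<forall>x. \<bar>poly u (- (x\<^sup>2))\<bar> \<le> D * (1 + \<bar>x\<bar>) ^ p" for u :: "real poly"
proof (induction u)
  case 0 show ?case by (intro exI[of _ 0]) simp
next
  case (pCons a u)
  then obtain D p where D: "\<And>x. \<bar>poly u (- (x\<^sup>2))\<bar> \<le> D * (1 + \<bar>x\<bar>) ^ p" by blast
  have "\<bar>poly (pCons a u) (- (x\<^sup>2))\<bar> \<le> (\<bar>a\<bar> + D) * (1 + \<bar>x\<bar>) ^ (p + 2)" for x
  proof -
    have "\<bar>poly (pCons a u) (- (x\<^sup>2))\<bar> \<le> \<bar>a\<bar> + x\<^sup>2 * \<bar>poly u (- (x\<^sup>2))\<bar>"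
      using abs_triangle_ineq[of a "- (x\<^sup>2 * poly u (- (x\<^sup>2)))"] by (simp add: abs_mult)
    also have "\<dots> \<le> \<bar>a\<bar> * (1 + \<bar>x\<bar>) ^ (p + 2) + (1 + \<bar>x\<bar>)\<^sup>2 * (D * (1 + \<bar>x\<bar>) ^ p)"
    proof (intro add_mono mult_mono D)
      show "\<bar>a\<bar> \<le> \<bar>a\<bar> * (1 + \<bar>x\<bar>) ^ (p + 2)"
        using mult_left_mono[OF one_le_power[of "1 + \<bar>x\<bar>" "p + 2"], of "\<bar>a\<bar>"] by simp
      show "x\<^sup>2 \<le> (1 + \<bar>x\<bar>)\<^sup>2" by (rule power2_le_iff_abs_le[THEN iffD2]) auto
    qed auto
    also have "\<dots> = (\<bar>a\<bar> + D) * (1 + \<bar>x\<bar>) ^ (p + 2)"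
      unfolding power_add by (simp only: distrib_right mult_ac)
    finally show ?thesis .
  qed
  thus ?case by blast
qed

lemma integrable_poly_wilson_weight:
  assumes "0 < b" "0 < c"
  shows "integrable lborel (\<lambda>x. poly u (- (x\<^sup>2)) * wilson_weight b c x)"
proof -
  obtain D p where D: "\<And>x. \<bar>poly u (- (x\<^sup>2))\<bar> \<le> D * (1 + \<bar>x\<bar>) ^ p"
    using poly_minus_square_le by blast
  show ?thesis
    by (rule integrable_wilson_weight_mult[OF assms, of _ 0 D p])
      (use D in \<open>auto intro!: borel_measurable_continuous_onI continuous_intros\<close>)
qed

text \<open>Multiplying the weight by a Newton polynomial raises c, so the normalised integral has
  the quotients of consecutive moments that \<open>wilson_moment\<close> has.\<close>

lemma wilson_eq_integral:
  assumes b: "0 < b" and c: "0 < c"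
  shows "wilson b b c u = (\<integral>x. poly u (- (x\<^sup>2)) * wilson_weight b c x \<partial>lborel) / (\<integral>x. wilson_weight b c x \<partial>lborel)"
proof (rule wilson_eqI)
  show "linear_functional (\<lambda>u. (\<integral>x. poly u (- (x\<^sup>2)) * wilson_weight b c x \<partial>lborel) / (\<integral>x. wilson_weight b c x \<partial>lborel))"
    unfolding linear_functional_def
    by (simp add: ring_distribs mult.assoc integrable_poly_wilson_weight[OF assms] add_divide_distrib)
  define J where "J c = (\<integral>x. wilson_weight b c x \<partial>lborel)" for c
  fix k :: nat
  have "poly (newton c k) (- (x\<^sup>2)) * wilson_weight b c x = wilson_weight b (c + real k) x" for x
  proof (induction k)
    case (Suc k)
    have "Complex (c + real k) x \<notin> \<int>\<^sub>\<le>\<^sub>0"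
      using c by (auto elim!: nonpos_Ints_cases simp: complex_eq_iff)
    moreover have "Complex (c + real (Suc k)) x = Complex (c + real k) x + 1" by (simp add: complex_eq_iff)
    ultimately have "norm (Gamma (Complex (c + real (Suc k)) x)) ^ 2 = ((c + real k)\<^sup>2 + x\<^sup>2) * norm (Gamma (Complex (c + real k) x)) ^ 2"
      by (simp add: Gamma_plus1 norm_mult power_mult_distrib cmod_power2)
    hence "wilson_weight b (c + real (Suc k)) x = ((c + real k)\<^sup>2 + x\<^sup>2) * wilson_weight b (c + real k) x"
      by (simp add: wilson_weight_def)
    also have "\<dots> = poly (newton c (Suc k)) (- (x\<^sup>2)) * wilson_weight b c x"
      unfolding Suc[symmetric] newton_Suc by (simp add: algebra_simps)
    finally show ?case ..
  qed simp
  moreover have "J (c + real k) = wilson_moment b b c k * J c"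
  proof (induction k)
    case (Suc k)
    have "J (c + real (Suc k)) = (c + real k + 1 / 2) * (c + real k + b)\<^sup>2 / (1 / 2 + 2 * b + (c + real k)) * J (c + real k)"
      using integral_wilson_weight_Suc[of b "c + real k"] b c by (simp add: J_def add_ac)
    also have "\<dots> = wilson_moment b b c (Suc k) * J c"
      unfolding Suc wilson_moment_def pochhammer_Suc by (simp add: power2_eq_square add_ac mult_ac)
    finally show ?case .
  qed (simp add: wilson_moment_def)
  moreover have "J c > 0" unfolding J_def by (rule integral_wilson_weight_pos[OF assms])
  ultimately show "(\<integral>x. poly (newton c k) (- (x\<^sup>2)) * wilson_weight b c x \<partial>lborel) / (\<integral>x. wilson_weight b c x \<partial>lborel) = wilson_moment b b c k"
    by (simp add: J_def[symmetric])
qed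

text \<open>In the notation of the Askey scheme this is S_n(x^2; a, b, c) / (n! (a + b)_n), in the
  variable -x^2. With this normalisation the generating function at the argument z^2 is (1 - t)^(z -
  c) F(a + z, b + z; a + b; t), so that c enters only through a power of 1 - t.\<close>

fun cdh :: "real \<Rightarrow> real \<Rightarrow> real \<Rightarrow> nat \<Rightarrow> real poly" where
  "cdh a b c 0 = 1"
| "cdh a b c (Suc 0) = smult (1 / (a + b)) [:(a + c) * (b + c) - c\<^sup>2, 1:]"
| "cdh a b c (Suc (Suc n)) = smult (1 / ((real n + 2) * (real n + 1 + a + b)))
    ([:(real n + 1 + a + c) * (real n + 1 + b + c) + (real n + 1) * (real n + a + b) - c\<^sup>2, 1:] * cdh a b c (Suc n)
      - smult ((real n + a + c) * (real n + b + c)) (cdh a b c n))"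

text \<open>A predicate on number sequences at a fixed argument, so that closed forms and generating
  functions can be identified with the polynomials by uniqueness.\<close>

definition cdh_rec :: "real \<Rightarrow> real \<Rightarrow> real \<Rightarrow> real \<Rightarrow> (nat \<Rightarrow> real) \<Rightarrow> bool" where
  "cdh_rec a b c \<zeta> p \<longleftrightarrow> p 0 = 1 \<and> (\<forall>n. (real n + 1) * (real n + a + b) * p (Suc n) =
     (\<zeta> - c\<^sup>2 + (real n + a + c) * (real n + b + c) + real n * (real n - 1 + a + b)) * p n
       - (if n = 0 then 0 else (real n - 1 + a + c) * (real n - 1 + b + c) * p (n - 1)))"

lemma cdh_rec_cdh:
  assumes "0 < a + b"
  shows "cdh_rec a b c \<zeta> (\<lambda>n. poly (cdh a b c n) \<zeta>)"
  unfolding cdh_rec_def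
proof (intro conjI allI)
  fix n
  show "(real n + 1) * (real n + a + b) * poly (cdh a b c (Suc n)) \<zeta> =
     (\<zeta> - c\<^sup>2 + (real n + a + c) * (real n + b + c) + real n * (real n - 1 + a + b)) * poly (cdh a b c n) \<zeta>
       - (if n = 0 then 0 else (real n - 1 + a + c) * (real n - 1 + b + c) * poly (cdh a b c (n - 1)) \<zeta>)"
  proof (cases n)
    case 0
    define X where "X = (a + c) * (b + c) - c\<^sup>2 + \<zeta>"
    have "poly (cdh a b c (Suc 0)) \<zeta> = X / (a + b)" by (simp add: X_def add_divide_distrib)
    hence "(a + b) * poly (cdh a b c (Suc 0)) \<zeta> = X" using assms by simp
    thus ?thesis by (simp add: 0 X_def del: cdh.simps(2))
  next
    case (Suc m)
    define X where "X = (\<zeta> - c\<^sup>2 + (real m + 1 + a + c) * (real m + 1 + b + c) + (real m + 1) * (real m + a + b)) * poly (cdh a b c (Suc m)) \<zeta>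
       - (real m + a + c) * (real m + b + c) * poly (cdh a b c m) \<zeta>"
    have "(real m + 2) * (real m + 1 + a + b) \<noteq> 0" using assms by auto
    hence "(real m + 2) * (real m + 1 + a + b) * poly (cdh a b c (Suc (Suc m))) \<zeta> = X"
      by (simp add: X_def) (simp add: algebra_simps)
    thus ?thesis by (simp add: Suc X_def add_ac)
  qed
qed simp

lemma cdh_rec_unique:
  assumes "cdh_rec a b c \<zeta> p" "cdh_rec a b c \<zeta> q" "0 < a + b"
  shows "p n = q n"
proof (induction n rule: less_induct)
  case (less n)
  show ?case
  proof (cases n)
    case 0 thus ?thesis using assms by (simp add: cdh_rec_def)
  next
    case (Suc m)
    have "p m = q m" "m \<noteq> 0 \<Longrightarrow> p (m - 1) = q (m - 1)" using less Suc by auto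
    moreover have "(real m + 1) * (real m + a + b) * f (Suc m) =
        (\<zeta> - c\<^sup>2 + (real m + a + c) * (real m + b + c) + real m * (real m - 1 + a + b)) * f m
          - (if m = 0 then 0 else (real m - 1 + a + c) * (real m - 1 + b + c) * f (m - 1))" if "f = p \<or> f = q" for f
      using assms(1,2) that unfolding cdh_rec_def by blast
    from this[of p] this[of q]
    have "(real m + 1) * (real m + a + b) * p (Suc m) = (real m + 1) * (real m + a + b) * q (Suc m)"
      using calculation by (simp only:) (auto split: if_splits)
    thus ?thesis using assms(3) Suc by simp
  qed
qed

definition cdh_coeff :: "real \<Rightarrow> real \<Rightarrow> real \<Rightarrow> nat \<Rightarrow> nat \<Rightarrow> real" where
  "cdh_coeff a b c n k = (if k \<le> n then (- 1) ^ k * pochhammer (a + c + real k) (n - k) * pochhammer (b + c + real k) (n - k)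
      / (pochhammer (a + b) n * fact k * fact (n - k)) else 0)"

lemma cdh_coeff_up:
  assumes "k \<le> n" "0 < a + b"
  shows "(real n + 1 - real k) * (real n + a + b) * cdh_coeff a b c (Suc n) k
    = (real n + a + c) * (real n + b + c) * cdh_coeff a b c n k"
proof -
  have "Suc n - k = Suc (n - k)" using assms by simp
  moreover have "real n + 1 - real k \<noteq> 0" using assms by simp
  moreover have "a + b + real n \<noteq> 0" "pochhammer (a + b) n \<noteq> 0"
    using assms pochhammer_pos[of "a + b" n] by auto
  moreover have "(1 + real n - real k) = 1 + real (n - k)" using assms by (simp add: of_nat_diff)
  ultimately show ?thesis using assms
    by (simp add: cdh_coeff_def pochhammer_Suc of_nat_diff add_ac divide_simps)
qed

lemma cdh_coeff_left:
  assumes "Suc k \<le> n" "0 < a + b"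
  shows "(real n - real k) * cdh_coeff a b c n k
    = - (a + c + real k) * (b + c + real k) * (real k + 1) * cdh_coeff a b c n (Suc k)"
proof -
  obtain m where m: "n = Suc (k + m)" using assms by (metis Suc_le_D add_Suc_right le_add_diff_inverse less_eq_Suc_le less_imp_Suc_add add.commute)
  have "pochhammer (a + b) n \<noteq> 0" using assms pochhammer_pos[of "a + b" n] by auto
  moreover have "n - k = Suc m" "n - Suc k = m" "real n - real k = real m + 1" using m by auto
  ultimately show ?thesis using assms
    by (simp add: cdh_coeff_def pochhammer_rec add_ac divide_simps) (simp add: algebra_simps)
qed

text \<open>The terminating 3F2 representation. Multiplication by the variable acts on the Newton
  basis in two diagonals, and the neighbours of a coefficient are rational multiples of it, so the
  recursion can be verified coefficientwise.\<close>

lemma cdh_newton: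
  assumes ab: "0 < a + b"
  shows "cdh a b c n = (\<Sum>k\<le>n. smult (cdh_coeff a b c n k) (newton c k))"
proof -
  define S where "S \<zeta> n = (\<Sum>k\<le>n. cdh_coeff a b c n k * poly (newton c k) \<zeta>)" for \<zeta> n
  define g where "g = cdh_coeff a b c"
  have S': "S \<zeta> n = (\<Sum>k\<le>m. g n k * poly (newton c k) \<zeta>)" if "n \<le> m" for \<zeta> n m
    unfolding S_def g_def by (rule sum.mono_neutral_left) (use that in \<open>auto simp: cdh_coeff_def\<close>)
  have "cdh_rec a b c \<zeta> (S \<zeta>)" for \<zeta>
    unfolding cdh_rec_def
  proof (intro conjI allI)
    show "S \<zeta> 0 = 1" by (simp add: S_def cdh_coeff_def)
    fix n
    define M where "M = - c\<^sup>2 + (real n + a + c) * (real n + b + c) + real n * (real n - 1 + a + b)"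
    define D where "D = (if n = 0 then 0 else (real n - 1 + a + c) * (real n - 1 + b + c))"
    define g1 where "g1 k = (if k = 0 then 0 else g n (k - 1))" for k
    define h where "h k = (if n = 0 then 0 else g (n - 1) k)" for k
    have coeffs: "(real n + 1) * (real n + a + b) * g (Suc n) k = ((c + real k)\<^sup>2 + M) * g n k - g1 k - D * h k" for k
    proof -
      consider "k \<le> n" | "k = Suc n" | "k > Suc n" by linarith
      thus ?thesis
      proof cases
        case 1
        \<comment> \<open>Multiplication by u, which is nonzero for k \<le> n, lets all neighbouring
          coefficients be expressed by \<open>g n k\<close>.\<close>
        define u where "u = real n + 1 - real k"
        have u: "u \<noteq> 0" using 1 by (simp add: u_def)
        have up: "u * (real n + a + b) * g (Suc n) k = (real n + a + c) * (real n + b + c) * g n k"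
          unfolding u_def g_def by (rule cdh_coeff_up[OF 1 ab])
        have dn: "D * h k = (real n - real k) * (real n - 1 + a + b) * g n k"
        proof (cases n)
          case 0 thus ?thesis using 1 by (simp add: D_def h_def)
        next
          case (Suc m)
          show ?thesis
          proof (cases "k = n")
            case True thus ?thesis by (simp add: D_def h_def g_def cdh_coeff_def Suc)
          next
            case False
            hence "k \<le> m" using 1 Suc by simp
            from cdh_coeff_up[OF this ab, of c] show ?thesis
              by (simp add: D_def h_def g_def Suc algebra_simps)
          qed
        qed
        have lf: "u * g1 k = - (a + c + real k - 1) * (b + c + real k - 1) * real k * g n k"
        proof (cases k)
          case 0 thus ?thesis by (simp add: g1_def)
        next
          case (Suc j)
          from cdh_coeff_left[of j n a b c] 1 Suc ab show ?thesis
            by (simp add: g1_def g_def u_def algebra_simps)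
        qed
        have "u * ((real n + 1) * (real n + a + b) * g (Suc n) k) = (real n + 1) * (u * (real n + a + b) * g (Suc n) k)"
          by (simp add: mult_ac)
        also have "\<dots> = u * ((c + real k)\<^sup>2 + M) * g n k - u * g1 k - u * (D * h k)"
          unfolding up lf dn by (simp add: M_def u_def power2_eq_square algebra_simps)
        also have "\<dots> = u * (((c + real k)\<^sup>2 + M) * g n k - g1 k - D * h k)" by (simp add: algebra_simps)
        finally show ?thesis using u by simp
      next
        case 2
        have "pochhammer (a + b) n \<noteq> 0" "a + b + real n \<noteq> 0" using ab pochhammer_pos[of "a + b" n] by auto
        thus ?thesis
          by (simp add: 2 g_def g1_def h_def cdh_coeff_def pochhammer_Suc divide_simps) (simp add: algebra_simps)
      next
        case 3
        have "\<not> k - 1 \<le> n" "\<not> k \<le> n" "\<not> k \<le> n - 1" "\<not> k \<le> Suc n" "k \<noteq> 0" using 3 by auto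
        thus ?thesis by (simp add: g_def g1_def h_def cdh_coeff_def)
      qed
    qed
    have N: "\<zeta> * poly (newton c k) \<zeta> = (c + real k)\<^sup>2 * poly (newton c k) \<zeta> - poly (newton c (Suc k)) \<zeta>" for k
      by (simp add: newton_Suc algebra_simps)
    have "(real n + 1) * (real n + a + b) * S \<zeta> (Suc n) = (\<Sum>k\<le>Suc n. ((real n + 1) * (real n + a + b) * g (Suc n) k) * poly (newton c k) \<zeta>)"
      by (simp only: S'[OF order.refl] sum_distrib_left mult.assoc)
    also have "\<dots> = (\<Sum>k\<le>Suc n. ((c + real k)\<^sup>2 + M) * g n k * poly (newton c k) \<zeta>)
        - (\<Sum>k\<le>Suc n. g1 k * poly (newton c k) \<zeta>) - D * (\<Sum>k\<le>Suc n. h k * poly (newton c k) \<zeta>)"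
      unfolding coeffs by (simp only: left_diff_distrib sum_subtractf sum_distrib_left mult.assoc)
    also have "(\<Sum>k\<le>Suc n. g1 k * poly (newton c k) \<zeta>) = (\<Sum>k\<le>n. g n k * poly (newton c (Suc k)) \<zeta>)"
      by (subst sum.atMost_Suc_shift) (simp add: g1_def)
    also have "D * (\<Sum>k\<le>Suc n. h k * poly (newton c k) \<zeta>) = D * (if n = 0 then 0 else S \<zeta> (n - 1))"
    proof (cases n)
      case (Suc m)
      thus ?thesis using S'[of m "Suc n" \<zeta>] by (simp add: h_def del: sum.atMost_Suc)
    qed (simp add: h_def)
    also have "(\<Sum>k\<le>Suc n. ((c + real k)\<^sup>2 + M) * g n k * poly (newton c k) \<zeta>) = (\<Sum>k\<le>n. ((c + real k)\<^sup>2 + M) * g n k * poly (newton c k) \<zeta>)"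
      by (simp add: g_def cdh_coeff_def)
    also have "\<dots> - (\<Sum>k\<le>n. g n k * poly (newton c (Suc k)) \<zeta>) = (\<Sum>k\<le>n. (\<zeta> + M) * (g n k * poly (newton c k) \<zeta>))"
      unfolding sum_subtractf[symmetric]
    proof (rule sum.cong[OF refl])
      fix k
      have "(\<zeta> + M) * (g n k * poly (newton c k) \<zeta>) = g n k * (\<zeta> * poly (newton c k) \<zeta>) + M * g n k * poly (newton c k) \<zeta>"
        by (simp add: algebra_simps)
      also have "\<dots> = ((c + real k)\<^sup>2 + M) * g n k * poly (newton c k) \<zeta> - g n k * poly (newton c (Suc k)) \<zeta>"
        unfolding N by (simp add: algebra_simps)
      finally show "((c + real k)\<^sup>2 + M) * g n k * poly (newton c k) \<zeta> - g n k * poly (newton c (Suc k)) \<zeta> = (\<zeta> + M) * (g n k * poly (newton c k) \<zeta>)" ..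
    qed
    also have "\<dots> = (\<zeta> + M) * S \<zeta> n" by (simp add: S'[of n n] sum_distrib_left)
    finally show "(real n + 1) * (real n + a + b) * S \<zeta> (Suc n) =
       (\<zeta> - c\<^sup>2 + (real n + a + c) * (real n + b + c) + real n * (real n - 1 + a + b)) * S \<zeta> n
       - (if n = 0 then 0 else (real n - 1 + a + c) * (real n - 1 + b + c) * S \<zeta> (n - 1))"
      by (cases "n = 0") (simp_all add: M_def D_def algebra_simps)
  qed
  hence "poly (cdh a b c n) \<zeta> = S \<zeta> n" for \<zeta>
    by (rule cdh_rec_unique[OF cdh_rec_cdh[OF ab] _ ab])
  thus ?thesis by (intro poly_eq_poly_eq_iff[THEN iffD1] ext) (simp add: S_def poly_sum)
qed

lemma pochhammer_minus_of_nat: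
  "k \<le> n \<Longrightarrow> pochhammer (- real n) k = (- 1) ^ k * (fact n / fact (n - k))"
proof (induction k)
  case (Suc k)
  have "n - k = Suc (n - Suc k)" using Suc.prems by simp
  hence "fact (n - k) = real (n - k) * (fact (n - Suc k) :: real)" by (metis fact_Suc of_nat_mult)
  with Suc show ?case by (simp add: pochhammer_Suc of_nat_diff field_simps)
qed simp

text \<open>Newton coefficients and moments carry Pochhammer symbols in c + 1/2 and c + b that
  combine to index n, because polynomial and functional share the parameters 1/2, b, c. What remains
  is a terminating 2F1 at 1, summed by Chu-Vandermonde.\<close>

lemma wilson_cdh:
  assumes "0 < 1 / 2 + b" "0 < 1 / 2 + b + c + d"
  shows "wilson b d c (cdh (1 / 2) b c n) =
    pochhammer (c + 1 / 2) n * pochhammer (c + b) n / (fact n * pochhammer (1 / 2 + b + c + d) n)"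
proof -
  define e where "e = 1 / 2 + b + c + d"
  define K where "K = pochhammer (c + 1 / 2) n * pochhammer (c + b) n / (pochhammer (1 / 2 + b) n * fact n)"
  have "wilson b d c (cdh (1 / 2) b c n) = (\<Sum>k\<le>n. cdh_coeff (1 / 2) b c n k * wilson_moment b d c k)"
    by (simp add: cdh_newton[OF assms(1)] linear_functional_sum[OF linear_wilson] linear_functionalD[OF linear_wilson] wilson_newton)
  also have "\<dots> = (\<Sum>k\<le>n. K * (pochhammer (c + d) k * pochhammer (- real n) k / (fact k * pochhammer e k)))"
  proof (rule sum.cong[OF refl], clarsimp)
    fix k assume k: "k \<le> n"
    have 1: "pochhammer (c + 1 / 2) k * pochhammer (1 / 2 + c + real k) (n - k) = pochhammer (c + 1 / 2) n"
      using pochhammer_product[OF k, of "c + 1 / 2"] by (simp add: add_ac)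
    have 2: "pochhammer (c + b) k * pochhammer (b + c + real k) (n - k) = pochhammer (c + b) n"
      using pochhammer_product[OF k, of "c + b"] by (simp add: add_ac)
    have 3: "pochhammer (- real n) k = (- 1) ^ k * (fact n / fact (n - k))"
      by (rule pochhammer_minus_of_nat[OF k])
    have "cdh_coeff (1 / 2) b c n k * wilson_moment b d c k =
        (- 1) ^ k * (pochhammer (c + 1 / 2) k * pochhammer (1 / 2 + c + real k) (n - k)) *
          (pochhammer (c + b) k * pochhammer (b + c + real k) (n - k)) * pochhammer (c + d) k /
        (pochhammer (1 / 2 + b) n * fact k * fact (n - k) * pochhammer e k)"
      using k by (simp add: cdh_coeff_def wilson_moment_def e_def)
    also have "\<dots> = K * (pochhammer (c + d) k * pochhammer (- real n) k / (fact k * pochhammer e k))"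
      unfolding 1 2 3 K_def by (simp add: mult_ac)
    finally show "cdh_coeff (1 / 2) b c n k * wilson_moment b d c k =
      K * (pochhammer (c + d) k * pochhammer (- real n) k) / (fact k * pochhammer e k)" by simp
  qed
  also have "\<dots> = K * (pochhammer (e - (c + d)) n / pochhammer e n)"
  proof -
    have "\<forall>i\<in>{0..<n}. e \<noteq> - of_nat i" using assms(2) unfolding e_def[symmetric] by auto
    from Vandermonde_pochhammer[OF this, of "c + d"]
    have "(\<Sum>k\<le>n. pochhammer (c + d) k * pochhammer (- real n) k / (fact k * pochhammer e k)) =
        pochhammer (e - (c + d)) n / pochhammer e n"
      by (simp add: atLeast0AtMost)
    thus ?thesis by (simp only: sum_distrib_left[symmetric])
  qed
  also have "e - (c + d) = 1 / 2 + b" by (simp add: e_def)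
  also have "K * (pochhammer (1 / 2 + b) n / pochhammer e n) = pochhammer (c + 1 / 2) n * pochhammer (c + b) n / (fact n * pochhammer e n)"
    using pochhammer_pos[OF assms(1), of n] by (simp add: K_def)
  finally show ?thesis by (simp add: e_def)
qed

section \<open>Separation of the rainbow arrays\<close>

definition ext3 :: "(nat^3 \<Rightarrow> real) \<Rightarrow> int \<Rightarrow> int \<Rightarrow> int \<Rightarrow> real" where
  "ext3 f i j k = zero_extension f (vector [i, j, k])"

lemma ext3_neg: "i < 0 \<or> j < 0 \<or> k < 0 \<Longrightarrow> ext3 f i j k = 0"
  by (auto simp: ext3_def zero_extension_def forall_3)

lemma ext3_nat: "ext3 f (int i) (int j) (int k) = f (vector [i, j, k])"
  by (auto simp: ext3_def zero_extension_def forall_3 vec_eq_iff intro!: arg_cong[where f = f])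

lemma vector_3_shift:
  fixes i j k m :: int
  shows "vector [i, j, k] + axis 1 m = (vector [i + m, j, k] :: int^3)"
    "vector [i, j, k] + axis 2 m = (vector [i, j + m, k] :: int^3)"
    "vector [i, j, k] + axis 3 m = (vector [i, j, k + m] :: int^3)"
    "vector [i, j, k] - axis 1 m = (vector [i - m, j, k] :: int^3)"
    "vector [i, j, k] - axis 2 m = (vector [i, j - m, k] :: int^3)"
    "vector [i, j, k] - axis 3 m = (vector [i, j, k - m] :: int^3)"
  by (simp_all add: vec_eq_iff forall_3 axis_def)

lemma rainbow_arraysD:
  assumes "rainbow_arrays \<beta> A B"
  defines "a \<equiv> ext3 A" and "b \<equiv> ext3 B"
  shows "a 0 0 0 = 1"
    and "(of_int i + 1) * (of_int i + 2 * \<beta>) * a (i + 1) j k - (of_int i + \<beta>) * (of_int i + 1 - \<beta>) * a i j k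
      = b i j k - b i (j - 1) k - b i j (k - 1) + b i (j - 1) (k - 1)"
    and "(of_int j + 1) * (of_int j + 2 * \<beta>) * a i (j + 1) k - (of_int j + \<beta>) * (of_int j + 1 - \<beta>) * a i j k
      = b i j k - b (i - 1) j k - b i j (k - 1) + b (i - 1) j (k - 1)"
    and "(of_int k + 1) * (of_int k + 2 * \<beta>) * a i j (k + 1) - (of_int k + \<beta>) * (of_int k + 1 - \<beta>) * a i j k
      = b i j k - b (i - 1) j k - b i (j - 1) k + b (i - 1) (j - 1) k"
    and "(2 * of_int j * of_int k + \<beta> * of_int j + \<beta> * of_int k - \<beta> * of_int i) * a i j k
      = b (i - 1) j k + b (i - 1) (j - 1) (k - 1) - b i (j - 1) k - b i j (k - 1)"
    and "(2 * of_int i * of_int k + \<beta> * of_int i + \<beta> * of_int k - \<beta> * of_int j) * a i j k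
      = b i (j - 1) k + b (i - 1) (j - 1) (k - 1) - b (i - 1) j k - b i j (k - 1)"
    and "(2 * of_int i * of_int j + \<beta> * of_int i + \<beta> * of_int j - \<beta> * of_int k) * a i j k
      = b i j (k - 1) + b (i - 1) (j - 1) (k - 1) - b (i - 1) j k - b i (j - 1) k"
proof -
  note D = assms(1)[unfolded rainbow_arrays_def Let_def]
  have z: "(0 :: int^3) = vector [0, 0, 0]" by (simp add: vec_eq_iff forall_3)
  show "a 0 0 0 = 1" using D by (simp add: a_def ext3_def z)
  have E: "{j, k, l} = {1, 2, 3} \<Longrightarrow>
        (of_int (n $ l) + 1) * (of_int (n $ l) + 2 * \<beta>) * zero_extension A (n + axis l 1)
          - (of_int (n $ l) + \<beta>) * (of_int (n $ l) + 1 - \<beta>) * zero_extension A n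
        = zero_extension B n - zero_extension B (n - axis j 1) - zero_extension B (n - axis k 1) + zero_extension B (n - axis j 1 - axis k 1)"
    "{j, k, l} = {1, 2, 3} \<Longrightarrow>
        (2 * of_int (n $ j) * of_int (n $ k)
          + \<beta> * of_int (n $ j) + \<beta> * of_int (n $ k) - \<beta> * of_int (n $ l)) * zero_extension A n
        = zero_extension B (n - axis l 1) + zero_extension B (n - axis l 1 - axis j 1 - axis k 1) - zero_extension B (n - axis j 1) - zero_extension B (n - axis k 1)"
    for j k l :: 3 and n :: "int^3"
    using D by blast+
  have perm: "{2, 3, 1} = {1, 2, 3::3}" "{1, 3, 2} = {1, 2, 3::3}" by auto
  show "(of_int i + 1) * (of_int i + 2 * \<beta>) * a (i + 1) j k - (of_int i + \<beta>) * (of_int i + 1 - \<beta>) * a i j k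
      = b i j k - b i (j - 1) k - b i j (k - 1) + b i (j - 1) (k - 1)"
    using E(1)[OF perm(1), of "vector [i, j, k]"] by (simp add: a_def b_def ext3_def vector_3_shift)
  show "(of_int j + 1) * (of_int j + 2 * \<beta>) * a i (j + 1) k - (of_int j + \<beta>) * (of_int j + 1 - \<beta>) * a i j k
      = b i j k - b (i - 1) j k - b i j (k - 1) + b (i - 1) j (k - 1)"
    using E(1)[OF perm(2), of "vector [i, j, k]"] by (simp add: a_def b_def ext3_def vector_3_shift)
  show "(of_int k + 1) * (of_int k + 2 * \<beta>) * a i j (k + 1) - (of_int k + \<beta>) * (of_int k + 1 - \<beta>) * a i j k
      = b i j k - b (i - 1) j k - b i (j - 1) k + b (i - 1) (j - 1) k"
    using E(1)[OF refl, of "vector [i, j, k]"] by (simp add: a_def b_def ext3_def vector_3_shift)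
  show "(2 * of_int j * of_int k + \<beta> * of_int j + \<beta> * of_int k - \<beta> * of_int i) * a i j k
      = b (i - 1) j k + b (i - 1) (j - 1) (k - 1) - b i (j - 1) k - b i j (k - 1)"
    using E(2)[OF perm(1), of "vector [i, j, k]"] by (simp add: a_def b_def ext3_def vector_3_shift)
  show "(2 * of_int i * of_int k + \<beta> * of_int i + \<beta> * of_int k - \<beta> * of_int j) * a i j k
      = b i (j - 1) k + b (i - 1) (j - 1) (k - 1) - b (i - 1) j k - b i j (k - 1)"
    using E(2)[OF perm(2), of "vector [i, j, k]"] by (simp add: a_def b_def ext3_def vector_3_shift)
  show "(2 * of_int i * of_int j + \<beta> * of_int i + \<beta> * of_int j - \<beta> * of_int k) * a i j k
      = b i j (k - 1) + b (i - 1) (j - 1) (k - 1) - b (i - 1) j k - b i (j - 1) k"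
    using E(2)[OF refl, of "vector [i, j, k]"] by (simp add: a_def b_def ext3_def vector_3_shift)
qed

text \<open>In the sum of the second equations for l = 1 and l = 2 at third index k + 1 the terms
  with a single lowered first or second index cancel, and only two diagonal neighbours of
  \<open>B\<close> are left, each twice.\<close>

lemma rainbow_B_diff:
  assumes "rainbow_arrays \<beta> A B"
  shows "ext3 B i j k - ext3 B (i - 1) (j - 1) k = - (of_int k + 1) * (of_int i + of_int j + \<beta>) * ext3 A i j (k + 1)"
  using rainbow_arraysD(5)[OF assms, of j "k + 1" i] rainbow_arraysD(6)[OF assms, of i "k + 1" j]
  by (simp add: algebra_simps)

text \<open>The difference in n of the left-hand side of the first rainbow equation. The term with n
  - 1 is absent at n = 0, in accordance with the extension by zero.\<close>

definition rec_op :: "real \<Rightarrow> (nat \<Rightarrow> real) \<Rightarrow> nat \<Rightarrow> real" where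
  "rec_op \<beta> f n = (real n + 1) * (real n + 2 * \<beta>) * f (Suc n)
     - ((real n + \<beta>) * (real n + 1 - \<beta>) + real n * (real n - 1 + 2 * \<beta>)) * f n
     + (if n = 0 then 0 else (real n - 1 + \<beta>) * (real n - \<beta>) * f (n - 1))"

text \<open>A discrete wave equation: the values at j = 0 propagate to all j, since the leading
  coefficient (m + 1) (m + 2 \<beta>) is positive.\<close>

lemma rec_op_unique:
  assumes \<beta>: "0 < \<beta>"
    and f: "\<And>i j. rec_op \<beta> (\<lambda>i. f i j) i = rec_op \<beta> (f i) j"
    and g: "\<And>i j. rec_op \<beta> (\<lambda>i. g i j) i = rec_op \<beta> (g i) j"
    and 0: "\<And>i. f i 0 = g i 0"
  shows "f i j = g i j"
proof (induction j arbitrary: i rule: less_induct)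
  case (less j)
  show ?case
  proof (cases j)
    case 0 thus ?thesis using assms by simp
  next
    case (Suc m)
    have IH: "f i m = g i m" "m \<noteq> 0 \<Longrightarrow> f i (m - 1) = g i (m - 1)" for i using less Suc by auto
    have "rec_op \<beta> (f i) m = rec_op \<beta> (\<lambda>i. f i m) i" by (rule f[symmetric])
    also have "\<dots> = rec_op \<beta> (\<lambda>i. g i m) i" by (simp only: rec_op_def IH(1))
    also have "\<dots> = rec_op \<beta> (g i) m" by (rule g)
    finally have "(real m + 1) * (real m + 2 * \<beta>) * f i (Suc m) = (real m + 1) * (real m + 2 * \<beta>) * g i (Suc m)"
      using IH by (auto simp: rec_op_def split: if_splits)
    thus ?thesis using \<beta> Suc by simp
  qed
qed

text \<open>Subtracting from the first equation its translate by one in the distinguished index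
  turns the right-hand side into the mixed third difference of \<open>B\<close> over a unit cube,
  which is symmetric in the three indices.\<close>

lemma rainbow_rec_op:
  assumes "rainbow_arrays \<beta> A B"
  defines "a i j k \<equiv> ext3 A (int i) (int j) (int k)"
  shows "rec_op \<beta> (\<lambda>i. a i j k) i = rec_op \<beta> (\<lambda>j. a i j k) j"
    and "rec_op \<beta> (\<lambda>i. a i j k) i = rec_op \<beta> (\<lambda>k. a i j k) k"
proof -
  define D where "D = (ext3 B i j k - ext3 B i (int j - 1) k - ext3 B i j (int k - 1) + ext3 B i (int j - 1) (int k - 1))
    - (ext3 B (int i - 1) j k - ext3 B (int i - 1) (int j - 1) k - ext3 B (int i - 1) j (int k - 1) + ext3 B (int i - 1) (int j - 1) (int k - 1))"
  have 1: "rec_op \<beta> (\<lambda>i. a i j k) i = D"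
    using rainbow_arraysD(2)[OF assms(1), of i j k] rainbow_arraysD(2)[OF assms(1), of "int i - 1" j k]
    by (cases "i = 0") (auto simp: rec_op_def a_def D_def ext3_neg of_nat_diff algebra_simps)
  have 2: "rec_op \<beta> (\<lambda>j. a i j k) j = D"
    using rainbow_arraysD(3)[OF assms(1), of j i k] rainbow_arraysD(3)[OF assms(1), of "int j - 1" i k]
    by (cases "j = 0") (auto simp: rec_op_def a_def D_def ext3_neg of_nat_diff algebra_simps)
  have 3: "rec_op \<beta> (\<lambda>k. a i j k) k = D"
    using rainbow_arraysD(4)[OF assms(1), of k i j] rainbow_arraysD(4)[OF assms(1), of "int k - 1" i j]
    by (cases "k = 0") (auto simp: rec_op_def a_def D_def ext3_neg of_nat_diff algebra_simps)
  show "rec_op \<beta> (\<lambda>i. a i j k) i = rec_op \<beta> (\<lambda>j. a i j k) j"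
    and "rec_op \<beta> (\<lambda>i. a i j k) i = rec_op \<beta> (\<lambda>k. a i j k) k"
    using 1 2 3 by simp_all
qed

text \<open>On the axis the second equation expresses \<open>B\<close> by \<open>A\<close>, namely
  as -\<beta> (n + 1) times the next value. Inserted into the first equation this replaces n + 2
  \<beta> by n + 3 \<beta>.\<close>

lemma rainbow_axis:
  assumes "rainbow_arrays \<beta> A B" and \<beta>: "0 < \<beta>"
  shows "ext3 A (int n) 0 0 = pochhammer (1 - \<beta>) n * pochhammer \<beta> n / (fact n * pochhammer (3 * \<beta>) n)"
proof (induction n)
  case 0 show ?case using rainbow_arraysD(1)[OF assms(1)] by simp
next
  case (Suc n)
  have 1: "(real n + 1) * (real n + 3 * \<beta>) * ext3 A (int n + 1) 0 0 = (real n + \<beta>) * (real n + 1 - \<beta>) * ext3 A (int n) 0 0"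
    using rainbow_arraysD(2)[OF assms(1), of n 0 0] rainbow_arraysD(5)[OF assms(1), of 0 0 "int n + 1"]
    by (simp add: ext3_neg algebra_simps)
  have "(real n + 1) * (real n + 3 * \<beta>) \<noteq> 0" using \<beta> by auto
  hence "ext3 A (int n + 1) 0 0 = (real n + \<beta>) * (real n + 1 - \<beta>) * ext3 A (int n) 0 0 / ((real n + 1) * (real n + 3 * \<beta>))"
    by (subst nonzero_eq_divide_eq) (use 1 in \<open>simp_all add: mult_ac\<close>)
  also have "\<dots> = pochhammer (1 - \<beta>) (Suc n) * pochhammer \<beta> (Suc n) / (fact (Suc n) * pochhammer (3 * \<beta>) (Suc n))"
    unfolding Suc by (simp add: pochhammer_Suc add_ac mult_ac)
  finally show ?case by (simp add: add_ac)
qed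

definition rainbow_poly :: "real \<Rightarrow> nat \<Rightarrow> real poly" where
  "rainbow_poly \<beta> = cdh (1 / 2) (2 * \<beta> - 1 / 2) (1 / 2 - \<beta>)"

lemma rec_op_rainbow_poly:
  assumes \<beta>: "0 < \<beta>" and W: "linear_functional W"
  shows "rec_op \<beta> (\<lambda>n. W (rainbow_poly \<beta> n * q)) n = W ([:- ((1 / 2 - \<beta>)\<^sup>2), 1:] * rainbow_poly \<beta> n * q)"
proof -
  let ?P = "rainbow_poly \<beta>"
  have "[:- ((1 / 2 - \<beta>)\<^sup>2), 1:] * ?P n = smult ((real n + 1) * (real n + 2 * \<beta>)) (?P (Suc n))
     - smult ((real n + \<beta>) * (real n + 1 - \<beta>) + real n * (real n - 1 + 2 * \<beta>)) (?P n)
     + smult (if n = 0 then 0 else (real n - 1 + \<beta>) * (real n - \<beta>)) (?P (n - 1))"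
  proof (intro poly_eq_poly_eq_iff[THEN iffD1] ext)
    fix \<zeta>
    have "0 < 1 / 2 + (2 * \<beta> - 1 / 2)" using \<beta> by simp
    note rec = cdh_rec_cdh[OF this, of "1 / 2 - \<beta>" \<zeta>, unfolded cdh_rec_def, THEN conjunct2, THEN spec, of n]
    have e: "real n + 1 / 2 + (1 / 2 - \<beta>) = real n + 1 - \<beta>" "real n + (2 * \<beta> - 1 / 2) + (1 / 2 - \<beta>) = real n + \<beta>"
      "real n + 1 / 2 + (2 * \<beta> - 1 / 2) = real n + 2 * \<beta>" "real n - 1 + 1 / 2 + (2 * \<beta> - 1 / 2) = real n - 1 + 2 * \<beta>"
      "real n - 1 + 1 / 2 + (1 / 2 - \<beta>) = real n - \<beta>" "real n - 1 + (2 * \<beta> - 1 / 2) + (1 / 2 - \<beta>) = real n - 1 + \<beta>"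
      by simp_all
    have "(real n + 1) * (real n + 2 * \<beta>) * poly (?P (Suc n)) \<zeta> =
      (\<zeta> - (1 / 2 - \<beta>)\<^sup>2 + (real n + 1 - \<beta>) * (real n + \<beta>) + real n * (real n - 1 + 2 * \<beta>)) * poly (?P n) \<zeta>
       - (if n = 0 then 0 else (real n - \<beta>) * (real n - 1 + \<beta>) * poly (?P (n - 1)) \<zeta>)"
      using rec unfolding e rainbow_poly_def .
    thus "poly ([:- ((1 / 2 - \<beta>)\<^sup>2), 1:] * ?P n) \<zeta> = poly (smult ((real n + 1) * (real n + 2 * \<beta>)) (?P (Suc n))
     - smult ((real n + \<beta>) * (real n + 1 - \<beta>) + real n * (real n - 1 + 2 * \<beta>)) (?P n)
     + smult (if n = 0 then 0 else (real n - 1 + \<beta>) * (real n - \<beta>)) (?P (n - 1))) \<zeta>"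
      by (cases "n = 0") (simp_all add: algebra_simps)
  qed
  thus ?thesis unfolding rec_op_def
    by (simp add: ring_distribs linear_functionalD[OF W] left_diff_distrib del: mult_pCons_left)
qed

text \<open>
  Both sides are determined by the recursions \<open>rec_op\<close> in the three indices, which agree with
  multiplication by one and the same linear polynomial, and by their values on one axis.
\<close>

theorem rainbow_eq_wilson:
  assumes "rainbow_arrays \<beta> A B" and \<beta>: "0 < \<beta>"
  shows "A (vector [i, j, k]) = wilson (2 * \<beta> - 1 / 2) (2 * \<beta> - 1 / 2) (1 / 2 - \<beta>)
    (rainbow_poly \<beta> i * rainbow_poly \<beta> j * rainbow_poly \<beta> k)"
proof -
  let ?P = "rainbow_poly \<beta>"
  define W where "W = wilson (2 * \<beta> - 1 / 2) (2 * \<beta> - 1 / 2) (1 / 2 - \<beta>)"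
  have W: "linear_functional W" unfolding W_def by (rule linear_wilson)
  define X where "X = [:- ((1 / 2 - \<beta>)\<^sup>2), 1:]"
  define a where "a i j k = ext3 A (int i) (int j) (int k)" for i j k
  note rec = rainbow_rec_op[OF assms(1), folded a_def]
  note recP = rec_op_rainbow_poly[OF \<beta> W, folded X_def]
  have P0: "?P 0 = 1" by (simp add: rainbow_poly_def)
  \<comment> \<open>With d = b the denominator parameter 1/2 + b + c + d of the functional is 3
    \<beta>, the one found on the axis.\<close>
  have 0: "a i 0 0 = W (?P i)" for i
    unfolding a_def W_def using rainbow_axis[OF assms, of i] \<beta>
    by (simp add: rainbow_poly_def wilson_cdh)
  have 1: "a i j 0 = W (?P i * ?P j)" for i j
  proof (rule rec_op_unique[OF \<beta>])
    show "rec_op \<beta> (\<lambda>i. W (?P i * ?P j)) i = rec_op \<beta> (\<lambda>j. W (?P i * ?P j)) j" for i j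
      using recP[of "?P j" i] recP[of "?P i" j] by (simp add: mult_ac)
  qed (use rec 0 in \<open>simp_all add: P0\<close>)
  have "a i j k = W (?P i * ?P j * ?P k)" for k
  proof (rule rec_op_unique[OF \<beta>, of "\<lambda>i k. a i j k" "\<lambda>i k. W (?P i * ?P j * ?P k)"])
    show "rec_op \<beta> (\<lambda>i. W (?P i * ?P j * ?P k)) i = rec_op \<beta> (\<lambda>k. W (?P i * ?P j * ?P k)) k" for i k
      using recP[of "?P j * ?P k" i] recP[of "?P i * ?P j" k] by (simp add: mult_ac)
  qed (use rec 1 in \<open>simp_all add: P0\<close>)
  thus ?thesis by (simp add: a_def W_def ext3_nat)
qed

section \<open>Bounds on the imaginary axis\<close>

text \<open>The brackets contain the hypergeometric operator with parameters a + c, b + c, a + b; at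
  \<zeta> = c^2 the equation is that of Gauss. It is stated for formal power series, so no radius of
  convergence enters.\<close>

definition cdh_ode :: "real \<Rightarrow> real \<Rightarrow> real \<Rightarrow> real \<Rightarrow> real fps \<Rightarrow> bool" where
  "cdh_ode a b c \<zeta> f \<longleftrightarrow>
    (1 - fps_X) * (fps_X * fps_deriv (fps_deriv f) + fps_const (a + b) * fps_deriv f
      - (fps_X * (fps_X * fps_deriv (fps_deriv f)) + fps_const (a + c + (b + c) + 1) * (fps_X * fps_deriv f)
        + fps_const ((a + c) * (b + c)) * f)) = fps_const (\<zeta> - c\<^sup>2) * f"

lemma cdh_rec_iff_ode:
  "cdh_rec a b c \<zeta> (fps_nth f) \<longleftrightarrow> fps_nth f 0 = 1 \<and> cdh_ode a b c \<zeta> f"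
proof -
  define G where "G = fps_X * fps_deriv (fps_deriv f) + fps_const (a + b) * fps_deriv f
      - (fps_X * (fps_X * fps_deriv (fps_deriv f)) + fps_const (a + c + (b + c) + 1) * (fps_X * fps_deriv f)
        + fps_const ((a + c) * (b + c)) * f)"
  have X: "fps_nth (fps_X * fps_deriv (fps_deriv f)) n = real n * (real n + 1) * fps_nth f (Suc n)" for n
    by (cases n) (simp_all add: algebra_simps)
  have XX: "fps_nth (fps_X * (fps_X * fps_deriv (fps_deriv f))) n = (real n - 1) * real n * fps_nth f n" for n
    by (cases n) (simp_all add: X algebra_simps)
  have X1: "fps_nth (fps_X * fps_deriv f) n = real n * fps_nth f n" for n
    by (cases n) simp_all
  have G: "fps_nth G n = (real n + 1) * (real n + a + b) * fps_nth f (Suc n)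
      - (real n + a + c) * (real n + b + c) * fps_nth f n" for n
    unfolding G_def fps_sub_nth fps_add_nth fps_mult_left_const_nth X XX X1 fps_deriv_nth
    by (simp add: algebra_simps)
  have "cdh_ode a b c \<zeta> f \<longleftrightarrow> (\<forall>n. fps_nth G n - (if n = 0 then 0 else fps_nth G (n - 1)) = (\<zeta> - c\<^sup>2) * fps_nth f n)"
    unfolding cdh_ode_def G_def[symmetric] by (simp add: fps_eq_iff left_diff_distrib)
  also have "\<dots> \<longleftrightarrow> (\<forall>n. (real n + 1) * (real n + a + b) * fps_nth f (Suc n) =
     (\<zeta> - c\<^sup>2 + (real n + a + c) * (real n + b + c) + real n * (real n - 1 + a + b)) * fps_nth f n
       - (if n = 0 then 0 else (real n - 1 + a + c) * (real n - 1 + b + c) * fps_nth f (n - 1)))"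
  proof (intro all_cong1)
    fix n
    show "(fps_nth G n - (if n = 0 then 0 else fps_nth G (n - 1)) = (\<zeta> - c\<^sup>2) * fps_nth f n) \<longleftrightarrow>
      ((real n + 1) * (real n + a + b) * fps_nth f (Suc n) =
     (\<zeta> - c\<^sup>2 + (real n + a + c) * (real n + b + c) + real n * (real n - 1 + a + b)) * fps_nth f n
       - (if n = 0 then 0 else (real n - 1 + a + c) * (real n - 1 + b + c) * fps_nth f (n - 1)))"
      by (cases n) (auto simp: G algebra_simps)
  qed
  finally show ?thesis by (simp add: cdh_rec_def)
qed

section \<open>Change of the parameter c\<close>

definition one_minus_powr :: "real \<Rightarrow> real fps" where
  "one_minus_powr g = Abs_fps (\<lambda>n. pochhammer (- g) n / fact n)"

lemma one_minus_powr_nth: "fps_nth (one_minus_powr g) n = pochhammer (- g) n / fact n"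
  by (simp add: one_minus_powr_def)

lemma deriv_one_minus_powr: "(1 - fps_X) * fps_deriv (one_minus_powr g) = - fps_const g * one_minus_powr g"
proof (rule fps_ext)
  fix n
  have key: "real (Suc n) * fps_nth (one_minus_powr g) (Suc n) = (real n - g) * fps_nth (one_minus_powr g) n" for n
    by (simp add: pochhammer_Suc one_minus_powr_nth)
  show "fps_nth ((1 - fps_X) * fps_deriv (one_minus_powr g)) n = fps_nth (- fps_const g * one_minus_powr g) n"
    using key[of n] by (cases n) (simp_all add: left_diff_distrib algebra_simps)
qed

lemma one_minus_powr_diff_1: "(1 - fps_X) * one_minus_powr (g - 1) = one_minus_powr g"
proof (rule fps_ext)
  fix n
  show "fps_nth ((1 - fps_X) * one_minus_powr (g - 1)) n = fps_nth (one_minus_powr g) n"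
  proof (cases n)
    case 0 thus ?thesis by (simp add: one_minus_powr_nth left_diff_distrib)
  next
    case (Suc m)
    have "pochhammer (1 - g) (Suc m) / fact (Suc m) - pochhammer (1 - g) m / fact m
        = pochhammer (1 - g) m * ((1 - g + real m) - (1 + real m)) / fact (Suc m)"
      by (simp add: pochhammer_Suc divide_simps) (simp add: algebra_simps)
    also have "\<dots> = (- g * pochhammer (- g + 1) m) / fact (Suc m)" by (simp add: mult_ac)
    also have "- g * pochhammer (- g + 1) m = pochhammer (- g) (Suc m)" by (rule pochhammer_rec[symmetric])
    finally show ?thesis by (simp add: Suc one_minus_powr_nth left_diff_distrib)
  qed
qed

text \<open>Conjugation of the operator by E = (1 - X)^g, whose first two derivatives enter through
  the first two hypotheses. In a bare commutative ring this is a polynomial identity, with constants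
  and series on the same footing.\<close>

lemma ode_shift_ring:
  fixes X E E1 E2 f f1 f2 a b c g z :: "'a::comm_ring_1"
  assumes "(1 - X) * E1 = - g * E" "(1 - X) * E2 - E1 = - g * E1"
    and "(1 - X) * (X * f2 + (a + b) * f1 - (X * (X * f2) + (a + c + (b + c) + 1) * (X * f1) + (a + c) * (b + c) * f)) = (z - c * c) * f"
  shows "(1 - X) * (X * (E2 * f + 2 * E1 * f1 + E * f2) + (a + b) * (E1 * f + E * f1)
    - (X * (X * (E2 * f + 2 * E1 * f1 + E * f2)) + (a + (c - g) + (b + (c - g)) + 1) * (X * (E1 * f + E * f1))
        + (a + (c - g)) * (b + (c - g)) * (E * f))) = (z - (c - g) * (c - g)) * (E * f)"
proof -
  define D where "D = 1 - X"
  define s where "s = a + c + (b + c) + 1"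
  have X: "X = 1 - D" by (simp add: D_def)
  have 1: "D * E1 = - g * E" using assms(1) by (simp add: D_def)
  have "D * E2 = E1 - g * E1" using assms(2) by (simp add: D_def algebra_simps)
  hence "D * (D * E2) = D * (E1 - g * E1)" by (simp only:)
  also have "\<dots> = D * E1 - g * (D * E1)" by (simp add: algebra_simps)
  finally have 2: "D * (D * E2) = g * (g - 1) * E" unfolding 1 by (simp add: algebra_simps)
  have "(1 - X) * (X * (E2 * f + 2 * E1 * f1 + E * f2) + (a + b) * (E1 * f + E * f1)
    - (X * (X * (E2 * f + 2 * E1 * f1 + E * f2)) + (a + (c - g) + (b + (c - g)) + 1) * (X * (E1 * f + E * f1))
        + (a + (c - g)) * (b + (c - g)) * (E * f)))
    = X * f * (D * (D * E2)) + 2 * X * f1 * D * (D * E1) + ((a + b) - (s - 2 * g) * X) * f * (D * E1)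
      + E * (D * (X * D * f2 + ((a + b) - (s - 2 * g) * X) * f1)) - D * ((a + (c - g)) * (b + (c - g)) * (E * f))"
    by (simp add: D_def s_def algebra_simps)
  also have "\<dots> = E * (D * (X * f2 + (a + b) * f1 - (X * (X * f2) + s * (X * f1) + (a + c) * (b + c) * f)))
      + (X * g * (g - 1) - g * ((a + b) - (s - 2 * g) * X) - D * ((a + (c - g)) * (b + (c - g)) - (a + c) * (b + c))) * (E * f)"
    unfolding 1 2 by (simp add: D_def algebra_simps)
  also have "D * (X * f2 + (a + b) * f1 - (X * (X * f2) + s * (X * f1) + (a + c) * (b + c) * f)) = (z - c * c) * f"
    using assms(3) by (simp add: D_def s_def)
  also have "X * g * (g - 1) - g * ((a + b) - (s - 2 * g) * X) - D * ((a + (c - g)) * (b + (c - g)) - (a + c) * (b + c)) = c * c - (c - g) * (c - g)"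
    by (simp add: D_def s_def algebra_simps)
  finally show ?thesis by (simp add: algebra_simps)
qed

lemma cdh_ode_shift:
  assumes "cdh_ode a b c \<zeta> f"
  shows "cdh_ode a b (c - g) \<zeta> (one_minus_powr g * f)"
proof -
  let ?E = "one_minus_powr g" and ?k = "fps_const :: real \<Rightarrow> real fps"
  have 1: "(1 - fps_X) * fps_deriv ?E = - ?k g * ?E" by (rule deriv_one_minus_powr)
  have 2: "(1 - fps_X) * fps_deriv (fps_deriv ?E) - fps_deriv ?E = - ?k g * fps_deriv ?E"
    using arg_cong[OF 1, of fps_deriv] by (simp add: algebra_simps)
  have c: "?k (a + b) = ?k a + ?k b" "?k (a + c + (b + c) + 1) = ?k a + ?k c + (?k b + ?k c) + 1"
    "?k ((a + c) * (b + c)) = (?k a + ?k c) * (?k b + ?k c)" "?k (\<zeta> - c\<^sup>2) = ?k \<zeta> - ?k c * ?k c" for c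
    by (simp_all add: power2_eq_square flip: fps_const_1_eq_1)
  have g: "?k (c - g) = ?k c - ?k g" by simp
  have d: "fps_deriv (?E * f) = fps_deriv ?E * f + ?E * fps_deriv f"
    "fps_deriv (fps_deriv ?E * f + ?E * fps_deriv f) =
      fps_deriv (fps_deriv ?E) * f + 2 * fps_deriv ?E * fps_deriv f + ?E * fps_deriv (fps_deriv f)"
    by (simp_all add: algebra_simps)
  show ?thesis
    using ode_shift_ring[OF 1 2 assms[unfolded cdh_ode_def c]]
    unfolding cdh_ode_def c g d .
qed

text \<open>Replacing c by c - g multiplies the generating function by (1 - t)^g. The product
  satisfies the differential equation for c - g, and the constant term 1 singles out the
  solution.\<close>

lemma cdh_shift:
  assumes "cdh_rec a b c \<zeta> p" "0 < a + b"
  shows "poly (cdh a b (c - g) n) \<zeta> = (\<Sum>k\<le>n. pochhammer (- g) k / fact k * p (n - k))"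
proof -
  have "cdh_rec a b c \<zeta> (fps_nth (Abs_fps p))" using assms by (simp add: Abs_fps_inverse)
  hence "cdh_ode a b c \<zeta> (Abs_fps p)" "p 0 = 1" by (simp_all add: cdh_rec_iff_ode)
  hence "cdh_rec a b (c - g) \<zeta> (fps_nth (one_minus_powr g * Abs_fps p))"
    unfolding cdh_rec_iff_ode by (simp add: cdh_ode_shift one_minus_powr_nth)
  from cdh_rec_unique[OF cdh_rec_cdh[OF assms(2)] this assms(2)] show ?thesis
    by (simp add: fps_mult_nth one_minus_powr_nth atLeast0AtMost)
qed

text \<open>For \<zeta> = z^2 and c = z the right-hand side of the differential equation vanishes,
  and the generating function is F(a + z, b + z; a + b; t).\<close>

lemma cdh_rec_terminating:
  assumes "0 < a + b"
  shows "cdh_rec a b z (z\<^sup>2) (\<lambda>n. pochhammer (a + z) n * pochhammer (b + z) n / (pochhammer (a + b) n * fact n))"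
  unfolding cdh_rec_def
proof (intro conjI allI)
  fix n
  define q where "q n = pochhammer (a + z) n * pochhammer (b + z) n / (pochhammer (a + b) n * fact n)" for n
  have q: "(real n + 1) * (real n + a + b) * q (Suc n) = (real n + a + z) * (real n + b + z) * q n" for n
  proof -
    have "a + b + real n \<noteq> 0" "pochhammer (a + b) n \<noteq> 0" "real n + 1 \<noteq> 0" using assms pochhammer_pos[of "a + b" n] by auto
    thus ?thesis by (simp add: q_def pochhammer_Suc divide_simps) (simp add: algebra_simps)
  qed
  show "(real n + 1) * (real n + a + b) * q (Suc n) =
     (z\<^sup>2 - z\<^sup>2 + (real n + a + z) * (real n + b + z) + real n * (real n - 1 + a + b)) * q n
       - (if n = 0 then 0 else (real n - 1 + a + z) * (real n - 1 + b + z) * q (n - 1))"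
    using q[of n] q[of "n - 1"] by (cases n) (auto simp: algebra_simps)
qed simp

section \<open>The quadratic transformation at c = 0\<close>

definition mp_even :: "real \<Rightarrow> real \<Rightarrow> nat \<Rightarrow> real" where
  "mp_even b x k = Re (mp_coeff b (\<i> * of_real x) (2 * k)) * pochhammer (1 / 2) k / pochhammer (1 / 2 + b) k"

text \<open>By the duplication formula the continuous dual Hahn weight with parameters 1/2, b, 0 is
  a multiple of |\<Gamma>(b + ix)|^2, the Meixner-Pollaczek weight, and the even ones among the
  polynomials orthogonal for it are polynomials in x^2. The Pochhammer quotient in
  \<open>mp_even\<close> adjusts the normalisation.\<close>

lemma cdh_rec_mp_even:
  assumes b: "0 < b"
  shows "cdh_rec (1 / 2) b 0 (- (x\<^sup>2)) (mp_even b x)"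
  unfolding cdh_rec_def
proof (intro conjI allI)
  show "mp_even b x 0 = 1" by (simp add: mp_even_def mp_coeff_rec(3))
  fix k
  define z where "z = \<i> * complex_of_real x"
  define H where "H = mp_coeff b z"
  have z2: "z * z = - of_real (x * x)" by (simp add: z_def complex_eq_iff)
  define h where "h k = Re (H (2 * k))" for k
  have r1: "of_nat (2 * k + 2) * H (2 * k + 2) = 2 * z * H (2 * k + 1) + (of_nat (2 * k) + 2 * of_real b) * H (2 * k)" for k
    unfolding H_def using mp_coeff_rec(1)[of "2 * k" b z] by simp
  have three: "2 * (real k + 1 / 2) * (2 * (real k + 1)) * h (Suc k) = (- 4 * x\<^sup>2 + 2 * (real k + 1 / 2) * (2 * (real k + b)) + 2 * real k * (2 * (real k - 1 / 2 + b))) * h k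
    - (if k = 0 then 0 else 2 * (real k - 1 / 2 + b) * (2 * (real k - 1 + b)) * h (k - 1))"
  proof (cases k)
    case 0
    have "H 1 = 2 * z" "H 0 = 1" unfolding H_def by (simp_all add: mp_coeff_rec(2,3)[simplified])
    hence "2 * H 2 = 4 * (z * z) + 2 * of_real b"
      using r1[of 0] by (simp add: numeral_2_eq_2)
    hence "2 * H 2 = of_real (- 4 * (x * x) + 2 * b)" unfolding z2 by simp
    from arg_cong[OF this, of Re] have "2 * h 1 = - 4 * (x * x) + 2 * b"
      unfolding Re_complex_of_real by (simp add: h_def)
    thus ?thesis using 0 by (simp add: h_def H_def mp_coeff_rec(3) power2_eq_square)
  next
    case (Suc m)
    have r2: "of_nat (2 * k + 1) * H (2 * k + 1) = 2 * z * H (2 * k) + (of_nat (2 * k - 1) + 2 * of_real b) * H (2 * k - 1)"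
      unfolding H_def using mp_coeff_rec(1)[of "2 * m + 1" b z] Suc by simp
    have r3: "of_nat (2 * k) * H (2 * k) = 2 * z * H (2 * k - 1) + (of_nat (2 * k - 2) + 2 * of_real b) * H (2 * k - 2)"
      unfolding H_def using mp_coeff_rec(1)[of "2 * m" b z] Suc by simp
    define \<kappa> where "\<kappa> = (of_nat k :: complex)"
    define B where "B = complex_of_real b"
    have e: "of_nat (2 * k + 2) = 2 * \<kappa> + 2" "of_nat (2 * k + 1) = 2 * \<kappa> + 1" "of_nat (2 * k) = 2 * \<kappa>"
      "of_nat (2 * k - 1) = 2 * \<kappa> - 1" "of_nat (2 * k - 2) = 2 * \<kappa> - 2"
      using Suc by (simp_all add: \<kappa>_def of_nat_diff)
    \<comment> \<open>The two odd coefficients occur only in the combinations u and v, which the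
      outer two of three consecutive recursion steps express by even ones; the middle step then
      relates even coefficients alone.\<close>
    define u v where "u = 2 * z * H (2 * k + 1)" and "v = 2 * z * H (2 * k - 1)"
    have u: "u = (2 * \<kappa> + 2) * H (2 * k + 2) - (2 * \<kappa> + 2 * B) * H (2 * k)"
      using r1[of k] unfolding e by (simp add: u_def B_def)
    have v: "v = 2 * \<kappa> * H (2 * k) - (2 * \<kappa> - 2 + 2 * B) * H (2 * k - 2)"
      using r3 unfolding e by (simp add: v_def B_def)
    have "(2 * \<kappa> + 1) * u = 2 * z * ((2 * \<kappa> + 1) * H (2 * k + 1))" by (simp add: u_def)
    also have "(2 * \<kappa> + 1) * H (2 * k + 1) = 2 * z * H (2 * k) + (2 * \<kappa> - 1 + 2 * B) * H (2 * k - 1)"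
      using r2 unfolding e B_def .
    also have "2 * z * \<dots> = 4 * (z * z) * H (2 * k) + (2 * \<kappa> - 1 + 2 * B) * v"
      by (simp add: v_def algebra_simps)
    finally have "(2 * \<kappa> + 1) * ((2 * \<kappa> + 2) * H (2 * k + 2) - (2 * \<kappa> + 2 * B) * H (2 * k)) =
        - 4 * of_real (x * x) * H (2 * k) + (2 * \<kappa> - 1 + 2 * B) * (2 * \<kappa> * H (2 * k) - (2 * \<kappa> - 2 + 2 * B) * H (2 * k - 2))"
      unfolding u v z2 by simp
    hence "of_real ((2 * real k + 1) * (2 * real k + 2)) * H (2 * Suc k) =
        of_real ((2 * real k + 1) * (2 * real k + 2 * b) - 4 * (x * x) + (2 * real k - 1 + 2 * b) * (2 * real k)) * H (2 * k)
        - of_real ((2 * real k - 1 + 2 * b) * (2 * real k - 2 + 2 * b)) * H (2 * (k - 1))"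
      using Suc by (simp add: \<kappa>_def B_def algebra_simps)
    from arg_cong[OF this, of Re]
    have "((2 * real k + 1) * (2 * real k + 2)) * h (Suc k) =
        ((2 * real k + 1) * (2 * real k + 2 * b) - 4 * (x * x) + (2 * real k - 1 + 2 * b) * (2 * real k)) * h k
        - ((2 * real k - 1 + 2 * b) * (2 * real k - 2 + 2 * b)) * h (k - 1)"
      unfolding h_def minus_complex.sel times_complex.sel Re_complex_of_real Im_complex_of_real by simp
    thus ?thesis using Suc by (simp add: power2_eq_square algebra_simps)
  qed
  define p where "p k = pochhammer (1 / 2) k / pochhammer (1 / 2 + b) k" for k
  have mp: "mp_even b x k = h k * p k" for k by (simp add: mp_even_def h_def H_def z_def p_def)
  have p: "(real k + 1 / 2 + b) * p (Suc k) = (real k + 1 / 2) * p k" for k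
  proof -
    have "pochhammer (1 / 2 + b) k \<noteq> 0" "1 / 2 + b + real k \<noteq> 0" using b pochhammer_pos[of "1 / 2 + b" k] by auto
    thus ?thesis by (simp add: p_def pochhammer_Suc add_ac)
  qed
  have "4 * ((real k + 1) * (real k + 1 / 2 + b) * (h (Suc k) * p (Suc k))) = 4 * (real k + 1) * h (Suc k) * ((real k + 1 / 2 + b) * p (Suc k))"
    by (simp only: mult_ac)
  also have "\<dots> = (2 * (real k + 1 / 2) * (2 * (real k + 1)) * h (Suc k)) * p k"
    unfolding p by (simp add: algebra_simps)
  also have "\<dots> = (- 4 * x\<^sup>2 + 2 * (real k + 1 / 2) * (2 * (real k + b)) + 2 * real k * (2 * (real k - 1 / 2 + b))) * (h k * p k)
    - (if k = 0 then 0 else 4 * (real k - 1 + b) * h (k - 1) * ((real k - 1 / 2 + b) * p k))"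
    unfolding three by (simp add: algebra_simps)
  also have "(if k = 0 then 0 else 4 * (real k - 1 + b) * h (k - 1) * ((real k - 1 / 2 + b) * p k)) =
    (if k = 0 then 0 else 4 * (real k - 1 + b) * h (k - 1) * ((real k - 1 / 2) * p (k - 1)))"
    using p[of "k - 1"] by (cases k) (simp_all add: algebra_simps)
  finally show "(real k + 1) * (real k + 1 / 2 + b) * mp_even b x (Suc k) =
     (- (x\<^sup>2) - 0\<^sup>2 + (real k + 1 / 2 + 0) * (real k + b + 0) + real k * (real k - 1 + 1 / 2 + b)) * mp_even b x k
       - (if k = 0 then 0 else (real k - 1 + 1 / 2 + 0) * (real k - 1 + b + 0) * mp_even b x (k - 1))"
    unfolding mp by (cases "k = 0") (simp_all add: field_simps)
qed

text \<open>The product of the two Gamma sequences converges and so is bounded; times n^(p - q) it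
  is the left side at k = n + 1. For n \<ge> 1 the bases n and k + 1 differ by a factor of at most
  3, whence \<open>L\<close>; the indices k = 0 and k = 1 are treated apart.\<close>

lemma pochhammer_ratio_le:
  assumes q: "0 < q"
  shows "\<exists>C>0. \<forall>k. \<bar>pochhammer p k\<bar> / pochhammer q k \<le> C * (real k + 1) powr (p - q)"
proof -
  have "(\<lambda>n. rGamma_series p n * Gamma_series q n) \<longlonglongrightarrow> rGamma p * Gamma q"
    by (intro tendsto_intros)
  hence "Bseq (\<lambda>n. rGamma_series p n * Gamma_series q n)" by (rule convergent_imp_Bseq[OF convergentI])
  then obtain K where K: "K > 0" "\<And>n. \<bar>rGamma_series p n * Gamma_series q n\<bar> \<le> K"
    by (auto simp: Bseq_def)
  define L where "L = 3 powr \<bar>p - q\<bar>"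
  have L: "L \<ge> 1" by (simp add: L_def ge_one_powr_ge_zero)
  define C where "C = 1 + K * L + \<bar>p\<bar> / q * L"
  have C: "C > 0" using K L q by (auto simp: C_def intro!: add_pos_nonneg)
  have C1: "K * L \<le> C" "\<bar>p\<bar> / q * L \<le> C" using K L q by (auto simp: C_def)
  have "\<bar>pochhammer p k\<bar> / pochhammer q k \<le> C * (real k + 1) powr (p - q)" for k
  proof -
    have powr_le: "u powr (p - q) \<le> L * v powr (p - q)" if "0 < u" "u \<le> 3 * v" "v \<le> 3 * u" for u v :: real
    proof -
      have "(u / v) powr (p - q) \<le> L"
      proof (cases "p \<ge> q")
        case True
        hence "(u / v) powr (p - q) \<le> 3 powr (p - q)" using that by (intro powr_mono2) (auto simp: divide_simps)
        thus ?thesis using True by (simp add: L_def)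
      next
        case False
        have "(u / v) powr (p - q) \<le> (1 / 3) powr (p - q)" using that False by (intro powr_mono2') (auto simp: divide_simps)
        also have "\<dots> = 3 powr (q - p)" by (simp add: powr_divide powr_minus_divide[symmetric])
        finally show ?thesis using False by (simp add: L_def)
      qed
      thus ?thesis using that by (simp add: powr_divide divide_simps)
    qed
    consider "k = 0" | "k = 1" | n where "k = Suc n" "n \<ge> 1" by (cases k) force+
    thus ?thesis
    proof cases
      case 1 thus ?thesis using K L q by (simp add: C_def)
    next
      case 2
      have "\<bar>p\<bar> / q * 1 powr (p - q) \<le> \<bar>p\<bar> / q * (L * 2 powr (p - q))"
        using powr_le[of 1 2] q by (intro mult_left_mono) auto
      also have "\<dots> \<le> C * 2 powr (p - q)"
        using mult_right_mono[OF C1(2), of "2 powr (p - q)"] by (simp add: mult_ac)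
      finally show ?thesis using 2 by simp
    next
      case (3 n)
      have "\<bar>pochhammer p k\<bar> / pochhammer q k = \<bar>rGamma_series p n * Gamma_series q n\<bar> * real n powr (p - q)"
        using 3 pochhammer_pos[OF q, of "Suc n"]
        by (simp add: rGamma_series_def Gamma_series_def abs_mult powr_def exp_diff left_diff_distrib mult_ac divide_simps)
      also have "\<dots> \<le> K * (L * (real k + 1) powr (p - q))"
        using 3 K powr_le[of "real n" "real k + 1"] by (intro mult_mono) auto
      also have "\<dots> \<le> C * (real k + 1) powr (p - q)"
        using mult_right_mono[OF C1(1), of "(real k + 1) powr (p - q)"] by (simp add: mult_ac)
      finally show ?thesis .
    qed
  qed
  thus ?thesis using C by blast
qed

text \<open>The coefficient of index 2 k is of order k^(b - 1), the normalising quotient of order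
  k^(-b), which leaves 1/k whatever b is. Here the sharp coefficient bound pays off.\<close>

lemma mp_even_le:
  assumes b: "0 < b"
  shows "\<exists>C>0. \<forall>x k. \<bar>mp_even b x k\<bar> \<le> C * (1 + \<bar>x\<bar>)\<^sup>2 * exp (pi * \<bar>x\<bar> / 2) / (real k + 1)"
proof -
  obtain C where C: "C > 0" "\<And>k. \<bar>pochhammer (1 / 2) k\<bar> / pochhammer (1 / 2 + b) k \<le> C * (real k + 1) powr (1 / 2 - (1 / 2 + b))"
    using pochhammer_ratio_le[of "1 / 2 + b" "1 / 2"] b by auto
  define D where "D = 1 + 4 * exp 1 * (b + 1)\<^sup>2 * 2 powr (b + 2) * C"
  have D: "D \<ge> 1" using C by (auto simp: D_def)
  have "\<bar>mp_even b x k\<bar> \<le> D * (1 + \<bar>x\<bar>)\<^sup>2 * exp (pi * \<bar>x\<bar> / 2) / (real k + 1)" for x k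
  proof (cases k)
    case 0
    have "1 * 1 \<le> (1 + \<bar>x\<bar>)\<^sup>2 * exp (pi * \<bar>x\<bar> / 2)" by (intro mult_mono) (auto simp: one_le_power)
    hence "1 * (1 * 1) \<le> D * ((1 + \<bar>x\<bar>)\<^sup>2 * exp (pi * \<bar>x\<bar> / 2))" using D by (intro mult_mono) auto
    thus ?thesis by (simp add: 0 mp_even_def mp_coeff_rec(3) mult.assoc)
  next
    case (Suc m)
    define K where "K = real k + 1"
    have K: "K > 0" by (simp add: K_def)
    have "\<bar>Re (mp_coeff b (\<i> * of_real x) (2 * k))\<bar> \<le> norm (mp_coeff b (\<i> * of_real x) (2 * m + 2))"
      using abs_Re_le_cmod Suc by simp
    also have "\<dots> \<le> 4 * exp 1 * (\<bar>x\<bar> + b + 1)\<^sup>2 * exp (pi * \<bar>x\<bar> / 2) * ((2 * real k) powr (b + 1) / ((2 * real k) * (2 * real k - 1)))"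
      using norm_mp_coeff_le[of b x "2 * m"] b Suc by (simp add: algebra_simps)
    also have "\<dots> \<le> 4 * exp 1 * ((b + 1) * (1 + \<bar>x\<bar>))\<^sup>2 * exp (pi * \<bar>x\<bar> / 2) * (2 powr (b + 2) * K powr (b - 1))"
    proof (intro mult_mono)
      show "(\<bar>x\<bar> + b + 1)\<^sup>2 \<le> ((b + 1) * (1 + \<bar>x\<bar>))\<^sup>2" using b by (intro power_mono) (auto simp: algebra_simps)
      have "K * (K / 2) \<le> (2 * real k) * (2 * real k - 1)" using Suc by (intro mult_mono) (auto simp: K_def)
      moreover have "(2 * real k) powr (b + 1) \<le> (2 * K) powr (b + 1)" using b by (intro powr_mono2) (auto simp: K_def)
      ultimately have "(2 * real k) powr (b + 1) / ((2 * real k) * (2 * real k - 1)) \<le> (2 * K) powr (b + 1) / (K * (K / 2))"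
        using K by (intro frac_le) auto
      also have "\<dots> = 2 powr (b + 2) * K powr (b - 1)"
      proof -
        have "b + 1 = (b - 1) + 2" "b + 2 = (b + 1) + 1" by simp_all
        hence "K powr (b + 1) = K powr (b - 1) * K\<^sup>2" "2 powr (b + 2) = 2 powr (b + 1) * (2 :: real)"
          using K by (simp_all only: powr_add) simp_all
        thus ?thesis using K by (simp add: powr_mult power2_eq_square)
      qed
      finally show "(2 * real k) powr (b + 1) / ((2 * real k) * (2 * real k - 1)) \<le> 2 powr (b + 2) * K powr (b - 1)" .
    qed (use b Suc in auto)
    finally have 1: "\<bar>Re (mp_coeff b (\<i> * of_real x) (2 * k))\<bar> \<le> 4 * exp 1 * ((b + 1) * (1 + \<bar>x\<bar>))\<^sup>2 * exp (pi * \<bar>x\<bar> / 2) * (2 powr (b + 2) * K powr (b - 1))" .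
    have 2: "\<bar>pochhammer (1 / 2) k\<bar> / pochhammer (1 / 2 + b) k \<le> C * K powr (- b)"
      using C(2)[of k] by (simp add: K_def)
    have "\<bar>mp_even b x k\<bar> = \<bar>Re (mp_coeff b (\<i> * of_real x) (2 * k))\<bar> * (\<bar>pochhammer (1 / 2) k\<bar> / pochhammer (1 / 2 + b) k)"
      using b pochhammer_pos[of "1 / 2 + b" k] by (simp add: mp_even_def abs_mult)
    also have "\<dots> \<le> (4 * exp 1 * ((b + 1) * (1 + \<bar>x\<bar>))\<^sup>2 * exp (pi * \<bar>x\<bar> / 2) * (2 powr (b + 2) * K powr (b - 1))) * (C * K powr (- b))"
      using b pochhammer_pos[of "1 / 2 + b" k] C by (intro mult_mono 1 2) (auto intro!: divide_nonneg_pos)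
    also have "\<dots> = (4 * exp 1 * (b + 1)\<^sup>2 * 2 powr (b + 2) * C) * (1 + \<bar>x\<bar>)\<^sup>2 * exp (pi * \<bar>x\<bar> / 2) * (K powr (b - 1) * K powr (- b))"
      by (simp add: power_mult_distrib mult_ac)
    also have "K powr (b - 1) * K powr (- b) = 1 / K"
    proof -
      have "K powr (b - 1) * K powr (- b) = K powr (- 1)" by (simp only: powr_add[symmetric]) simp
      thus ?thesis using K by (simp add: powr_minus_divide)
    qed
    also have "(4 * exp 1 * (b + 1)\<^sup>2 * 2 powr (b + 2) * C) * (1 + \<bar>x\<bar>)\<^sup>2 * exp (pi * \<bar>x\<bar> / 2) * (1 / K)
       \<le> D * (1 + \<bar>x\<bar>)\<^sup>2 * exp (pi * \<bar>x\<bar> / 2) * (1 / K)"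
      using K by (intro mult_right_mono) (auto simp: D_def)
    finally show ?thesis by (simp add: K_def)
  qed
  thus ?thesis using D by (intro exI[of _ D]) auto
qed

text \<open>Coefficients of (1 - t)^(\<beta> - 3/2) times the series of \<open>mp_even\<close>. For
  \<open>rainbow_poly\<close> the exponent is \<beta> - 1/2, one more, so these are its partial
  sums.\<close>

definition rainbow_shift :: "real \<Rightarrow> real \<Rightarrow> nat \<Rightarrow> real" where
  "rainbow_shift \<beta> x n = (\<Sum>k\<le>n. pochhammer (3 / 2 - \<beta>) k / fact k * mp_even (2 * \<beta> - 1 / 2) x (n - k))"

lemma rainbow_poly_diff_shift:
  assumes "1 / 4 < \<beta>"
  shows "poly (rainbow_poly \<beta> n) (- (x\<^sup>2)) =
    rainbow_shift \<beta> x n - (if n = 0 then 0 else rainbow_shift \<beta> x (n - 1))"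
proof -
  define M where "M = Abs_fps (mp_even (2 * \<beta> - 1 / 2) x)"
  have sh: "fps_nth (one_minus_powr (\<beta> - 3 / 2) * M) m = rainbow_shift \<beta> x m" for m
    by (simp add: rainbow_shift_def fps_mult_nth one_minus_powr_nth M_def atLeast0AtMost)
  have "0 < 2 * \<beta> - 1 / 2" "0 < 1 / 2 + (2 * \<beta> - 1 / 2)" using assms by auto
  from cdh_shift[OF cdh_rec_mp_even[OF this(1), of x] this(2), of "\<beta> - 1 / 2" n]
  have "poly (rainbow_poly \<beta> n) (- (x\<^sup>2)) = fps_nth (one_minus_powr (\<beta> - 1 / 2) * M) n"
    by (simp add: rainbow_poly_def fps_mult_nth one_minus_powr_nth M_def atLeast0AtMost)
  also have "one_minus_powr (\<beta> - 1 / 2) * M = (1 - fps_X) * (one_minus_powr (\<beta> - 3 / 2) * M)"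
    using one_minus_powr_diff_1[of "\<beta> - 1 / 2"] by (simp add: mult.assoc[symmetric])
  also have "fps_nth \<dots> n = fps_nth (one_minus_powr (\<beta> - 3 / 2) * M) n -
      (if n = 0 then 0 else fps_nth (one_minus_powr (\<beta> - 3 / 2) * M) (n - 1))"
    by (simp add: left_diff_distrib del: fps_mult_nth_0)
  finally show ?thesis unfolding sh .
qed

lemma rainbow_shift_eq_sum:
  assumes "1 / 4 < \<beta>"
  shows "rainbow_shift \<beta> x n = (\<Sum>k\<le>n. poly (rainbow_poly \<beta> k) (- (x\<^sup>2)))"
  by (induction n) (simp_all add: rainbow_poly_diff_shift[OF assms])

lemma rainbow_shift_bound:
  assumes \<beta>: "1 / 4 < \<beta>"
  shows "\<exists>C>0. \<forall>x n. \<bar>rainbow_shift \<beta> x n\<bar> \<le> C * (1 + \<bar>x\<bar>)\<^sup>2 * exp (pi * \<bar>x\<bar> / 2) *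
    (\<Sum>k\<le>n. (real k + 1) powr (1 / 2 - \<beta>) * (1 / (real (n - k) + 1)))"
proof -
  have "0 < 2 * \<beta> - 1 / 2" using \<beta> by simp
  then obtain C where C: "C > 0" "\<And>x k. \<bar>mp_even (2 * \<beta> - 1 / 2) x k\<bar> \<le> C * (1 + \<bar>x\<bar>)\<^sup>2 * exp (pi * \<bar>x\<bar> / 2) / (real k + 1)"
    using mp_even_le by metis
  obtain D where D: "D > 0" "\<And>k. \<bar>pochhammer (3 / 2 - \<beta>) k\<bar> / pochhammer 1 k \<le> D * (real k + 1) powr (3 / 2 - \<beta> - 1)"
    using pochhammer_ratio_le[of 1 "3 / 2 - \<beta>"] by auto
  have "\<bar>rainbow_shift \<beta> x n\<bar> \<le> (D * C) * (1 + \<bar>x\<bar>)\<^sup>2 * exp (pi * \<bar>x\<bar> / 2) *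
    (\<Sum>k\<le>n. (real k + 1) powr (1 / 2 - \<beta>) * (1 / (real (n - k) + 1)))" for x n
  proof -
    have "\<bar>rainbow_shift \<beta> x n\<bar> \<le> (\<Sum>k\<le>n. \<bar>pochhammer (3 / 2 - \<beta>) k / fact k * mp_even (2 * \<beta> - 1 / 2) x (n - k)\<bar>)"
      unfolding rainbow_shift_def by (rule sum_abs)
    also have "\<dots> \<le> (\<Sum>k\<le>n. D * (real k + 1) powr (1 / 2 - \<beta>) * (C * (1 + \<bar>x\<bar>)\<^sup>2 * exp (pi * \<bar>x\<bar> / 2) / (real (n - k) + 1)))"
    proof (rule sum_mono)
      fix k
      have "\<bar>pochhammer (3 / 2 - \<beta>) k / fact k\<bar> \<le> D * (real k + 1) powr (1 / 2 - \<beta>)"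
        using D(2)[of k] by (simp add: pochhammer_fact[symmetric])
      thus "\<bar>pochhammer (3 / 2 - \<beta>) k / fact k * mp_even (2 * \<beta> - 1 / 2) x (n - k)\<bar> \<le>
          D * (real k + 1) powr (1 / 2 - \<beta>) * (C * (1 + \<bar>x\<bar>)\<^sup>2 * exp (pi * \<bar>x\<bar> / 2) / (real (n - k) + 1))"
        unfolding abs_mult using D(1) by (intro mult_mono C) auto
    qed
    also have "\<dots> = (D * C) * (1 + \<bar>x\<bar>)\<^sup>2 * exp (pi * \<bar>x\<bar> / 2) * (\<Sum>k\<le>n. (real k + 1) powr (1 / 2 - \<beta>) * (1 / (real (n - k) + 1)))"
      unfolding sum_distrib_left by (intro sum.cong) (simp_all add: mult_ac)
    finally show ?thesis .
  qed
  thus ?thesis using C D by (intro exI[of _ "D * C"]) auto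
qed

text \<open>Crude growth in n, which serves the boundary case \<beta> = 1/2, where the argument for
  absolute summability breaks down.\<close>

lemma rainbow_poly_le:
  assumes \<beta>: "1 / 4 < \<beta>"
  shows "\<exists>C>0. \<forall>x n. \<bar>poly (rainbow_poly \<beta> n) (- (x\<^sup>2))\<bar> \<le>
    C * (1 + \<bar>x\<bar>)\<^sup>2 * exp (pi * \<bar>x\<bar> / 2) * (real n + 1) ^ 2"
proof -
  obtain C where C: "C > 0" "\<And>x n. \<bar>rainbow_shift \<beta> x n\<bar> \<le> C * (1 + \<bar>x\<bar>)\<^sup>2 * exp (pi * \<bar>x\<bar> / 2) *
    (\<Sum>k\<le>n. (real k + 1) powr (1 / 2 - \<beta>) * (1 / (real (n - k) + 1)))"
    using rainbow_shift_bound[OF \<beta>] by blast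
  have S: "\<bar>rainbow_shift \<beta> x n\<bar> \<le> C * (1 + \<bar>x\<bar>)\<^sup>2 * exp (pi * \<bar>x\<bar> / 2) * (real n + 1)\<^sup>2" for x n
  proof (rule order.trans[OF C(2) mult_left_mono])
    have "(\<Sum>k\<le>n. (real k + 1) powr (1 / 2 - \<beta>) * (1 / (real (n - k) + 1))) \<le> (\<Sum>k\<le>n. (real n + 1) * 1)"
    proof (intro sum_mono mult_mono)
      fix k assume "k \<in> {..n}"
      have "(real k + 1) powr (1 / 2 - \<beta>) \<le> (real k + 1) powr 1" using \<beta> by (intro powr_mono) auto
      thus "(real k + 1) powr (1 / 2 - \<beta>) \<le> real n + 1" using \<open>k \<in> {..n}\<close> by simp
    qed auto
    thus "(\<Sum>k\<le>n. (real k + 1) powr (1 / 2 - \<beta>) * (1 / (real (n - k) + 1))) \<le> (real n + 1)\<^sup>2"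
      by (simp add: power2_eq_square algebra_simps)
  qed (use C in auto)
  have "\<bar>poly (rainbow_poly \<beta> n) (- (x\<^sup>2))\<bar> \<le> (2 * C) * (1 + \<bar>x\<bar>)\<^sup>2 * exp (pi * \<bar>x\<bar> / 2) * (real n + 1) ^ 2" for x n
  proof -
    define K where "K = C * (1 + \<bar>x\<bar>)\<^sup>2 * exp (pi * \<bar>x\<bar> / 2)"
    have K: "K \<ge> 0" using C by (simp add: K_def)
    have "\<bar>rainbow_shift \<beta> x (n - 1)\<bar> \<le> K * (real n + 1)\<^sup>2"
      using S[of x "n - 1"] mult_left_mono[OF power_mono[of "real (n - 1) + 1" "real n + 1" 2] K] by (auto simp: K_def)
    moreover have "\<bar>rainbow_shift \<beta> x n\<bar> \<le> K * (real n + 1)\<^sup>2" using S[of x n] by (simp add: K_def)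
    moreover have "0 \<le> K * (real n + 1)\<^sup>2" using K by simp
    ultimately have "\<bar>rainbow_shift \<beta> x n - (if n = 0 then 0 else rainbow_shift \<beta> x (n - 1))\<bar> \<le> 2 * (K * (real n + 1)\<^sup>2)"
      by (auto simp: abs_le_iff)
    thus ?thesis unfolding rainbow_poly_diff_shift[OF \<beta>] K_def by (simp add: mult_ac)
  qed
  thus ?thesis using C(1) by (intro exI[of _ "2 * C"]) auto
qed

text \<open>
  The first-order recursion with the partial sums as inhomogeneity turns a decay rate of the
  partial sums, through summation by parts, into absolute summability.
\<close>

lemma rainbow_poly_first_order:
  fixes \<zeta> :: real
  assumes \<beta>: "1 / 4 < \<beta>"
  defines "P n \<equiv> poly (rainbow_poly \<beta> n) \<zeta>"
  shows "(real n + 1) * (real n + 2 * \<beta>) * P (Suc n) =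
    (real n + \<beta>) * (real n + 1 - \<beta>) * P n + (\<zeta> - (1 / 2 - \<beta>)\<^sup>2) * (\<Sum>k\<le>n. P k)"
proof -
  define X where "X = \<zeta> - (1 / 2 - \<beta>)\<^sup>2"
  have "0 < 1 / 2 + (2 * \<beta> - 1 / 2)" using \<beta> by simp
  note rec = cdh_rec_cdh[OF this, of "1 / 2 - \<beta>" \<zeta>, unfolded cdh_rec_def, THEN conjunct2, THEN spec]
  have e: "real n + 1 / 2 + (1 / 2 - \<beta>) = real n + 1 - \<beta>" "real n + (2 * \<beta> - 1 / 2) + (1 / 2 - \<beta>) = real n + \<beta>"
      "real n + 1 / 2 + (2 * \<beta> - 1 / 2) = real n + 2 * \<beta>" "real n - 1 + 1 / 2 + (2 * \<beta> - 1 / 2) = real n - 1 + 2 * \<beta>"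
      "real n - 1 + 1 / 2 + (1 / 2 - \<beta>) = real n - \<beta>" "real n - 1 + (2 * \<beta> - 1 / 2) + (1 / 2 - \<beta>) = real n - 1 + \<beta>" for n
      by simp_all
  have rec: "(real n + 1) * (real n + 2 * \<beta>) * P (Suc n) =
      (X + (real n + 1 - \<beta>) * (real n + \<beta>) + real n * (real n - 1 + 2 * \<beta>)) * P n
       - (if n = 0 then 0 else (real n - \<beta>) * (real n - 1 + \<beta>) * P (n - 1))" for n
    using rec[of n] unfolding e P_def rainbow_poly_def X_def .
  have "(real n + 1) * (real n + 2 * \<beta>) * P (Suc n) = (real n + \<beta>) * (real n + 1 - \<beta>) * P n + X * (\<Sum>k\<le>n. P k)"
  proof (induction n)
    case 0 show ?case using rec[of 0] by (simp add: algebra_simps)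
  next
    case (Suc n)
    show ?case using rec[of "Suc n"] Suc by (simp add: algebra_simps)
  qed
  thus ?thesis by (simp add: X_def)
qed

text \<open>Put y n = n (n - 1 + 2 \<beta>) |P n|. The recursion bounds (y (n + 1) - y n) / (n + 1)
  by (2 - 2 \<beta>) |P n| to leading order, while summation by parts bounds the sum of these
  quotients below by that of |P n|, again to leading order. The surplus 2 \<beta> - 1 is positive;
  all remaining terms carry 1 / (n + 1) and are controlled by \<open>T\<close>.\<close>

lemma sum_abs_by_parts:
  fixes P S :: "nat \<Rightarrow> real"
  assumes \<beta>: "1 / 2 < \<beta>"
    and rec: "\<And>n. (real n + 1) * (real n + 2 * \<beta>) * P (Suc n) = (real n + \<beta>) * (real n + 1 - \<beta>) * P n + \<mu> * S n"
    and S: "\<And>n. P n = S n - (if n = 0 then 0 else S (n - 1))"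
    and sum: "\<And>N. (\<Sum>n<N. \<bar>S n\<bar> / (real n + 1)) \<le> T"
  shows "(2 * \<beta> - 1) * (\<Sum>n<N. \<bar>P n\<bar>) \<le> (\<bar>\<mu>\<bar> + 3 * (5 * \<beta>\<^sup>2 + \<beta>)) * T"
proof -
  define y where "y n = real n * (real n - 1 + 2 * \<beta>) * \<bar>P n\<bar>" for n
  have y0: "y n \<ge> 0" for n using \<beta> by (cases n) (auto simp: y_def)
  \<comment> \<open>The product is negative only for the finitely many n with n + 1 < \<beta>, where
    its modulus is at most 2 \<beta>^2.\<close>
  have Q: "\<bar>(real n + \<beta>) * (real n + 1 - \<beta>)\<bar> \<le> (real n + \<beta>) * (real n + 1 - \<beta>) + 4 * \<beta>\<^sup>2" for n
  proof (cases "\<beta> \<le> real n + 1")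
    case True thus ?thesis using \<beta> by simp
  next
    case False
    have "(real n + \<beta>) * (\<beta> - (real n + 1)) \<le> (2 * \<beta>) * \<beta>" using False \<beta> by (intro mult_mono) auto
    moreover have "(real n + \<beta>) * (real n + 1 - \<beta>) \<le> 0" using False \<beta> by (intro mult_nonneg_nonpos) auto
    ultimately show ?thesis by (simp add: power2_eq_square algebra_simps)
  qed
  have step: "y (Suc n) \<le> ((real n + \<beta>) * (real n + 1 - \<beta>) + 4 * \<beta>\<^sup>2) * \<bar>P n\<bar> + \<bar>\<mu>\<bar> * \<bar>S n\<bar>" for n
  proof -
    have "y (Suc n) = \<bar>(real n + 1) * (real n + 2 * \<beta>) * P (Suc n)\<bar>" using \<beta> by (simp add: y_def abs_mult)
    also have "\<dots> \<le> \<bar>(real n + \<beta>) * (real n + 1 - \<beta>)\<bar> * \<bar>P n\<bar> + \<bar>\<mu>\<bar> * \<bar>S n\<bar>"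
      unfolding rec abs_mult[symmetric] by (rule abs_triangle_ineq)
    also have "\<dots> \<le> ((real n + \<beta>) * (real n + 1 - \<beta>) + 4 * \<beta>\<^sup>2) * \<bar>P n\<bar> + \<bar>\<mu>\<bar> * \<bar>S n\<bar>"
      by (intro add_right_mono mult_right_mono Q) auto
    finally show ?thesis .
  qed
  have tel: "(\<Sum>n<N. (real n - 1 + 2 * \<beta>) / (real n + 1) * \<bar>P n\<bar>) \<le>
      (\<Sum>n<N. (y (Suc n) - y n) / (real n + 1)) + (2 * \<beta> - 1) * \<bar>P 0\<bar>" for N
  proof -
    \<comment> \<open>The boundary term y N / N makes the inequality inductive; being nonnegative,
      it is dropped afterwards.\<close>
    have "(\<Sum>n<N. (real n - 1 + 2 * \<beta>) / (real n + 1) * \<bar>P n\<bar>) + (if N = 0 then 0 else y N / real N) \<le>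
      (\<Sum>n<N. (y (Suc n) - y n) / (real n + 1)) + (2 * \<beta> - 1) * \<bar>P 0\<bar>"
    proof (induction N)
      case 0 thus ?case using \<beta> by simp
    next
      case (Suc N)
      have "(real N - 1 + 2 * \<beta>) / (real N + 1) * \<bar>P N\<bar> + y (Suc N) / (real N + 1) \<le>
        (y (Suc N) - y N) / (real N + 1) + (if N = 0 then (2 * \<beta> - 1) * \<bar>P 0\<bar> else y N / real N)"
      proof (cases "N = 0")
        case True thus ?thesis by (simp add: y_def)
      next
        case False
        hence "y N / real N = (real N - 1 + 2 * \<beta>) * \<bar>P N\<bar>" by (simp add: y_def)
        moreover have "y N / (real N + 1) + (real N - 1 + 2 * \<beta>) / (real N + 1) * \<bar>P N\<bar> = (real N - 1 + 2 * \<beta>) * \<bar>P N\<bar>"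
          by (simp add: y_def divide_simps) (simp add: algebra_simps)
        ultimately show ?thesis using False by (simp add: diff_divide_distrib)
      qed
      with Suc show ?case by (cases "N = 0") (simp_all add: y_def add.commute)
    qed
    moreover have "0 \<le> (if N = 0 then 0 else y N / real N)" using y0 by simp
    ultimately show ?thesis by linarith
  qed
  have T1: "(\<Sum>n<N. \<bar>P n\<bar> / (real n + 1)) \<le> 2 * T"
  proof -
    have "(\<Sum>n<N. \<bar>P n\<bar> / (real n + 1)) \<le> (\<Sum>n<N. \<bar>S n\<bar> / (real n + 1) + (if n = 0 then 0 else \<bar>S (n - 1)\<bar> / (real (n - 1) + 1)))"
    proof (rule sum_mono)
      fix n
      have "\<bar>S (n - 1)\<bar> / (real n + 1) \<le> \<bar>S (n - 1)\<bar> / (real (n - 1) + 1)"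
        by (intro divide_left_mono) auto
      moreover have "\<bar>P n\<bar> / (real n + 1) \<le> \<bar>S n\<bar> / (real n + 1) + (if n = 0 then 0 else \<bar>S (n - 1)\<bar> / (real n + 1))"
        unfolding S by (auto simp: add_divide_distrib[symmetric] intro!: divide_right_mono)
      ultimately show "\<bar>P n\<bar> / (real n + 1) \<le> \<bar>S n\<bar> / (real n + 1) + (if n = 0 then 0 else \<bar>S (n - 1)\<bar> / (real (n - 1) + 1))"
        by (auto split: if_splits)
    qed
    also have "\<dots> = (\<Sum>n<N. \<bar>S n\<bar> / (real n + 1)) + (\<Sum>n<N. if n = 0 then 0 else \<bar>S (n - 1)\<bar> / (real (n - 1) + 1))"
      by (rule sum.distrib)
    also have "(\<Sum>n<N. if n = 0 then 0 else \<bar>S (n - 1)\<bar> / (real (n - 1) + 1)) = (\<Sum>n<N - 1. \<bar>S n\<bar> / (real n + 1))"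
      by (cases N) (simp_all add: sum.lessThan_Suc_shift del: sum.lessThan_Suc)
    finally show ?thesis using sum[of N] sum[of "N - 1"] by linarith
  qed
  have T0: "0 \<le> T" using sum[of 0] by simp
  have P0: "\<bar>P 0\<bar> \<le> T" using sum[of 1] S[of 0] by simp
  have "(2 * \<beta> - 1) * (\<Sum>n<N. \<bar>P n\<bar>) \<le>
      (\<Sum>n<N. (real n - 1 + 2 * \<beta>) / (real n + 1) * \<bar>P n\<bar>) - (\<Sum>n<N. (y (Suc n) - y n) / (real n + 1))
      + (5 * \<beta>\<^sup>2 + \<beta>) * (\<Sum>n<N. \<bar>P n\<bar> / (real n + 1)) + \<bar>\<mu>\<bar> * (\<Sum>n<N. \<bar>S n\<bar> / (real n + 1))"
    unfolding sum_distrib_left sum_subtractf[symmetric] sum.distrib[symmetric]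
  proof (rule sum_mono)
    fix n
    define D where "D = real n + 1"
    have D: "D > 0" by (simp add: D_def)
    define p Q R E where "p = \<bar>P n\<bar>" and "Q = (real n + \<beta>) * (real n + 1 - \<beta>)"
      and "R = real n * (real n - 1 + 2 * \<beta>)" and "E = real n - 1 + 2 * \<beta>"
    have "y (Suc n) - y n \<le> (Q + 4 * \<beta>\<^sup>2) * p + \<bar>\<mu>\<bar> * \<bar>S n\<bar> - R * p"
      using step[of n] by (simp add: y_def p_def Q_def R_def)
    moreover have "((2 * \<beta> - 1) * D) * p = E * p - (Q * p - R * p) + (\<beta> - \<beta>\<^sup>2) * p"
      by (simp add: D_def E_def Q_def R_def power2_eq_square algebra_simps)
    moreover have "(\<beta> - \<beta>\<^sup>2) * p \<le> (\<beta> + \<beta>\<^sup>2) * p" unfolding p_def by (intro mult_right_mono) auto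
    moreover have "(Q + 4 * \<beta>\<^sup>2) * p = Q * p + 4 * (\<beta>\<^sup>2 * p)" "(\<beta> + \<beta>\<^sup>2) * p = \<beta> * p + \<beta>\<^sup>2 * p"
      "(5 * \<beta>\<^sup>2 + \<beta>) * p = 5 * (\<beta>\<^sup>2 * p) + \<beta> * p" by (simp_all add: algebra_simps)
    ultimately have "((2 * \<beta> - 1) * D) * p \<le> E * p - (y (Suc n) - y n) + (5 * \<beta>\<^sup>2 + \<beta>) * p + \<bar>\<mu>\<bar> * \<bar>S n\<bar>"
      by linarith
    from divide_right_mono[OF this, of D] D
    have "(2 * \<beta> - 1) * p \<le> E / D * p - (y (Suc n) - y n) / D + (5 * \<beta>\<^sup>2 + \<beta>) * (p / D) + \<bar>\<mu>\<bar> * (\<bar>S n\<bar> / D)"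
      by (simp add: add_divide_distrib diff_divide_distrib)
    thus "(2 * \<beta> - 1) * \<bar>P n\<bar> \<le> (real n - 1 + 2 * \<beta>) / (real n + 1) * \<bar>P n\<bar> - (y (Suc n) - y n) / (real n + 1)
      + (5 * \<beta>\<^sup>2 + \<beta>) * (\<bar>P n\<bar> / (real n + 1)) + \<bar>\<mu>\<bar> * (\<bar>S n\<bar> / (real n + 1))"
      by (simp only: D_def E_def p_def)
  qed
  also have "\<dots> \<le> (2 * \<beta> - 1) * \<bar>P 0\<bar> + (5 * \<beta>\<^sup>2 + \<beta>) * (2 * T) + \<bar>\<mu>\<bar> * T"
    using tel[of N] mult_left_mono[OF T1, of "5 * \<beta>\<^sup>2 + \<beta>"] mult_left_mono[OF sum[of N], of "\<bar>\<mu>\<bar>"] \<beta>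
    by (simp add: add_nonneg_nonneg)
  also have "\<dots> \<le> (5 * \<beta>\<^sup>2 + \<beta>) * T + (5 * \<beta>\<^sup>2 + \<beta>) * (2 * T) + \<bar>\<mu>\<bar> * T"
  proof -
    have "0 \<le> \<beta>\<^sup>2 - \<beta> + 1 / 4"
      using zero_le_power2[of "\<beta> - 1 / 2"] by (simp add: power2_diff power_divide)
    moreover have "0 \<le> \<beta>\<^sup>2" by simp
    ultimately have "2 * \<beta> - 1 \<le> 5 * \<beta>\<^sup>2 + \<beta>" by linarith
    hence "(2 * \<beta> - 1) * \<bar>P 0\<bar> \<le> (5 * \<beta>\<^sup>2 + \<beta>) * T" using P0 \<beta> by (intro mult_mono) auto
    thus ?thesis by (simp add: mult.commute)
  qed
  also have "\<dots> = (\<bar>\<mu>\<bar> + 3 * (5 * \<beta>\<^sup>2 + \<beta>)) * T" by (simp add: algebra_simps)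
  finally show ?thesis .
qed

text \<open>With u = k + 1 and v = n - k + 1 one has n + 1 \<ge> u^(1 - \<epsilon>) v^\<epsilon>.
  This turns u^(-2 \<epsilon>) v^(-1) / (n + 1) into at most u^(-1 - \<epsilon>) v^(-1 -
  \<epsilon>), and the double sum into at most the square of a convergent series.\<close>

lemma convolution_weight_bound:
  assumes "0 < \<epsilon>" "\<epsilon> \<le> (1::real)"
  shows "\<exists>T. \<forall>N. (\<Sum>n<N. (\<Sum>k\<le>n. (real k + 1) powr (- 2 * \<epsilon>) * (1 / (real (n - k) + 1))) / (real n + 1)) \<le> T"
proof -
  define g where "g k = (real k + 1) powr (- 1 - \<epsilon>)" for k
  have g0: "g k \<ge> 0" for k by (simp add: g_def)
  have "summable (\<lambda>n. real n powr (- 1 - \<epsilon>))" using assms by (subst summable_real_powr_iff) auto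
  hence "summable (\<lambda>n. real (Suc n) powr (- 1 - \<epsilon>))" by (subst summable_Suc_iff)
  hence sg: "summable g" by (simp add: g_def[abs_def] add.commute)
  define T where "T = suminf g"
  have gT: "(\<Sum>k<N. g k) \<le> T" for N unfolding T_def by (rule sum_le_suminf[OF sg]) (auto simp: g0)
  have T0: "T \<ge> 0" using gT[of 0] by simp
  have le: "(real k + 1) powr (- 2 * \<epsilon>) * (1 / (real (n - k) + 1)) / (real n + 1) \<le> g k * g (n - k)" if "k \<le> n" for k n
  proof -
    define u v where "u = real k + 1" and "v = real (n - k) + 1"
    have uv: "u \<ge> 1" "v \<ge> 1" "real n + 1 = u + v - 1" using that by (auto simp: u_def v_def of_nat_diff)
    define w where "w = real n + 1"
    have "w > 0" by (simp add: w_def)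
    with uv have w: "u \<le> w" "v \<le> w" "w > 0" by (auto simp: w_def)
    have "u powr (1 - \<epsilon>) * v powr \<epsilon> \<le> w powr (1 - \<epsilon>) * w powr \<epsilon>"
      using assms uv w by (intro mult_mono powr_mono2) auto
    also have "\<dots> = w" using w by (simp add: powr_add[symmetric])
    finally have "1 / w \<le> 1 / (u powr (1 - \<epsilon>) * v powr \<epsilon>)"
      using uv w by (intro divide_left_mono) (auto intro!: mult_pos_pos)
    also have "\<dots> = u powr (\<epsilon> - 1) * v powr (- \<epsilon>)"
      using powr_minus_divide[of u "1 - \<epsilon>"] powr_minus_divide[of v \<epsilon>] by simp
    finally have "u powr (- 2 * \<epsilon>) * (1 / v) * (1 / w) \<le> u powr (- 2 * \<epsilon>) * (1 / v) * (u powr (\<epsilon> - 1) * v powr (- \<epsilon>))"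
      using uv by (intro mult_left_mono) auto
    also have "\<dots> = (u powr (- 2 * \<epsilon>) * u powr (\<epsilon> - 1)) * (v powr (- 1) * v powr (- \<epsilon>))"
      using uv by (simp add: powr_minus_divide)
    also have "u powr (- 2 * \<epsilon>) * u powr (\<epsilon> - 1) = u powr (- 1 - \<epsilon>)"
      unfolding powr_add[symmetric] by (rule arg_cong[where f = "\<lambda>t. u powr t"]) simp
    also have "v powr (- 1) * v powr (- \<epsilon>) = v powr (- 1 - \<epsilon>)"
      unfolding powr_add[symmetric] by (rule arg_cong[where f = "\<lambda>t. v powr t"]) simp
    finally show ?thesis by (simp add: g_def u_def v_def w_def)
  qed
  have "(\<Sum>n<N. (\<Sum>k\<le>n. (real k + 1) powr (- 2 * \<epsilon>) * (1 / (real (n - k) + 1))) / (real n + 1)) \<le> T * T" for N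
  proof -
    have "(\<Sum>n<N. (\<Sum>k\<le>n. (real k + 1) powr (- 2 * \<epsilon>) * (1 / (real (n - k) + 1))) / (real n + 1)) \<le> (\<Sum>n<N. \<Sum>k\<le>n. g k * g (n - k))"
      unfolding sum_divide_distrib by (intro sum_mono le) auto
    also have "\<dots> = (\<Sum>(i, j)\<in>{(i, j). i + j < N}. g i * g j)"
      by (rule sum.triangle_reindex[symmetric])
    also have "\<dots> \<le> (\<Sum>(i, j)\<in>{..<N} \<times> {..<N}. g i * g j)"
      by (rule sum_mono2) (auto simp: g0)
    also have "\<dots> = (\<Sum>i<N. g i) * (\<Sum>j<N. g j)"
      by (simp add: sum_product sum.cartesian_product)
    also have "\<dots> \<le> T * T" by (intro mult_mono gT T0 sum_nonneg g0)
    finally show ?thesis .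
  qed
  thus ?thesis by blast
qed

text \<open>Of the four powers of 1 + |x| two come from the bound on \<open>mp_even\<close> and two
  from the factor -x^2 - (1/2 - \<beta>)^2 in front of the partial sums.\<close>

lemma rainbow_poly_summable:
  assumes \<beta>: "1 / 2 < \<beta>"
  shows "\<exists>C>0. \<forall>x N. (\<Sum>n<N. \<bar>poly (rainbow_poly \<beta> n) (- (x\<^sup>2))\<bar>) \<le> C * (1 + \<bar>x\<bar>) ^ 4 * exp (pi * \<bar>x\<bar> / 2)"
proof -
  have \<beta>': "1 / 4 < \<beta>" using \<beta> by simp
  \<comment> \<open>Chosen such that (k + 1)^(1/2 - \<beta>) \<le> (k + 1)^(-2 \<epsilon>), within
    the range \<epsilon> \<le> 1 of the convolution bound.\<close>
  define \<epsilon> where "\<epsilon> = min ((\<beta> - 1 / 2) / 2) 1"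
  have \<epsilon>: "0 < \<epsilon>" "\<epsilon> \<le> 1" "2 * \<epsilon> \<le> \<beta> - 1 / 2" using \<beta> by (auto simp: \<epsilon>_def min_def)
  obtain T where T: "\<And>N. (\<Sum>n<N. (\<Sum>k\<le>n. (real k + 1) powr (- 2 * \<epsilon>) * (1 / (real (n - k) + 1))) / (real n + 1)) \<le> T"
    using convolution_weight_bound[OF \<epsilon>(1,2)] by blast
  obtain C where C: "C > 0" "\<And>x n. \<bar>rainbow_shift \<beta> x n\<bar> \<le> C * (1 + \<bar>x\<bar>)\<^sup>2 * exp (pi * \<bar>x\<bar> / 2) *
    (\<Sum>k\<le>n. (real k + 1) powr (1 / 2 - \<beta>) * (1 / (real (n - k) + 1)))"
    using rainbow_shift_bound[OF \<beta>'] by blast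
  define M where "M = 3 * (5 * \<beta>\<^sup>2 + \<beta>) + (1 / 2 - \<beta>)\<^sup>2 + 1"
  have M: "M \<ge> 1" using \<beta> by (simp add: M_def)
  have T0: "T \<ge> 0" using T[of 0] by simp
  have "(\<Sum>n<N. \<bar>poly (rainbow_poly \<beta> n) (- (x\<^sup>2))\<bar>) \<le> (M * C * (T + 1) / (2 * \<beta> - 1)) * (1 + \<bar>x\<bar>) ^ 4 * exp (pi * \<bar>x\<bar> / 2)" for x N
  proof -
    define K where "K = C * (1 + \<bar>x\<bar>)\<^sup>2 * exp (pi * \<bar>x\<bar> / 2)"
    have K: "K \<ge> 0" using C by (simp add: K_def)
    have S: "(\<Sum>n<N. \<bar>rainbow_shift \<beta> x n\<bar> / (real n + 1)) \<le> K * T" for N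
    proof -
      have "(\<Sum>n<N. \<bar>rainbow_shift \<beta> x n\<bar> / (real n + 1)) \<le>
          (\<Sum>n<N. K * (\<Sum>k\<le>n. (real k + 1) powr (- 2 * \<epsilon>) * (1 / (real (n - k) + 1))) / (real n + 1))"
      proof (intro sum_mono divide_right_mono order.trans[OF C(2)])
        fix n
        show "C * (1 + \<bar>x\<bar>)\<^sup>2 * exp (pi * \<bar>x\<bar> / 2) * (\<Sum>k\<le>n. (real k + 1) powr (1 / 2 - \<beta>) * (1 / (real (n - k) + 1)))
          \<le> K * (\<Sum>k\<le>n. (real k + 1) powr (- 2 * \<epsilon>) * (1 / (real (n - k) + 1)))"
          unfolding K_def[symmetric] using K \<epsilon> by (intro mult_left_mono sum_mono mult_right_mono powr_mono) auto
      qed auto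
      also have "\<dots> = K * (\<Sum>n<N. (\<Sum>k\<le>n. (real k + 1) powr (- 2 * \<epsilon>) * (1 / (real (n - k) + 1))) / (real n + 1))"
        by (simp add: sum_distrib_left)
      also have "\<dots> \<le> K * T" by (intro mult_left_mono T K)
      finally show ?thesis .
    qed
    have "(2 * \<beta> - 1) * (\<Sum>n<N. \<bar>poly (rainbow_poly \<beta> n) (- (x\<^sup>2))\<bar>) \<le> (\<bar>- (x\<^sup>2) - (1 / 2 - \<beta>)\<^sup>2\<bar> + 3 * (5 * \<beta>\<^sup>2 + \<beta>)) * (K * T)"
    proof (rule sum_abs_by_parts[OF \<beta> _ rainbow_poly_diff_shift[OF \<beta>'] S])
      fix n
      show "(real n + 1) * (real n + 2 * \<beta>) * poly (rainbow_poly \<beta> (Suc n)) (- (x\<^sup>2)) =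
        (real n + \<beta>) * (real n + 1 - \<beta>) * poly (rainbow_poly \<beta> n) (- (x\<^sup>2)) + (- (x\<^sup>2) - (1 / 2 - \<beta>)\<^sup>2) * rainbow_shift \<beta> x n"
        unfolding rainbow_shift_eq_sum[OF \<beta>'] by (rule rainbow_poly_first_order[OF \<beta>'])
    qed
    also have "\<dots> \<le> (M * (1 + \<bar>x\<bar>)\<^sup>2) * (K * (T + 1))"
    proof (intro mult_mono)
      have "\<bar>- (x\<^sup>2) - (1 / 2 - \<beta>)\<^sup>2\<bar> + 3 * (5 * \<beta>\<^sup>2 + \<beta>) = x\<^sup>2 + (M - 1)" by (simp add: M_def)
      also have "\<dots> \<le> M * x\<^sup>2 + M * 1"
        using M mult_right_mono[OF M, of "x\<^sup>2"] by simp
      also have "\<dots> = M * (1 + x\<^sup>2)" by (simp add: algebra_simps)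
      also have "\<dots> \<le> M * (1 + \<bar>x\<bar>)\<^sup>2"
        using M by (intro mult_left_mono) (auto simp: power2_eq_square algebra_simps)
      finally show "\<bar>- (x\<^sup>2) - (1 / 2 - \<beta>)\<^sup>2\<bar> + 3 * (5 * \<beta>\<^sup>2 + \<beta>) \<le> M * (1 + \<bar>x\<bar>)\<^sup>2" .
    qed (use K T0 M in auto)
    also have "\<dots> = (M * C * (T + 1)) * (1 + \<bar>x\<bar>) ^ 4 * exp (pi * \<bar>x\<bar> / 2)"
      by (simp add: K_def power4_eq_xxxx power2_eq_square mult_ac)
    finally show ?thesis using \<beta> by (simp add: field_simps)
  qed
  moreover have "M * C * (T + 1) / (2 * \<beta> - 1) > 0" using M C T0 \<beta> by simp
  ultimately show ?thesis by blast
qed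

section \<open>Growth of the arrays\<close>

text \<open>A remainder modulo the Newton polynomial is determined by its values at the nodes.
  Besides the weights of \<open>W\<close> the interpolation polynomials are returned, since the
  remainder has to be estimated on the imaginary axis as well.\<close>

lemma linear_functional_lagrange:
  assumes W: "linear_functional W" and inj: "inj_on t {..<m}"
  shows "\<exists>L \<omega>. \<forall>r. (r = 0 \<or> degree r < m) \<longrightarrow>
    r = (\<Sum>k<m. smult (poly r (t k)) (L k)) \<and> W r = (\<Sum>k<m. \<omega> k * poly r (t k))"
proof -
  define L where "L k = smult (1 / (\<Prod>i\<in>{..<m} - {k}. t k - t i)) (\<Prod>i\<in>{..<m} - {k}. [:- t i, 1:])" for k
  have L: "poly (L k) (t j) = (if j = k then 1 else 0)" if "k < m" "j < m" for k j
  proof (cases "j = k")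
    case True
    have "(\<Prod>i\<in>{..<m} - {k}. t k - t i) \<noteq> 0"
      using inj that by (auto simp: prod_zero_iff inj_on_def)
    thus ?thesis using True by (simp add: L_def poly_prod)
  next
    case False
    hence "(\<Prod>i\<in>{..<m} - {k}. t j - t i) = 0" using that by (auto simp: prod_zero_iff)
    thus ?thesis using False by (simp add: L_def poly_prod)
  qed
  have degL: "degree (L k) < m" if "k < m" for k
  proof -
    have "degree (\<Prod>i\<in>{..<m} - {k}. [:- t i, 1:]) \<le> (\<Sum>i\<in>{..<m} - {k}. degree [:- t i, 1:])"
      using degree_prod_sum_le[of "{..<m} - {k}" "\<lambda>i. [:- t i, 1:]"] by (simp add: comp_def)
    also have "\<dots> = m - 1" using that by simp
    finally show ?thesis using that unfolding L_def by (intro le_less_trans[OF degree_smult_le]) auto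
  qed
  have r: "r = (\<Sum>k<m. smult (poly r (t k)) (L k))" if "r = 0 \<or> degree r < m" for r
  proof (cases "m = 0")
    case True thus ?thesis using that by simp
  next
    case False
    have card: "card (t ` {..<m}) = m" using inj by (simp add: card_image)
    show ?thesis
    proof (rule poly_eqI_degree[of "t ` {..<m}"])
      fix x assume "x \<in> t ` {..<m}"
      then obtain j where j: "x = t j" "j < m" by auto
      have "poly (\<Sum>k<m. smult (poly r (t k)) (L k)) x = (\<Sum>k<m. if k = j then poly r (t k) else 0)"
        unfolding poly_sum by (intro sum.cong) (auto simp: L j)
      thus "poly r x = poly (\<Sum>k<m. smult (poly r (t k)) (L k)) x" using j by simp
    next
      show "degree r < card (t ` {..<m})" using that False by (auto simp: card)
      show "degree (\<Sum>k<m. smult (poly r (t k)) (L k)) < card (t ` {..<m})"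
        unfolding card using False degL
        by (intro degree_sum_less) (auto intro: le_less_trans[OF degree_smult_le])
    qed
  qed
  show ?thesis
  proof (intro exI[of _ L] exI[of _ "\<lambda>k. W (L k)"] allI impI conjI)
    fix r :: "real poly" assume *: "r = 0 \<or> degree r < m"
    show "r = (\<Sum>k<m. smult (poly r (t k)) (L k))" by (rule r[OF *])
    have "W r = W (\<Sum>k<m. smult (poly r (t k)) (L k))" using r[OF *] by simp
    thus "W r = (\<Sum>k<m. W (L k) * poly r (t k))"
      by (simp add: linear_functional_sum[OF W] linear_functionalD[OF W] mult.commute)
  qed
qed

lemma poly_newton: "poly (newton c m) \<zeta> = (\<Prod>i<m. (c + real i)\<^sup>2 - \<zeta>)"
  by (simp add: newton_def poly_prod)

text \<open>
  For \<open>c \<le> 0\<close> the functional is no longer the integral against the weight; dividing by the Newton polynomial of the first \<open>m\<close>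
  nodes, where \<open>c + m > 0\<close>, leaves point evaluations and an integral against a decaying weight.
\<close>

lemma wilson_representation:
  assumes b: "0 < b" and c: "c \<le> 0"
  defines "m \<equiv> nat (\<lfloor>- c\<rfloor> + 1)"
  obtains \<omega> \<nu> C q where "\<And>k. 0 \<le> \<omega> k" "\<And>x. 0 \<le> \<nu> x" "\<nu> \<in> borel_measurable borel"
    "\<And>x. \<nu> x \<le> C * (1 + \<bar>x\<bar>) ^ q * exp (- 2 * pi * \<bar>x\<bar>)"
    "\<And>u. \<bar>wilson b b c u\<bar> \<le> (\<Sum>k<m. \<omega> k * \<bar>poly u ((c + real k)\<^sup>2)\<bar>) + (\<integral>x. \<bar>poly u (- (x\<^sup>2))\<bar> * \<nu> x \<partial>lborel)"
proof -
  have m: "real m = of_int \<lfloor>- c\<rfloor> + 1" using c unfolding m_def by (subst of_nat_nat) auto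
  have cm: "0 < c + real m" unfolding m by linarith
  have m1: "m \<ge> 1" using c unfolding m_def by linarith
  have ck: "c + real k \<le> 0" if "k < m" for k
  proof -
    have "real k \<le> real m - 1" using that by linarith
    thus ?thesis unfolding m by linarith
  qed
  define N where "N = newton c m"
  define t where "t k = (c + real k)\<^sup>2" for k
  define W where "W = wilson b b c"
  define e where "e = wilson_moment b b c m"
  define I where "I = (\<integral>x. wilson_weight b (c + real m) x \<partial>lborel)"
  have W: "linear_functional W" by (simp add: W_def linear_wilson)
  have I: "I > 0" unfolding I_def by (rule integral_wilson_weight_pos[OF b cm])
  \<comment> \<open>The nodes are squares of c + k \<le> 0, so equal squares force equal k.\<close>
  have inj: "inj_on t {..<m}"
  proof (rule inj_onI)
    fix i j assume ij: "i \<in> {..<m}" "j \<in> {..<m}" "t i = t j"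
    hence "c + real i = c + real j \<or> c + real i = - (c + real j)" by (simp add: t_def power2_eq_iff)
    thus "i = j" using ck[of i] ck[of j] ij by auto
  qed
  obtain L \<omega> where L: "\<And>r. r = 0 \<or> degree r < m \<Longrightarrow> r = (\<Sum>k<m. smult (poly r (t k)) (L k))"
    and \<omega>: "\<And>r. r = 0 \<or> degree r < m \<Longrightarrow> W r = (\<Sum>k<m. \<omega> k * poly r (t k))"
    using linear_functional_lagrange[OF W inj] by blast
  define \<nu> where "\<nu> x = \<bar>e\<bar> / I * (wilson_weight b (c + real m) x / poly N (- (x\<^sup>2)))" for x
  \<comment> \<open>Every factor but the last is at least 1, since c + i \<le> -1 there. Only the
    last can vanish, at x = 0, and only to the order x^2 that the weight supplies.\<close>
  have Npos: "x\<^sup>2 \<le> poly N (- (x\<^sup>2))" for x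
  proof -
    define j where "j = m - 1"
    have mj: "m = Suc j" using m1 by (simp add: j_def)
    have "1 \<le> (\<Prod>i<j. (c + real i)\<^sup>2 + x\<^sup>2)"
    proof (rule prod_ge_1)
      fix i assume "i \<in> {..<j}"
      hence "c + real i \<le> - 1" using ck[of "Suc i"] by (auto simp: mj)
      hence "1 \<le> - (c + real i)" by simp
      hence "1\<^sup>2 \<le> (- (c + real i))\<^sup>2" by (intro power_mono) auto
      hence "1 \<le> (c + real i)\<^sup>2" by (simp only: power2_minus one_power2)
      thus "1 \<le> (c + real i)\<^sup>2 + x\<^sup>2" using zero_le_power2[of x] by linarith
    qed
    hence "1 * x\<^sup>2 \<le> (\<Prod>i<j. (c + real i)\<^sup>2 + x\<^sup>2) * ((c + real j)\<^sup>2 + x\<^sup>2)"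
      by (intro mult_mono) auto
    thus ?thesis by (simp add: N_def poly_newton mj)
  qed
  have N0: "0 \<le> poly N (- (x\<^sup>2))" for x using Npos[of x] zero_le_power2[of x] by linarith
  have \<nu>0: "0 \<le> \<nu> x" for x unfolding \<nu>_def using I N0 wilson_weight_nonneg by simp
  have \<nu>m: "\<nu> \<in> borel_measurable borel"
    unfolding \<nu>_def
    by (intro borel_measurable_times borel_measurable_divide borel_measurable_const borel_measurable_continuous_onI
        continuous_wilson_weight[OF b cm] continuous_intros)
  obtain C q where C: "C > 0" "\<And>x. wilson_weight b (c + real m) x \<le> x\<^sup>2 * (C * (1 + \<bar>x\<bar>) ^ q * exp (- 2 * pi * \<bar>x\<bar>))"
    using wilson_weight_le_square[OF b cm] by blast
  have \<nu>le: "\<nu> x \<le> (\<bar>e\<bar> / I * C) * (1 + \<bar>x\<bar>) ^ q * exp (- 2 * pi * \<bar>x\<bar>)" for x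
  proof -
    have "wilson_weight b (c + real m) x / poly N (- (x\<^sup>2)) \<le> C * (1 + \<bar>x\<bar>) ^ q * exp (- 2 * pi * \<bar>x\<bar>)"
    proof (cases "x = 0")
      case True thus ?thesis using C(1) by (simp add: wilson_weight_def)
    next
      case False
      hence "0 < poly N (- (x\<^sup>2))" using Npos[of x] by (smt (verit) zero_less_power2)
      moreover have "x\<^sup>2 * (C * (1 + \<bar>x\<bar>) ^ q * exp (- 2 * pi * \<bar>x\<bar>)) \<le> poly N (- (x\<^sup>2)) * (C * (1 + \<bar>x\<bar>) ^ q * exp (- 2 * pi * \<bar>x\<bar>))"
        using C(1) by (intro mult_right_mono Npos) auto
      ultimately show ?thesis using C(2)[of x] by (simp add: pos_divide_le_eq mult.commute)
    qed
    hence "\<bar>e\<bar> / I * (wilson_weight b (c + real m) x / poly N (- (x\<^sup>2))) \<le> \<bar>e\<bar> / I * (C * (1 + \<bar>x\<bar>) ^ q * exp (- 2 * pi * \<bar>x\<bar>))"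
      using I by (intro mult_left_mono) auto
    thus ?thesis by (simp add: \<nu>_def mult_ac)
  qed
  have int: "integrable lborel (\<lambda>x. \<bar>poly u (- (x\<^sup>2))\<bar> * \<nu> x)" for u
  proof -
    obtain D p where D: "\<And>x. \<bar>poly u (- (x\<^sup>2))\<bar> \<le> D * (1 + \<bar>x\<bar>) ^ p" using poly_minus_square_le by blast
    show ?thesis
    proof (rule integrable_poly_exp_bound)
      show "(\<lambda>x. \<bar>poly u (- (x\<^sup>2))\<bar> * \<nu> x) \<in> borel_measurable borel"
        by (intro borel_measurable_times \<nu>m borel_measurable_continuous_onI continuous_intros)
      show "\<bar>\<bar>poly u (- (x\<^sup>2))\<bar> * \<nu> x\<bar> \<le> (D * (\<bar>e\<bar> / I * C)) * (1 + \<bar>x\<bar>) ^ (p + q) * exp (- (2 * pi) * \<bar>x\<bar>)" for x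
      proof -
        have "\<bar>\<bar>poly u (- (x\<^sup>2))\<bar> * \<nu> x\<bar> \<le> (D * (1 + \<bar>x\<bar>) ^ p) * ((\<bar>e\<bar> / I * C) * (1 + \<bar>x\<bar>) ^ q * exp (- 2 * pi * \<bar>x\<bar>))"
          unfolding abs_mult abs_abs abs_of_nonneg[OF \<nu>0]
          by (intro mult_mono D \<nu>le \<nu>0 order.trans[OF abs_ge_zero D])
        thus ?thesis by (simp add: power_add mult_ac)
      qed
    qed simp
  qed
  \<comment> \<open>On the imaginary axis the quotient of u by \<open>N\<close> involves the
    remainder, whose size is at most the sum of |u| at the nodes times |L k|. The integrals of |L k|
    are therefore added to the point masses.\<close>
  define \<omega>' where "\<omega>' k = \<bar>\<omega> k\<bar> + (\<integral>x. \<bar>poly (L k) (- (x\<^sup>2))\<bar> * \<nu> x \<partial>lborel)" for k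
  have bound: "\<bar>W u\<bar> \<le> (\<Sum>k<m. \<omega>' k * \<bar>poly u (t k)\<bar>) + (\<integral>x. \<bar>poly u (- (x\<^sup>2))\<bar> * \<nu> x \<partial>lborel)" for u
  proof -
    define r where "r = u mod N"
    define h where "h = u div N"
    have u: "u = r + N * h" by (simp add: r_def h_def)
    have degN: "degree N = m" "N \<noteq> 0" by (simp_all add: N_def)
    have deg: "r = 0 \<or> degree r < m" using degree_mod_less[of N u] degN by (auto simp: r_def)
    have rt: "poly r (t k) = poly u (t k)" if "k < m" for k
    proof -
      have "poly N (t k) = 0" using that by (auto simp: N_def poly_newton t_def prod_zero_iff)
      thus ?thesis unfolding u by simp
    qed
    have "W u = W r + e * wilson b b (c + real m) h"
      unfolding u by (simp add: linear_functionalD[OF W]) (simp add: W_def N_def wilson_newton_mult e_def)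
    also have "wilson b b (c + real m) h = (\<integral>x. poly h (- (x\<^sup>2)) * wilson_weight b (c + real m) x \<partial>lborel) / I"
      unfolding I_def by (rule wilson_eq_integral[OF b cm])
    finally have "\<bar>W u\<bar> \<le> \<bar>W r\<bar> + \<bar>e\<bar> / I * \<bar>\<integral>x. poly h (- (x\<^sup>2)) * wilson_weight b (c + real m) x \<partial>lborel\<bar>"
      using I abs_triangle_ineq[of "W r" "e * ((\<integral>x. poly h (- (x\<^sup>2)) * wilson_weight b (c + real m) x \<partial>lborel) / I)"]
      by (simp add: abs_mult)
    also have "\<bar>W r\<bar> \<le> (\<Sum>k<m. \<bar>\<omega> k\<bar> * \<bar>poly u (t k)\<bar>)"
      unfolding \<omega>[OF deg] using rt by (intro sum_abs[THEN order.trans] sum_mono) (simp add: abs_mult)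
    also have "\<bar>e\<bar> / I * \<bar>\<integral>x. poly h (- (x\<^sup>2)) * wilson_weight b (c + real m) x \<partial>lborel\<bar> \<le>
        \<bar>e\<bar> / I * (\<integral>x. \<bar>poly h (- (x\<^sup>2)) * wilson_weight b (c + real m) x\<bar> \<partial>lborel)"
      using I by (intro mult_left_mono integral_abs_bound) auto
    also have "\<dots> = (\<integral>x. \<bar>e\<bar> / I * \<bar>poly h (- (x\<^sup>2)) * wilson_weight b (c + real m) x\<bar> \<partial>lborel)"
      by simp
    also have "\<dots> \<le> (\<integral>x. \<bar>poly u (- (x\<^sup>2))\<bar> * \<nu> x + (\<Sum>k<m. \<bar>poly u (t k)\<bar> * (\<bar>poly (L k) (- (x\<^sup>2))\<bar> * \<nu> x)) \<partial>lborel)"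
    proof (rule integral_mono)
      show "integrable lborel (\<lambda>x. \<bar>e\<bar> / I * \<bar>poly h (- (x\<^sup>2)) * wilson_weight b (c + real m) x\<bar>)"
        using integrable_poly_wilson_weight[OF b cm] by (intro integrable_mult_right integrable_abs)
      show "integrable lborel (\<lambda>x. \<bar>poly u (- (x\<^sup>2))\<bar> * \<nu> x + (\<Sum>k<m. \<bar>poly u (t k)\<bar> * (\<bar>poly (L k) (- (x\<^sup>2))\<bar> * \<nu> x)))"
        using int by (intro Bochner_Integration.integrable_add Bochner_Integration.integrable_sum integrable_mult_right)
      fix x
      show "\<bar>e\<bar> / I * \<bar>poly h (- (x\<^sup>2)) * wilson_weight b (c + real m) x\<bar> \<le>
        \<bar>poly u (- (x\<^sup>2))\<bar> * \<nu> x + (\<Sum>k<m. \<bar>poly u (t k)\<bar> * (\<bar>poly (L k) (- (x\<^sup>2))\<bar> * \<nu> x))"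
      proof (cases "x = 0")
        \<comment> \<open>At x = 0 the weight is zero, which settles the point where
          \<open>N\<close> may vanish.\<close>
        case True
        thus ?thesis using \<nu>0 by (auto simp: wilson_weight_def intro!: add_nonneg_nonneg sum_nonneg mult_nonneg_nonneg)
      next
        case False
        hence Np: "0 < poly N (- (x\<^sup>2))" using Npos[of x] by (smt (verit) zero_less_power2)
        have "poly N (- (x\<^sup>2)) * poly h (- (x\<^sup>2)) = poly u (- (x\<^sup>2)) - poly r (- (x\<^sup>2))"
          by (subst u) simp
        also have "poly r (- (x\<^sup>2)) = (\<Sum>k<m. poly u (t k) * poly (L k) (- (x\<^sup>2)))"
          by (subst L[OF deg]) (simp add: poly_sum rt)
        finally have "poly N (- (x\<^sup>2)) * \<bar>poly h (- (x\<^sup>2))\<bar> = \<bar>poly u (- (x\<^sup>2)) - (\<Sum>k<m. poly u (t k) * poly (L k) (- (x\<^sup>2)))\<bar>"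
          using Np by (metis abs_mult abs_of_pos)
        also have "\<dots> \<le> \<bar>poly u (- (x\<^sup>2))\<bar> + (\<Sum>k<m. \<bar>poly u (t k)\<bar> * \<bar>poly (L k) (- (x\<^sup>2))\<bar>)"
          using sum_abs[of "\<lambda>k. poly u (t k) * poly (L k) (- (x\<^sup>2))" "{..<m}"]
          by (intro order.trans[OF abs_triangle_ineq4] add_left_mono) (simp add: abs_mult)
        finally have "poly N (- (x\<^sup>2)) * \<bar>poly h (- (x\<^sup>2))\<bar> * \<nu> x \<le>
            (\<bar>poly u (- (x\<^sup>2))\<bar> + (\<Sum>k<m. \<bar>poly u (t k)\<bar> * \<bar>poly (L k) (- (x\<^sup>2))\<bar>)) * \<nu> x"
          by (rule mult_right_mono[OF _ \<nu>0])
        moreover have "poly N (- (x\<^sup>2)) * \<bar>poly h (- (x\<^sup>2))\<bar> * \<nu> x = \<bar>e\<bar> / I * \<bar>poly h (- (x\<^sup>2)) * wilson_weight b (c + real m) x\<bar>"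
          using Np by (simp add: \<nu>_def abs_mult wilson_weight_nonneg)
        ultimately show ?thesis by (simp add: distrib_right sum_distrib_right mult.assoc)
      qed
    qed
    also have "\<dots> = (\<integral>x. \<bar>poly u (- (x\<^sup>2))\<bar> * \<nu> x \<partial>lborel) + (\<Sum>k<m. \<bar>poly u (t k)\<bar> * (\<integral>x. \<bar>poly (L k) (- (x\<^sup>2))\<bar> * \<nu> x \<partial>lborel))"
      using int by (subst Bochner_Integration.integral_add) (auto simp: Bochner_Integration.integral_sum)
    finally show ?thesis
      unfolding \<omega>'_def distrib_right sum.distrib by (simp only: mult.commute[of "\<integral>x. _ x \<partial>lborel"] add_ac)
  qed
  show ?thesis
  proof (rule that)
    show "0 \<le> \<omega>' k" for k
      unfolding \<omega>'_def using \<nu>0 by (intro add_nonneg_nonneg Bochner_Integration.integral_nonneg mult_nonneg_nonneg) auto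
    show "\<nu> x \<le> (\<bar>e\<bar> / I * C) * (1 + \<bar>x\<bar>) ^ q * exp (- 2 * pi * \<bar>x\<bar>)" for x by (rule \<nu>le)
    show "\<bar>wilson b b c u\<bar> \<le> (\<Sum>k<m. \<omega>' k * \<bar>poly u ((c + real k)\<^sup>2)\<bar>) + (\<integral>x. \<bar>poly u (- (x\<^sup>2))\<bar> * \<nu> x \<partial>lborel)" for u
      using bound[of u] by (simp add: W_def t_def)
  qed (use \<nu>0 \<nu>m in auto)
qed

text \<open>With z = 1/2 - \<beta> + k the generating function at z^2 is a hypergeometric series
  with coefficients of order n^(2 z - 1), times the polynomial (1 - t)^k. Negative z gives
  summability; z = 0 is the point x = 0 of the imaginary axis, where it is known.\<close>

lemma summable_at_node:
  assumes \<beta>: "1 / 2 < \<beta>" and k: "1 / 2 - \<beta> + real k \<le> 0"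
  shows "summable (\<lambda>n. \<bar>poly (rainbow_poly \<beta> n) ((1 / 2 - \<beta> + real k)\<^sup>2)\<bar>)"
proof (cases "1 / 2 - \<beta> + real k = 0")
  case True
  obtain C where C: "\<And>x N. (\<Sum>n<N. \<bar>poly (rainbow_poly \<beta> n) (- (x\<^sup>2))\<bar>) \<le> C * (1 + \<bar>x\<bar>) ^ 4 * exp (pi * \<bar>x\<bar> / 2)"
    using rainbow_poly_summable[OF \<beta>] by blast
  show ?thesis unfolding True
    by (rule bounded_imp_summable[where B = C]) (use C[where x = 0] in \<open>simp_all flip: lessThan_Suc_atMost del: sum.lessThan_Suc\<close>)
next
  case False
  define z where "z = 1 / 2 - \<beta> + real k"
  have z: "z < 0" using False k by (simp add: z_def)
  define b where "b = 2 * \<beta> - 1 / 2"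
  have ab: "0 < 1 / 2 + b" using \<beta> by (simp add: b_def)
  define q where "q n = pochhammer (1 / 2 + z) n * pochhammer (b + z) n / (pochhammer (1 / 2 + b) n * fact n)" for n
  have q: "cdh_rec (1 / 2) b z (z\<^sup>2) q" unfolding q_def[abs_def] by (rule cdh_rec_terminating[OF ab])
  have P: "poly (rainbow_poly \<beta> n) (z\<^sup>2) = (\<Sum>j\<le>n. pochhammer (- real k) j / fact j * q (n - j))" for n
    using cdh_shift[OF q ab, of "real k" n] by (simp add: rainbow_poly_def b_def z_def)
  obtain C where C: "C > 0" "\<And>n. \<bar>pochhammer (1 / 2 + z) n\<bar> / pochhammer (1 / 2 + b) n \<le> C * (real n + 1) powr (1 / 2 + z - (1 / 2 + b))"
    using pochhammer_ratio_le[OF ab] by blast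
  obtain D where D: "D > 0" "\<And>n. \<bar>pochhammer (b + z) n\<bar> / pochhammer 1 n \<le> D * (real n + 1) powr (b + z - 1)"
    using pochhammer_ratio_le[of 1 "b + z"] by auto
  have qle: "norm (q n) \<le> C * D * (real n + 1) powr (2 * z - 1)" for n
  proof -
    have "norm (q n) = (\<bar>pochhammer (1 / 2 + z) n\<bar> / pochhammer (1 / 2 + b) n) * (\<bar>pochhammer (b + z) n\<bar> / pochhammer 1 n)"
      using pochhammer_pos[OF ab, of n] by (simp add: q_def abs_mult pochhammer_fact[symmetric])
    also have "\<dots> \<le> (C * (real n + 1) powr (1 / 2 + z - (1 / 2 + b))) * (D * (real n + 1) powr (b + z - 1))"
      using pochhammer_pos[OF ab, of n] pochhammer_pos[of "1::real" n] C D
      by (intro mult_mono) (auto intro!: divide_nonneg_pos)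
    also have "\<dots> = C * D * ((real n + 1) powr (1 / 2 + z - (1 / 2 + b)) * (real n + 1) powr (b + z - 1))" by simp
    also have "(real n + 1) powr (1 / 2 + z - (1 / 2 + b)) * (real n + 1) powr (b + z - 1) = (real n + 1) powr (2 * z - 1)"
      unfolding powr_add[symmetric] by (rule arg_cong[where f = "\<lambda>t. (real n + 1) powr t"]) simp
    finally show ?thesis .
  qed
  have "summable (\<lambda>n. real n powr (2 * z - 1))" using z by (subst summable_real_powr_iff) auto
  hence "summable (\<lambda>n. real (Suc n) powr (2 * z - 1))" by (subst summable_Suc_iff)
  hence "summable (\<lambda>n. C * D * (real n + 1) powr (2 * z - 1))" by (intro summable_mult) (simp add: add.commute)
  hence "summable (\<lambda>n. norm (q n))"
    by (rule summable_comparison_test'[where N = 0]) (use qle in simp)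
  moreover have "summable (\<lambda>j. norm (pochhammer (- real k) j / fact j))"
    by (rule summable_finite[of "{..k}"]) (auto simp: pochhammer_of_nat_eq_0_lemma)
  ultimately have "summable (\<lambda>n. \<Sum>j\<le>n. norm (pochhammer (- real k) j / fact j) * norm (q (n - j)))"
    by (intro summable_Cauchy_product) auto
  thus ?thesis unfolding z_def[symmetric] P
    by (rule summable_comparison_test'[of _ 0]) (auto intro!: sum_abs[THEN order.trans] simp: abs_mult)
qed

theorem rainbow_A_summable:
  assumes A: "rainbow_arrays \<beta> A B" and \<beta>: "1 / 2 < \<beta>"
  shows "\<exists>T. \<forall>N. (\<Sum>i<N. \<Sum>j<N. \<Sum>k<N. \<bar>A (vector [i, j, k])\<bar>) \<le> T"
proof -
  let ?P = "rainbow_poly \<beta>"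
  define b c where "b = 2 * \<beta> - 1 / 2" and "c = 1 / 2 - \<beta>"
  define m where "m = nat (\<lfloor>- c\<rfloor> + 1)"
  have b: "0 < b" and c: "c \<le> 0" using \<beta> by (auto simp: b_def c_def)
  obtain \<omega> \<nu> C q where \<omega>: "\<And>k. 0 \<le> \<omega> k" and \<nu>: "\<And>x. 0 \<le> \<nu> x" "\<nu> \<in> borel_measurable borel"
    "\<And>x. \<nu> x \<le> C * (1 + \<bar>x\<bar>) ^ q * exp (- 2 * pi * \<bar>x\<bar>)"
    and rep: "\<And>u. \<bar>wilson b b c u\<bar> \<le> (\<Sum>k<m. \<omega> k * \<bar>poly u ((c + real k)\<^sup>2)\<bar>) + (\<integral>x. \<bar>poly u (- (x\<^sup>2))\<bar> * \<nu> x \<partial>lborel)"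
    by (rule wilson_representation[OF b c, folded m_def], rule that)
  have ck: "c + real k \<le> 0" if "k < m" for k
  proof -
    have "real m = of_int \<lfloor>- c\<rfloor> + 1" using c unfolding m_def by (subst of_nat_nat) auto
    moreover have "real k \<le> real m - 1" using that by linarith
    ultimately show ?thesis by linarith
  qed
  obtain D where D: "D > 0" "\<And>x N. (\<Sum>n<N. \<bar>poly (?P n) (- (x\<^sup>2))\<bar>) \<le> D * (1 + \<bar>x\<bar>) ^ 4 * exp (pi * \<bar>x\<bar> / 2)"
    using rainbow_poly_summable[OF \<beta>] by blast
  define s where "s k = (\<Sum>n. \<bar>poly (?P n) ((c + real k)\<^sup>2)\<bar>)" for k
  have s: "(\<Sum>n<N. \<bar>poly (?P n) ((c + real k)\<^sup>2)\<bar>) \<le> s k" if "k < m" for k N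
    unfolding s_def using summable_at_node[OF \<beta>, of k] ck[OF that]
    by (intro sum_le_suminf) (auto simp: c_def)
  define Q where "Q x = (D * (1 + \<bar>x\<bar>) ^ 4 * exp (pi * \<bar>x\<bar> / 2)) ^ 3 * \<nu> x" for x
  have intQ: "integrable lborel Q"
  proof (rule integrable_poly_exp_bound)
    show "Q \<in> borel_measurable borel"
      unfolding Q_def[abs_def] by (intro borel_measurable_times \<nu> borel_measurable_continuous_onI continuous_intros) auto
    show "\<bar>Q x\<bar> \<le> (D ^ 3 * C) * (1 + \<bar>x\<bar>) ^ (12 + q) * exp (- (pi / 2) * \<bar>x\<bar>)" for x
    proof -
      have "\<bar>Q x\<bar> = (D * (1 + \<bar>x\<bar>) ^ 4 * exp (pi * \<bar>x\<bar> / 2)) ^ 3 * \<nu> x"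
        unfolding Q_def using D(1) \<nu>(1) by (intro abs_of_nonneg mult_nonneg_nonneg) auto
      also have "\<dots> \<le> (D * (1 + \<bar>x\<bar>) ^ 4 * exp (pi * \<bar>x\<bar> / 2)) ^ 3 * (C * (1 + \<bar>x\<bar>) ^ q * exp (- 2 * pi * \<bar>x\<bar>))"
        using D(1) by (intro mult_left_mono \<nu>) auto
      also have "\<dots> = (D ^ 3 * C) * (1 + \<bar>x\<bar>) ^ (12 + q) * (exp (pi * \<bar>x\<bar> / 2) ^ 3 * exp (- 2 * pi * \<bar>x\<bar>))"
        by (simp add: power_mult_distrib power_mult[symmetric] power_add mult_ac)
      also have "exp (pi * \<bar>x\<bar> / 2) ^ 3 * exp (- 2 * pi * \<bar>x\<bar>) = exp (- (pi / 2) * \<bar>x\<bar>)"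
        by (simp add: exp_of_nat_mult[symmetric] exp_add[symmetric])
      finally show ?thesis .
    qed
  qed simp
  define T where "T = (\<Sum>k<m. \<omega> k * s k ^ 3) + (\<integral>x. Q x \<partial>lborel)"
  have "(\<Sum>i<N. \<Sum>j<N. \<Sum>k<N. \<bar>A (vector [i, j, k])\<bar>) \<le> T" for N
  proof -
    define p where "p n \<zeta> = \<bar>poly (?P n) \<zeta>\<bar>" for n \<zeta>
    \<comment> \<open>Since the three indices separate, the sum over a cube of indices is a third
      power, and the bounds on the single sums are independent of N.\<close>
    have cube: "(\<Sum>i<N. \<Sum>j<N. \<Sum>k<N. p i \<zeta> * p j \<zeta> * p k \<zeta>) = (\<Sum>n<N. p n \<zeta>) ^ 3" for \<zeta>
    proof -
      have "(\<Sum>i<N. \<Sum>j<N. \<Sum>k<N. p i \<zeta> * p j \<zeta> * p k \<zeta>) = (\<Sum>i<N. \<Sum>j<N. p i \<zeta> * p j \<zeta>) * (\<Sum>k<N. p k \<zeta>)"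
        by (simp only: sum_distrib_right) (simp only: sum_distrib_left)
      also have "(\<Sum>i<N. \<Sum>j<N. p i \<zeta> * p j \<zeta>) = (\<Sum>i<N. p i \<zeta>) * (\<Sum>j<N. p j \<zeta>)"
        by (simp add: sum_product)
      finally show ?thesis by (simp add: power3_eq_cube)
    qed
    have meas: "(\<lambda>x. p n (- (x\<^sup>2))) \<in> borel_measurable borel" for n
      unfolding p_def by (intro borel_measurable_continuous_onI continuous_intros)
    have p1: "p n (- (x\<^sup>2)) \<le> D * (1 + \<bar>x\<bar>) ^ 4 * exp (pi * \<bar>x\<bar> / 2)" for n x
    proof -
      have "p n (- (x\<^sup>2)) \<le> (\<Sum>i<Suc n. p i (- (x\<^sup>2)))"
        by (rule member_le_sum) (auto simp: p_def)
      also have "\<dots> \<le> D * (1 + \<bar>x\<bar>) ^ 4 * exp (pi * \<bar>x\<bar> / 2)" unfolding p_def by (rule D(2))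
      finally show ?thesis .
    qed
    have intp: "integrable lborel (\<lambda>x. p i (- (x\<^sup>2)) * p j (- (x\<^sup>2)) * p k (- (x\<^sup>2)) * \<nu> x)" for i j k
    proof (rule Bochner_Integration.integrable_bound[OF intQ])
      show "(\<lambda>x. p i (- (x\<^sup>2)) * p j (- (x\<^sup>2)) * p k (- (x\<^sup>2)) * \<nu> x) \<in> borel_measurable lborel"
        using meas \<nu>(2) by (intro borel_measurable_times) (simp_all only: measurable_lborel2)
      have "norm (p i (- (x\<^sup>2)) * p j (- (x\<^sup>2)) * p k (- (x\<^sup>2)) * \<nu> x) \<le> norm (Q x)" for x
      proof -
        define E where "E = D * (1 + \<bar>x\<bar>) ^ 4 * exp (pi * \<bar>x\<bar> / 2)"
        have E: "E \<ge> 0" using D(1) by (simp add: E_def)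
        have "p i (- (x\<^sup>2)) * p j (- (x\<^sup>2)) * p k (- (x\<^sup>2)) * \<nu> x \<le> E * E * E * \<nu> x"
          using p1[of _ x] E \<nu>(1) unfolding E_def[symmetric] by (intro mult_mono mult_nonneg_nonneg) (auto simp: p_def)
        also have "\<dots> = Q x" by (simp add: Q_def E_def power3_eq_cube)
        finally show ?thesis using \<nu>(1)[of x] by (simp add: p_def abs_mult)
      qed
      thus "AE x in lborel. norm (p i (- (x\<^sup>2)) * p j (- (x\<^sup>2)) * p k (- (x\<^sup>2)) * \<nu> x) \<le> norm (Q x)" by simp
    qed
    have "\<bar>A (vector [i, j, k])\<bar> \<le> (\<Sum>l<m. \<omega> l * (p i ((c + real l)\<^sup>2) * p j ((c + real l)\<^sup>2) * p k ((c + real l)\<^sup>2)))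
        + (\<integral>x. p i (- (x\<^sup>2)) * p j (- (x\<^sup>2)) * p k (- (x\<^sup>2)) * \<nu> x \<partial>lborel)" for i j k
      using rep[of "?P i * ?P j * ?P k"] \<beta> unfolding b_def c_def
      by (subst rainbow_eq_wilson[OF A]) (simp_all add: p_def abs_mult)
    hence "(\<Sum>i<N. \<Sum>j<N. \<Sum>k<N. \<bar>A (vector [i, j, k])\<bar>) \<le> (\<Sum>i<N. \<Sum>j<N. \<Sum>k<N.
        (\<Sum>l<m. \<omega> l * (p i ((c + real l)\<^sup>2) * p j ((c + real l)\<^sup>2) * p k ((c + real l)\<^sup>2)))
        + (\<integral>x. p i (- (x\<^sup>2)) * p j (- (x\<^sup>2)) * p k (- (x\<^sup>2)) * \<nu> x \<partial>lborel))"
      by (intro sum_mono)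
    also have "\<dots> = (\<Sum>i<N. \<Sum>j<N. \<Sum>k<N. \<Sum>l<m. \<omega> l * (p i ((c + real l)\<^sup>2) * p j ((c + real l)\<^sup>2) * p k ((c + real l)\<^sup>2)))
        + (\<integral>x. (\<Sum>i<N. \<Sum>j<N. \<Sum>k<N. p i (- (x\<^sup>2)) * p j (- (x\<^sup>2)) * p k (- (x\<^sup>2)) * \<nu> x) \<partial>lborel)"
      using intp by (simp add: sum.distrib Bochner_Integration.integral_sum Bochner_Integration.integrable_sum)
    also have "(\<Sum>i<N. \<Sum>j<N. \<Sum>k<N. \<Sum>l<m. \<omega> l * (p i ((c + real l)\<^sup>2) * p j ((c + real l)\<^sup>2) * p k ((c + real l)\<^sup>2)))
        = (\<Sum>l<m. \<omega> l * (\<Sum>i<N. \<Sum>j<N. \<Sum>k<N. p i ((c + real l)\<^sup>2) * p j ((c + real l)\<^sup>2) * p k ((c + real l)\<^sup>2)))"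
      unfolding sum.swap[of _ "{..<m}"] sum_distrib_left ..
    also have "\<dots> \<le> (\<Sum>l<m. \<omega> l * s l ^ 3)"
      unfolding cube using s by (intro sum_mono mult_left_mono power_mono \<omega> sum_nonneg) (auto simp: p_def)
    also have "(\<integral>x. (\<Sum>i<N. \<Sum>j<N. \<Sum>k<N. p i (- (x\<^sup>2)) * p j (- (x\<^sup>2)) * p k (- (x\<^sup>2)) * \<nu> x) \<partial>lborel) \<le> (\<integral>x. Q x \<partial>lborel)"
    proof (rule integral_mono[OF _ intQ])
      show "integrable lborel (\<lambda>x. \<Sum>i<N. \<Sum>j<N. \<Sum>k<N. p i (- (x\<^sup>2)) * p j (- (x\<^sup>2)) * p k (- (x\<^sup>2)) * \<nu> x)"
        by (intro Bochner_Integration.integrable_sum intp)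
      fix x
      have "(\<Sum>i<N. \<Sum>j<N. \<Sum>k<N. p i (- (x\<^sup>2)) * p j (- (x\<^sup>2)) * p k (- (x\<^sup>2)) * \<nu> x) = (\<Sum>n<N. p n (- (x\<^sup>2))) ^ 3 * \<nu> x"
        unfolding cube[symmetric] sum_distrib_right ..
      also have "\<dots> \<le> Q x"
        unfolding Q_def using D(2) by (intro mult_right_mono power_mono \<nu> sum_nonneg) (auto simp: p_def)
      finally show "(\<Sum>i<N. \<Sum>j<N. \<Sum>k<N. p i (- (x\<^sup>2)) * p j (- (x\<^sup>2)) * p k (- (x\<^sup>2)) * \<nu> x) \<le> Q x" .
    qed
    finally show ?thesis by (simp add: T_def)
  qed
  thus ?thesis by blast
qed

section \<open>Growth for \<beta> < 1/2 through the polynomials with c = -b\<close>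

lemma cdh_poly_shift:
  assumes "0 < a + b"
  shows "cdh a b (c - g) n = (\<Sum>k\<le>n. smult (pochhammer (- g) k / fact k) (cdh a b c (n - k)))"
  by (intro poly_eq_poly_eq_iff[THEN iffD1] ext)
    (simp add: poly_sum cdh_shift[OF cdh_rec_cdh[OF assms] assms])

text \<open>For c = -b the factor (b + c)_n removes the term k = 0 of the Newton expansion, and all
  others contain b^2 - X. The cofactor belongs to the same family, with b + 1 and c + 1 = 1 -
  b.\<close>

lemma cdh_minus_Suc:
  assumes "0 < 1 / 2 + b"
  shows "cdh (1 / 2) b (- b) (Suc n) =
    [:b\<^sup>2, - 1:] * smult (- 1 / ((1 / 2 + b) * (real n + 1))) (cdh (1 / 2) (b + 1) (1 - b) n)"
proof (intro poly_eq_poly_eq_iff[THEN iffD1] ext)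
  fix \<zeta>
  define h where "h n = poly (cdh (1 / 2) (b + 1) (1 - b) n) \<zeta>" for n
  define p where "p n = (if n = 0 then 1 else (\<zeta> - b\<^sup>2) / ((1 / 2 + b) * real n) * h (n - 1))" for n
  have "0 < 1 / 2 + (b + 1)" using assms by simp
  from cdh_rec_cdh[OF this, of "1 - b" \<zeta>] have h: "cdh_rec (1 / 2) (b + 1) (1 - b) \<zeta> h"
    by (simp add: h_def[abs_def])
  have "cdh_rec (1 / 2) b (- b) \<zeta> p"
    unfolding cdh_rec_def
  proof (intro conjI allI)
    show "p 0 = 1" by (simp add: p_def)
    fix n
    show "(real n + 1) * (real n + 1 / 2 + b) * p (Suc n) =
       (\<zeta> - (- b)\<^sup>2 + (real n + 1 / 2 + - b) * (real n + b + - b) + real n * (real n - 1 + 1 / 2 + b)) * p n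
         - (if n = 0 then 0 else (real n - 1 + 1 / 2 + - b) * (real n - 1 + b + - b) * p (n - 1))"
    proof (cases n)
      case 0
      have "1 + b * 2 \<noteq> 0" using assms by auto
      thus ?thesis using h 0 assms by (simp add: p_def cdh_rec_def field_simps)
    next
      case (Suc m)
      define K where "K = (\<zeta> - b\<^sup>2) / (1 / 2 + b)"
      have p: "p (Suc (Suc m)) * (real m + 2) = K * h (Suc m)" "p (Suc m) * (real m + 1) = K * h m"
        "m \<noteq> 0 \<Longrightarrow> p m * real m = K * h (m - 1)"
        using assms by (simp_all add: p_def K_def divide_simps)
      have "(real m + 1) * (real m + 1 / 2 + (b + 1)) * h (Suc m) =
        (\<zeta> - (1 - b)\<^sup>2 + (real m + 1 / 2 + (1 - b)) * (real m + (b + 1) + (1 - b)) + real m * (real m - 1 + 1 / 2 + (b + 1))) * h m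
       - (if m = 0 then 0 else (real m - 1 + 1 / 2 + (1 - b)) * (real m - 1 + (b + 1) + (1 - b)) * h (m - 1))"
        using h unfolding cdh_rec_def by blast
      also have "\<zeta> - (1 - b)\<^sup>2 + (real m + 1 / 2 + (1 - b)) * (real m + (b + 1) + (1 - b)) + real m * (real m - 1 + 1 / 2 + (b + 1))
        = \<zeta> - b\<^sup>2 + 2 * (real m + 1)\<^sup>2"
        by (simp add: power2_eq_square field_simps)
      finally have r: "(real m + 1) * (real m + 3 / 2 + b) * h (Suc m) = (\<zeta> - b\<^sup>2 + 2 * (real m + 1)\<^sup>2) * h m
        - (if m = 0 then 0 else (real m + 1 / 2 - b) * (real m + 1) * h (m - 1))"
        by (simp add: add_ac diff_add_eq)
      have "(real m + 1) * ((real m + 3 / 2 + b) * (p (Suc (Suc m)) * (real m + 2))) = K * ((real m + 1) * (real m + 3 / 2 + b) * h (Suc m))"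
        unfolding p by simp
      also have "\<dots> = (\<zeta> - b\<^sup>2 + 2 * (real m + 1)\<^sup>2) * (K * h m) - (if m = 0 then 0 else (real m + 1 / 2 - b) * (real m + 1) * (K * h (m - 1)))"
        unfolding r by (simp add: right_diff_distrib)
      also have "\<dots> = (real m + 1) * ((\<zeta> - b\<^sup>2 + 2 * (real m + 1)\<^sup>2) * p (Suc m) - (real m + 1 / 2 - b) * real m * p m)"
        unfolding p(2)[symmetric] using p(3) by (cases "m = 0") (simp_all add: algebra_simps)
      finally have "(real m + 3 / 2 + b) * (p (Suc (Suc m)) * (real m + 2)) = (\<zeta> - b\<^sup>2 + 2 * (real m + 1)\<^sup>2) * p (Suc m) - (real m + 1 / 2 - b) * real m * p m"
        by (subst (asm) mult_left_cancel) auto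
      thus ?thesis by (simp add: Suc power2_eq_square field_simps)
    qed
  qed
  from cdh_rec_unique[OF cdh_rec_cdh[OF assms] this assms, of "Suc n"]
  show "poly (cdh (1 / 2) b (- b) (Suc n)) \<zeta> =
    poly ([:b\<^sup>2, - 1:] * smult (- 1 / ((1 / 2 + b) * (real n + 1))) (cdh (1 / 2) (b + 1) (1 - b) n)) \<zeta>"
    unfolding p_def h_def poly_mult poly_smult
    by (simp add: diff_divide_distrib left_diff_distrib right_diff_distrib mult.commute add.commute)
qed

lemma convolution_le:
  fixes f g :: "nat \<Rightarrow> real"
  assumes "\<And>k. \<bar>f k\<bar> \<le> C * (real k + 1) ^ p" "\<And>k. \<bar>g k\<bar> \<le> D * (real k + 1) ^ q"
  shows "\<bar>\<Sum>k\<le>n. f k * g (n - k)\<bar> \<le> C * D * (real n + 1) ^ (p + q + 1)"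
proof -
  have C: "0 \<le> C" using assms(1)[of 0] abs_ge_zero[of "f 0"] by simp
  have D: "0 \<le> D" using assms(2)[of 0] abs_ge_zero[of "g 0"] by simp
  have "\<bar>f k * g (n - k)\<bar> \<le> (C * (real n + 1) ^ p) * (D * (real n + 1) ^ q)" if "k \<le> n" for k
    unfolding abs_mult using that C D
    by (intro mult_mono order.trans[OF assms(1)] order.trans[OF assms(2)] mult_left_mono power_mono) auto
  hence "(\<Sum>k\<le>n. \<bar>f k * g (n - k)\<bar>) \<le> (\<Sum>k\<le>n. (C * (real n + 1) ^ p) * (D * (real n + 1) ^ q))"
    by (intro sum_mono) auto
  also have "\<dots> = C * D * (real n + 1) ^ (p + q + 1)" by (simp add: power_add algebra_simps)
  finally show ?thesis by (rule order.trans[OF sum_abs])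
qed

lemma pochhammer_ratio_le_power:
  assumes "p - q \<le> real m" "0 < q"
  obtains C where "C > 0" "\<And>k. \<bar>pochhammer p k / pochhammer q k\<bar> \<le> C * (real k + 1) ^ m"
proof -
  obtain C where C: "C > 0" "\<And>k. \<bar>pochhammer p k\<bar> / pochhammer q k \<le> C * (real k + 1) powr (p - q)"
    using pochhammer_ratio_le[OF assms(2)] by blast
  have "\<bar>pochhammer p k / pochhammer q k\<bar> \<le> C * (real k + 1) ^ m" for k
  proof -
    have "(real k + 1) powr (p - q) \<le> (real k + 1) powr (real m)" using assms by (intro powr_mono) auto
    also have "\<dots> = (real k + 1) ^ m" by (simp add: powr_realpow)
    finally have "C * (real k + 1) powr (p - q) \<le> C * (real k + 1) ^ m" using C(1) by simp
    moreover have "\<bar>pochhammer p k / pochhammer q k\<bar> = \<bar>pochhammer p k\<bar> / pochhammer q k"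
      using pochhammer_pos[OF assms(2), of k] by simp
    ultimately show ?thesis using C(2)[of k] by linarith
  qed
  with C(1) show ?thesis by (rule that)
qed

lemma wilson_le:
  assumes b: "0 < b" and c: "0 < c" and \<kappa>: "\<kappa> < 2 * pi"
  obtains M where "\<And>u E. (\<And>x. \<bar>poly u (- (x\<^sup>2))\<bar> \<le> E * ((1 + \<bar>x\<bar>) ^ p * exp (\<kappa> * \<bar>x\<bar>))) \<Longrightarrow> \<bar>wilson b b c u\<bar> \<le> M * E"
proof -
  define I where "I = (\<integral>x. wilson_weight b c x \<partial>lborel)"
  define g where "g x = (1 + \<bar>x\<bar>) ^ p * exp (\<kappa> * \<bar>x\<bar>)" for x
  have I: "I > 0" unfolding I_def by (rule integral_wilson_weight_pos[OF b c])
  have int: "integrable lborel (\<lambda>x. g x * wilson_weight b c x)"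
    by (rule integrable_wilson_weight_mult[OF b c _ \<kappa>, of _ 1 p])
      (auto simp: g_def[abs_def] intro!: borel_measurable_continuous_onI continuous_intros)
  have *: "\<bar>wilson b b c u\<bar> \<le> ((\<integral>x. g x * wilson_weight b c x \<partial>lborel) / I) * E"
    if u: "\<And>x. \<bar>poly u (- (x\<^sup>2))\<bar> \<le> E * g x" for u E
  proof -
    have "\<bar>\<integral>x. poly u (- (x\<^sup>2)) * wilson_weight b c x \<partial>lborel\<bar> \<le> (\<integral>x. \<bar>poly u (- (x\<^sup>2)) * wilson_weight b c x\<bar> \<partial>lborel)"
      by (rule integral_abs_bound)
    also have "\<dots> \<le> (\<integral>x. E * (g x * wilson_weight b c x) \<partial>lborel)"
    proof (rule integral_mono)
      fix x
      have "\<bar>poly u (- (x\<^sup>2))\<bar> * wilson_weight b c x \<le> (E * g x) * wilson_weight b c x"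
        by (rule mult_right_mono[OF u wilson_weight_nonneg])
      thus "\<bar>poly u (- (x\<^sup>2)) * wilson_weight b c x\<bar> \<le> E * (g x * wilson_weight b c x)"
        unfolding abs_mult abs_of_nonneg[OF wilson_weight_nonneg] by (simp only: mult.assoc)
    qed (use int integrable_poly_wilson_weight[OF b c] in \<open>auto intro!: integrable_abs\<close>)
    finally have "\<bar>\<integral>x. poly u (- (x\<^sup>2)) * wilson_weight b c x \<partial>lborel\<bar> \<le> (\<integral>x. g x * wilson_weight b c x \<partial>lborel) * E"
      by (simp add: mult.commute)
    thus ?thesis using I unfolding wilson_eq_integral[OF b c] I_def[symmetric]
      by (simp add: abs_of_pos divide_right_mono)
  qed
  show ?thesis by (rule that[OF *]) (simp add: g_def)
qed

text \<open>As b may be negative, the estimate starts from the cofactor, whose parameter b + 1 is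
  positive and admits the bound on \<open>mp_even\<close>. The factor b^2 + x^2 then costs two more
  powers of 1 + |x|.\<close>

lemma cdh_minus_le:
  assumes b: "- (1 / 2) < b"
  obtains C where "C > 0"
    "\<And>x n. \<bar>poly (cdh (1 / 2) (b + 1) (1 - b) n) (- (x\<^sup>2))\<bar> \<le> C * (real n + 1)\<^sup>2 * ((1 + \<bar>x\<bar>)\<^sup>2 * exp (pi * \<bar>x\<bar> / 2))"
    "\<And>x n. \<bar>poly (cdh (1 / 2) b (- b) n) (- (x\<^sup>2))\<bar> \<le> C * (real n + 1)\<^sup>2 * ((1 + \<bar>x\<bar>) ^ 4 * exp (pi * \<bar>x\<bar> / 2))"
proof -
  define K where "K x = (1 + \<bar>x\<bar>)\<^sup>2 * exp (pi * \<bar>x\<bar> / 2)" for x :: real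
  have K1: "1 \<le> K x" for x
    unfolding K_def using mult_mono[of 1 "(1 + \<bar>x\<bar>)\<^sup>2" 1 "exp (pi * \<bar>x\<bar> / 2)"] by (simp add: one_le_power)
  have b1: "0 < b + 1" and ab: "0 < 1 / 2 + (b + 1)" and ab': "0 < 1 / 2 + b" using b by auto
  obtain C where C: "C > 0" "\<And>x k. \<bar>mp_even (b + 1) x k\<bar> \<le> C * (1 + \<bar>x\<bar>)\<^sup>2 * exp (pi * \<bar>x\<bar> / 2) / (real k + 1)"
    using mp_even_le[OF b1] by blast
  obtain D where D: "D > 0" "\<And>k. \<bar>pochhammer (1 - b) k / pochhammer 1 k\<bar> \<le> D * (real k + 1) ^ 1"
    using pochhammer_ratio_le_power[of "1 - b" 1 1] b by auto
  have h: "\<bar>poly (cdh (1 / 2) (b + 1) (1 - b) n) (- (x\<^sup>2))\<bar> \<le> D * C * (real n + 1)\<^sup>2 * K x" for x n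
  proof -
    have "\<bar>mp_even (b + 1) x k\<bar> \<le> C * K x * (real k + 1) ^ 0" for k
    proof -
      have "C * K x / (real k + 1) \<le> C * K x / 1" using C(1) K1[of x] by (intro divide_left_mono) auto
      thus ?thesis using C(2)[of x k] unfolding K_def by simp
    qed
    from convolution_le[OF D(2) this, of n] show ?thesis
      using cdh_shift[OF cdh_rec_mp_even[OF b1, of x] ab, of "b - 1" n]
      by (simp add: pochhammer_fact power2_eq_square mult_ac)
  qed
  define E where "E = 1 + (b\<^sup>2 + 1) / (1 / 2 + b) * (D * C)"
  have \<Phi>: "\<bar>poly (cdh (1 / 2) b (- b) n) (- (x\<^sup>2))\<bar> \<le> E * (real n + 1)\<^sup>2 * ((1 + \<bar>x\<bar>)\<^sup>2 * K x)" for x n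
  proof -
    have X: "1 \<le> (1 + \<bar>x\<bar>)\<^sup>2" by (simp add: one_le_power)
    have E1: "1 \<le> E" using D(1) C(1) ab' by (simp add: E_def)
    show ?thesis
    proof (cases n)
      case 0
      have "1 * 1 \<le> E * ((1 + \<bar>x\<bar>)\<^sup>2 * K x)" using E1 X K1[of x]
        by (intro mult_mono) (auto simp: mult_ge1_I)
      thus ?thesis using 0 by (simp add: cdh_rec_cdh[OF ab', unfolded cdh_rec_def, THEN conjunct1])
    next
      case (Suc m)
      have "\<bar>poly (cdh (1 / 2) b (- b) n) (- (x\<^sup>2))\<bar> = (b\<^sup>2 + x\<^sup>2) * (1 / ((1 / 2 + b) * (real m + 1)) * \<bar>poly (cdh (1 / 2) (b + 1) (1 - b) m) (- (x\<^sup>2))\<bar>)"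
        unfolding Suc cdh_minus_Suc[OF ab'] poly_mult poly_smult abs_mult
        using ab' by (simp add: abs_of_nonneg[of "b\<^sup>2 + x\<^sup>2"])
      also have "\<dots> \<le> ((b\<^sup>2 + 1) * (1 + \<bar>x\<bar>)\<^sup>2) * (1 / ((1 / 2 + b) * 1) * (D * C * (real m + 1)\<^sup>2 * K x))"
      proof (intro mult_mono h divide_left_mono)
        have "x\<^sup>2 \<le> (1 + \<bar>x\<bar>)\<^sup>2" by (intro power2_le_iff_abs_le[THEN iffD2]) auto
        moreover have "b\<^sup>2 * 1 \<le> b\<^sup>2 * (1 + \<bar>x\<bar>)\<^sup>2" by (intro mult_left_mono X) auto
        ultimately show "b\<^sup>2 + x\<^sup>2 \<le> (b\<^sup>2 + 1) * (1 + \<bar>x\<bar>)\<^sup>2" by (simp add: distrib_right)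
      qed (use ab' in auto)
      also have "\<dots> = ((b\<^sup>2 + 1) / (1 / 2 + b) * (D * C)) * (real m + 1)\<^sup>2 * ((1 + \<bar>x\<bar>)\<^sup>2 * K x)" by simp
      also have "\<dots> \<le> E * (real n + 1)\<^sup>2 * ((1 + \<bar>x\<bar>)\<^sup>2 * K x)"
        using K1[of x] C(1) D(1) ab' E1 by (intro mult_mono power_mono mult_nonneg_nonneg) (auto simp: E_def Suc)
      finally show ?thesis .
    qed
  qed
  show ?thesis
  proof (rule that[of "max (D * C) E"])
    show "0 < max (D * C) E" using C D by (simp add: less_max_iff_disj)
    fix x n
    show "\<bar>poly (cdh (1 / 2) (b + 1) (1 - b) n) (- (x\<^sup>2))\<bar> \<le> max (D * C) E * (real n + 1)\<^sup>2 * ((1 + \<bar>x\<bar>)\<^sup>2 * exp (pi * \<bar>x\<bar> / 2))"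
      using K1[of x] by (intro order.trans[OF h]) (auto simp flip: K_def intro!: mult_right_mono)
    have "(1 + \<bar>x\<bar>) ^ 4 * exp (pi * \<bar>x\<bar> / 2) = (1 + \<bar>x\<bar>)\<^sup>2 * K x"
      by (simp add: K_def power2_eq_square power4_eq_xxxx)
    thus "\<bar>poly (cdh (1 / 2) b (- b) n) (- (x\<^sup>2))\<bar> \<le> max (D * C) E * (real n + 1)\<^sup>2 * ((1 + \<bar>x\<bar>) ^ 4 * exp (pi * \<bar>x\<bar> / 2))"
      using K1[of x] by (intro order.trans[OF \<Phi>]) (auto intro!: mult_right_mono)
  qed
qed

lemma rainbow_poly_eq_sum:
  assumes "0 < \<beta>"
  shows "rainbow_poly \<beta> n = (\<Sum>k\<le>n. smult (pochhammer \<beta> k / fact k) (cdh (1 / 2) (2 * \<beta> - 1 / 2) (- (2 * \<beta> - 1 / 2)) (n - k)))"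
  using cdh_poly_shift[of "1 / 2" "2 * \<beta> - 1 / 2" "- (2 * \<beta> - 1 / 2)" "- \<beta>" n] assms
  unfolding rainbow_poly_def by (simp add: algebra_simps)

text \<open>A single nonconstant factor contains b^2 - \<zeta> only once, which does not raise both
  parameters. Here the closed form of the functional on \<open>rainbow_poly\<close> is carried back
  by the inverse shift, with coefficients (-\<beta>)_k / k!.\<close>

lemma wilson_cdh_minus_le:
  assumes \<beta>: "0 < \<beta>"
  defines "b \<equiv> 2 * \<beta> - 1 / 2"
  obtains C where "\<And>n. \<bar>wilson b b (1 / 2 - \<beta>) (cdh (1 / 2) b (- b) n)\<bar> \<le> C * (real n + 1)"
proof -
  define W where "W = wilson b b (1 / 2 - \<beta>)"
  have W: "linear_functional W" by (simp add: W_def linear_wilson)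
  have ab: "0 < 1 / 2 + b" using \<beta> by (simp add: b_def)
  obtain C where C: "C > 0" "\<And>k. \<bar>pochhammer (- \<beta>) k / pochhammer 1 k\<bar> \<le> C * (real k + 1) ^ 0"
    using pochhammer_ratio_le_power[of "- \<beta>" 1 0] \<beta> by auto
  obtain D where D: "D > 0" "\<And>k. \<bar>pochhammer (1 - \<beta>) k / pochhammer 1 k\<bar> \<le> D * (real k + 1) ^ 0"
    using pochhammer_ratio_le_power[of "1 - \<beta>" 1 0] \<beta> by auto
  obtain E where E: "E > 0" "\<And>k. \<bar>pochhammer \<beta> k / pochhammer (3 * \<beta>) k\<bar> \<le> E * (real k + 1) ^ 0"
    using pochhammer_ratio_le_power[of \<beta> "3 * \<beta>" 0] \<beta> by auto
  have P: "\<bar>W (rainbow_poly \<beta> n)\<bar> \<le> (D * E) * (real n + 1) ^ 0" for n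
  proof -
    have "W (rainbow_poly \<beta> n) = (pochhammer (1 - \<beta>) n / pochhammer 1 n) * (pochhammer \<beta> n / pochhammer (3 * \<beta>) n)"
      unfolding W_def rainbow_poly_def b_def using \<beta> by (subst wilson_cdh) (simp_all add: pochhammer_fact)
    thus ?thesis unfolding abs_mult using mult_mono[OF D(2)[of n] E(2)[of n]] D(1) by (simp add: abs_mult)
  qed
  have "\<bar>W (cdh (1 / 2) b (- b) n)\<bar> \<le> C * (D * E) * (real n + 1) ^ (0 + 0 + 1)" for n
  proof -
    have "cdh (1 / 2) b (- b) n = (\<Sum>k\<le>n. smult (pochhammer (- \<beta>) k / pochhammer 1 k) (rainbow_poly \<beta> (n - k)))"
      using cdh_poly_shift[OF ab, of "1 / 2 - \<beta>" \<beta> n] unfolding rainbow_poly_def b_def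
      by (simp add: algebra_simps pochhammer_fact)
    hence "W (cdh (1 / 2) b (- b) n) = (\<Sum>k\<le>n. pochhammer (- \<beta>) k / pochhammer 1 k * W (rainbow_poly \<beta> (n - k)))"
      by (simp only: linear_functional_sum[OF W] linear_functionalD[OF W])
    thus ?thesis using convolution_le[OF C(2) P, of n] by simp
  qed
  thus ?thesis by (intro that[of "C * (D * E)"]) (simp add: W_def)
qed

text \<open>
  For \<open>\<beta> < 1/2\<close> the parameter \<open>b\<close> may be negative. The polynomials with \<open>c = -b\<close> are, except for the zeroth,
  divisible by \<open>b\<^sup>2 - \<zeta>\<close>; a product with two such factors raises both parameters \<open>b\<close> by one.
\<close>

lemma wilson_triple_le:
  assumes \<beta>: "0 < \<beta>" "\<beta> < 1 / 2"
  defines "b \<equiv> 2 * \<beta> - 1 / 2"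
  obtains C where "C \<ge> 0" "\<And>i j k. \<bar>wilson b b (1 / 2 - \<beta>) (cdh (1 / 2) b (- b) i * cdh (1 / 2) b (- b) j * cdh (1 / 2) b (- b) k)\<bar>
    \<le> C * (real i + 1)\<^sup>2 * (real j + 1)\<^sup>2 * (real k + 1)\<^sup>2"
proof -
  define c where "c = 1 / 2 - \<beta>"
  define \<Phi> where "\<Phi> = cdh (1 / 2) b (- b)"
  define h where "h = cdh (1 / 2) (b + 1) (1 - b)"
  have b: "- (1 / 2) < b" "0 < b + 1" "0 < 1 / 2 + b" and c: "0 < c" using \<beta> by (auto simp: b_def c_def)
  have \<Phi>0: "\<Phi> 0 = 1" by (simp add: \<Phi>_def)
  obtain C1 where C1: "\<And>n. \<bar>wilson b b c (\<Phi> n)\<bar> \<le> C1 * (real n + 1)"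
    using wilson_cdh_minus_le[OF \<beta>(1)] unfolding b_def c_def \<Phi>_def by blast
  have C1_0: "0 \<le> C1" using C1[of 0] abs_ge_zero[of "wilson b b c (\<Phi> 0)"] by simp
  have one: "\<bar>wilson b b c (\<Phi> n)\<bar> \<le> C1 * (real n + 1)\<^sup>2" for n
    by (rule order.trans[OF C1]) (use C1_0 in \<open>auto simp: power2_eq_square intro!: mult_left_mono mult_ge1_I\<close>)
  obtain C2 where C2: "C2 > 0"
    "\<And>x n. \<bar>poly (h n) (- (x\<^sup>2))\<bar> \<le> C2 * (real n + 1)\<^sup>2 * ((1 + \<bar>x\<bar>)\<^sup>2 * exp (pi * \<bar>x\<bar> / 2))"
    "\<And>x n. \<bar>poly (\<Phi> n) (- (x\<^sup>2))\<bar> \<le> C2 * (real n + 1)\<^sup>2 * ((1 + \<bar>x\<bar>) ^ 4 * exp (pi * \<bar>x\<bar> / 2))"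
    using cdh_minus_le[OF b(1)] unfolding \<Phi>_def h_def by blast
  have "0 < 1 / 2 + 2 * b + c" using \<beta> by (simp add: b_def c_def)
  then obtain K where K: "\<And>q. wilson b b c ([:b\<^sup>2, - 1:] ^ 2 * q) = K * wilson (b + 1) (b + 1) c q"
    using wilson_mult_shift2 by blast
  \<comment> \<open>Growth of the product of two cofactors and one full polynomial: rate \<pi>/2
    from each, exponent 8 = 2 + 2 + 4.\<close>
  have "3 * pi / 2 < 2 * pi" by simp
  then obtain M where M: "\<And>u E. (\<And>x. \<bar>poly u (- (x\<^sup>2))\<bar> \<le> E * ((1 + \<bar>x\<bar>) ^ 8 * exp (3 * pi / 2 * \<bar>x\<bar>))) \<Longrightarrow> \<bar>wilson (b + 1) (b + 1) c u\<bar> \<le> M * E"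
    using wilson_le[OF b(2) c] by blast
  define L where "L = (1 / (1 / 2 + b))\<^sup>2 * C2 ^ 3"
  have two: "\<bar>wilson b b c (\<Phi> (Suc i) * \<Phi> (Suc j) * \<Phi> k)\<bar> \<le> \<bar>K * M * L\<bar> * (real (Suc i) + 1)\<^sup>2 * (real (Suc j) + 1)\<^sup>2 * (real k + 1)\<^sup>2" for i j k
  proof -
    define s where "s n = - 1 / ((1 / 2 + b) * (real n + 1))" for n
    have s: "\<bar>s n\<bar> \<le> 1 / (1 / 2 + b)" for n
    proof -
      have "1 / ((1 / 2 + b) * (real n + 1)) \<le> 1 / ((1 / 2 + b) * 1)"
        using b(3) by (intro divide_left_mono mult_left_mono mult_pos_pos) auto
      moreover have "0 \<le> (1 / 2 + b) * (real n + 1)" using b(3) by (intro mult_nonneg_nonneg) auto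
      ultimately show ?thesis unfolding s_def abs_divide by (simp only: abs_of_nonneg abs_minus abs_one mult_1_right)
    qed
    define u where "u = smult (s i) (h i) * smult (s j) (h j) * \<Phi> k"
    define E where "E = L * (real i + 1)\<^sup>2 * (real j + 1)\<^sup>2 * (real k + 1)\<^sup>2"
    have E: "0 \<le> E" using C2(1) b(3) by (simp add: E_def L_def)
    have eq: "\<Phi> (Suc i) * \<Phi> (Suc j) * \<Phi> k = [:b\<^sup>2, - 1:] ^ 2 * u"
      unfolding \<Phi>_def cdh_minus_Suc[OF b(3)] u_def h_def s_def by (simp only: power2_eq_square mult_ac)
    have "\<bar>poly u (- (x\<^sup>2))\<bar> \<le> E * ((1 + \<bar>x\<bar>) ^ 8 * exp (3 * pi / 2 * \<bar>x\<bar>))" for x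
    proof -
      define e where "e = exp (pi * \<bar>x\<bar> / 2)"
      have e: "0 < e" "e ^ 3 = exp (3 * pi / 2 * \<bar>x\<bar>)" by (simp_all add: e_def exp_of_nat_mult[symmetric])
      have "\<bar>poly u (- (x\<^sup>2))\<bar> = (\<bar>s i\<bar> * \<bar>poly (h i) (- (x\<^sup>2))\<bar>) * (\<bar>s j\<bar> * \<bar>poly (h j) (- (x\<^sup>2))\<bar>) * \<bar>poly (\<Phi> k) (- (x\<^sup>2))\<bar>"
        by (simp add: u_def abs_mult)
      also have "\<dots> \<le> (1 / (1 / 2 + b) * (C2 * (real i + 1)\<^sup>2 * ((1 + \<bar>x\<bar>)\<^sup>2 * e)))
          * (1 / (1 / 2 + b) * (C2 * (real j + 1)\<^sup>2 * ((1 + \<bar>x\<bar>)\<^sup>2 * e))) * (C2 * (real k + 1)\<^sup>2 * ((1 + \<bar>x\<bar>) ^ 4 * e))"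
        unfolding e_def using C2(1) b(3)
        by (intro mult_mono s C2(2,3) mult_nonneg_nonneg abs_ge_zero) auto
      also have "\<dots> = E * ((1 + \<bar>x\<bar>) ^ (2 + 2 + 4) * e ^ 3)"
        unfolding E_def L_def power_add power3_eq_cube power2_eq_square[of "1 / (1 / 2 + b)"] by (simp only: mult_ac)
      finally show ?thesis by (simp add: e)
    qed
    hence "\<bar>wilson (b + 1) (b + 1) c u\<bar> \<le> M * E" by (rule M)
    hence "\<bar>K\<bar> * \<bar>wilson (b + 1) (b + 1) c u\<bar> \<le> \<bar>K\<bar> * (M * E)" by (rule mult_left_mono) simp
    also have "\<dots> \<le> \<bar>K * M * L\<bar> * (real i + 1)\<^sup>2 * (real j + 1)\<^sup>2 * (real k + 1)\<^sup>2"
    proof -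
      have "\<bar>K\<bar> * (M * L) \<le> \<bar>K * M * L\<bar>" using abs_ge_self[of "\<bar>K\<bar> * (M * L)"] by (simp add: abs_mult mult_ac)
      hence "\<bar>K\<bar> * (M * L) * ((real i + 1)\<^sup>2 * (real j + 1)\<^sup>2 * (real k + 1)\<^sup>2) \<le> \<bar>K * M * L\<bar> * ((real i + 1)\<^sup>2 * (real j + 1)\<^sup>2 * (real k + 1)\<^sup>2)"
        by (rule mult_right_mono) simp
      thus ?thesis by (simp only: E_def mult.assoc)
    qed
    also have "\<dots> \<le> \<bar>K * M * L\<bar> * (real (Suc i) + 1)\<^sup>2 * (real (Suc j) + 1)\<^sup>2 * (real k + 1)\<^sup>2"
      by (intro mult_mono power_mono mult_nonneg_nonneg) auto
    finally show ?thesis unfolding eq K abs_mult[of K] .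
  qed
  define C where "C = C1 + \<bar>K * M * L\<bar>"
  have C: "C \<ge> 0" "C1 \<le> C" "\<bar>K * M * L\<bar> \<le> C" using C1_0 by (auto simp: C_def)
  have one': "\<bar>wilson b b c (\<Phi> n)\<bar> \<le> C * (real n + 1)\<^sup>2" for n
    by (rule order.trans[OF one]) (use C in \<open>auto intro!: mult_right_mono\<close>)
  have two': "\<bar>wilson b b c (\<Phi> (Suc i) * \<Phi> (Suc j) * \<Phi> k)\<bar> \<le> C * (real (Suc i) + 1)\<^sup>2 * (real (Suc j) + 1)\<^sup>2 * (real k + 1)\<^sup>2" for i j k
    by (rule order.trans[OF two]) (use C in \<open>auto intro!: mult_right_mono\<close>)
  have "\<bar>wilson b b c (\<Phi> i * \<Phi> j * \<Phi> k)\<bar> \<le> C * (real i + 1)\<^sup>2 * (real j + 1)\<^sup>2 * (real k + 1)\<^sup>2" for i j k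
  proof -
    \<comment> \<open>Either at most one index is nonzero, which is the case of a single factor, or
      two of them are positive and the double shift applies.\<close>
    consider "i = 0" "j = 0" | "i = 0" "k = 0" | "j = 0" "k = 0" | i' j' where "i = Suc i'" "j = Suc j'"
      | i' k' where "i = Suc i'" "k = Suc k'" | j' k' where "j = Suc j'" "k = Suc k'"
      by (metis not0_implies_Suc)
    thus ?thesis
    proof cases
      case 1 thus ?thesis using one'[of k] by (simp add: \<Phi>0)
    next
      case 2 thus ?thesis using one'[of j] by (simp add: \<Phi>0)
    next
      case 3 thus ?thesis using one'[of i] by (simp add: \<Phi>0)
    next
      case 4 thus ?thesis using two'[of i' j' k] by simp
    next
      case (5 i' k')
      have "\<Phi> i * \<Phi> j * \<Phi> k = \<Phi> i * \<Phi> k * \<Phi> j" by (simp only: mult_ac)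
      thus ?thesis using two'[of i' k' j] by (simp only: 5 mult_ac)
    next
      case (6 j' k')
      have "\<Phi> i * \<Phi> j * \<Phi> k = \<Phi> j * \<Phi> k * \<Phi> i" by (simp only: mult_ac)
      thus ?thesis using two'[of j' k' i] by (simp only: 6 mult_ac)
    qed
  qed
  with C(1) show ?thesis unfolding \<Phi>_def c_def by (rule that)
qed

text \<open>Three convolutions, one for each index, lead from the polynomials with c = -b to
  \<open>rainbow_poly\<close>; each raises the exponent of its index from 2 to 1 + 2 + 1.\<close>

lemma rainbow_A_growth_small:
  assumes A: "rainbow_arrays \<beta> A B" and \<beta>: "0 < \<beta>" "\<beta> < 1 / 2"
  shows "\<exists>C. \<forall>i j k. \<bar>A (vector [i, j, k])\<bar> \<le> C * ((real i + 1) * (real j + 1) * (real k + 1)) ^ 4"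
proof -
  define b where "b = 2 * \<beta> - 1 / 2"
  define W where "W = wilson b b (1 / 2 - \<beta>)"
  define \<Phi> where "\<Phi> = cdh (1 / 2) b (- b)"
  define f where "f k = pochhammer \<beta> k / fact k" for k
  have W: "linear_functional W" by (simp add: W_def linear_wilson)
  obtain C where C: "C \<ge> 0" "\<And>i j k. \<bar>W (\<Phi> i * \<Phi> j * \<Phi> k)\<bar> \<le> C * (real i + 1)\<^sup>2 * (real j + 1)\<^sup>2 * (real k + 1)\<^sup>2"
    using wilson_triple_le[OF \<beta>] unfolding W_def \<Phi>_def b_def by blast
  obtain D where D: "D > 0" "\<And>k. \<bar>f k\<bar> \<le> D * (real k + 1) ^ 1"
    using pochhammer_ratio_le_power[of \<beta> 1 1] \<beta> unfolding f_def pochhammer_fact by auto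
  have P: "rainbow_poly \<beta> n = (\<Sum>k\<le>n. smult (f k) (\<Phi> (n - k)))" for n
    using rainbow_poly_eq_sum[OF \<beta>(1), of n] by (simp only: f_def \<Phi>_def b_def)
  have e: "1 + 2 + 1 = (4::nat)" by simp
  have 1: "\<bar>W (rainbow_poly \<beta> i * \<Phi> j * \<Phi> k)\<bar> \<le> D * (C * (real j + 1)\<^sup>2 * (real k + 1)\<^sup>2) * (real i + 1) ^ 4" for i j k
  proof -
    have "W (rainbow_poly \<beta> i * \<Phi> j * \<Phi> k) = (\<Sum>l\<le>i. f l * W (\<Phi> (i - l) * \<Phi> j * \<Phi> k))"
      unfolding P by (simp add: sum_distrib_right linear_functional_sum[OF W] linear_functionalD[OF W])
    moreover have "\<bar>W (\<Phi> l * \<Phi> j * \<Phi> k)\<bar> \<le> C * (real j + 1)\<^sup>2 * (real k + 1)\<^sup>2 * (real l + 1)\<^sup>2" for l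
      using C(2)[of l j k] by (simp only: mult_ac)
    ultimately show ?thesis using convolution_le[OF D(2), of "\<lambda>l. W (\<Phi> l * \<Phi> j * \<Phi> k)" _ 2 i, unfolded e] by simp
  qed
  have 2: "\<bar>W (rainbow_poly \<beta> i * rainbow_poly \<beta> j * \<Phi> k)\<bar> \<le> D * (D * (C * (real k + 1)\<^sup>2) * (real i + 1) ^ 4) * (real j + 1) ^ 4" for i j k
  proof -
    have "W (rainbow_poly \<beta> i * rainbow_poly \<beta> j * \<Phi> k) = (\<Sum>l\<le>j. f l * W (rainbow_poly \<beta> i * \<Phi> (j - l) * \<Phi> k))"
      unfolding P[of j] by (simp add: sum_distrib_right sum_distrib_left linear_functional_sum[OF W] linear_functionalD[OF W])
    moreover have "\<bar>W (rainbow_poly \<beta> i * \<Phi> l * \<Phi> k)\<bar> \<le> D * (C * (real k + 1)\<^sup>2) * (real i + 1) ^ 4 * (real l + 1)\<^sup>2" for l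
      using 1[of i l k] by (simp only: mult_ac)
    ultimately show ?thesis using convolution_le[OF D(2), of "\<lambda>l. W (rainbow_poly \<beta> i * \<Phi> l * \<Phi> k)" _ 2 j, unfolded e] by simp
  qed
  have 3: "\<bar>W (rainbow_poly \<beta> i * rainbow_poly \<beta> j * rainbow_poly \<beta> k)\<bar> \<le> D * (D * (D * C * (real i + 1) ^ 4) * (real j + 1) ^ 4) * (real k + 1) ^ 4" for i j k
  proof -
    have "W (rainbow_poly \<beta> i * rainbow_poly \<beta> j * rainbow_poly \<beta> k) = (\<Sum>l\<le>k. f l * W (rainbow_poly \<beta> i * rainbow_poly \<beta> j * \<Phi> (k - l)))"
      unfolding P[of k] by (simp add: sum_distrib_left linear_functional_sum[OF W] linear_functionalD[OF W])
    moreover have "\<bar>W (rainbow_poly \<beta> i * rainbow_poly \<beta> j * \<Phi> l)\<bar> \<le> D * (D * C * (real i + 1) ^ 4) * (real j + 1) ^ 4 * (real l + 1)\<^sup>2" for l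
      using 2[of i j l] by (simp only: mult_ac)
    ultimately show ?thesis using convolution_le[OF D(2), of "\<lambda>l. W (rainbow_poly \<beta> i * rainbow_poly \<beta> j * \<Phi> l)" _ 2 k, unfolded e] by simp
  qed
  show ?thesis
  proof (intro exI allI)
    fix i j k
    show "\<bar>A (vector [i, j, k])\<bar> \<le> (D * D * D * C) * ((real i + 1) * (real j + 1) * (real k + 1)) ^ 4"
      using 3[of i j k] unfolding rainbow_eq_wilson[OF A \<beta>(1)] W_def b_def power_mult_distrib by (simp only: mult_ac)
  qed
qed

text \<open>Here b = 1/2 and c = 0. The only point mass sits at 0, which is itself on the imaginary
  axis, so bounds there cover the whole functional.\<close>

lemma rainbow_A_growth_half:
  assumes A: "rainbow_arrays (1 / 2) A B"
  shows "\<exists>C. \<forall>i j k. \<bar>A (vector [i, j, k])\<bar> \<le> C * ((real i + 1) * (real j + 1) * (real k + 1)) ^ 2"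
proof -
  let ?P = "rainbow_poly (1 / 2)"
  obtain \<omega> \<nu> C q where \<omega>: "\<And>k. 0 \<le> \<omega> k" and \<nu>: "\<And>x. 0 \<le> \<nu> x" "\<nu> \<in> borel_measurable borel"
    "\<And>x. \<nu> x \<le> C * (1 + \<bar>x\<bar>) ^ q * exp (- 2 * pi * \<bar>x\<bar>)"
    and rep: "\<And>u. \<bar>wilson (1 / 2) (1 / 2) 0 u\<bar> \<le> (\<Sum>k<nat (\<lfloor>- 0 :: real\<rfloor> + 1). \<omega> k * \<bar>poly u ((0 + real k)\<^sup>2)\<bar>) + (\<integral>x. \<bar>poly u (- (x\<^sup>2))\<bar> * \<nu> x \<partial>lborel)"
    by (rule wilson_representation[of "1 / 2" 0], simp, simp, rule that)
  have rep': "\<bar>wilson (1 / 2) (1 / 2) 0 u\<bar> \<le> \<omega> 0 * \<bar>poly u (- (0\<^sup>2))\<bar> + (\<integral>x. \<bar>poly u (- (x\<^sup>2))\<bar> * \<nu> x \<partial>lborel)" for u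
    using rep[of u] by simp
  obtain D where D: "D > 0" "\<And>x n. \<bar>poly (?P n) (- (x\<^sup>2))\<bar> \<le> D * (1 + \<bar>x\<bar>)\<^sup>2 * exp (pi * \<bar>x\<bar> / 2) * (real n + 1) ^ 2"
    using rainbow_poly_le[of "1 / 2"] by auto
  define Q where "Q x = (D * (1 + \<bar>x\<bar>)\<^sup>2 * exp (pi * \<bar>x\<bar> / 2)) ^ 3" for x
  have Q: "Q x = D ^ 3 * (1 + \<bar>x\<bar>) ^ 6 * exp (3 * pi / 2 * \<bar>x\<bar>)" for x
    by (simp add: Q_def power_mult_distrib power_mult[symmetric] exp_of_nat_mult[symmetric])
  have intQ: "integrable lborel (\<lambda>x. Q x * \<nu> x)"
  proof (rule integrable_poly_exp_bound)
    show "(\<lambda>x. Q x * \<nu> x) \<in> borel_measurable borel"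
      unfolding Q by (intro borel_measurable_times \<nu> borel_measurable_continuous_onI continuous_intros)
    show "\<bar>Q x * \<nu> x\<bar> \<le> (D ^ 3 * C) * (1 + \<bar>x\<bar>) ^ (6 + q) * exp (- (pi / 2) * \<bar>x\<bar>)" for x
    proof -
      have "\<bar>Q x * \<nu> x\<bar> = Q x * \<nu> x"
        unfolding Q using D(1) \<nu>(1) by (intro abs_of_nonneg mult_nonneg_nonneg) auto
      also have "\<dots> \<le> Q x * (C * (1 + \<bar>x\<bar>) ^ q * exp (- 2 * pi * \<bar>x\<bar>))"
        unfolding Q using D(1) by (intro mult_left_mono \<nu>) auto
      also have "\<dots> = (D ^ 3 * C) * (1 + \<bar>x\<bar>) ^ (6 + q) * (exp (3 * pi / 2 * \<bar>x\<bar>) * exp (- 2 * pi * \<bar>x\<bar>))"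
        unfolding Q by (simp only: power_add mult_ac)
      also have "exp (3 * pi / 2 * \<bar>x\<bar>) * exp (- 2 * pi * \<bar>x\<bar>) = exp (- (pi / 2) * \<bar>x\<bar>)"
        by (simp add: exp_add[symmetric])
      finally show ?thesis .
    qed
  qed simp
  define T where "T = \<omega> 0 * Q 0 + (\<integral>x. Q x * \<nu> x \<partial>lborel)"
  have "\<bar>A (vector [i, j, k])\<bar> \<le> T * ((real i + 1) * (real j + 1) * (real k + 1)) ^ 2" for i j k
  proof -
    define u where "u = ?P i * ?P j * ?P k"
    define R where "R = ((real i + 1) * (real j + 1) * (real k + 1)) ^ 2"
    have R: "R \<ge> 0" by (simp add: R_def)
    have u: "\<bar>poly u (- (x\<^sup>2))\<bar> \<le> R * Q x" for x
    proof -
      define E where "E = D * (1 + \<bar>x\<bar>)\<^sup>2 * exp (pi * \<bar>x\<bar> / 2)"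
      have "E \<ge> 0" using D(1) by (simp add: E_def)
      hence "\<bar>poly u (- (x\<^sup>2))\<bar> \<le> (E * (real i + 1)\<^sup>2) * (E * (real j + 1)\<^sup>2) * (E * (real k + 1)\<^sup>2)"
        unfolding u_def poly_mult abs_mult using D(2)[of _ x] unfolding E_def[symmetric] by (intro mult_mono mult_nonneg_nonneg) auto
      also have "\<dots> = R * Q x"
        unfolding R_def Q_def E_def[symmetric] power3_eq_cube power_mult_distrib by (simp only: mult_ac)
      finally show ?thesis .
    qed
    have int: "integrable lborel (\<lambda>x. \<bar>poly u (- (x\<^sup>2))\<bar> * \<nu> x)"
    proof (rule Bochner_Integration.integrable_bound[OF integrable_mult_right[OF intQ, of R]])
      have "(\<lambda>x. \<bar>poly u (- (x\<^sup>2))\<bar> * \<nu> x) \<in> borel_measurable borel"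
        by (intro borel_measurable_times \<nu>(2) borel_measurable_continuous_onI continuous_intros)
      thus "(\<lambda>x. \<bar>poly u (- (x\<^sup>2))\<bar> * \<nu> x) \<in> borel_measurable lborel" by simp
      have "norm (\<bar>poly u (- (x\<^sup>2))\<bar> * \<nu> x) \<le> norm (R * (Q x * \<nu> x))" for x
      proof -
        have "norm (\<bar>poly u (- (x\<^sup>2))\<bar> * \<nu> x) = \<bar>poly u (- (x\<^sup>2))\<bar> * \<nu> x" using \<nu>(1) by simp
        also have "\<dots> \<le> (R * Q x) * \<nu> x" by (intro mult_right_mono u \<nu>)
        also have "\<dots> \<le> norm (R * (Q x * \<nu> x))" by (simp add: mult.assoc)
        finally show ?thesis .
      qed
      thus "AE x in lborel. norm (\<bar>poly u (- (x\<^sup>2))\<bar> * \<nu> x) \<le> norm (R * (Q x * \<nu> x))" by simp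
    qed
    have "\<bar>A (vector [i, j, k])\<bar> = \<bar>wilson (1 / 2) (1 / 2) 0 u\<bar>"
      using rainbow_eq_wilson[OF A, of i j k] by (simp add: u_def)
    also have "\<dots> \<le> \<omega> 0 * \<bar>poly u (- (0\<^sup>2))\<bar> + (\<integral>x. \<bar>poly u (- (x\<^sup>2))\<bar> * \<nu> x \<partial>lborel)" by (rule rep')
    also have "\<dots> \<le> \<omega> 0 * (R * Q 0) + (\<integral>x. R * (Q x * \<nu> x) \<partial>lborel)"
    proof (intro add_mono mult_left_mono u \<omega> integral_mono int)
      show "integrable lborel (\<lambda>x. R * (Q x * \<nu> x))" using intQ by simp
      fix x show "\<bar>poly u (- (x\<^sup>2))\<bar> * \<nu> x \<le> R * (Q x * \<nu> x)"
        using mult_right_mono[OF u[of x] \<nu>(1)[of x]] by (simp only: mult.assoc)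
    qed
    also have "\<dots> = T * R" by (simp add: T_def algebra_simps)
    finally show ?thesis by (simp add: R_def)
  qed
  thus ?thesis by blast
qed

section \<open>Polynomial growth for all \<beta> > 0\<close>

theorem rainbow_A_growth:
  assumes A: "rainbow_arrays \<beta> A B" and \<beta>: "0 < \<beta>"
  shows "\<exists>C q. \<forall>i j k. \<bar>A (vector [i, j, k])\<bar> \<le> C * ((real i + 1) * (real j + 1) * (real k + 1)) ^ q"
proof -
  consider "\<beta> < 1 / 2" | "\<beta> = 1 / 2" | "1 / 2 < \<beta>" by linarith
  thus ?thesis
  proof cases
    case 1 thus ?thesis using rainbow_A_growth_small[OF A \<beta>] by blast
  next
    case 2 thus ?thesis using rainbow_A_growth_half A by blast
  next
    case 3
    obtain T where T: "\<And>N. (\<Sum>i<N. \<Sum>j<N. \<Sum>k<N. \<bar>A (vector [i, j, k])\<bar>) \<le> T"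
      using rainbow_A_summable[OF A 3] by blast
    have "\<bar>A (vector [i, j, k])\<bar> \<le> T" for i j k
    proof -
      obtain N where N: "i < N" "j < N" "k < N" by (rule that[of "Suc (i + j + k)"]) auto
      have "\<bar>A (vector [i, j, k])\<bar> \<le> (\<Sum>k<N. \<bar>A (vector [i, j, k])\<bar>)"
        by (rule member_le_sum[of k "{..<N}" "\<lambda>k. \<bar>A (vector [i, j, k])\<bar>"]) (auto simp: N)
      also have "\<dots> \<le> (\<Sum>j<N. \<Sum>k<N. \<bar>A (vector [i, j, k])\<bar>)"
        by (rule member_le_sum[of j "{..<N}" "\<lambda>j. \<Sum>k<N. \<bar>A (vector [i, j, k])\<bar>"]) (auto simp: N intro!: sum_nonneg)
      also have "\<dots> \<le> (\<Sum>i<N. \<Sum>j<N. \<Sum>k<N. \<bar>A (vector [i, j, k])\<bar>)"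
        by (rule member_le_sum[of i "{..<N}" "\<lambda>i. \<Sum>j<N. \<Sum>k<N. \<bar>A (vector [i, j, k])\<bar>"]) (auto simp: N intro!: sum_nonneg)
      finally show ?thesis using T[of N] by linarith
    qed
    thus ?thesis by (intro exI[of _ T] exI[of _ 0]) simp
  qed
qed

text \<open>The diagonal through (i, j, k) leaves the octant after at most i + 1 steps, where
  \<open>B\<close> is zero. The coefficient of \<open>A\<close> in one step costs one power of the
  product of the shifted indices, the number of steps another.\<close>

theorem rainbow_B_growth:
  assumes A: "rainbow_arrays \<beta> A B" and \<beta>: "0 < \<beta>"
  shows "\<exists>C q. \<forall>i j k. \<bar>B (vector [i, j, k])\<bar> \<le> C * ((real i + 1) * (real j + 1) * (real k + 1)) ^ q"
proof -
  obtain C q where C: "\<And>i j k. \<bar>A (vector [i, j, k])\<bar> \<le> C * ((real i + 1) * (real j + 1) * (real k + 1)) ^ q"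
    using rainbow_A_growth[OF assms] by blast
  define D where "D = C * 2 ^ q * (2 + \<beta>)"
  have C0: "C \<ge> 0" using C[of 0 0 0] abs_ge_zero[of "A (vector [0, 0, 0])"] by simp
  have D0: "D \<ge> 0" using C0 \<beta> by (simp add: D_def)
  define R where "R i j k = (real i + 1) * (real j + 1) * (real k + 1)" for i j k
  have R1: "1 \<le> R i j k" for i j k by (simp add: R_def mult_ge1_I)
  have step: "\<bar>ext3 B (int i) (int j) (int k)\<bar> \<le> \<bar>ext3 B (int i - 1) (int j - 1) (int k)\<bar> + D * R i j k ^ (q + 1)" for i j k
  proof -
    have "ext3 B (int i) (int j) (int k) - ext3 B (int i - 1) (int j - 1) (int k) = - (real k + 1) * (real i + real j + \<beta>) * A (vector [i, j, Suc k])"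
      using rainbow_B_diff[OF A, of "int i" "int j" "int k"] ext3_nat[of A i j "Suc k"] by (simp add: add.commute)
    hence "\<bar>ext3 B (int i) (int j) (int k) - ext3 B (int i - 1) (int j - 1) (int k)\<bar> = ((real k + 1) * (real i + real j + \<beta>)) * \<bar>A (vector [i, j, Suc k])\<bar>"
      using \<beta> by (simp add: abs_mult)
    also have "\<dots> \<le> ((2 + \<beta>) * R i j k) * (C * (2 * R i j k) ^ q)"
    proof (rule mult_mono)
      have "real i + real j + \<beta> \<le> (2 + \<beta>) * ((real i + 1) * (real j + 1))"
      proof -
        have "real i + real j + \<beta> \<le> (2 + \<beta>) + (2 + \<beta>) * real i + (2 + \<beta>) * real j + (2 + \<beta>) * (real i * real j)"
        proof -
          have "1 * real i \<le> (2 + \<beta>) * real i" "1 * real j \<le> (2 + \<beta>) * real j" "0 \<le> (2 + \<beta>) * (real i * real j)"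
            using \<beta> by (simp_all add: distrib_right)
          thus ?thesis by linarith
        qed
        thus ?thesis by (simp add: algebra_simps)
      qed
      hence "(real k + 1) * (real i + real j + \<beta>) \<le> (real k + 1) * ((2 + \<beta>) * ((real i + 1) * (real j + 1)))"
        by (rule mult_left_mono) simp
      thus "(real k + 1) * (real i + real j + \<beta>) \<le> (2 + \<beta>) * R i j k" by (simp only: R_def mult_ac)
      have "real (Suc k) + 1 \<le> 2 * (real k + 1)" by simp
      hence "(real i + 1) * (real j + 1) * (real (Suc k) + 1) \<le> (real i + 1) * (real j + 1) * (2 * (real k + 1))"
        by (intro mult_left_mono) auto
      hence "((real i + 1) * (real j + 1) * (real (Suc k) + 1)) ^ q \<le> (2 * R i j k) ^ q"
        by (intro power_mono) (simp_all only: R_def mult_ac, simp)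
      hence "C * ((real i + 1) * (real j + 1) * (real (Suc k) + 1)) ^ q \<le> C * (2 * R i j k) ^ q"
        using C0 by (rule mult_left_mono)
      thus "\<bar>A (vector [i, j, Suc k])\<bar> \<le> C * (2 * R i j k) ^ q" using C[of i j "Suc k"] by linarith
      show "0 \<le> (2 + \<beta>) * R i j k" using \<beta> R1[of i j k] by simp
    qed simp
    also have "\<dots> = D * R i j k ^ (q + 1)"
      unfolding D_def power_mult_distrib power_add power_one_right by (simp only: mult_ac)
    finally show ?thesis by linarith
  qed
  have "\<bar>ext3 B (int i) (int j) (int k)\<bar> \<le> (real i + 1) * (D * R i j k ^ (q + 1))" for i j k
  proof (induction i arbitrary: j)
    case 0 show ?case using step[of 0 j k] by (simp add: ext3_neg)
  next
    case (Suc i)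
    have "\<bar>ext3 B (int i) (int j - 1) (int k)\<bar> \<le> (real i + 1) * (D * R (Suc i) j k ^ (q + 1))"
    proof (cases j)
      case 0 thus ?thesis using D0 R1[of "Suc i" j k] by (simp add: ext3_neg)
    next
      case (Suc j')
      have "R i j' k \<le> R (Suc i) j k" unfolding R_def Suc by (intro mult_mono) auto
      hence "(real i + 1) * (D * R i j' k ^ (q + 1)) \<le> (real i + 1) * (D * R (Suc i) j k ^ (q + 1))"
        using D0 R1[of i j' k] by (intro mult_left_mono power_mono) auto
      moreover have "int j - 1 = int j'" using Suc by simp
      ultimately show ?thesis using Suc.IH[of j'] by (simp only:)
    qed
    thus ?case using step[of "Suc i" j k] by (simp add: algebra_simps)
  qed
  note B = this
  have "\<bar>B (vector [i, j, k])\<bar> \<le> D * ((real i + 1) * (real j + 1) * (real k + 1)) ^ (q + 2)" for i j k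
  proof -
    have "(real i + 1) * 1 \<le> (real i + 1) * ((real j + 1) * (real k + 1))" by (intro mult_left_mono mult_ge1_I) auto
    hence "real i + 1 \<le> R i j k" by (simp add: R_def mult.assoc)
    hence "(real i + 1) * (D * R i j k ^ (q + 1)) \<le> R i j k * (D * R i j k ^ (q + 1))"
      using D0 R1[of i j k] by (intro mult_right_mono mult_nonneg_nonneg) auto
    also have "\<dots> = D * R i j k ^ (q + 2)" by (simp add: mult_ac)
    finally show ?thesis using B[of i j k] unfolding ext3_nat R_def by linarith
  qed
  thus ?thesis by blast
qed

section \<open>Power series on the cube\<close>

text \<open>Absolute convergence at the diagonal points; each point of the open cube is dominated by
  one of them.\<close>

definition cube_summable :: "(nat^'n \<Rightarrow> real) \<Rightarrow> bool" where
  "cube_summable a \<longleftrightarrow> (\<forall>\<rho>. 0 \<le> \<rho> \<and> \<rho> < 1 \<longrightarrow> (\<lambda>n. \<bar>a n\<bar> * monomial (\<chi> i. \<rho>) n) summable_on UNIV)"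

definition power_sum :: "(nat^'n \<Rightarrow> real) \<Rightarrow> real^'n \<Rightarrow> real" where
  "power_sum a r = (\<Sum>\<^sub>\<infinity>n. a n * monomial r n)"

text \<open>The coefficient of h^k in (p + h)^n. Where k exceeds n the binomial coefficient is zero,
  which makes the truncated subtraction in the exponent harmless.\<close>

definition taylor_term :: "real^'n \<Rightarrow> nat^'n \<Rightarrow> nat^'n \<Rightarrow> real" where
  "taylor_term p n k = (\<Prod>i\<in>UNIV. real (n $ i choose k $ i) * p $ i ^ (n $ i - k $ i))"

text \<open>This array and \<open>shift_coeff\<close> are those of the l-th partial derivative and
  of the product with the l-th variable.\<close>

definition deriv_coeff :: "'n \<Rightarrow> (nat^'n \<Rightarrow> real) \<Rightarrow> nat^'n \<Rightarrow> real" where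
  "deriv_coeff l a n = (real (n $ l) + 1) * a (n + axis l 1)"

definition shift_coeff :: "'n \<Rightarrow> (nat^'n \<Rightarrow> real) \<Rightarrow> nat^'n \<Rightarrow> real" where
  "shift_coeff l a n = (if n $ l = 0 then 0 else a (n - axis l 1))"

lemma abs_monomial: "\<bar>monomial r n\<bar> = monomial (\<chi> i. \<bar>r $ i\<bar>) n" for r :: "real^'n"
  by (simp add: monomial_def abs_prod power_abs)

lemma monomial_nonneg: "(\<And>i. 0 \<le> r $ i) \<Longrightarrow> 0 \<le> monomial r n" for r :: "real^'n"
  by (simp add: monomial_def prod_nonneg)

lemma monomial_mono: "(\<And>i. 0 \<le> r $ i \<and> r $ i \<le> s $ i) \<Longrightarrow> monomial r n \<le> monomial s n" for r s :: "real^'n"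
  unfolding monomial_def by (intro prod_mono) (auto intro: power_mono)

lemma cube_point_radius:
  fixes p :: "real^'n"
  assumes "\<And>i. \<bar>p $ i\<bar> < 1"
  obtains \<rho> where "0 \<le> \<rho>" "\<rho> < 1" "\<And>i. \<bar>p $ i\<bar> \<le> \<rho>"
proof -
  define \<rho> where "\<rho> = Max (range (\<lambda>i. \<bar>p $ i\<bar>))"
  have le: "\<bar>p $ i\<bar> \<le> \<rho>" for i unfolding \<rho>_def by (intro Max_ge) simp_all
  moreover have "0 \<le> \<rho>" using le[of undefined] by linarith
  moreover have "\<rho> \<in> range (\<lambda>i. \<bar>p $ i\<bar>)" unfolding \<rho>_def by (rule Max_in) simp_all
  hence "\<rho> < 1" using assms by (elim rangeE) (simp only:)
  ultimately show ?thesis by (intro that)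
qed

lemma abs_term_le:
  fixes r :: "real^'n"
  assumes "\<And>i. \<bar>r $ i\<bar> \<le> \<rho>"
  shows "\<bar>a n * monomial r n\<bar> \<le> \<bar>a n\<bar> * monomial (\<chi> i. \<rho>) n"
  unfolding abs_mult abs_monomial using assms by (intro mult_left_mono monomial_mono) auto

lemma has_sum_power_sum:
  fixes r :: "real^'n"
  assumes a: "cube_summable a" and r: "\<And>i. \<bar>r $ i\<bar> < 1"
  shows "((\<lambda>n. a n * monomial r n) has_sum power_sum a r) UNIV"
proof -
  obtain \<rho> where \<rho>: "0 \<le> \<rho>" "\<rho> < 1" "\<And>i. \<bar>r $ i\<bar> \<le> \<rho>" using cube_point_radius[OF r] by blast
  have "(\<lambda>n. \<bar>a n\<bar> * monomial (\<chi> i. \<rho>) n) summable_on UNIV" using a \<rho> by (simp add: cube_summable_def)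
  hence "(\<lambda>n. norm (a n * monomial r n)) summable_on UNIV"
    by (rule summable_on_comparison_test) (use abs_term_le[OF \<rho>(3)] in auto)
  hence "(\<lambda>n. a n * monomial r n) summable_on UNIV" by (subst summable_on_iff_abs_summable_on_real)
  thus ?thesis unfolding power_sum_def by simp
qed

lemma power_series_locally_uniform_on_cube:
  fixes a :: "nat^3 \<Rightarrow> real"
  assumes a: "cube_summable a"
  shows "power_series_locally_uniform_on a open_cube"
  unfolding power_series_locally_uniform_on_def
proof
  fix p :: "real^3" assume "p \<in> open_cube"
  hence "\<And>i. \<bar>p $ i\<bar> < 1" by (simp add: abs_less_iff minus_less_iff)
  then obtain \<rho> where \<rho>: "0 \<le> \<rho>" "\<rho> < 1" "\<And>i. \<bar>p $ i\<bar> \<le> \<rho>" using cube_point_radius by blast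
  define \<sigma> where "\<sigma> = (1 + \<rho>) / 2"
  have \<sigma>: "0 \<le> \<sigma>" "\<sigma> < 1" using \<rho> by (auto simp: \<sigma>_def)
  define V where "V = ball p (\<sigma> - \<rho>)"
  have V: "\<bar>r $ i\<bar> \<le> \<sigma>" if "r \<in> V" for r :: "real^3" and i
    using component_le_norm_cart[of "r - p" i] \<rho>(3)[of i] that by (auto simp: V_def dist_norm norm_minus_commute)
  have "uniform_limit (V \<inter> open_cube) (\<lambda>S r. \<Sum>n\<in>S. a n * monomial r n) (\<lambda>r. \<Sum>\<^sub>\<infinity>n. a n * monomial r n) (finite_subsets_at_top UNIV)"
  proof (rule Weierstrass_m_test_general)
    show "(\<lambda>n. \<bar>a n\<bar> * monomial (\<chi> i. \<sigma>) n) summable_on UNIV" using a \<sigma> by (simp add: cube_summable_def)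
    show "norm (a n * monomial r n) \<le> \<bar>a n\<bar> * monomial (\<chi> i. \<sigma>) n" if "r \<in> V \<inter> open_cube" for n r
      using abs_term_le[OF V, of r a n] that by simp
  qed
  moreover have "p \<in> V" using \<rho> by (simp add: V_def \<sigma>_def)
  ultimately show "\<exists>V. open V \<and> p \<in> V \<and> uniform_limit (V \<inter> open_cube) (\<lambda>S r. \<Sum>n\<in>S. a n * monomial r n) (\<lambda>r. \<Sum>\<^sub>\<infinity>n. a n * monomial r n) (finite_subsets_at_top UNIV)"
    by (intro exI[of _ V]) (auto simp: V_def)
qed

section \<open>Recentring at interior points\<close>

lemma monomial_add:
  "((\<lambda>k. taylor_term p n k * monomial h k) has_sum monomial (p + h) n) UNIV"
proof -
  define B where "B = (\<lambda>i. {..n $ i})"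
  define K where "K = vec_lambda ` (Pi\<^sub>E UNIV B)"
  have finP: "finite (Pi\<^sub>E UNIV B)" by (intro finite_PiE) (auto simp: B_def)
  have K: "k \<in> K \<longleftrightarrow> (\<forall>i. k $ i \<le> n $ i)" for k
  proof
    assume "\<forall>i. k $ i \<le> n $ i"
    hence "vec_nth k \<in> Pi\<^sub>E UNIV B" by (auto simp: B_def PiE_UNIV_domain)
    thus "k \<in> K" unfolding K_def by (intro image_eqI[of _ _ "vec_nth k"]) auto
  qed (auto simp: K_def B_def PiE_UNIV_domain)
  have "monomial (p + h) n = (\<Prod>i\<in>UNIV. \<Sum>m\<in>B i. real (n $ i choose m) * p $ i ^ (n $ i - m) * h $ i ^ m)"
    unfolding monomial_def vector_add_component add.commute[of "p $ _"] binomial_ring B_def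
    by (simp add: mult_ac)
  also have "\<dots> = (\<Sum>g\<in>Pi\<^sub>E UNIV B. \<Prod>i\<in>UNIV. real (n $ i choose g i) * p $ i ^ (n $ i - g i) * h $ i ^ g i)"
    by (rule prod_sum_PiE) (auto simp: B_def)
  also have "\<dots> = (\<Sum>k\<in>K. \<Prod>i\<in>UNIV. real (n $ i choose k $ i) * p $ i ^ (n $ i - k $ i) * h $ i ^ k $ i)"
    unfolding K_def by (subst sum.reindex) (auto simp: inj_on_def vec_lambda_inject)
  also have "\<dots> = (\<Sum>k\<in>K. taylor_term p n k * monomial h k)"
    by (simp add: taylor_term_def monomial_def prod.distrib)
  finally show ?thesis
  proof (rule has_sum_finite_neutralI[rotated 3])
    show "finite K" unfolding K_def using finP by simp
    fix k assume "k \<in> UNIV - K"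
    then obtain i where "n $ i < k $ i" by (auto simp: K not_le)
    hence "real (n $ i choose k $ i) * p $ i ^ (n $ i - k $ i) = 0" by simp
    hence "taylor_term p n k = 0" unfolding taylor_term_def by (intro prod_zero) auto
    thus "taylor_term p n k * monomial h k = 0" by simp
  qed simp
qed

lemma abs_taylor_term: "\<bar>taylor_term p n k\<bar> = taylor_term (\<chi> i. \<bar>p $ i\<bar>) n k" for p :: "real^'n"
  by (simp add: taylor_term_def abs_prod abs_mult power_abs)

text \<open>The double series over n and k is absolutely summable, because summing moduli over k
  first gives the monomial at |p| + |h|; exchanging the sums yields the new coefficients. The second
  claim records a single column of this family and is what gives summability of the differentiated
  series.\<close>

lemma power_sum_recentre:
  fixes p h :: "real^'n"
  assumes a: "cube_summable a" and p: "\<And>i. \<bar>p $ i\<bar> \<le> \<rho>" and h: "\<And>i. \<bar>h $ i\<bar> \<le> \<delta>" and "\<rho> + \<delta> < 1"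
  shows "((\<lambda>k. (\<Sum>\<^sub>\<infinity>n. a n * taylor_term p n k) * monomial h k) has_sum power_sum a (p + h)) UNIV"
    and "(\<lambda>n. \<bar>a n * taylor_term p n k\<bar> * \<bar>monomial h k\<bar>) summable_on UNIV"
proof -
  have \<sigma>: "0 \<le> \<rho> + \<delta>" using p[of undefined] h[of undefined] by linarith
  define f where "f = (\<lambda>(n, k). a n * taylor_term p n k * monomial h k)"
  have abs: "(\<lambda>x. \<bar>f x\<bar>) summable_on (UNIV \<times> UNIV)"
  proof (rule summable_on_SigmaI)
    fix n
    have "((\<lambda>k. \<bar>a n\<bar> * (taylor_term (\<chi> i. \<bar>p $ i\<bar>) n k * monomial (\<chi> i. \<bar>h $ i\<bar>) k)) has_sum
        \<bar>a n\<bar> * monomial ((\<chi> i. \<bar>p $ i\<bar>) + (\<chi> i. \<bar>h $ i\<bar>)) n) UNIV"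
      by (intro has_sum_cmult_right monomial_add)
    thus "((\<lambda>k. \<bar>f (n, k)\<bar>) has_sum \<bar>a n\<bar> * monomial ((\<chi> i. \<bar>p $ i\<bar>) + (\<chi> i. \<bar>h $ i\<bar>)) n) UNIV"
      by (simp add: f_def abs_mult abs_taylor_term abs_monomial mult.assoc)
  next
    have "(\<lambda>n. \<bar>a n\<bar> * monomial (\<chi> i. \<rho> + \<delta>) n) summable_on UNIV"
      using a \<sigma> assms(4) by (simp add: cube_summable_def)
    thus "(\<lambda>n. \<bar>a n\<bar> * monomial ((\<chi> i. \<bar>p $ i\<bar>) + (\<chi> i. \<bar>h $ i\<bar>)) n) summable_on UNIV"
    proof (rule summable_on_comparison_test)
      fix n
      show "\<bar>a n\<bar> * monomial ((\<chi> i. \<bar>p $ i\<bar>) + (\<chi> i. \<bar>h $ i\<bar>)) n \<le> \<bar>a n\<bar> * monomial (\<chi> i. \<rho> + \<delta>) n"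
        using p h by (intro mult_left_mono monomial_mono) (auto intro: add_mono)
      show "0 \<le> \<bar>a n\<bar> * monomial ((\<chi> i. \<bar>p $ i\<bar>) + (\<chi> i. \<bar>h $ i\<bar>)) n"
        by (intro mult_nonneg_nonneg monomial_nonneg) auto
    qed
  qed auto
  hence f: "f summable_on (UNIV \<times> UNIV)" by (subst summable_on_iff_abs_summable_on_real) simp
  have r: "\<bar>(p + h) $ i\<bar> < 1" for i using p[of i] h[of i] assms(4) unfolding vector_add_component by linarith
  have "((\<lambda>n. a n * monomial (p + h) n) has_sum infsum f (UNIV \<times> UNIV)) UNIV"
  proof (rule has_sum_SigmaD[OF has_sum_infsum[OF f]])
    fix n
    show "((\<lambda>k. f (n, k)) has_sum a n * monomial (p + h) n) UNIV"
      unfolding f_def prod.case mult.assoc by (intro has_sum_cmult_right monomial_add)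
  qed
  hence "infsum f (UNIV \<times> UNIV) = power_sum a (p + h)" by (rule has_sum_unique[OF _ has_sum_power_sum[OF a r]])
  hence sum: "(f has_sum power_sum a (p + h)) (UNIV \<times> UNIV)" using has_sum_infsum[OF f] by (simp only:)
  show "((\<lambda>k. (\<Sum>\<^sub>\<infinity>n. a n * taylor_term p n k) * monomial h k) has_sum power_sum a (p + h)) UNIV"
  proof (rule has_sum_SigmaD[OF has_sum_swap[THEN iffD1, OF sum]])
    fix k
    have "(\<lambda>(k, n). f (n, k)) summable_on (UNIV \<times> UNIV)" using f summable_on_swap by blast
    from summable_on_SigmaD1[OF this, of k] have "(\<lambda>n. f (n, k)) summable_on UNIV" by simp
    from has_sum_infsum[OF this]
    show "((\<lambda>n. (\<lambda>(x, y). f (y, x)) (k, n)) has_sum (\<Sum>\<^sub>\<infinity>n. a n * taylor_term p n k) * monomial h k) UNIV"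
      by (simp add: f_def infsum_cmult_left')
  qed
  have "(\<lambda>(k, n). \<bar>f (n, k)\<bar>) summable_on (UNIV \<times> UNIV)" using abs summable_on_swap[of "\<lambda>x. \<bar>f x\<bar>"] by blast
  from summable_on_SigmaD1[OF this, of k] show "(\<lambda>n. \<bar>a n * taylor_term p n k\<bar> * \<bar>monomial h k\<bar>) summable_on UNIV"
    by (simp add: f_def abs_mult)
qed

lemma real_analytic_on_cube:
  fixes a :: "nat^3 \<Rightarrow> real"
  assumes a: "cube_summable a"
  shows "real_analytic_on (power_sum a) open_cube"
  unfolding real_analytic_on_def
proof
  fix p :: "real^3" assume "p \<in> open_cube"
  hence "\<And>i. \<bar>p $ i\<bar> < 1" by (simp add: abs_less_iff minus_less_iff)
  then obtain \<rho> where \<rho>: "0 \<le> \<rho>" "\<rho> < 1" "\<And>i. \<bar>p $ i\<bar> \<le> \<rho>" using cube_point_radius by blast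
  define \<delta> where "\<delta> = (1 - \<rho>) / 2"
  have \<delta>: "0 < \<delta>" "\<rho> + \<delta> < 1" using \<rho> by (auto simp: \<delta>_def field_simps)
  show "\<exists>\<epsilon>>0. \<exists>c. \<forall>r\<in>ball p \<epsilon>. ((\<lambda>n. c n * monomial (r - p) n) has_sum power_sum a r) UNIV"
  proof (intro exI[of _ \<delta>] conjI exI[of _ "\<lambda>k. \<Sum>\<^sub>\<infinity>n. a n * taylor_term p n k"] ballI)
    fix r assume r: "r \<in> ball p \<delta>"
    have "\<bar>(r - p) $ i\<bar> \<le> \<delta>" for i
      using component_le_norm_cart[of "r - p" i] r by (auto simp: dist_norm norm_minus_commute)
    from power_sum_recentre(1)[OF a \<rho>(3) this \<delta>(2)]
    show "((\<lambda>k. (\<Sum>\<^sub>\<infinity>n. a n * taylor_term p n k) * monomial (r - p) k) has_sum power_sum a r) UNIV" by simp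
  qed (rule \<delta>(1))
qed

section \<open>Differentiation term by term\<close>

lemma has_sum_shift_iff:
  fixes f :: "nat^'n \<Rightarrow> real"
  assumes "\<And>n. n $ l = 0 \<Longrightarrow> f n = 0"
  shows "(f has_sum S) UNIV \<longleftrightarrow> ((\<lambda>n. f (n + axis l 1)) has_sum S) UNIV"
proof -
  have "(f has_sum S) UNIV \<longleftrightarrow> (f has_sum S) (range (\<lambda>n. n + axis l 1))"
  proof (rule has_sum_cong_neutral)
    fix n assume n: "n \<in> UNIV - range (\<lambda>n. n + axis l (1::nat))"
    have "n $ l = 0"
    proof (rule ccontr)
      assume "n $ l \<noteq> 0"
      hence "n = (n - axis l 1) + axis l 1" by (simp add: vec_eq_iff axis_def)
      thus False using n by blast
    qed
    thus "f n = 0" by (rule assms)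
  qed auto
  also have "\<dots> \<longleftrightarrow> ((f \<circ> (\<lambda>n. n + axis l 1)) has_sum S) UNIV"
    by (rule has_sum_reindex) (simp add: inj_on_def)
  finally show ?thesis by (simp add: comp_def)
qed

lemma taylor_term_axis:
  fixes n :: "nat^'n"
  shows   "taylor_term p (n + axis l 1) (axis l 1) = (real (n $ l) + 1) * monomial p n"
proof -
  have "taylor_term p (n + axis l 1) (axis l 1) = (\<Prod>i\<in>UNIV. (if i = l then real (n $ l) + 1 else 1) * p $ i ^ n $ i)"
    unfolding taylor_term_def by (intro prod.cong) (auto simp: axis_def)
  thus ?thesis by (simp add: prod.distrib monomial_def)
qed

lemma taylor_term_axis_0: "n $ l = 0 \<Longrightarrow> taylor_term p n (axis l 1) = 0" for n :: "nat^'n"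
  unfolding taylor_term_def by (intro prod_zero) (simp, rule bexI[of _ l], simp_all)

lemma monomial_shift: "monomial r (n + axis l 1) = r $ l * monomial r n" for r :: "real^'n"
proof -
  have "monomial r (n + axis l 1) = (\<Prod>i\<in>UNIV. (if i = l then r $ l else 1) * r $ i ^ n $ i)"
    unfolding monomial_def by (intro prod.cong) (auto simp: axis_def)
  thus ?thesis by (simp add: prod.distrib monomial_def)
qed

lemma has_sum_shift_coeff:
  fixes r :: "real^'n"
  assumes "((\<lambda>n. a n * monomial r n) has_sum S) UNIV"
  shows "((\<lambda>n. shift_coeff l a n * monomial r n) has_sum r $ l * S) UNIV"
proof (subst has_sum_shift_iff[of l])
  have "shift_coeff l a (n + axis l 1) * monomial r (n + axis l 1) = r $ l * (a n * monomial r n)" for n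
  proof -
    have "(n + axis l 1) $ l \<noteq> 0" by simp
    thus ?thesis unfolding shift_coeff_def monomial_shift by simp
  qed
  thus "((\<lambda>n. shift_coeff l a (n + axis l 1) * monomial r (n + axis l 1)) has_sum r $ l * S) UNIV"
    using has_sum_cmult_right[OF assms, of "r $ l"] by simp
qed (simp add: shift_coeff_def)

text \<open>Up to a translation of the index, the differentiated series is the column of the
  recentred double series that belongs to the l-th unit vector.\<close>

lemma cube_summable_deriv_coeff:
  assumes a: "cube_summable a"
  shows "cube_summable (deriv_coeff l a)"
  unfolding cube_summable_def
proof (intro allI impI)
  fix \<rho> :: real assume \<rho>: "0 \<le> \<rho> \<and> \<rho> < 1"
  define \<delta> where "\<delta> = (1 - \<rho>) / 2"
  have \<delta>: "0 < \<delta>" "\<rho> + \<delta> < 1" using \<rho> by (auto simp: \<delta>_def field_simps)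
  have "monomial (\<chi> i. \<delta>) (axis l 1) > 0" unfolding monomial_def using \<delta> by (intro prod_pos) auto
  moreover have "(\<lambda>n. \<bar>a n * taylor_term (\<chi> i. \<rho>) n (axis l 1)\<bar> * \<bar>monomial (\<chi> i. \<delta>) (axis l 1)\<bar>) summable_on UNIV"
    by (rule power_sum_recentre(2)[OF a _ _ \<delta>(2)]) (use \<rho> \<delta> in auto)
  ultimately have "(\<lambda>n. \<bar>a n * taylor_term (\<chi> i. \<rho>) n (axis l 1)\<bar>) summable_on UNIV"
    by (subst (asm) summable_on_cmult_left') auto
  then obtain S where "((\<lambda>n. \<bar>a n * taylor_term (\<chi> i. \<rho>) n (axis l 1)\<bar>) has_sum S) UNIV"
    by (auto simp: summable_on_def)
  hence "((\<lambda>n. \<bar>a (n + axis l 1) * taylor_term (\<chi> i. \<rho>) (n + axis l 1) (axis l 1)\<bar>) has_sum S) UNIV"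
    by (subst (asm) has_sum_shift_iff[of l]) (auto simp: taylor_term_axis_0 simp del: One_nat_def)
  moreover have "\<bar>a (n + axis l 1) * taylor_term (\<chi> i. \<rho>) (n + axis l 1) (axis l 1)\<bar> = \<bar>deriv_coeff l a n\<bar> * monomial (\<chi> i. \<rho>) n" for n
    using monomial_nonneg[of "\<chi> i. \<rho>" n] \<rho> by (simp add: taylor_term_axis deriv_coeff_def abs_mult del: One_nat_def)
  ultimately show "(\<lambda>n. \<bar>deriv_coeff l a n\<bar> * monomial (\<chi> i. \<rho>) n) summable_on UNIV"
    by (auto simp: summable_on_def)
qed

lemma monomial_axis:
  "monomial (t *\<^sub>R axis l 1) (axis l m) = t ^ m"
  "k \<notin> range (axis l) \<Longrightarrow> monomial (t *\<^sub>R axis l 1) k = 0"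
proof -
  have "monomial (t *\<^sub>R axis l 1) (axis l m) = (\<Prod>i\<in>UNIV. if i = l then t ^ m else 1)"
    unfolding monomial_def by (intro prod.cong) (auto simp: axis_def)
  thus "monomial (t *\<^sub>R axis l 1) (axis l m) = t ^ m" by simp
  assume k: "k \<notin> range (axis l)"
  obtain i where "i \<noteq> l" "k $ i \<noteq> 0"
  proof (rule ccontr)
    assume *: "\<not> thesis"
    have "k = axis l (k $ l)" using * that by (auto simp: vec_eq_iff axis_def)
    thus False using k by blast
  qed
  thus "monomial (t *\<^sub>R axis l 1) k = 0"
    unfolding monomial_def by (intro prod_zero) (auto intro!: bexI[of _ i] simp: axis_def)
qed

text \<open>On a line in direction l only the multiples of the l-th unit vector contribute to the
  recentred series, which leaves a power series in one variable. \<open>g\<close> is tied to the sum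
  in the open cube alone, so that the result can be applied again to a derivative.\<close>

lemma partial_deriv_power_sum:
  fixes p :: "real^'n"
  assumes a: "cube_summable a" and p: "\<And>i. \<bar>p $ i\<bar> < 1"
    and g: "\<And>r. (\<And>i. \<bar>r $ i\<bar> < 1) \<Longrightarrow> g r = power_sum a r"
  shows "partial_deriv l g p = power_sum (deriv_coeff l a) p"
proof -
  obtain \<rho> where \<rho>: "0 \<le> \<rho>" "\<rho> < 1" "\<And>i. \<bar>p $ i\<bar> \<le> \<rho>" using cube_point_radius[OF p] by blast
  define \<delta> where "\<delta> = (1 - \<rho>) / 2"
  have \<delta>: "0 < \<delta>" "\<rho> + \<delta> < 1" using \<rho> by (auto simp: \<delta>_def field_simps)
  define c where "c k = (\<Sum>\<^sub>\<infinity>n. a n * taylor_term p n k)" for k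
  have line: "(\<lambda>m. c (axis l m) * t ^ m) sums g (p + t *\<^sub>R axis l 1)" if t: "\<bar>t\<bar> \<le> \<delta>" for t
  proof -
    have h: "\<bar>(t *\<^sub>R axis l 1) $ i\<bar> \<le> \<delta>" for i using t \<delta> by (simp add: axis_def)
    have "\<bar>(p + t *\<^sub>R axis l 1) $ i\<bar> < 1" for i
      using h[of i] \<rho>(3)[of i] \<delta>(2) unfolding vector_add_component by linarith
    hence "g (p + t *\<^sub>R axis l 1) = power_sum a (p + t *\<^sub>R axis l 1)" by (rule g)
    hence "((\<lambda>k. c k * monomial (t *\<^sub>R axis l 1) k) has_sum g (p + t *\<^sub>R axis l 1)) UNIV"
      using power_sum_recentre(1)[OF a \<rho>(3) h \<delta>(2)] by (simp add: c_def)
    also have "?this \<longleftrightarrow> ((\<lambda>k. c k * monomial (t *\<^sub>R axis l 1) k) has_sum g (p + t *\<^sub>R axis l 1)) (range (axis l))"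
      by (rule has_sum_cong_neutral) (auto simp: monomial_axis)
    also have "\<dots> \<longleftrightarrow> (((\<lambda>k. c k * monomial (t *\<^sub>R axis l 1) k) \<circ> axis l) has_sum g (p + t *\<^sub>R axis l 1)) UNIV"
      by (rule has_sum_reindex) (auto simp: inj_on_def axis_eq_axis)
    finally show ?thesis by (intro has_sum_imp_sums) (simp add: comp_def monomial_axis)
  qed
  have "((\<lambda>t. \<Sum>m. c (axis l m) * t ^ m) has_real_derivative (\<Sum>m. diffs (\<lambda>m. c (axis l m)) m * 0 ^ m)) (at 0)"
    by (rule termdiffs_strong[of _ \<delta>]) (use line[of \<delta>] \<delta> in \<open>auto intro: sums_summable\<close>)
  hence "((\<lambda>t. g (p + t *\<^sub>R axis l 1)) has_real_derivative (\<Sum>m. diffs (\<lambda>m. c (axis l m)) m * 0 ^ m)) (at 0)"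
    by (rule has_field_derivative_transform_within_open[of _ _ _ "ball 0 \<delta>"])
      (use \<delta> in \<open>auto intro!: sums_unique[symmetric] line\<close>)
  hence "partial_deriv l g p = c (axis l 1)"
    unfolding partial_deriv_def by (simp add: DERIV_imp_deriv diffs_def)
  also have "\<dots> = power_sum (deriv_coeff l a) p"
  proof -
    have "(\<lambda>n. deriv_coeff l a n * monomial p n) = (\<lambda>n. a (n + axis l 1) * taylor_term p (n + axis l 1) (axis l 1))"
      by (simp add: fun_eq_iff taylor_term_axis deriv_coeff_def del: One_nat_def)
    hence "((\<lambda>n. a (n + axis l 1) * taylor_term p (n + axis l 1) (axis l 1)) has_sum power_sum (deriv_coeff l a) p) UNIV"
      using has_sum_power_sum[OF cube_summable_deriv_coeff[OF a] p, of l] by simp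
    hence "((\<lambda>n. a n * taylor_term p n (axis l 1)) has_sum power_sum (deriv_coeff l a) p) UNIV"
      by (subst has_sum_shift_iff[of l]) (auto simp: taylor_term_axis_0 simp del: One_nat_def)
    thus ?thesis unfolding c_def by (rule infsumI)
  qed
  finally show ?thesis .
qed

lemma sum3_summable:
  fixes f :: "nat^3 \<Rightarrow> real"
  assumes "\<And>n. 0 \<le> f n" and le: "\<And>N. (\<Sum>i<N. \<Sum>j<N. \<Sum>k<N. f (vector [i, j, k])) \<le> T"
  shows "f summable_on UNIV"
proof (rule nonneg_bdd_above_summable_on)
  define v where "v = (\<lambda>(i, j, k). vector [i, j, k] :: nat^3)"
  have inj: "inj v" by (auto simp: inj_on_def v_def vec_eq_iff forall_3)
  show "bdd_above (sum f ` {F. F \<subseteq> UNIV \<and> finite F})"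
  proof (rule bdd_aboveI2)
    fix F :: "(nat^3) set" assume "F \<in> {F. F \<subseteq> UNIV \<and> finite F}"
    hence F: "finite F" by simp
    define N where "N = Suc (\<Sum>n\<in>F. n $ 1 + n $ 2 + n $ 3)"
    have N: "n $ 1 < N \<and> n $ 2 < N \<and> n $ 3 < N" if "n \<in> F" for n :: "nat^3"
      using member_le_sum[OF that, of "\<lambda>n::nat^3. n $ 1 + n $ 2 + n $ 3"] F by (simp add: N_def)
    have "F \<subseteq> v ` ({..<N} \<times> {..<N} \<times> {..<N})"
    proof
      fix n assume n: "n \<in> F"
      have "n = v (n $ 1, n $ 2, n $ 3)" by (simp add: v_def vec_eq_iff forall_3)
      thus "n \<in> v ` ({..<N} \<times> {..<N} \<times> {..<N})" using N[OF n] by blast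
    qed
    hence "sum f F \<le> sum f (v ` ({..<N} \<times> {..<N} \<times> {..<N}))" using assms(1) by (intro sum_mono2) auto
    also have "\<dots> = (\<Sum>i<N. \<Sum>j<N. \<Sum>k<N. f (vector [i, j, k]))"
      by (subst sum.reindex[OF inj_on_subset[OF inj]]) (simp_all add: v_def sum.cartesian_product split_def)
    finally show "sum f F \<le> T" using le[of N] by linarith
  qed
qed (rule assms(1))

lemma monomial_3: "monomial r (vector [i, j, k]) = r $ 1 ^ i * r $ 2 ^ j * r $ 3 ^ k" for r :: "real^3"
proof -
  have "monomial r (vector [i, j, k]) = (\<Prod>m\<in>{1, 2, 3}. r $ m ^ (vector [i, j, k] :: nat^3) $ m)"
    unfolding monomial_def UNIV_3 ..
  also have "\<dots> = r $ 1 ^ i * (r $ 2 ^ j * r $ 3 ^ k)"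
    by (subst prod.insert, simp, simp)+ simp
  finally show ?thesis by (simp only: mult.assoc)
qed

lemma cube_summable_growth:
  fixes a :: "nat^3 \<Rightarrow> real"
  assumes le: "\<And>i j k. \<bar>a (vector [i, j, k])\<bar> \<le> C * ((real i + 1) * (real j + 1) * (real k + 1)) ^ q"
  shows "cube_summable a"
  unfolding cube_summable_def
proof (intro allI impI)
  fix \<rho> :: real assume \<rho>: "0 \<le> \<rho> \<and> \<rho> < 1"
  define f where "f i = (real i + 1) ^ q * \<rho> ^ i" for i
  have C: "0 \<le> C" using le[of 0 0 0] abs_ge_zero[of "a (vector [0, 0, 0])"] by simp
  have f0: "0 \<le> f i" for i using \<rho> by (simp add: f_def)
  have "summable f"
  proof (cases "\<rho> = 0")
    case True thus ?thesis by (intro summable_finite[of "{0}"]) (auto simp: f_def)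
  next
    case False
    \<comment> \<open>Half of the available decay absorbs the polynomial factor: exp \<epsilon>
      times \<rho> is still exp (-\<epsilon>).\<close>
    define \<epsilon> where "\<epsilon> = - ln \<rho> / 2"
    have \<epsilon>: "0 < \<epsilon>" using \<rho> False by (simp add: \<epsilon>_def ln_less_zero)
    define K where "K = fact q / \<epsilon> ^ q * exp \<epsilon>"
    have eq: "exp \<epsilon> * \<rho> = exp (- \<epsilon>)"
      using \<rho> False exp_add[of \<epsilon> "ln \<rho>"] by (simp add: \<epsilon>_def)
    have "f i \<le> K * exp (- \<epsilon>) ^ i" for i
    proof -
      have "f i \<le> (K * exp (\<epsilon> * real i)) * \<rho> ^ i"
        unfolding f_def K_def using one_plus_power_le_exp[of "real i" \<epsilon> q] \<epsilon> \<rho>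
        by (intro mult_right_mono) (auto simp: add.commute)
      also have "exp (\<epsilon> * real i) = exp \<epsilon> ^ i" by (rule exp_of_nat2_mult)
      also have "K * exp \<epsilon> ^ i * \<rho> ^ i = K * (exp \<epsilon> * \<rho>) ^ i" by (simp add: power_mult_distrib)
      finally show ?thesis by (simp only: eq)
    qed
    moreover have "summable (\<lambda>i. K * exp (- \<epsilon>) ^ i)" using \<epsilon> by (intro summable_mult summable_geometric) simp
    ultimately show ?thesis
      using f0 by - (rule summable_comparison_test'[where N = 0 and g = "\<lambda>i. K * exp (- \<epsilon>) ^ i"], simp_all)
  qed
  hence S: "(\<Sum>i<N. f i) \<le> suminf f" for N using f0 by (intro sum_le_suminf) auto
  show "(\<lambda>n. \<bar>a n\<bar> * monomial (\<chi> i. \<rho>) n) summable_on UNIV"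
  proof (rule sum3_summable)
    show "0 \<le> \<bar>a n\<bar> * monomial (\<chi> i. \<rho>) n" for n using \<rho> by (intro mult_nonneg_nonneg monomial_nonneg) auto
    fix N
    have "(\<Sum>i<N. \<Sum>j<N. \<Sum>k<N. \<bar>a (vector [i, j, k])\<bar> * monomial (\<chi> i. \<rho>) (vector [i, j, k] :: nat^3)) \<le>
      (\<Sum>i<N. \<Sum>j<N. \<Sum>k<N. C * (f i * f j * f k))"
    proof (intro sum_mono)
      fix i j k
      have "\<bar>a (vector [i, j, k])\<bar> * (\<rho> ^ i * \<rho> ^ j * \<rho> ^ k) \<le> C * ((real i + 1) * (real j + 1) * (real k + 1)) ^ q * (\<rho> ^ i * \<rho> ^ j * \<rho> ^ k)"
        using \<rho> by (intro mult_right_mono le) auto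
      also have "\<dots> = C * (f i * f j * f k)" unfolding f_def power_mult_distrib by (simp only: mult_ac)
      finally show "\<bar>a (vector [i, j, k])\<bar> * monomial (\<chi> i. \<rho>) (vector [i, j, k] :: nat^3) \<le> C * (f i * f j * f k)"
        by (simp add: monomial_3)
    qed
    also have "\<dots> = C * (\<Sum>i<N. f i) ^ 3"
    proof -
      define S where "S = (\<Sum>i<N. f i)"
      have "(\<Sum>k<N. C * (f i * f j * f k)) = C * (f i * (f j * S))" for i j
        unfolding S_def by (simp only: sum_distrib_left mult.assoc)
      moreover have "(\<Sum>j<N. C * (f i * (f j * S))) = C * (f i * (S * S))" for i
        unfolding S_def sum_distrib_right[of f] by (simp only: sum_distrib_left)
      moreover have "(\<Sum>i<N. C * (f i * (S * S))) = C * (S * (S * S))"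
        unfolding sum_distrib_left[symmetric] sum_distrib_right[symmetric] S_def ..
      ultimately show ?thesis by (simp add: S_def[symmetric] power3_eq_cube)
    qed
    also have "\<dots> \<le> C * suminf f ^ 3"
      using C S f0 by (intro mult_left_mono power_mono sum_nonneg) auto
    finally show "(\<Sum>i<N. \<Sum>j<N. \<Sum>k<N. \<bar>a (vector [i, j, k])\<bar> * monomial (\<chi> i. \<rho>) (vector [i, j, k] :: nat^3)) \<le> C * suminf f ^ 3" .
  qed
qed

section \<open>The differential equations\<close>

lemma zero_extension_int: "zero_extension a (\<chi> i. int (n $ i)) = a n" for n :: "nat^'n"
  by (simp add: zero_extension_def)

text \<open>Translation of the extended array and \<open>shift_coeff\<close> agree on the boundary
  of the octant too, where the former steps outside and the latter tests for zero. Through this the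
  defining system becomes one of arrays on natural indices.\<close>

lemma zero_extension_shift:
  fixes m :: "int^'n"
  shows "zero_extension a (m - axis k 1) = zero_extension (shift_coeff k a) m"
proof (cases "\<forall>i. 0 \<le> m $ i")
  case False
  then obtain i where "m $ i < 0" by (auto simp: not_le)
  moreover from this have "(m - axis k 1) $ i < 0" by (auto simp: axis_def)
  ultimately have "\<not> (\<forall>i. 0 \<le> m $ i)" "\<not> (\<forall>i. 0 \<le> (m - axis k 1) $ i)" by (metis not_le)+
  thus ?thesis unfolding zero_extension_def by (simp only: if_False)
next
  case True
  show ?thesis
  proof (cases "m $ k = 0")
    case k0: True
    hence "(m - axis k 1) $ k < 0" by simp
    hence "\<not> (\<forall>i. 0 \<le> (m - axis k 1) $ i)" by (metis not_le)
    hence "zero_extension a (m - axis k 1) = 0" unfolding zero_extension_def by (simp only: if_False)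
    moreover have "zero_extension (shift_coeff k a) m = 0" using k0 by (simp add: zero_extension_def shift_coeff_def)
    ultimately show ?thesis by (simp only:)
  next
    case False
    have k: "0 < m $ k" using True False by (metis less_le)
    have "\<forall>i. 0 \<le> (m - axis k 1) $ i" using True k by (auto simp: axis_def)
    moreover have "(\<chi> i. nat ((m - axis k 1) $ i)) = (\<chi> i. nat (m $ i)) - axis k 1"
      by (auto simp: vec_eq_iff axis_def nat_diff_distrib)
    moreover have "(\<chi> i. nat (m $ i)) $ k \<noteq> (0::nat)" using k by simp
    ultimately show ?thesis using True unfolding zero_extension_def shift_coeff_def by simp
  qed
qed

lemma zero_extension_add_axis:
  fixes n :: "nat^'n"
  shows "zero_extension a ((\<chi> i. int (n $ i)) + axis l 1) = a (n + axis l 1)"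
proof -
  have "(\<chi> i. int (n $ i)) + axis l 1 = (\<chi> i. int ((n + axis l 1) $ i))"
    by (simp add: vec_eq_iff axis_def)
  thus ?thesis by (simp only: zero_extension_int)
qed

lemma minus_axis_plus_axis: "n $ l \<noteq> 0 \<Longrightarrow> n - axis l 1 + axis l 1 = n" for n :: "nat^'n"
  by (simp add: vec_eq_iff axis_def)

text \<open>The Euler operator in the l-th variable.\<close>

lemma shift_deriv_coeff: "shift_coeff l (deriv_coeff l a) n = real (n $ l) * a n"
proof (cases "n $ l = 0")
  case False
  have "real ((n - axis l 1) $ l) + 1 = real (n $ l)" using False by simp
  thus ?thesis using False unfolding shift_coeff_def deriv_coeff_def by (simp only: minus_axis_plus_axis[OF False] if_False)
qed (simp add: shift_coeff_def)

lemma shift_shift_deriv_deriv_coeff: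
  "shift_coeff l (shift_coeff l (deriv_coeff l (deriv_coeff l a))) n = (real (n $ l) - 1) * real (n $ l) * a n"
proof (cases "n $ l = 0")
  case False
  have "real ((n - axis l 1) $ l) = real (n $ l) - 1" using False by simp
  thus ?thesis using False
    unfolding shift_coeff_def[of l "shift_coeff l (deriv_coeff l (deriv_coeff l a))"] shift_deriv_coeff deriv_coeff_def[of l a]
    by (simp only: minus_axis_plus_axis[OF False] if_False) simp
qed (simp add: shift_coeff_def)

lemma shift_deriv_coeff_commute:
  assumes "j \<noteq> k"
  shows "shift_coeff k (deriv_coeff j a) = deriv_coeff j (shift_coeff k a)"
proof
  fix n
  show "shift_coeff k (deriv_coeff j a) n = deriv_coeff j (shift_coeff k a) n"
  proof (cases "n $ k = 0")
    case True thus ?thesis using assms by (simp add: shift_coeff_def deriv_coeff_def axis_def)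
  next
    case False
    have "n - axis k 1 + axis j 1 = n + axis j 1 - axis k 1" using False assms by (auto simp: vec_eq_iff axis_def)
    moreover have "(n - axis k 1) $ j = n $ j" "(n + axis j 1) $ k = n $ k" using assms by (simp_all add: axis_def)
    ultimately show ?thesis using False unfolding shift_coeff_def deriv_coeff_def by (simp only: if_False)
  qed
qed

lemma rainbow_pde:
  fixes A B :: "nat^3 \<Rightarrow> real" and r :: "real^3" and j k l :: 3
  assumes arr: "rainbow_arrays \<beta> A B" and A: "cube_summable A" and B: "cube_summable B"
    and jkl: "{j, k, l} = {1, 2, 3}" and r: "\<And>i. \<bar>r $ i\<bar> < 1"
  defines "F \<equiv> power_sum A" and "G \<equiv> power_sum B"
  shows "r $ l * (1 - r $ l) * partial_deriv l (partial_deriv l F) r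
          + (2 * \<beta> - 2 * r $ l) * partial_deriv l F r - \<beta> * (1 - \<beta>) * F r
        = (1 - r $ j) * (1 - r $ k) * G r"
    and "2 * r $ j * r $ k * partial_deriv j (partial_deriv k F) r
          + \<beta> * r $ j * partial_deriv j F r + \<beta> * r $ k * partial_deriv k F r
          - \<beta> * r $ l * partial_deriv l F r
        = (r $ l * (1 + r $ j * r $ k) - (r $ j + r $ k)) * G r"
proof -
  have jk: "j \<noteq> k"
  proof
    assume "j = k"
    hence "{1, 2, 3} = {k, l}" using jkl by simp
    hence "card {1, 2, 3 :: 3} \<le> 2" by (simp add: card_insert_if)
    thus False by simp
  qed
  \<comment> \<open>\<open>H\<close> comes with rules for sums, multiples and shifts, so each side
    of an equation is the sum of one explicit array, and the rainbow system identifies the arrays.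
    Differences are written with a factor -1 to fit these rules.\<close>
  define H where "H a S \<longleftrightarrow> ((\<lambda>n. a n * monomial r n) has_sum S) UNIV" for a S
  have Hadd: "H a S \<Longrightarrow> H b T \<Longrightarrow> H (\<lambda>n. a n + b n) (S + T)" for a b S T
    unfolding H_def by (simp add: distrib_right has_sum_add)
  have Hcmult: "H a S \<Longrightarrow> H (\<lambda>n. c * a n) (c * S)" for a S c
    unfolding H_def mult.assoc by (rule has_sum_cmult_right)
  have Hshift: "H a S \<Longrightarrow> H (shift_coeff i a) (r $ i * S)" for a S i
    unfolding H_def by (rule has_sum_shift_coeff)
  have Hunique: "H a S \<Longrightarrow> H a T \<Longrightarrow> S = T" for a S T
    unfolding H_def by (rule has_sum_unique)
  have HF: "H A (F r)" and HG: "H B (G r)"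
    unfolding H_def F_def G_def by (rule has_sum_power_sum[OF A r], rule has_sum_power_sum[OF B r])
  have d1: "partial_deriv i F s = power_sum (deriv_coeff i A) s" if "\<And>i. \<bar>s $ i\<bar> < 1" for i and s :: "real^3"
    by (rule partial_deriv_power_sum[OF A that]) (simp add: F_def)
  have d2: "partial_deriv i' (partial_deriv i F) r = power_sum (deriv_coeff i' (deriv_coeff i A)) r" for i i'
    by (rule partial_deriv_power_sum[OF cube_summable_deriv_coeff[OF A] r]) (rule d1)
  have H1: "H (deriv_coeff i A) (partial_deriv i F r)" for i
    unfolding d1[OF r] H_def by (rule has_sum_power_sum[OF cube_summable_deriv_coeff[OF A] r])
  have H2: "H (deriv_coeff i' (deriv_coeff i A)) (partial_deriv i' (partial_deriv i F) r)" for i i'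
    unfolding d2 H_def by (rule has_sum_power_sum[OF cube_summable_deriv_coeff[OF cube_summable_deriv_coeff[OF A]] r])
  have arr1: "(real (n $ l) + 1) * (real (n $ l) + 2 * \<beta>) * A (n + axis l 1) - (real (n $ l) + \<beta>) * (real (n $ l) + 1 - \<beta>) * A n
      = B n - shift_coeff j B n - shift_coeff k B n + shift_coeff j (shift_coeff k B) n" 
    and arr2: "(2 * real (n $ j) * real (n $ k) + \<beta> * real (n $ j) + \<beta> * real (n $ k) - \<beta> * real (n $ l)) * A n
      = shift_coeff l B n + shift_coeff l (shift_coeff j (shift_coeff k B)) n - shift_coeff j B n - shift_coeff k B n" for n
    using arr[unfolded rainbow_arrays_def Let_def, THEN conjunct2, THEN spec, THEN spec, THEN spec, THEN spec, THEN mp, OF jkl, of "\<chi> i. int (n $ i)"]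
    unfolding zero_extension_shift zero_extension_add_axis zero_extension_int vec_lambda_beta of_int_of_nat_eq by blast+
  define X Y where "X = partial_deriv l (partial_deriv l F) r" and "Y = partial_deriv l F r"
  have "H (\<lambda>n. shift_coeff l (deriv_coeff l (deriv_coeff l A)) n + (- 1 * shift_coeff l (shift_coeff l (deriv_coeff l (deriv_coeff l A))) n
      + (2 * \<beta> * deriv_coeff l A n + (- 2 * shift_coeff l (deriv_coeff l A) n + - (\<beta> * (1 - \<beta>)) * A n))))
    (r $ l * X + (- 1 * (r $ l * (r $ l * X)) + (2 * \<beta> * Y + (- 2 * (r $ l * Y) + - (\<beta> * (1 - \<beta>)) * F r))))"
    unfolding X_def Y_def by (intro Hadd Hcmult Hshift H1 H2 HF)
  moreover have "H (\<lambda>n. B n + (- 1 * shift_coeff j B n + (- 1 * shift_coeff k B n + shift_coeff j (shift_coeff k B) n)))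
    (G r + (- 1 * (r $ j * G r) + (- 1 * (r $ k * G r) + r $ j * (r $ k * G r))))"
    by (intro Hadd Hcmult Hshift HG)
  moreover have "(\<lambda>n. shift_coeff l (deriv_coeff l (deriv_coeff l A)) n + (- 1 * shift_coeff l (shift_coeff l (deriv_coeff l (deriv_coeff l A))) n
      + (2 * \<beta> * deriv_coeff l A n + (- 2 * shift_coeff l (deriv_coeff l A) n + - (\<beta> * (1 - \<beta>)) * A n))))
    = (\<lambda>n. B n + (- 1 * shift_coeff j B n + (- 1 * shift_coeff k B n + shift_coeff j (shift_coeff k B) n)))"
  proof
    fix n
    define x where "x = real (n $ l)"
    have "x * ((x + 1) * A (n + axis l 1)) + (- 1 * ((x - 1) * x * A n) + (2 * \<beta> * ((x + 1) * A (n + axis l 1)) + (- 2 * (x * A n) + - (\<beta> * (1 - \<beta>)) * A n)))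
      = (x + 1) * (x + 2 * \<beta>) * A (n + axis l 1) - (x + \<beta>) * (x + 1 - \<beta>) * A n" by (simp add: algebra_simps)
    with arr1[of n] show "shift_coeff l (deriv_coeff l (deriv_coeff l A)) n + (- 1 * shift_coeff l (shift_coeff l (deriv_coeff l (deriv_coeff l A))) n
      + (2 * \<beta> * deriv_coeff l A n + (- 2 * shift_coeff l (deriv_coeff l A) n + - (\<beta> * (1 - \<beta>)) * A n)))
      = B n + (- 1 * shift_coeff j B n + (- 1 * shift_coeff k B n + shift_coeff j (shift_coeff k B) n))"
      unfolding shift_shift_deriv_deriv_coeff shift_deriv_coeff deriv_coeff_def[of l A] x_def[symmetric] by linarith
  qed
  ultimately have "r $ l * X + (- 1 * (r $ l * (r $ l * X)) + (2 * \<beta> * Y + (- 2 * (r $ l * Y) + - (\<beta> * (1 - \<beta>)) * F r)))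
    = G r + (- 1 * (r $ j * G r) + (- 1 * (r $ k * G r) + r $ j * (r $ k * G r)))"
    by (simp only: Hunique)
  thus "r $ l * (1 - r $ l) * partial_deriv l (partial_deriv l F) r
          + (2 * \<beta> - 2 * r $ l) * partial_deriv l F r - \<beta> * (1 - \<beta>) * F r = (1 - r $ j) * (1 - r $ k) * G r"
    unfolding X_def[symmetric] Y_def[symmetric] by (simp add: algebra_simps)
  define Z where "Z = partial_deriv j (partial_deriv k F) r"
  have "H (\<lambda>n. 2 * shift_coeff j (shift_coeff k (deriv_coeff j (deriv_coeff k A))) n + (\<beta> * shift_coeff j (deriv_coeff j A) n
      + (\<beta> * shift_coeff k (deriv_coeff k A) n + - \<beta> * shift_coeff l (deriv_coeff l A) n)))
    (2 * (r $ j * (r $ k * Z)) + (\<beta> * (r $ j * partial_deriv j F r) + (\<beta> * (r $ k * partial_deriv k F r) + - \<beta> * (r $ l * partial_deriv l F r))))"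
    unfolding Z_def by (intro Hadd Hcmult Hshift H1 H2)
  moreover have "H (\<lambda>n. shift_coeff l B n + (shift_coeff l (shift_coeff j (shift_coeff k B)) n + (- 1 * shift_coeff j B n + - 1 * shift_coeff k B n)))
    (r $ l * G r + (r $ l * (r $ j * (r $ k * G r)) + (- 1 * (r $ j * G r) + - 1 * (r $ k * G r))))"
    by (intro Hadd Hcmult Hshift HG)
  moreover have "(\<lambda>n. 2 * shift_coeff j (shift_coeff k (deriv_coeff j (deriv_coeff k A))) n + (\<beta> * shift_coeff j (deriv_coeff j A) n
      + (\<beta> * shift_coeff k (deriv_coeff k A) n + - \<beta> * shift_coeff l (deriv_coeff l A) n)))
    = (\<lambda>n. shift_coeff l B n + (shift_coeff l (shift_coeff j (shift_coeff k B)) n + (- 1 * shift_coeff j B n + - 1 * shift_coeff k B n)))"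
  proof
    fix n
    define x y z where "x = real (n $ j)" and "y = real (n $ k)" and "z = real (n $ l)"
    have "2 * (x * (y * A n)) + (\<beta> * (x * A n) + (\<beta> * (y * A n) + - \<beta> * (z * A n))) = (2 * x * y + \<beta> * x + \<beta> * y - \<beta> * z) * A n"
      by (simp add: algebra_simps)
    with arr2[of n] show "2 * shift_coeff j (shift_coeff k (deriv_coeff j (deriv_coeff k A))) n + (\<beta> * shift_coeff j (deriv_coeff j A) n
      + (\<beta> * shift_coeff k (deriv_coeff k A) n + - \<beta> * shift_coeff l (deriv_coeff l A) n))
      = shift_coeff l B n + (shift_coeff l (shift_coeff j (shift_coeff k B)) n + (- 1 * shift_coeff j B n + - 1 * shift_coeff k B n))"
      unfolding shift_deriv_coeff_commute[OF jk] shift_deriv_coeff x_def[symmetric] y_def[symmetric] z_def[symmetric] by linarith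
  qed
  ultimately have "2 * (r $ j * (r $ k * Z)) + (\<beta> * (r $ j * partial_deriv j F r) + (\<beta> * (r $ k * partial_deriv k F r) + - \<beta> * (r $ l * partial_deriv l F r)))
    = r $ l * G r + (r $ l * (r $ j * (r $ k * G r)) + (- 1 * (r $ j * G r) + - 1 * (r $ k * G r)))"
    by (simp only: Hunique)
  thus "2 * r $ j * r $ k * partial_deriv j (partial_deriv k F) r
          + \<beta> * r $ j * partial_deriv j F r + \<beta> * r $ k * partial_deriv k F r - \<beta> * r $ l * partial_deriv l F r
        = (r $ l * (1 + r $ j * r $ k) - (r $ j + r $ k)) * G r"
    unfolding Z_def[symmetric] by (simp add: algebra_simps)
qed

section \<open>The boundary value\<close>

lemma binomial_series_pochhammer:
  fixes a t :: real
  assumes "\<bar>t\<bar> < 1"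
  shows "(\<lambda>n. pochhammer a n / fact n * t ^ n) sums (1 - t) powr (- a)"
proof -
  have "(\<lambda>n. (- a gchoose n) * (- t) ^ n) sums (1 + - t) powr (- a)"
    using assms by (intro gen_binomial_real) simp
  moreover have "(- a gchoose n) * (- t) ^ n = pochhammer a n / fact n * t ^ n" for n
  proof -
    have "(- a gchoose n) * (- t) ^ n = pochhammer a n / fact n * ((- 1) ^ n * (- t) ^ n)"
      unfolding gbinomial_pochhammer minus_minus by (simp only: times_divide_eq_left times_divide_eq_right mult_ac)
    also have "(- 1) ^ n * (- t) ^ n = t ^ n" unfolding power_mult_distrib[symmetric] by simp
    finally show ?thesis .
  qed
  ultimately show ?thesis by simp
qed

text \<open>
  Expand \<open>(1 - t) powr (-a)\<close> in Euler's integral. The dominating function exists since the binomial coefficients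
  are nonnegative for \<open>a \<ge> 0\<close> and absolutely summable for \<open>a < 0\<close>.
\<close>

lemma gauss_summation:
  fixes a b c :: real
  assumes b: "0 < b" "b < c" and abc: "a + b < c"
  shows "(\<lambda>n. pochhammer a n * pochhammer b n / (fact n * pochhammer c n)) sums
    (Gamma c * Gamma (c - a - b) / (Gamma (c - a) * Gamma (c - b)))"
proof -
  define e where "e n = pochhammer a n / fact n" for n
  define w where "w t = t powr (b - 1) * (1 - t) powr (c - b - 1)" for t
  define g where "g t = t powr (b - 1) * (1 - t) powr (c - a - b - 1)" for t
  have w0: "0 \<le> w t" for t by (simp add: w_def)
  have g0: "0 \<le> g t" for t by (simp add: g_def)
  have gw: "(1 - t) powr (- a) * w t = g t" for t
    by (simp add: g_def w_def powr_add[symmetric] algebra_simps)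
  have int_w: "((\<lambda>t. t ^ n * w t) has_integral Beta (b + real n) (c - b)) {0..1}" for n
  proof -
    have "((\<lambda>t. t powr (b + real n - 1) * (1 - t) powr (c - b - 1)) has_integral Beta (b + real n) (c - b)) {0..1}"
      using b by (intro has_integral_Beta_real) auto
    moreover have "t powr (b + real n - 1) * (1 - t) powr (c - b - 1) = t ^ n * w t" if "t \<in> {0..1}" for t
    proof (cases "t = 0")
      case False
      hence "t powr (b + real n - 1) = t ^ n * t powr (b - 1)"
        using that powr_add[of t "real n" "b - 1"] by (simp add: powr_realpow algebra_simps)
      thus ?thesis by (simp add: w_def)
    qed (simp add: w_def)
    ultimately show ?thesis by (rule has_integral_eq[rotated])
  qed
  have int_g: "(g has_integral Beta b (c - a - b)) {0..1}"
    unfolding g_def using b abc by (intro has_integral_Beta_real) auto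
  obtain M where M: "M \<ge> 0" "\<And>N t. 0 \<le> t \<Longrightarrow> t < 1 \<Longrightarrow> \<bar>\<Sum>n<N. e n * t ^ n\<bar> \<le> M + (1 - t) powr (- a)"
  proof (cases "0 \<le> a")
    case True
    have e0: "0 \<le> e n" for n unfolding e_def pochhammer_prod using True by (intro divide_nonneg_nonneg prod_nonneg) auto
    have "\<bar>\<Sum>n<N. e n * t ^ n\<bar> \<le> 0 + (1 - t) powr (- a)" if "0 \<le> t" "t < 1" for N t
    proof -
      have s: "(\<lambda>n. e n * t ^ n) sums (1 - t) powr (- a)"
        unfolding e_def using that by (intro binomial_series_pochhammer) simp
      have "(\<Sum>n<N. e n * t ^ n) \<le> (1 - t) powr (- a)"
        unfolding sums_unique[OF s] using that e0 by (intro sum_le_suminf sums_summable[OF s]) auto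
      moreover have "0 \<le> (\<Sum>n<N. e n * t ^ n)" using that e0 by (intro sum_nonneg) auto
      ultimately show ?thesis by simp
    qed
    thus ?thesis by (intro that[of 0]) auto
  next
    case False
    obtain C where C: "\<And>k. \<bar>pochhammer a k\<bar> / pochhammer 1 k \<le> C * (real k + 1) powr (a - 1)"
      using pochhammer_ratio_le[of 1 a] by auto
    have "summable (\<lambda>n. real n powr (a - 1))" using False by (subst summable_real_powr_iff) auto
    hence "summable (\<lambda>n. real (Suc n) powr (a - 1))" by (subst summable_Suc_iff)
    hence "summable (\<lambda>n. C * (real n + 1) powr (a - 1))" by (intro summable_mult) (simp add: add.commute)
    hence s: "summable (\<lambda>n. \<bar>e n\<bar>)"
      by (rule summable_comparison_test'[where N = 0]) (use C in \<open>simp add: e_def flip: pochhammer_fact\<close>)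
    have "\<bar>\<Sum>n<N. e n * t ^ n\<bar> \<le> (\<Sum>n. \<bar>e n\<bar>) + (1 - t) powr (- a)" if "0 \<le> t" "t < 1" for N t
    proof -
      have "\<bar>\<Sum>n<N. e n * t ^ n\<bar> \<le> (\<Sum>n<N. \<bar>e n * t ^ n\<bar>)" by (rule sum_abs)
      also have "\<dots> \<le> (\<Sum>n<N. \<bar>e n\<bar>)"
        using that by (intro sum_mono) (simp add: abs_mult mult_left_le power_le_one)
      also have "\<dots> \<le> (\<Sum>n. \<bar>e n\<bar>)" by (intro sum_le_suminf s) auto
      finally show ?thesis by (intro add_increasing2) auto
    qed
    thus ?thesis using suminf_nonneg[OF s] by (intro that[of "\<Sum>n. \<bar>e n\<bar>"]) auto
  qed
  define f where "f N t = (\<Sum>n<N. e n * (t ^ n * w t))" for N t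
  have int_f: "(f N has_integral (\<Sum>n<N. e n * Beta (b + real n) (c - b))) {0..1}" for N
    unfolding f_def by (intro has_integral_sum has_integral_mult_right int_w) simp
  have fe: "f N t = (\<Sum>n<N. e n * t ^ n) * w t" for N t
    unfolding f_def sum_distrib_right by (simp add: mult.assoc)
  \<comment> \<open>At the endpoint, where the binomial series may diverge, both integrands are 0
    because 0 to any real power is 0 by convention.\<close>
  have at1: "w 1 = 0" "g 1 = 0" by (simp_all add: w_def g_def)
  have "(\<lambda>N. integral {0..1} (f N)) \<longlonglongrightarrow> integral {0..1} g"
  proof (rule dominated_convergence(2)[where h = "\<lambda>t. M * (t ^ 0 * w t) + g t"])
    show "f N integrable_on {0..1}" for N using int_f by (rule has_integral_integrable)
    show "(\<lambda>t. M * (t ^ 0 * w t) + g t) integrable_on {0..1}"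
      by (rule has_integral_integrable[OF has_integral_add[OF has_integral_mult_right[OF int_w[of 0]] int_g]])
    show "norm (f N t) \<le> M * (t ^ 0 * w t) + g t" if "t \<in> {0..1}" for N t
    proof (cases "t = 1")
      case True thus ?thesis by (simp add: fe at1)
    next
      case False
      have "norm (f N t) = \<bar>\<Sum>n<N. e n * t ^ n\<bar> * w t" unfolding fe using w0[of t] by (simp add: abs_mult)
      also have "\<dots> \<le> (M + (1 - t) powr (- a)) * w t" using False that by (intro mult_right_mono M w0) auto
      also have "\<dots> = M * (t ^ 0 * w t) + g t" by (simp add: distrib_right gw)
      finally show ?thesis .
    qed
    show "(\<lambda>N. f N t) \<longlonglongrightarrow> g t" if "t \<in> {0..1}" for t
    proof (cases "t = 1")
      case True thus ?thesis by (simp add: fe at1)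
    next
      case False
      have "(\<lambda>n. e n * t ^ n) sums (1 - t) powr (- a)"
        unfolding e_def using False that by (intro binomial_series_pochhammer) auto
      hence "(\<lambda>N. (\<Sum>n<N. e n * t ^ n) * w t) \<longlonglongrightarrow> (1 - t) powr (- a) * w t"
        unfolding sums_def by (rule tendsto_mult_right)
      thus ?thesis by (simp only: fe gw)
    qed
  qed
  hence S: "(\<lambda>n. e n * Beta (b + real n) (c - b)) sums Beta b (c - a - b)"
    unfolding sums_def integral_unique[OF int_f] integral_unique[OF int_g] .
  have pos: "Gamma b > 0" "Gamma c > 0" "Gamma (c - b) > 0" using b by (auto intro: Gamma_real_pos)
  have nz: "b \<notin> \<int>\<^sub>\<le>\<^sub>0" "c \<notin> \<int>\<^sub>\<le>\<^sub>0" using b by (auto dest: nonpos_Ints_nonpos)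
  \<comment> \<open>The factor in Euler's integral that turns Beta values into quotients of
    Pochhammer symbols.\<close>
  define K where "K = Gamma c / (Gamma b * Gamma (c - b))"
  have "K * (e n * Beta (b + real n) (c - b)) = pochhammer a n * pochhammer b n / (fact n * pochhammer c n)" for n
  proof -
    have eq: "b + real n + (c - b) = c + real n" by simp
    have "K * (e n * Beta (b + real n) (c - b)) = e n * (Gamma (b + real n) / Gamma b) / (Gamma (c + real n) / Gamma c)"
      unfolding K_def Beta_def eq using pos by (simp add: mult_ac)
    also have "\<dots> = e n * pochhammer b n / pochhammer c n" by (simp only: pochhammer_Gamma[OF nz(1)] pochhammer_Gamma[OF nz(2)])
    finally show ?thesis by (simp add: e_def)
  qed
  moreover have "K * Beta b (c - a - b) = Gamma c * Gamma (c - a - b) / (Gamma (c - a) * Gamma (c - b))"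
    using pos by (simp add: K_def Beta_def mult_ac)
  ultimately show ?thesis using sums_mult[OF S, of K] by simp
qed

text \<open>A nonzero limit would bound |u n| below by a multiple of 1 / n, against the divergence
  of the harmonic series.\<close>

lemma summable_times_convergent_zero:
  fixes u :: "nat \<Rightarrow> real"
  assumes "summable (\<lambda>n. \<bar>u n\<bar>)" and lim: "(\<lambda>n. real n * u n) \<longlonglongrightarrow> c"
  shows "c = 0"
proof (rule ccontr)
  assume "c \<noteq> 0"
  hence "eventually (\<lambda>n. \<bar>c\<bar> / 2 < \<bar>real n * u n\<bar>) sequentially"
    by (intro order_tendstoD(1)[OF tendsto_rabs[OF lim]]) simp
  then obtain N where N: "\<And>n. n \<ge> N \<Longrightarrow> \<bar>c\<bar> / 2 < \<bar>real n * u n\<bar>" by (auto simp: eventually_sequentially)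
  have "summable (\<lambda>n. \<bar>c\<bar> / 2 * inverse (real n))"
  proof (rule summable_comparison_test'[OF assms(1), of N])
    fix n assume "N \<le> n"
    hence n: "\<bar>c\<bar> / 2 < real n * \<bar>u n\<bar>" using N[of n] by (simp add: abs_mult)
    hence "n \<noteq> 0" using \<open>c \<noteq> 0\<close> by (intro notI) simp
    thus "norm (\<bar>c\<bar> / 2 * inverse (real n)) \<le> \<bar>u n\<bar>" using n by (simp add: field_simps abs_mult)
  qed
  hence "summable (\<lambda>n. inverse (real n))" using \<open>c \<noteq> 0\<close> by (subst (asm) summable_cmult_iff) simp
  thus False using not_summable_harmonic by blast
qed

lemma summable_partial_bound:
  fixes f :: "nat \<Rightarrow> real"
  assumes "\<And>N. (\<Sum>n<N. \<bar>f n\<bar>) \<le> T"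
  shows "summable (\<lambda>n. \<bar>f n\<bar>)"
proof (rule bounded_imp_summable[where B = T])
  show "(\<Sum>n\<le>N. \<bar>f n\<bar>) \<le> T" for N using assms[of "Suc N"] by (simp only: lessThan_Suc_atMost)
qed simp

section \<open>Summation over the third index\<close>

lemma sum_telescope_lessThan:
  fixes x d :: "nat \<Rightarrow> real"
  assumes "\<And>k. x k = d k - (if k = 0 then 0 else d (k - 1))"
  shows "(\<Sum>k<Suc N. x k) = d N"
proof (induction N)
  case 0 show ?case using assms[of 0] by simp
next
  case (Suc N)
  have "x (Suc N) = d (Suc N) - d N" using assms[of "Suc N"] by simp
  thus ?case using Suc unfolding sum.lessThan_Suc[of x "Suc N"] by linarith
qed

lemma sums_telescope:
  fixes x d :: "nat \<Rightarrow> real"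
  assumes "\<And>k. x k = d k - (if k = 0 then 0 else d (k - 1))" and "d \<longlonglongrightarrow> D"
  shows "x sums D"
proof -
  have "(\<lambda>N. \<Sum>k<Suc N. x k) \<longlonglongrightarrow> D" using assms(2) unfolding sum_telescope_lessThan[of x d, OF assms(1)] .
  thus ?thesis unfolding sums_def by (subst filterlim_sequentially_Suc[symmetric])
qed

lemma summable_telescope_convergent:
  fixes x d :: "nat \<Rightarrow> real"
  assumes "\<And>k. x k = d k - (if k = 0 then 0 else d (k - 1))" and "summable x"
  shows "convergent d"
proof -
  have "(\<lambda>N. \<Sum>k<Suc N. x k) \<longlonglongrightarrow> suminf x"
    using summable_LIMSEQ[OF assms(2)] by (subst filterlim_sequentially_Suc)
  thus ?thesis unfolding sum_telescope_lessThan[of x d, OF assms(1)] by (auto simp: convergent_def)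
qed

context
  fixes \<beta> A B T
  assumes arr: "rainbow_arrays \<beta> A B" and \<beta>: "1 / 2 < \<beta>"
    and T: "\<And>N. (\<Sum>i<N. \<Sum>j<N. \<Sum>k<N. \<bar>A (vector [i, j, k])\<bar>) \<le> T"
begin

lemma summable_rainbow_A_ext: "summable (\<lambda>k. \<bar>ext3 A i j (int k)\<bar>)"
proof (cases "i < 0 \<or> j < 0")
  case True thus ?thesis by (simp add: ext3_neg)
next
  case False
  define i' j' where "i' = nat i" and "j' = nat j"
  have ij: "i = int i'" "j = int j'" using False by (auto simp: i'_def j'_def)
  show ?thesis unfolding ij ext3_nat
  proof (rule summable_partial_bound)
    fix N
    define M where "M = Suc (N + i' + j')"
    have "(\<Sum>k<N. \<bar>A (vector [i', j', k])\<bar>) \<le> (\<Sum>k<M. \<bar>A (vector [i', j', k])\<bar>)"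
      by (rule sum_mono2) (auto simp: M_def)
    also have "\<dots> \<le> (\<Sum>j<M. \<Sum>k<M. \<bar>A (vector [i', j, k])\<bar>)"
      by (rule member_le_sum[of j' "{..<M}" "\<lambda>j. \<Sum>k<M. \<bar>A (vector [i', j, k])\<bar>"]) (simp_all add: M_def sum_nonneg del: sum.lessThan_Suc)
    also have "\<dots> \<le> (\<Sum>i<M. \<Sum>j<M. \<Sum>k<M. \<bar>A (vector [i, j, k])\<bar>)"
      by (rule member_le_sum[of i' "{..<M}" "\<lambda>i. \<Sum>j<M. \<Sum>k<M. \<bar>A (vector [i, j, k])\<bar>"]) (simp_all add: M_def sum_nonneg del: sum.lessThan_Suc)
    finally show "(\<Sum>k<N. \<bar>A (vector [i', j', k])\<bar>) \<le> T" using T[of M] by linarith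
  qed
qed

text \<open>The first rainbow equation read as a difference in the third index, so that summing over
  k telescopes. At k = 0 the subtracted term is zero by the extension of \<open>B\<close>.\<close>

lemma rainbow_B_first_difference:
  "(of_int i + 1) * (of_int i + 2 * \<beta>) * ext3 A (i + 1) j (int k) - (of_int i + \<beta>) * (of_int i + 1 - \<beta>) * ext3 A i j (int k)
    = (ext3 B i j (int k) - ext3 B i (j - 1) (int k)) - (if k = 0 then 0 else ext3 B i j (int (k - 1)) - ext3 B i (j - 1) (int (k - 1)))"
  using rainbow_arraysD(2)[OF arr, of i j "int k"] by (cases k) (simp_all add: ext3_neg)

lemma rainbow_B_second_difference:
  "(of_int j + 1) * (of_int j + 2 * \<beta>) * ext3 A i (j + 1) (int k) - (of_int j + \<beta>) * (of_int j + 1 - \<beta>) * ext3 A i j (int k)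
    = (ext3 B i j (int k) - ext3 B (i - 1) j (int k)) - (if k = 0 then 0 else ext3 B i j (int (k - 1)) - ext3 B (i - 1) j (int (k - 1)))"
  using rainbow_arraysD(3)[OF arr, of j i "int k"] by (cases k) (simp_all add: ext3_neg)

text \<open>The induction starts at second index -1, where \<open>B\<close> is zero; each step adds
  the limit of a telescoping sum whose terms are summable with those of \<open>A\<close>.\<close>

lemma convergent_rainbow_B: "convergent (\<lambda>k. ext3 B i (int j - 1) (int k))"
proof (induction j)
  case 0 show ?case by (simp add: ext3_neg convergent_const)
next
  case (Suc j)
  have "convergent (\<lambda>k. ext3 B i (int j) (int k) - ext3 B i (int j - 1) (int k))"
    by (rule summable_telescope_convergent[OF rainbow_B_first_difference])
      (intro summable_diff summable_mult summable_rabs_cancel[OF summable_rainbow_A_ext])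
  from convergent_add[OF this Suc] show ?case by simp
qed

text \<open>One step along the diagonal changes the limit by -(i + j + \<beta>) times the limit of k
  A (i, j, k), which exists and must be 0 because \<open>A\<close> is summable in k. Indices are
  lowered by one so that the induction starts outside the octant.\<close>

lemma rainbow_B_tendsto_zero: "(\<lambda>k. ext3 B (int i - 1) (int j - 1) (int k)) \<longlonglongrightarrow> 0"
proof (induction i arbitrary: j)
  case 0 show ?case by (simp add: ext3_neg)
next
  case (Suc i)
  show ?case
  proof (cases j)
    case 0 thus ?thesis by (simp add: ext3_neg)
  next
    case (Suc j')
    define u where "u k = ext3 A (int i) (int j') (int k)" for k
    define s where "s = real i + real j' + \<beta>"
    have s: "s > 0" using \<beta> by (simp add: s_def)
    obtain L where L: "(\<lambda>k. ext3 B (int i) (int j') (int k)) \<longlonglongrightarrow> L"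
      using convergent_rainbow_B[of "int i" "Suc j'"] by (auto simp: convergent_def)
    have diff: "ext3 B (int i) (int j') (int k) - ext3 B (int i - 1) (int j' - 1) (int k) = - s * (real (Suc k) * u (Suc k))" for k
      using rainbow_B_diff[OF arr, of "int i" "int j'" "int k"] by (simp add: u_def s_def algebra_simps)
    have "(\<lambda>k. - s * (real (Suc k) * u (Suc k))) \<longlonglongrightarrow> L - 0"
      unfolding diff[symmetric] by (intro tendsto_diff L Suc.IH)
    hence "(\<lambda>k. (- 1 / s) * (- s * (real (Suc k) * u (Suc k)))) \<longlonglongrightarrow> (- 1 / s) * (L - 0)"
      by (rule tendsto_mult_left)
    hence "(\<lambda>k. real (Suc k) * u (Suc k)) \<longlonglongrightarrow> - L / s" using s by simp
    hence "(\<lambda>k. real k * u k) \<longlonglongrightarrow> - L / s" by (subst (asm) filterlim_sequentially_Suc)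
    from summable_times_convergent_zero[OF _ this] have "L = 0"
      using summable_rainbow_A_ext s by (simp add: u_def)
    thus ?thesis using L Suc by simp
  qed
qed

text \<open>The coefficient of the monomial with exponents i and j in the restriction to the
  face.\<close>

definition alpha :: "nat \<Rightarrow> nat \<Rightarrow> real" where
  "alpha i j = (\<Sum>k. ext3 A (int i) (int j) (int k))"

lemma alpha_sums: "(\<lambda>k. ext3 A (int i) (int j) (int k)) sums alpha i j"
  unfolding alpha_def by (intro summable_sums summable_rabs_cancel[OF summable_rainbow_A_ext])

lemma rainbow_B_tendsto_zero': "(\<lambda>k. ext3 B (int i) (int j) (int k)) \<longlonglongrightarrow> 0"
    "(\<lambda>k. ext3 B (int i - 1) (int j) (int k)) \<longlonglongrightarrow> 0" "(\<lambda>k. ext3 B (int i) (int j - 1) (int k)) \<longlonglongrightarrow> 0"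
  using rainbow_B_tendsto_zero[of "Suc i" "Suc j"] rainbow_B_tendsto_zero[of i "Suc j"] rainbow_B_tendsto_zero[of "Suc i" j] by simp_all

lemma alpha_Suc:
  "(real i + 1) * (real i + 2 * \<beta>) * alpha (Suc i) j = (real i + \<beta>) * (real i + 1 - \<beta>) * alpha i j"
  "(real j + 1) * (real j + 2 * \<beta>) * alpha i (Suc j) = (real j + \<beta>) * (real j + 1 - \<beta>) * alpha i j"
proof -
  have "(\<lambda>k. (real i + 1) * (real i + 2 * \<beta>) * ext3 A (int (Suc i)) (int j) (int k) - (real i + \<beta>) * (real i + 1 - \<beta>) * ext3 A (int i) (int j) (int k))
     sums ((real i + 1) * (real i + 2 * \<beta>) * alpha (Suc i) j - (real i + \<beta>) * (real i + 1 - \<beta>) * alpha i j)"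
    by (intro sums_diff sums_mult alpha_sums)
  moreover have "(\<lambda>k. (real i + 1) * (real i + 2 * \<beta>) * ext3 A (int (Suc i)) (int j) (int k) - (real i + \<beta>) * (real i + 1 - \<beta>) * ext3 A (int i) (int j) (int k)) sums (0 - 0)"
  proof (rule sums_telescope)
    show "(\<lambda>k. ext3 B (int i) (int j) (int k) - ext3 B (int i) (int j - 1) (int k)) \<longlonglongrightarrow> 0 - 0"
      by (intro tendsto_diff rainbow_B_tendsto_zero')
  qed (use rainbow_B_first_difference[of "int i" "int j"] in \<open>simp add: add.commute\<close>)
  ultimately show "(real i + 1) * (real i + 2 * \<beta>) * alpha (Suc i) j = (real i + \<beta>) * (real i + 1 - \<beta>) * alpha i j"
    using sums_unique2 by fastforce
  have "(\<lambda>k. (real j + 1) * (real j + 2 * \<beta>) * ext3 A (int i) (int (Suc j)) (int k) - (real j + \<beta>) * (real j + 1 - \<beta>) * ext3 A (int i) (int j) (int k))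
     sums ((real j + 1) * (real j + 2 * \<beta>) * alpha i (Suc j) - (real j + \<beta>) * (real j + 1 - \<beta>) * alpha i j)"
    by (intro sums_diff sums_mult alpha_sums)
  moreover have "(\<lambda>k. (real j + 1) * (real j + 2 * \<beta>) * ext3 A (int i) (int (Suc j)) (int k) - (real j + \<beta>) * (real j + 1 - \<beta>) * ext3 A (int i) (int j) (int k)) sums (0 - 0)"
  proof (rule sums_telescope)
    show "(\<lambda>k. ext3 B (int i) (int j) (int k) - ext3 B (int i - 1) (int j) (int k)) \<longlonglongrightarrow> 0 - 0"
      by (intro tendsto_diff rainbow_B_tendsto_zero')
  qed (use rainbow_B_second_difference[of "int j" "int i"] in \<open>simp add: add.commute\<close>)
  ultimately show "(real j + 1) * (real j + 2 * \<beta>) * alpha i (Suc j) = (real j + \<beta>) * (real j + 1 - \<beta>) * alpha i j"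
    using sums_unique2 by fastforce
qed

text \<open>Gauss's sum with parameters 1 - \<beta>, \<beta>, 3 \<beta>. The closed form is known on
  the first axis; the separated form of \<open>A\<close> is symmetric in the indices and moves it to
  the third.\<close>

lemma alpha_0_0: "alpha 0 0 = Gamma (3 * \<beta>) * Gamma (3 * \<beta> - 1) / (Gamma (2 * \<beta>) * Gamma (4 * \<beta> - 1))"
proof -
  have \<beta>0: "0 < \<beta>" using \<beta> by simp
  have "ext3 A 0 0 (int n) = pochhammer (1 - \<beta>) n * pochhammer \<beta> n / (fact n * pochhammer (3 * \<beta>) n)" for n
  proof -
    have "A (vector [0, 0, n]) = A (vector [n, 0, 0])"
      unfolding rainbow_eq_wilson[OF arr \<beta>0] by (simp only: mult_ac)
    hence "ext3 A 0 0 (int n) = ext3 A (int n) 0 0" using ext3_nat[of A 0 0 n] ext3_nat[of A n 0 0] by simp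
    thus ?thesis using rainbow_axis[OF arr \<beta>0] by simp
  qed
  moreover have "(\<lambda>n. pochhammer (1 - \<beta>) n * pochhammer \<beta> n / (fact n * pochhammer (3 * \<beta>) n)) sums
    (Gamma (3 * \<beta>) * Gamma (3 * \<beta> - (1 - \<beta>) - \<beta>) / (Gamma (3 * \<beta> - (1 - \<beta>)) * Gamma (3 * \<beta> - \<beta>)))"
    using \<beta> by (intro gauss_summation) auto
  ultimately show ?thesis using alpha_sums[of 0 0] by (simp add: sums_unique2 mult.commute sums_iff)
qed

definition gauss_coeff :: "nat \<Rightarrow> real" where
  "gauss_coeff n = pochhammer (1 - \<beta>) n * pochhammer \<beta> n / (pochhammer (2 * \<beta>) n * fact n)"

lemma gauss_coeff_Suc: "(real n + 1) * (real n + 2 * \<beta>) * gauss_coeff (Suc n) = (real n + \<beta>) * (real n + 1 - \<beta>) * gauss_coeff n"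
proof -
  have "2 * \<beta> + real n \<noteq> 0" "pochhammer (2 * \<beta>) n \<noteq> 0" "1 + real n \<noteq> 0"
    using \<beta> pochhammer_pos[of "2 * \<beta>" n] by auto
  thus ?thesis by (simp add: gauss_coeff_def pochhammer_Suc divide_simps) (simp add: algebra_simps)
qed

lemma alpha_eq: "alpha i j = alpha 0 0 * gauss_coeff i * gauss_coeff j"
proof -
  have nz: "(real n + 1) * (real n + 2 * \<beta>) \<noteq> 0" for n using \<beta> by auto
  have 1: "alpha 0 j = alpha 0 0 * gauss_coeff j" for j
  proof (induction j)
    case (Suc j)
    have "(real j + 1) * (real j + 2 * \<beta>) * alpha 0 (Suc j) = alpha 0 0 * ((real j + \<beta>) * (real j + 1 - \<beta>) * gauss_coeff j)"
      unfolding alpha_Suc(2) Suc by (simp only: mult_ac)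
    also have "\<dots> = (real j + 1) * (real j + 2 * \<beta>) * (alpha 0 0 * gauss_coeff (Suc j))"
      unfolding gauss_coeff_Suc[symmetric] by (simp only: mult_ac)
    finally show ?case by (simp only: mult_left_cancel[OF nz])
  qed (simp add: gauss_coeff_def)
  show ?thesis
  proof (induction i)
    case 0
    show ?case unfolding 1[of j] by (simp add: gauss_coeff_def)
  next
    case (Suc i)
    have "(real i + 1) * (real i + 2 * \<beta>) * alpha (Suc i) j = alpha 0 0 * gauss_coeff j * ((real i + \<beta>) * (real i + 1 - \<beta>) * gauss_coeff i)"
      unfolding alpha_Suc(1) Suc by (simp only: mult_ac)
    also have "\<dots> = (real i + 1) * (real i + 2 * \<beta>) * (alpha 0 0 * gauss_coeff (Suc i) * gauss_coeff j)"
      unfolding gauss_coeff_Suc[symmetric] by (simp only: mult_ac)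
    finally show ?case by (simp only: mult_left_cancel[OF nz])
  qed
qed

text \<open>The coefficients are of order n^(-2 \<beta>) with 2 \<beta> > 1, so the series converges
  absolutely on the closed interval, endpoints included.\<close>

lemma gauss_f_has_sum:
  assumes "\<bar>x\<bar> \<le> 1"
  shows "((\<lambda>n. gauss_coeff n * x ^ n) has_sum gauss_f \<beta> x) UNIV"
proof -
  obtain C where C: "C > 0" "\<And>k. \<bar>pochhammer (1 - \<beta>) k\<bar> / pochhammer 1 k \<le> C * (real k + 1) powr (1 - \<beta> - 1)"
    using pochhammer_ratio_le[of 1 "1 - \<beta>"] by auto
  obtain D where D: "D > 0" "\<And>k. \<bar>pochhammer \<beta> k\<bar> / pochhammer (2 * \<beta>) k \<le> D * (real k + 1) powr (\<beta> - 2 * \<beta>)"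
    using pochhammer_ratio_le[of "2 * \<beta>" \<beta>] \<beta> by auto
  have le: "\<bar>gauss_coeff n\<bar> \<le> C * D * (real n + 1) powr (- 2 * \<beta>)" for n
  proof -
    have "\<bar>gauss_coeff n\<bar> = (\<bar>pochhammer (1 - \<beta>) n\<bar> / pochhammer 1 n) * (\<bar>pochhammer \<beta> n\<bar> / pochhammer (2 * \<beta>) n)"
      using pochhammer_pos[of "2 * \<beta>" n] \<beta> by (simp add: gauss_coeff_def abs_mult flip: pochhammer_fact)
    also have "\<dots> \<le> (C * (real n + 1) powr (1 - \<beta> - 1)) * (D * (real n + 1) powr (\<beta> - 2 * \<beta>))"
      using C(1) pochhammer_pos[of "2 * \<beta>" n] \<beta> by (intro mult_mono C(2) D(2)) auto
    also have "\<dots> = C * D * ((real n + 1) powr (1 - \<beta> - 1) * (real n + 1) powr (\<beta> - 2 * \<beta>))" by (simp only: mult_ac)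
    also have "(real n + 1) powr (1 - \<beta> - 1) * (real n + 1) powr (\<beta> - 2 * \<beta>) = (real n + 1) powr (- 2 * \<beta>)"
      by (simp add: powr_add[symmetric])
    finally show ?thesis .
  qed
  have "summable (\<lambda>n. real n powr (- 2 * \<beta>))" using \<beta> by (subst summable_real_powr_iff) auto
  hence "summable (\<lambda>n. real (Suc n) powr (- 2 * \<beta>))" by (subst summable_Suc_iff)
  hence "summable (\<lambda>n. C * D * (real n + 1) powr (- 2 * \<beta>))" by (intro summable_mult) (simp add: add.commute)
  hence s: "summable (\<lambda>n. norm (gauss_coeff n * x ^ n))"
  proof (rule summable_comparison_test'[where N = 0])
    fix n
    have "\<bar>gauss_coeff n * x ^ n\<bar> \<le> \<bar>gauss_coeff n\<bar>"
      using assms by (simp add: abs_mult power_abs mult_left_le power_le_one)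
    thus "norm (norm (gauss_coeff n * x ^ n)) \<le> C * D * (real n + 1) powr (- 2 * \<beta>)" using le[of n] by simp
  qed
  have "fps_nth (fps_hypergeo [1 - \<beta>, \<beta>] [2 * \<beta>] 1) n = gauss_coeff n" for n
    by (simp add: gauss_coeff_def)
  hence "gauss_f \<beta> x = (\<Sum>n. gauss_coeff n * x ^ n)" unfolding gauss_f_def eval_fps_def by (simp only:)
  thus ?thesis using norm_summable_imp_has_sum[OF s summable_sums[OF summable_norm_cancel[OF s]]] by simp
qed

text \<open>Unordered summation allows the third index to be summed first; the product form of
  \<open>alpha\<close> then splits the double series into two.\<close>

lemma rainbow_boundary_value:
  assumes r: "\<bar>r\<^sub>1\<bar> \<le> 1" "\<bar>r\<^sub>2\<bar> \<le> 1"
    and F: "((\<lambda>n. A n * monomial (vector [r\<^sub>1, r\<^sub>2, 1]) n) has_sum F) UNIV"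
  shows "F = alpha 0 0 * gauss_f \<beta> r\<^sub>1 * gauss_f \<beta> r\<^sub>2"
proof -
  define v where "v = (\<lambda>((i, j), k). vector [i, j, k] :: nat^3)"
  have bij: "bij_betw v (UNIV \<times> UNIV) UNIV"
  proof (rule bij_betw_byWitness[where f' = "\<lambda>n::nat^3. ((n $ 1, n $ 2), n $ 3)"])
    show "\<forall>n\<in>UNIV. v ((n $ 1, n $ 2), n $ 3) = n" by (simp add: v_def vec_eq_iff forall_3)
  qed (auto simp: v_def)
  define f where "f = (\<lambda>((i, j), k). ext3 A (int i) (int j) (int k) * (r\<^sub>1 ^ i * r\<^sub>2 ^ j))"
  have "A (v x) * monomial (vector [r\<^sub>1, r\<^sub>2, 1]) (v x) = f x" for x
    by (cases x) (auto simp: v_def f_def ext3_nat monomial_3)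
  with has_sum_reindex_bij_betw[OF bij, of "\<lambda>n. A n * monomial (vector [r\<^sub>1, r\<^sub>2, 1]) n" F] F
  have "(f has_sum F) (UNIV \<times> UNIV)" by simp
  hence "((\<lambda>(i, j). alpha i j * (r\<^sub>1 ^ i * r\<^sub>2 ^ j)) has_sum F) UNIV"
  proof (rule has_sum_SigmaD)
    fix x :: "nat \<times> nat"
    obtain i j where x: "x = (i, j)" by (cases x)
    have "((\<lambda>k. ext3 A (int i) (int j) (int k)) has_sum alpha i j) UNIV"
      by (rule norm_summable_imp_has_sum[OF _ alpha_sums]) (simp add: summable_rainbow_A_ext)
    from has_sum_cmult_left[OF this, of "r\<^sub>1 ^ i * r\<^sub>2 ^ j"]
    show "((\<lambda>k. f (x, k)) has_sum (case x of (i, j) \<Rightarrow> alpha i j * (r\<^sub>1 ^ i * r\<^sub>2 ^ j))) UNIV"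
      by (simp add: x f_def)
  qed
  hence "((\<lambda>(i, j). alpha i j * (r\<^sub>1 ^ i * r\<^sub>2 ^ j)) has_sum F) (UNIV \<times> UNIV)" by simp
  hence "((\<lambda>i. (alpha 0 0 * gauss_f \<beta> r\<^sub>2) * (gauss_coeff i * r\<^sub>1 ^ i)) has_sum F) UNIV"
  proof (rule has_sum_SigmaD)
    fix i
    have "((\<lambda>j. (alpha 0 0 * gauss_coeff i * r\<^sub>1 ^ i) * (gauss_coeff j * r\<^sub>2 ^ j)) has_sum
        (alpha 0 0 * gauss_coeff i * r\<^sub>1 ^ i) * gauss_f \<beta> r\<^sub>2) UNIV"
      by (rule has_sum_cmult_right[OF gauss_f_has_sum[OF r(2)]])
    moreover have "(alpha 0 0 * gauss_coeff i * r\<^sub>1 ^ i) * (gauss_coeff j * r\<^sub>2 ^ j) = alpha i j * (r\<^sub>1 ^ i * r\<^sub>2 ^ j)" for j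
      unfolding alpha_eq[of i j] by (simp only: mult_ac)
    moreover have "(alpha 0 0 * gauss_coeff i * r\<^sub>1 ^ i) * gauss_f \<beta> r\<^sub>2 = (alpha 0 0 * gauss_f \<beta> r\<^sub>2) * (gauss_coeff i * r\<^sub>1 ^ i)"
      by (simp only: mult_ac)
    ultimately show "((\<lambda>j. case (i, j) of (i, j) \<Rightarrow> alpha i j * (r\<^sub>1 ^ i * r\<^sub>2 ^ j)) has_sum
        (alpha 0 0 * gauss_f \<beta> r\<^sub>2) * (gauss_coeff i * r\<^sub>1 ^ i)) UNIV"
      by (simp only: prod.case)
  qed
  from has_sum_unique[OF this has_sum_cmult_right[OF gauss_f_has_sum[OF r(1)]]]
  show ?thesis by (simp only: mult_ac)
qed

end

section \<open>Continuity on the closed cube\<close>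

lemma abs_monomial_le_1:
  fixes r :: "real^'n"
  assumes "\<And>i. \<bar>r $ i\<bar> \<le> 1"
  shows "\<bar>monomial r n\<bar> \<le> 1"
  unfolding monomial_def abs_prod power_abs using assms by (intro prod_le_1) (auto intro: power_le_one)

lemma summable_closed_cube:
  fixes r :: "real^'n"
  assumes A: "(\<lambda>n. \<bar>A n\<bar>) summable_on UNIV" and r: "\<And>i. \<bar>r $ i\<bar> \<le> 1"
  shows "(\<lambda>n. A n * monomial r n) summable_on UNIV"
proof -
  have "\<bar>A n * monomial r n\<bar> \<le> \<bar>A n\<bar>" for n
    unfolding abs_mult using mult_left_mono[OF abs_monomial_le_1[OF r] abs_ge_zero[of "A n"], of n] by simp
  hence "(\<lambda>n. norm (A n * monomial r n)) summable_on UNIV"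
    by (intro summable_on_comparison_test[OF A]) auto
  thus ?thesis by (subst summable_on_iff_abs_summable_on_real)
qed

lemma continuous_on_closed_cube:
  fixes A :: "nat^3 \<Rightarrow> real"
  assumes A: "(\<lambda>n. \<bar>A n\<bar>) summable_on UNIV"
  shows "continuous_on closed_cube (\<lambda>r. \<Sum>\<^sub>\<infinity>n. A n * monomial r n)"
proof (rule uniform_limit_theorem)
  show "uniform_limit closed_cube (\<lambda>S r. \<Sum>n\<in>S. A n * monomial r n) (\<lambda>r. \<Sum>\<^sub>\<infinity>n. A n * monomial r n) (finite_subsets_at_top UNIV)"
  proof (rule Weierstrass_m_test_general[OF _ A])
    fix n and r :: "real^3" assume "r \<in> closed_cube"
    hence "\<And>i. \<bar>r $ i\<bar> \<le> 1" by (simp add: abs_le_iff minus_le_iff)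
    from mult_left_mono[OF abs_monomial_le_1[OF this] abs_ge_zero[of "A n"], of n]
    show "norm (A n * monomial r n) \<le> \<bar>A n\<bar>" by (simp add: abs_mult)
  qed
  show "\<forall>\<^sub>F S in finite_subsets_at_top UNIV. continuous_on closed_cube (\<lambda>r. \<Sum>n\<in>S. A n * monomial r n)"
    unfolding monomial_def by (intro always_eventually allI continuous_intros)
  show "finite_subsets_at_top (UNIV :: (nat^3) set) \<noteq> bot" by simp
qed

theorem theorem5p2:
  fixes \<beta> :: real and A B :: "nat^3 \<Rightarrow> real" and F G :: "real^3 \<Rightarrow> real"
  assumes "\<beta> > 0"
    and "rainbow_arrays \<beta> A B"
    and "F = (\<lambda>r. \<Sum>\<^sub>\<infinity>n. A n * monomial r n)"
    and "G = (\<lambda>r. \<Sum>\<^sub>\<infinity>n. B n * monomial r n)"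
  shows
    "(\<beta> > 1 / 2 \<longrightarrow>
        (\<lambda>n. \<bar>A n\<bar>) summable_on UNIV \<and>
        (\<forall>r\<in>closed_cube. (\<lambda>n. A n * monomial r n) summable_on UNIV) \<and>
        continuous_on closed_cube F \<and>
        (\<forall>r\<^sub>1\<in>{-1..1}. \<forall>r\<^sub>2\<in>{-1..1}.
          F (vector [r\<^sub>1, r\<^sub>2, 1]) =
            (Gamma (3 * \<beta>) * Gamma (3 * \<beta> - 1)) / (Gamma (2 * \<beta>) * Gamma (4 * \<beta> - 1))
              * gauss_f \<beta> r\<^sub>1 * gauss_f \<beta> r\<^sub>2)) \<and>
     power_series_locally_uniform_on A open_cube \<and>
     power_series_locally_uniform_on B open_cube \<and>
     real_analytic_on F open_cube \<and>
     real_analytic_on G open_cube \<and>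
     (\<forall>j k l. {j, k, l} = {1, 2, 3} \<longrightarrow> (\<forall>r\<in>open_cube.
        r $ l * (1 - r $ l) * partial_deriv l (partial_deriv l F) r
          + (2 * \<beta> - 2 * r $ l) * partial_deriv l F r - \<beta> * (1 - \<beta>) * F r
        = (1 - r $ j) * (1 - r $ k) * G r \<and>
        2 * r $ j * r $ k * partial_deriv j (partial_deriv k F) r
          + \<beta> * r $ j * partial_deriv j F r + \<beta> * r $ k * partial_deriv k F r
          - \<beta> * r $ l * partial_deriv l F r
        = (r $ l * (1 + r $ j * r $ k) - (r $ j + r $ k)) * G r))"
proof -
  note \<beta> = assms(1) and arr = assms(2)
  have F: "F = power_sum A" and G: "G = power_sum B"
    unfolding assms(3,4) power_sum_def by (rule refl)+
  have A: "cube_summable A"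
    using rainbow_A_growth[OF arr \<beta>] cube_summable_growth by blast
  have B: "cube_summable B"
    using rainbow_B_growth[OF arr \<beta>] cube_summable_growth by blast
  have open_cube: "\<bar>r $ i\<bar> < 1" if "r \<in> open_cube" for r :: "real^3" and i
    using that by (simp add: abs_less_iff minus_less_iff)
  have closed_cube: "\<bar>r $ i\<bar> \<le> 1" if "r \<in> closed_cube" for r :: "real^3" and i
    using that by (simp add: abs_le_iff minus_le_iff)
  have boundary: "(\<lambda>n. \<bar>A n\<bar>) summable_on UNIV \<and>
        (\<forall>r\<in>closed_cube. (\<lambda>n. A n * monomial r n) summable_on UNIV) \<and>
        continuous_on closed_cube F \<and>
        (\<forall>r\<^sub>1\<in>{-1..1}. \<forall>r\<^sub>2\<in>{-1..1}.
          F (vector [r\<^sub>1, r\<^sub>2, 1]) =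
            (Gamma (3 * \<beta>) * Gamma (3 * \<beta> - 1)) / (Gamma (2 * \<beta>) * Gamma (4 * \<beta> - 1))
              * gauss_f \<beta> r\<^sub>1 * gauss_f \<beta> r\<^sub>2)" if \<beta>': "1 / 2 < \<beta>"
  proof -
    obtain T where T: "\<And>N. (\<Sum>i<N. \<Sum>j<N. \<Sum>k<N. \<bar>A (vector [i, j, k])\<bar>) \<le> T"
      using rainbow_A_summable[OF arr \<beta>'] by blast
    have sA: "(\<lambda>n. \<bar>A n\<bar>) summable_on UNIV"
      by (rule sum3_summable[OF _ T]) simp
    have gauss: "F (vector [r\<^sub>1, r\<^sub>2, 1]) = Gamma (3 * \<beta>) * Gamma (3 * \<beta> - 1) / (Gamma (2 * \<beta>) * Gamma (4 * \<beta> - 1))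
        * gauss_f \<beta> r\<^sub>1 * gauss_f \<beta> r\<^sub>2" if "r\<^sub>1 \<in> {-1..1}" "r\<^sub>2 \<in> {-1..1}" for r\<^sub>1 r\<^sub>2
    proof -
      have r: "\<bar>r\<^sub>1\<bar> \<le> 1" "\<bar>r\<^sub>2\<bar> \<le> 1" using that by auto
      hence "\<forall>i. \<bar>(vector [r\<^sub>1, r\<^sub>2, 1] :: real^3) $ i\<bar> \<le> 1" by (simp add: forall_3)
      hence "((\<lambda>n. A n * monomial (vector [r\<^sub>1, r\<^sub>2, 1]) n) has_sum F (vector [r\<^sub>1, r\<^sub>2, 1])) UNIV"
        unfolding assms(3) by (intro has_sum_infsum summable_closed_cube sA) blast
      from rainbow_boundary_value[OF arr \<beta>' T r this] show ?thesis
        unfolding alpha_0_0[OF arr \<beta>' T] .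
    qed
    show ?thesis
      using sA summable_closed_cube[OF sA closed_cube] continuous_on_closed_cube[OF sA] gauss
      unfolding assms(3) by blast
  qed
  have pde: "r $ l * (1 - r $ l) * partial_deriv l (partial_deriv l F) r
          + (2 * \<beta> - 2 * r $ l) * partial_deriv l F r - \<beta> * (1 - \<beta>) * F r
        = (1 - r $ j) * (1 - r $ k) * G r \<and>
        2 * r $ j * r $ k * partial_deriv j (partial_deriv k F) r
          + \<beta> * r $ j * partial_deriv j F r + \<beta> * r $ k * partial_deriv k F r
          - \<beta> * r $ l * partial_deriv l F r
        = (r $ l * (1 + r $ j * r $ k) - (r $ j + r $ k)) * G r"
    if "{j, k, l} = {1, 2, 3}" "r \<in> open_cube" for j k l :: 3 and r :: "real^3"
    unfolding F G using rainbow_pde[OF arr A B that(1) open_cube[OF that(2)]] by blast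
  have series: "power_series_locally_uniform_on A open_cube" "power_series_locally_uniform_on B open_cube"
    "real_analytic_on F open_cube" "real_analytic_on G open_cube"
    unfolding F G by (intro power_series_locally_uniform_on_cube real_analytic_on_cube A B)+
  show ?thesis
    by (intro conjI series, rule impI, erule boundary, intro allI impI ballI, rule pde)
qed

end
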